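(* For every $\epsilon>0$ there is a constant $C_\epsilon>0$ depending only on $\epsilon$ such that for every $X\ge 2$, $$\left|\sum_{\substack{p\le X\\ p\equiv -1\ (\mathrm{mod}\ 16)}}\left(\frac{v}{u}\right)\right|\le C_\epsilon X^{\frac{149}{150}+\epsilon},$$ where the sum is over primes $p$, and for each such prime $p$, $u$ and $v$ are integers satisfying $p=u^2-2v^2$, $u>0$ and $u\equiv 1\pmod{16}$.
   Context: $\left(\frac{v}{u}\right)$ denotes the Jacobi symbol (for $u$ odd and positive, $v\in\mathbb{Z}$). *)

theory Defs
  imports Complex_Main "HOL-Number_Theory.Number_Theory"
begin

(* The Jacobi symbol (v/u), intended for odd u > 0: the product of the Legendre symbols (v/q)
   over the prime factors q of u, counted with multiplicity. In particular (v/1) = 1, and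
   (v/u) = 0 when v and u are not coprime. Values at other u have no significance. *)
definition Jacobi :: "int \<Rightarrow> int \<Rightarrow> int" where
  "Jacobi v u = (\<Prod>q\<in>#prime_factorization u. Legendre v q)"

end

theory Submission
  imports Defs "HOL-Computational_Algebra.Nth_Powers" "HOL-Computational_Algebra.Squarefree"
begin

text \<open>
  Regard \<open>u + v \<surd>2\<close> as an element of norm \<open>u\<^sup>2 - 2 v\<^sup>2\<close>. On totally positive elements with
  \<open>u \<equiv> 1 (mod 16)\<close> and \<open>v\<close> odd, the symbol \<open>(v/u)\<close> is invariant under conjugation and under
  multiplication by \<open>(1 + \<surd>2)^8\<close>, so a sum over primes \<open>p\<close> is half the sum of the symbol over the
  elements of norm \<open>p\<close> in a fundamental domain, and Vaughan's identity applies to the latter.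
  For sums over all elements whose norm is a multiple of \<open>d\<close>, fix \<open>u\<close>: then \<open>v\<close> runs through an
  interval and progressions modulo \<open>2 d\<close>, and the inequality of Polya and Vinogradov gives cancellation.
  For the bilinear sums, quadratic reciprocity factors \<open>(v/u)\<close> at a product \<open>w z\<close> into functions of
  \<open>w\<close> and of \<open>z\<close> alone and the quadratic residue symbol of \<open>w\<close> modulo \<open>z\<close>. Hoelder's inequality
  opens the \<open>w\<close>-sum into products of several primes, which fill a box longer than the moduli, and
  the complete sums over this box vanish unless the product of the two norms is a square.
\<close>

section \<open>The Jacobi symbol\<close>

text \<open>Vaughan's identity is cut at \<open>X powr (3/100)\<close> and
  \<open>X powr (17/200)\<close>. Sums of the first type save a quarter power and lose at worst the
  square of the product of the cuts, reaching the power 0.98 before logarithms. In the bilinear part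
  one norm has size \<open>M\<close> anywhere between \<open>X powr (3/100)\<close> and
  \<open>X powr (183/200)\<close>, so either variable may be far the longer one. The complete sums
  have moduli of size \<open>M^2\<close>, and the products of \<open>k\<close> primes must fill a
  box of side at least \<open>M^3\<close>. Hence \<open>k\<close> depends on \<open>M\<close>, grows
  into the sixties at the upper end, and only a \<open>2 k\<close>-th root of the saving survives.
  The condition that the product of the norms be at most \<open>X\<close> is separated by cutting
  one norm into intervals of ratio \<open>1 + X powr (-1/150)\<close>, whose edges cost
  \<open>X powr (149/150)\<close>. The other norm is kept prime, so that an element has boundedly
  many factorisations into \<open>k\<close> such factors; this dictates a form of Vaughan's identity
  with higher prime powers split off.\<close>

lemma odd_prime_int_obtain:
  assumes "prime (q::int)" "odd q"
  obtains p where "q = int p" "prime p" "2 < p"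
proof -
  have "q > 2" using assms prime_ge_2_int[of q] by (cases "q = 2") auto
  moreover have "prime (nat q)" using assms(1) prime_int_nat_transfer by blast
  ultimately show ?thesis using that[of "nat q"] by auto
qed

lemma dvd_small_imp_0: "(q::int) > 2 \<Longrightarrow> q dvd d \<Longrightarrow> \<bar>d\<bar> \<le> 2 \<Longrightarrow> d = 0"
  using zdvd_imp_le[of q "\<bar>d\<bar>"] by auto

text \<open>Euler's criterion makes both sides congruent modulo \<open>q\<close>; as both lie
  between -1 and 1, they differ by at most 2, which is less than \<open>q\<close>.\<close>

lemma Legendre_mult:
  assumes "prime (q::int)" "odd q"
  shows "Legendre (a * b) q = Legendre a q * Legendre b q"
proof -
  obtain p where p: "q = int p" "prime p" "2 < p" using odd_prime_int_obtain[OF assms] by blast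
  let ?e = "(p - 1) div 2"
  note E = euler_criterion[OF p(2,3)]
  have 1: "[Legendre (a*b) q = a ^ ?e * b ^ ?e] (mod q)"
    using E[of "a*b"] by (simp add: p power_mult_distrib)
  have 2: "[Legendre a q * Legendre b q = a ^ ?e * b ^ ?e] (mod q)"
    using cong_mult[OF E[of a] E[of b]] by (simp add: p)
  have c: "[Legendre (a*b) q = Legendre a q * Legendre b q] (mod q)"
    using 1 2 cong_sym cong_trans by blast
  have q: "q > 2" using p by simp
  have d: "q dvd Legendre (a*b) q - Legendre a q * Legendre b q" using c by (simp add: cong_iff_dvd_diff)
  have "\<bar>Legendre (a*b) q - Legendre a q * Legendre b q\<bar> \<le> 2" by (auto simp: Legendre_def)
  with q d show ?thesis
    using zdvd_imp_le[of q "\<bar>Legendre (a*b) q - Legendre a q * Legendre b q\<bar>"] by auto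
qed

lemma Legendre_cong:
  assumes "[a = b] (mod q)"
  shows "Legendre a q = Legendre b q"
proof -
  have "[a = 0] (mod q) \<longleftrightarrow> [b = 0] (mod q)" using assms cong_sym cong_trans by blast
  moreover have "QuadRes q a \<longleftrightarrow> QuadRes q b"
    unfolding QuadRes_def using assms cong_sym cong_trans by blast
  ultimately show ?thesis by (simp add: Legendre_def)
qed

lemma Legendre_eq_0_iff: "Legendre a q = 0 \<longleftrightarrow> q dvd a"
  by (auto simp: Legendre_def cong_0_iff)

text \<open>Peels off one prime at a time, which reduces statements about the Jacobi symbol to the
  Legendre symbol at odd primes.\<close>

lemma odd_pos_induct [consumes 2, case_names one prime]:
  fixes u :: int
  assumes "u > 0" "odd u" "P 1"
    "\<And>q n. prime q \<Longrightarrow> odd q \<Longrightarrow> n > 0 \<Longrightarrow> odd n \<Longrightarrow> P n \<Longrightarrow> P (q * n)"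
  shows "P u"
proof -
  have "u > 0 \<longrightarrow> odd u \<longrightarrow> P u"
  proof (induction u rule: prime_divisors_induct)
    case (unit x)
    then show ?case using assms(3) by auto
  next
    case (factor p x)
    show ?case
    proof (intro impI)
      assume h: "p * x > 0" "odd (p * x)"
      have "p > 0" using factor(1) prime_gt_0_int by blast
      with h have "x > 0" by (simp add: zero_less_mult_iff)
      with h factor assms(4)[of p x] show "P (p * x)" by auto
    qed
  qed auto
  with assms(1,2) show ?thesis by blast
qed

lemma Jacobi_1 [simp]: "Jacobi v 1 = 1"
  by (simp add: Jacobi_def)

lemma Jacobi_prime: "prime q \<Longrightarrow> Jacobi v q = Legendre v q"
  by (simp add: Jacobi_def prime_factorization_prime)

lemma Jacobi_mult_bot: "x \<noteq> 0 \<Longrightarrow> y \<noteq> 0 \<Longrightarrow> Jacobi v (x * y) = Jacobi v x * Jacobi v y"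
  by (simp add: Jacobi_def prime_factorization_mult)

lemma Jacobi_mult_prime: "prime q \<Longrightarrow> y > 0 \<Longrightarrow> Jacobi v (q * y) = Legendre v q * Jacobi v y"
  by (subst Jacobi_mult_bot) (auto simp: Jacobi_prime)

lemma Jacobi_mult_top:
  assumes "u > 0" "odd u"
  shows "Jacobi (a * b) u = Jacobi a u * Jacobi b u"
  using assms by (induction u rule: odd_pos_induct) (auto simp: Jacobi_mult_prime Legendre_mult)

lemma Jacobi_cong:
  assumes "u > 0" "odd u" "[a = b] (mod u)"
  shows "Jacobi a u = Jacobi b u"
proof -
  have "[a = b] (mod u) \<longrightarrow> Jacobi a u = Jacobi b u"
    using assms(1,2)
  proof (induction u rule: odd_pos_induct)
    case (prime q n)
    show ?case
    proof
      assume c: "[a = b] (mod q * n)"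
      have "Legendre a q = Legendre b q" using c by (intro Legendre_cong) (rule cong_modulus_mult)
      moreover have "[a = b] (mod n)" using c by (metis cong_modulus_mult mult.commute)
      ultimately show "Jacobi a (q * n) = Jacobi b (q * n)" using prime by (simp add: Jacobi_mult_prime)
    qed
  qed auto
  with assms(3) show ?thesis by blast
qed

lemma Jacobi_mod: "u > 0 \<Longrightarrow> odd u \<Longrightarrow> Jacobi (a mod u) u = Jacobi a u"
  by (rule Jacobi_cong) auto

lemma Jacobi_top_1 [simp]: 
  assumes "u > 0" "odd u" shows "Jacobi 1 u = 1"
  using assms
proof (induction u rule: odd_pos_induct)
  case (prime q n)
  have "Legendre 1 q = 1" unfolding Legendre_def QuadRes_def
    using prime(1) by (auto simp: cong_0_iff intro: exI[of _ 1])
  then show ?case using prime by (simp add: Jacobi_mult_prime)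
qed auto

lemma Jacobi_abs_le_1:
  assumes "u > 0" "odd u" shows "\<bar>Jacobi a u\<bar> \<le> 1"
  using assms
proof (induction u rule: odd_pos_induct)
  case (prime q n)
  have "\<bar>Legendre a q\<bar> \<le> 1" by (auto simp: Legendre_def)
  then show ?case using prime 
    by (simp add: Jacobi_mult_prime abs_mult) (metis abs_ge_zero mult_le_one)
qed auto

lemma Jacobi_eq_0_iff:
  assumes "u > 0" "odd u" shows "Jacobi a u = 0 \<longleftrightarrow> \<not> coprime a u"
  using assms
proof (induction u rule: odd_pos_induct)
  case (prime q n)
  have "coprime a q \<longleftrightarrow> \<not> q dvd a" using prime(1)
    by (metis coprime_absorb_right coprime_commute prime_imp_coprime not_prime_unit)
  then show ?case using prime 
    by (auto simp: Jacobi_mult_prime Legendre_eq_0_iff)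
qed auto

lemma Jacobi_square:
  assumes "u > 0" "odd u" "coprime a u" shows "Jacobi a u * Jacobi a u = 1"
proof -
  have "Jacobi a u \<noteq> 0" "\<bar>Jacobi a u\<bar> \<le> 1" using assms Jacobi_eq_0_iff Jacobi_abs_le_1 by auto
  then have "Jacobi a u = 1 \<or> Jacobi a u = -1" by arith
  then show ?thesis by auto
qed

lemma Jacobi_values:
  assumes "u > 0" "odd u" shows "Jacobi a u \<in> {-1,0,1}"
  using Jacobi_abs_le_1[OF assms, of a] by auto

section \<open>Quadratic reciprocity for the Jacobi symbol\<close>

definition recip_sign :: "int \<Rightarrow> int \<Rightarrow> int" where
  "recip_sign m n = (if m mod 4 = 3 \<and> n mod 4 = 3 then -1 else 1)"

lemma recip_sign_sym: "recip_sign m n = recip_sign n m"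
  by (auto simp: recip_sign_def)

lemma odd_mod4: "odd (x::int) \<Longrightarrow> x mod 4 = 1 \<or> x mod 4 = 3"
  by presburger

lemma recip_sign_mult:
  assumes "odd x" "odd y"
  shows "recip_sign (x * y) n = recip_sign x n * recip_sign y n"
proof -
  have c: "(x * y) mod 4 = (i * j) mod 4" if "x mod 4 = i" "y mod 4 = j" for i j
    using that by (metis mod_mult_eq)
  show ?thesis using odd_mod4[OF assms(1)] odd_mod4[OF assms(2)]
    by (elim disjE) (simp_all add: recip_sign_def c)
qed

text \<open>Euler's form gives the product of the two symbols. With one of them moved to the other
  side the law also covers \<open>p = q\<close>, where both sides vanish, and so passes to composite
  arguments with common factors.\<close>

lemma Legendre_reciprocity:
  assumes "prime (p::int)" "odd p" "prime q" "odd q"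
  shows "Legendre p q = recip_sign p q * Legendre q p"
proof (cases "p = q")
  case True
  then show ?thesis using Legendre_eq_0_iff[of q q] by simp
next
  case False
  obtain a where a: "p = int a" "prime a" "2 < a" using odd_prime_int_obtain assms by metis
  obtain b where b: "q = int b" "prime b" "2 < b" using odd_prime_int_obtain assms by metis
  have ab: "a \<noteq> b" using False a b by auto
  have R: "Legendre p q * Legendre q p = (-1) ^ ((a - 1) div 2 * ((b - 1) div 2))"
    using Quadratic_Reciprocity[OF a(2,3) b(2,3) ab] a b by simp
  have "odd a" "odd b" using a(1) b(1) assms(2,4) by simp_all
  then have e: "odd ((a - 1) div 2) \<longleftrightarrow> a mod 4 = 3" "odd ((b - 1) div 2) \<longleftrightarrow> b mod 4 = 3"
    by presburger+
  have m: "p mod 4 = 3 \<longleftrightarrow> a mod 4 = 3" "q mod 4 = 3 \<longleftrightarrow> b mod 4 = 3"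
    using zmod_int[of a 4] zmod_int[of b 4] a(1) b(1) by auto
  have S: "Legendre p q * Legendre q p = recip_sign p q"
    unfolding R recip_sign_def m using e by (auto simp: minus_one_power_iff)
  have "\<not> p dvd q" using False assms by (metis primes_dvd_imp_eq)
  then have "Legendre q p \<noteq> 0" by (simp add: Legendre_eq_0_iff)
  then have "Legendre q p * Legendre q p = 1" by (auto simp: Legendre_def)
  then show ?thesis using S by (metis mult.assoc mult.right_neutral)
qed

lemma Jacobi_reciprocity_prime:
  assumes "prime (p::int)" "odd p" "n > 0" "odd n"
  shows "Jacobi p n = recip_sign p n * Jacobi n p"
  using assms(3,4)
proof (induction n rule: odd_pos_induct)
  case one
  have "p > 0" using assms(1) prime_gt_0_int by blast
  then show ?case using assms by (simp add: recip_sign_def)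
next
  case (prime q n)
  have p: "p > 0" using assms(1) prime_gt_0_int by blast
  have "Jacobi p (q * n) = (recip_sign p q * Legendre q p) * (recip_sign p n * Jacobi n p)"
    using prime assms by (simp add: Jacobi_mult_prime Legendre_reciprocity[of p q])
  also have "\<dots> = recip_sign p (q * n) * Jacobi (q * n) p"
    using prime(1-4) assms(1,2) p
    by (simp add: recip_sign_mult Jacobi_mult_top Jacobi_prime Legendre_mult recip_sign_sym[of p])
  finally show ?case .
qed

theorem Jacobi_reciprocity:
  assumes "m > 0" "odd m" "n > 0" "odd n"
  shows "Jacobi m n = recip_sign m n * Jacobi n m"
  using assms(1,2)
proof (induction m rule: odd_pos_induct)
  case one
  then show ?case using assms by (simp add: recip_sign_def)
next
  case (prime q m)
  have "Jacobi (q * m) n = Jacobi q n * Jacobi m n" using assms by (simp add: Jacobi_mult_top)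
  also have "\<dots> = (recip_sign q n * Legendre n q) * (recip_sign m n * Jacobi n m)"
    using prime assms by (simp add: Jacobi_reciprocity_prime Jacobi_prime)
  also have "\<dots> = recip_sign (q * m) n * Jacobi n (q * m)"
    using prime assms by (simp add: recip_sign_mult Jacobi_mult_prime)
  finally show ?case .
qed

section \<open>The supplementary laws for -1 and 2\<close>

lemma Legendre_minus_1:
  assumes "prime (q::int)" "odd q"
  shows "Legendre (-1) q = (if q mod 4 = 1 then 1 else -1)"
proof -
  obtain p where p: "q = int p" "prime p" "2 < p" using odd_prime_int_obtain[OF assms] by blast
  have "odd p" using p assms by simp
  then have e: "even ((p - 1) div 2) \<longleftrightarrow> q mod 4 = 1" using p(1) by presburger
  have "[Legendre (-1) q = (-1) ^ ((p - 1) div 2)] (mod q)" using euler_criterion[OF p(2,3)] p by simp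
  then have "[Legendre (-1) q = (if q mod 4 = 1 then 1 else -1)] (mod q)"
    using e by (auto simp: minus_one_power_iff split: if_splits)
  then have d: "q dvd Legendre (-1) q - (if q mod 4 = 1 then 1 else -1)" by (simp add: cong_iff_dvd_diff)
  have "\<bar>Legendre (-1) q - (if q mod 4 = 1 then 1 else -1)\<bar> \<le> 2" by (auto simp: Legendre_def)
  with p d have "Legendre (-1) q - (if q mod 4 = 1 then 1 else -1) = 0"
    by (intro dvd_small_imp_0[of q]) auto
  then show ?thesis by simp
qed

lemma Jacobi_minus_1:
  assumes "n > 0" "odd n"
  shows "Jacobi (-1) n = (if n mod 4 = 1 then 1 else -1)"
  using assms
proof (induction n rule: odd_pos_induct)
  case (prime q n)
  have c: "(q * n) mod 4 = (i * j) mod 4" if "q mod 4 = i" "n mod 4 = j" for i j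
    using that by (metis mod_mult_eq)
  show ?case using odd_mod4[OF prime(2)] odd_mod4[OF prime(4)] prime
    by (elim disjE) (simp_all add: Jacobi_mult_prime Legendre_minus_1 c)
qed auto

text \<open>A descent in place of Gauss's lemma: 2 is \<open>- (n - 2)\<close> modulo
  \<open>n\<close>, and \<open>n\<close> is 2 modulo \<open>n - 2\<close>. Of two odd numbers
  differing by 2 only one is 3 modulo 4, so the reciprocity step between them has sign 1.\<close>

lemma Jacobi_2_step:
  assumes "n > 2" "odd n"
  shows "Jacobi 2 n = Jacobi (-1) n * Jacobi 2 (n - 2)"
proof -
  have n: "n > 0" "odd n" "n - 2 > 0" "odd (n - 2)" using assms by auto
  have "Jacobi 2 n = Jacobi ((-1) * (n - 2)) n"
    by (rule Jacobi_cong) (use n in \<open>auto simp: cong_iff_dvd_diff\<close>)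
  also have "\<dots> = Jacobi (-1) n * Jacobi (n - 2) n" using n by (subst Jacobi_mult_top) auto
  also have "Jacobi (n - 2) n = recip_sign (n - 2) n * Jacobi n (n - 2)"
    using n by (intro Jacobi_reciprocity)
  also have "recip_sign (n - 2) n = 1" using n unfolding recip_sign_def by presburger
  also have "Jacobi n (n - 2) = Jacobi 2 (n - 2)"
    by (rule Jacobi_cong) (use n in \<open>auto simp: cong_iff_dvd_diff\<close>)
  finally show ?thesis by simp
qed

lemma Jacobi_2:
  assumes "n > 0" "odd n"
  shows "Jacobi 2 n = (if n mod 8 = 1 \<or> n mod 8 = 7 then 1 else -1)"
proof -
  have "\<forall>n. n = int k \<longrightarrow> odd n \<longrightarrow> Jacobi 2 n = (if n mod 8 = 1 \<or> n mod 8 = 7 then 1 else -1)" for k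
  proof (induction k rule: less_induct)
    case (less k)
    show ?case
    proof (intro allI impI)
      fix n assume n: "n = int k" "odd n"
      show "Jacobi 2 n = (if n mod 8 = 1 \<or> n mod 8 = 7 then 1 else -1)"
      proof (cases "n = 1")
        case False
        then have "k \<noteq> 0" "k \<noteq> 1" "k \<noteq> 2" using n False by (auto intro!: gr0I)
        then have n2: "n > 2" using n(1) by linarith
        have IH: "Jacobi 2 (n - 2) = (if (n-2) mod 8 = 1 \<or> (n-2) mod 8 = 7 then 1 else -1)"
          using less.IH[of "nat (n - 2)"] n n2 by auto
        have s: "Jacobi (-1) n = (if n mod 4 = 1 then 1 else -1)" using n n2 by (intro Jacobi_minus_1) auto
        have c: "n mod 8 = 1 \<or> n mod 8 = 3 \<or> n mod 8 = 5 \<or> n mod 8 = 7" using n(2) by presburger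
        have r: "n mod 4 = r mod 4" "(n - 2) mod 8 = (r - 2) mod 8" if "n mod 8 = r" for r
          using that mod_mod_cancel[of 4 8 n] mod_diff_left_eq[of n 8 2] by auto
        show ?thesis unfolding Jacobi_2_step[OF n2 n(2)] IH s
          using c by (elim disjE) (simp_all add: r)
      qed auto
    qed
  qed
  from this[of "nat n"] assms show ?thesis by auto
qed

text \<open>Since \<open>z\<close> and \<open>q - z\<close> have the same square, squaring on the
  lower half of the residues already gives all nonzero squares; they are too few to exhaust
  \<open>{1..q-1}\<close>.\<close>

lemma exists_quadratic_nonresidue:
  assumes "prime (q::int)" "odd q"
  shows "\<exists>a. Legendre a q = -1"
proof (rule ccontr)
  assume "\<not> ?thesis"
  then have all: "Legendre a q = 1" if "\<not> q dvd a" for a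
    using that Legendre_eq_0_iff[of a q] by (auto simp: Legendre_def split: if_splits)
  have q: "q > 2" using assms prime_ge_2_int[of q] by (cases "q = 2") auto
  define f where "f = (\<lambda>x::int. x^2 mod q)"
  have sub: "{1..q-1} \<subseteq> f ` {1..(q-1) div 2}"
  proof
    fix a assume a: "a \<in> {1..q-1}"
    then have "\<not> q dvd a" using zdvd_imp_le[of q a] by auto
    from all[OF this] have "QuadRes q a" by (auto simp: Legendre_def split: if_splits)
    then obtain y where y: "[y^2 = a] (mod q)" by (auto simp: QuadRes_def)
    define z where "z = y mod q"
    have z: "[z^2 = a] (mod q)" using y unfolding z_def by (metis cong_def power_mod)
    have zr: "0 \<le> z" "z < q" using q by (auto simp: z_def)
    have z0: "z \<noteq> 0" using z \<open>\<not> q dvd a\<close> by (metis cong_0_iff cong_sym_eq power_zero_numeral)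
    have fz: "f z = a" using z a by (simp add: f_def cong_def)
    have "f (q - z) = a"
    proof -
      have "[(q - z)^2 = z^2] (mod q)" by (simp add: cong_iff_dvd_diff power2_eq_square algebra_simps)
      then show ?thesis using fz by (simp add: f_def cong_def)
    qed
    moreover have "z \<le> (q-1) div 2 \<or> q - z \<le> (q-1) div 2" using assms(2) by presburger
    ultimately show "a \<in> f ` {1..(q-1) div 2}" using fz zr z0
      by (cases "z \<le> (q-1) div 2") (force intro!: image_eqI[of _ _ z], force intro!: image_eqI[of _ _ "q - z"])
  qed
  have "card {1..q-1} \<le> card (f ` {1..(q-1) div 2})" by (rule card_mono[OF _ sub]) auto
  also have "\<dots> \<le> card {1..(q-1) div 2}" by (rule card_image_le) auto
  finally show False using q by auto
qed

text \<open>A modulus with a trivial symbol is a perfect square: take a prime of odd multiplicity and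
  combine a nonresidue there with the residue 1 elsewhere.\<close>
lemma exists_Jacobi_minus_1:
  fixes n :: int
  assumes "n > 0" "odd n" "\<not> is_square n"
  shows "\<exists>g. Jacobi g n = -1"
proof -
  have "normalize n = n" using assms by simp
  then obtain q where q: "prime q" "odd (multiplicity q n)"
    using assms(3) is_nth_power_conv_multiplicity[of 2 n] by auto
  define e where "e = multiplicity q n"
  have nz: "n \<noteq> 0" "\<not> is_unit q" using assms q not_prime_unit by auto
  obtain m where m: "n = q ^ e * m" "\<not> q dvd m"
    using multiplicity_decompose'[OF nz] unfolding e_def by blast
  have q0: "q > 0" using q prime_gt_0_int by blast
  have "odd e" using q(2) by (simp add: e_def)
  then have "e > 0" by (rule odd_pos)
  then have "q dvd n" using m(1) by (simp add: dvd_mult2 dvd_power)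
  then have "odd q" using assms by auto
  have m0: "m > 0" using m assms q0 by (simp add: zero_less_mult_iff)
  have "odd m" using m assms by auto
  obtain a where a: "Legendre a q = -1" using exists_quadratic_nonresidue[OF q(1) \<open>odd q\<close>] by blast
  have "coprime q m" using m q by (simp add: prime_imp_coprime)
  then obtain g where g: "[g = a] (mod q)" "[g = 1] (mod m)"
    using binary_chinese_remainder_int by blast
  have "Jacobi g (q ^ k) = Legendre a q ^ k" for k
    using Legendre_cong[OF g(1)] q q0 by (induction k) (simp_all add: Jacobi_mult_prime)
  moreover have "Jacobi g m = 1" using Jacobi_cong[OF m0 \<open>odd m\<close> g(2)] m0 \<open>odd m\<close> by simp
  ultimately have "Jacobi g n = (-1) ^ e"
    using m m0 q0 a by (subst m(1), subst Jacobi_mult_bot) auto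
  then show ?thesis using q by (auto simp: e_def)
qed

section \<open>Divisor bound, Moebius function and summation\<close>

definition divcount :: "nat \<Rightarrow> nat" where
  "divcount n = card {d. d dvd n}"

lemma divcount_prime_power_mult_le:
  assumes "prime p" "m > 0"
  shows "divcount (p ^ e * m) \<le> (e + 1) * divcount m"
proof -
  have fin: "finite ({0..e} \<times> {d. d dvd m})" using assms by simp
  have "{d. d dvd p ^ e * m} \<subseteq> (\<lambda>(i,d). p ^ i * d) ` ({0..e} \<times> {d. d dvd m})"
  proof
    fix d assume "d \<in> {d. d dvd p ^ e * m}"
    then obtain b c where "d = b * c" "b dvd p ^ e" "c dvd m" using division_decomp[of d "p^e" m] by auto
    then show "d \<in> (\<lambda>(i,d). p ^ i * d) ` ({0..e} \<times> {d. d dvd m})"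
      using divides_primepow_nat[OF assms(1), of b e] by force
  qed
  then have "divcount (p ^ e * m) \<le> card ((\<lambda>(i,d). p ^ i * d) ` ({0..e} \<times> {d. d dvd m}))"
    unfolding divcount_def using fin by (intro card_mono) auto
  also have "\<dots> \<le> card ({0..e} \<times> {d. d dvd m})" using fin by (rule card_image_le)
  also have "\<dots> = (e + 1) * divcount m" by (simp add: divcount_def card_cartesian_product)
  finally show ?thesis .
qed

text \<open>Only the finitely many primes below \<open>2 powr (1/\<epsilon>)\<close> have local factors that need a constant.\<close>
lemma divcount_bound:
  assumes "\<epsilon> > (0::real)"
  obtains C where "C \<ge> 1" "\<And>n. n > 0 \<Longrightarrow> real (divcount n) \<le> C * real n powr \<epsilon>"
proof -
  define K where "K = 2 powr (1/\<epsilon>)"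
  define L where "L = max 1 (1 / (\<epsilon> * ln 2))"
  define S where "S = (\<lambda>n::nat. {p. prime p \<and> p dvd n \<and> real p < K})"
  have L1: "L \<ge> 1" by (simp add: L_def)
  have local: "real (e + 1) \<le> L * (real p ^ e) powr \<epsilon>" if "prime p" for p e :: nat
  proof -
    have p: "real p \<ge> 2" using prime_ge_2_nat[OF that] by simp
    \<comment> \<open>This is the property for which \<open>L\<close> is chosen: it lets
      \<open>1 + x \<le> exp x\<close>, taken at \<open>x = \<epsilon> * e * ln 2\<close>, dominate
      \<open>e + 1\<close>.\<close>
    have "L * (\<epsilon> * ln 2) \<ge> 1"
    proof -
      have "1 / (\<epsilon> * ln 2) * (\<epsilon> * ln 2) \<le> L * (\<epsilon> * ln 2)"
        using assms by (intro mult_right_mono) (auto simp: L_def)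
      then show ?thesis using assms by simp
    qed
    then have "real e * (L * (\<epsilon> * ln 2)) \<ge> real e * 1" by (intro mult_left_mono) auto
    then have "real (e + 1) \<le> L * (1 + \<epsilon> * real e * ln 2)" using L1 by (simp add: algebra_simps)
    also have "1 + \<epsilon> * real e * ln 2 \<le> exp (\<epsilon> * real e * ln 2)" by (rule exp_ge_add_one_self)
    also have "\<dots> \<le> exp (\<epsilon> * (real e * ln (real p)))" using p assms by (simp add: mult_left_mono)
    also have "\<dots> = (real p ^ e) powr \<epsilon>" using p by (simp add: powr_def ln_realpow)
    finally show ?thesis using L1 by simp
  qed
  have local2: "real (e + 1) \<le> (real p ^ e) powr \<epsilon>" if "prime p" "real p \<ge> K" for p e :: nat
  proof -
    have p: "real p > 0" using prime_gt_0_nat[OF that(1)] by simp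
    have "real (e + 1) \<le> 2 ^ e" using less_exp[of e] by (metis Suc_eq_plus1 Suc_leI of_nat_le_iff of_nat_numeral of_nat_power)
    also have "2 = K powr \<epsilon>" using assms by (simp add: K_def powr_powr)
    also have "(K powr \<epsilon>) ^ e \<le> (real p powr \<epsilon>) ^ e" using that assms
      by (intro power_mono powr_mono2) (auto simp: K_def)
    also have "\<dots> = (real p ^ e) powr \<epsilon>" using p by (simp add: powr_power powr_realpow[symmetric] powr_powr mult.commute)
    finally show ?thesis .
  qed
  have finS: "finite (S n)" if "n > 0" for n
    by (rule finite_subset[of _ "{d. d dvd n}"]) (use that in \<open>auto simp: S_def\<close>)
  \<comment> \<open>Each prime factor below \<open>K\<close> costs one factor \<open>L\<close>, the
    others cost nothing; the number of small primes is bounded independently of \<open>n\<close>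
    only at the end.\<close>
  have main: "real (divcount n) \<le> L ^ card (S n) * real n powr \<epsilon>" if "n > 0" for n
    using that
  proof (induction n rule: less_induct)
    case (less n)
    show ?case
    proof (cases "n = 1")
      case True
      have "S 1 = {}" by (auto simp: S_def)
      then show ?thesis using True by (simp add: divcount_def)
    next
      case False
      then obtain p where p: "prime p" "p dvd n" using prime_factor_nat by blast
      obtain e m where em: "n = p ^ e * m" "\<not> p dvd m"
        using less(2) p multiplicity_decompose'[of n p] not_prime_unit by (metis gr0_conv_Suc nat.discI)
      have m: "m > 0" using em less by (auto intro: gr0I)
      have e: "e > 0" using em p by (auto intro: gr0I)
      have "p ^ e > 1" using e p prime_gt_1_nat one_less_power by blast
      then have mn: "m < n" using em m by simp
      note IH = less.IH[OF mn m]
      have p0: "real p > 0" using p prime_gt_0_nat by simp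
      have pw: "real n powr \<epsilon> = (real p ^ e) powr \<epsilon> * real m powr \<epsilon>"
        using em p0 m by (simp add: powr_mult)
      have le: "real (divcount n) \<le> real (e + 1) * real (divcount m)"
        using divcount_prime_power_mult_le[OF p(1) m, of e] unfolding em(1)[symmetric] of_nat_mult[symmetric] of_nat_le_iff .
      have sub: "S m \<subseteq> S n" using em by (auto simp: S_def)
      show ?thesis
      proof (cases "real p < K")
        case True
        have "insert p (S m) \<subseteq> S n" using sub p True by (auto simp: S_def)
        then have "card (insert p (S m)) \<le> card (S n)" using finS less(2) by (intro card_mono) auto
        moreover have "p \<notin> S m" using em by (auto simp: S_def)
        ultimately have c: "Suc (card (S m)) \<le> card (S n)" using finS[OF m] by simp
        have "real (divcount n) \<le> (L * (real p ^ e) powr \<epsilon>) * (L ^ card (S m) * real m powr \<epsilon>)"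
          by (rule order_trans[OF le mult_mono]) (use local[OF p(1)] IH L1 in auto)
        also have "\<dots> = L ^ Suc (card (S m)) * real n powr \<epsilon>" by (simp add: pw)
        also have "\<dots> \<le> L ^ card (S n) * real n powr \<epsilon>"
          using c L1 by (intro mult_right_mono power_increasing) auto
        finally show ?thesis .
      next
        case False
        have c: "card (S m) \<le> card (S n)" using sub finS less(2) by (intro card_mono) auto
        have "real (divcount n) \<le> (real p ^ e) powr \<epsilon> * (L ^ card (S m) * real m powr \<epsilon>)"
          by (rule order_trans[OF le mult_mono]) (use local2[OF p(1)] False IH L1 in auto)
        also have "\<dots> = L ^ card (S m) * real n powr \<epsilon>" by (simp add: pw)
        also have "\<dots> \<le> L ^ card (S n) * real n powr \<epsilon>"
          using c L1 by (intro mult_right_mono power_increasing) auto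
        finally show ?thesis .
      qed
    qed
  qed
  define T where "T = {p::nat. real p < K}"
  have finT: "finite T"
  proof (rule finite_subset)
    show "T \<subseteq> {..nat \<lceil>K\<rceil>}" unfolding T_def by (auto simp: nat_le_iff) linarith
  qed auto
  show ?thesis
  proof
    show "L ^ card T \<ge> 1" using L1 by simp
    fix n :: nat assume n: "n > 0"
    have "card (S n) \<le> card T" by (rule card_mono[OF finT]) (auto simp: S_def T_def)
    then have "L ^ card (S n) * real n powr \<epsilon> \<le> L ^ card T * real n powr \<epsilon>"
      using L1 by (intro mult_right_mono power_increasing) auto
    then show "real (divcount n) \<le> L ^ card T * real n powr \<epsilon>" using main[OF n] by linarith
  qed
qed

section \<open>The Moebius function, its truncated divisor sums and Vaughan's identity\<close>

definition moebius :: "nat \<Rightarrow> real" where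
  "moebius n = (if squarefree n then (-1) ^ card (prime_factors n) else 0)"

lemma moebius_1 [simp]: "moebius (Suc 0) = 1"
  by (simp add: moebius_def)

lemma abs_moebius_le_1: "\<bar>moebius n\<bar> \<le> 1"
  by (simp add: moebius_def)

lemma moebius_prime_mult:
  assumes "prime p" "\<not> p dvd d" "d > 0"
  shows "moebius (p * d) = - moebius d"
proof -
  have cop: "coprime p d" using assms prime_imp_coprime by blast
  have pf: "prime_factors (p * d) = insert p (prime_factors d)"
    using assms prime_gt_0_nat[of p] by (subst prime_factorization_mult) (auto simp: prime_factorization_prime)
  have "p \<notin> prime_factors d" using assms by auto
  moreover have "squarefree (p * d) \<longleftrightarrow> squarefree d"
    using squarefree_mult_coprime[OF cop] squarefree_prime[OF assms(1)] squarefree_multD(2) by blast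
  ultimately show ?thesis by (simp add: moebius_def pf)
qed

lemma moebius_mult_square:
  assumes "prime p" "p dvd d" shows "moebius (p * d) = 0"
proof -
  have "p ^ 2 dvd p * d" using assms by (simp add: power2_eq_square)
  then have "\<not> squarefree (p * d)" using assms by (intro not_squarefreeI[of p]) (auto simp: prime_gt_1_nat)
  then show ?thesis by (simp add: moebius_def)
qed

text \<open>For a fixed prime \<open>p\<close> dividing \<open>n\<close>, the divisors prime to
  \<open>p\<close> cancel against their multiples by \<open>p\<close>, and every other divisor
  contains the square of \<open>p\<close>.\<close>

lemma sum_moebius_divisors:
  assumes "n > 1"
  shows "(\<Sum>d | d dvd n. moebius d) = 0"
proof -
  obtain p where p: "prime p" "p dvd n" using assms prime_factor_nat[of n] by auto
  have fin: "finite {d. d dvd n}" using assms by simp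
  define A where "A = {d. d dvd n \<and> \<not> p dvd d}"
  define B where "B = {d. d dvd n \<and> p dvd d}"
  have p0: "p > 0" using p prime_gt_0_nat by blast
  have finA: "finite A" "finite B" using fin by (auto simp: A_def B_def intro: finite_subset)
  have "{d. d dvd n} = A \<union> B" "A \<inter> B = {}" by (auto simp: A_def B_def)
  then have "(\<Sum>d | d dvd n. moebius d) = sum moebius A + sum moebius B"
    using finA by (simp add: sum.union_disjoint)
  also have "sum moebius B = sum moebius ((*) p ` A)"
  proof (rule sum.mono_neutral_right[OF finA(2)])
    show "(*) p ` A \<subseteq> B"
    proof safe
      fix d assume d: "d \<in> A"
      then have "coprime p d" using p prime_imp_coprime by (auto simp: A_def)
      then show "p * d \<in> B" using d p by (auto simp: A_def B_def divides_mult)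
    qed
    show "\<forall>i\<in>B - (*) p ` A. moebius i = 0"
    proof
      fix i assume i: "i \<in> B - (*) p ` A"
      then obtain d where d: "i = p * d" by (auto simp: B_def)
      then have "p dvd d" using i by (auto simp: A_def B_def dest: dvd_mult_right)
      then show "moebius i = 0" using d moebius_mult_square p by simp
    qed
  qed
  also have "\<dots> = (\<Sum>d\<in>A. moebius (p * d))" using p0 by (subst sum.reindex) (auto intro: inj_onI)
  also have "\<dots> = (\<Sum>d\<in>A. - moebius d)"
  proof (rule sum.cong[OF refl])
    fix d assume "d \<in> A"
    then have "d > 0" "\<not> p dvd d" using assms by (auto simp: A_def intro: gr0I)
    then show "moebius (p * d) = - moebius d" using moebius_prime_mult p by blast
  qed
  finally show ?thesis by (simp add: sum_negf)
qed

text \<open>The coefficient of Vaughan's identity: for \<open>y \<ge> 1\<close> it is 1 at 1 and 0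
  for \<open>1 < n \<le> y\<close>, so up to \<open>y\<close> it cannot be told from the complete
  Moebius sum.\<close>

definition moebius_trunc :: "real \<Rightarrow> nat \<Rightarrow> real" where
  "moebius_trunc y n = (\<Sum>b | b dvd n \<and> real b \<le> y. moebius b)"

lemma moebius_trunc_1: "y \<ge> 1 \<Longrightarrow> moebius_trunc y (Suc 0) = 1"
proof -
  assume "y \<ge> 1"
  then have "{b. b dvd Suc 0 \<and> real b \<le> y} = {Suc 0}" by auto
  then show ?thesis by (simp add: moebius_trunc_def)
qed

lemma moebius_trunc_eq_0:
  assumes "n > 1" "real n \<le> y" shows "moebius_trunc y n = 0"
proof -
  have "{b. b dvd n \<and> real b \<le> y} = {b. b dvd n}"
  proof safe
    fix b assume "b dvd n"
    then have "b \<le> n" using assms by (intro dvd_imp_le) auto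
    then show "real b \<le> y" using assms by linarith
  qed
  then show ?thesis using sum_moebius_divisors[OF assms(1)] by (simp add: moebius_trunc_def)
qed

lemma abs_moebius_trunc_le:
  assumes "n > 0" shows "\<bar>moebius_trunc y n\<bar> \<le> real (divcount n)"
proof -
  have "\<bar>moebius_trunc y n\<bar> \<le> (\<Sum>b | b dvd n \<and> real b \<le> y. \<bar>moebius b\<bar>)"
    unfolding moebius_trunc_def by (rule sum_abs)
  also have "\<dots> \<le> (\<Sum>b | b dvd n \<and> real b \<le> y. 1)" by (intro sum_mono abs_moebius_le_1)
  also have "\<dots> \<le> (\<Sum>b | b dvd n. 1)" using assms by (intro sum_mono2) auto
  finally show ?thesis by (simp add: divcount_def)
qed

text \<open>A divisor of \<open>q * m\<close> that is at most \<open>y\<close> is smaller than the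
  prime \<open>q\<close>, hence coprime to it.\<close>

lemma moebius_trunc_prime_mult:
  assumes "prime q" "real q > y"
  shows "moebius_trunc y (q * m) = moebius_trunc y m"
proof -
  have "b dvd q * m \<and> real b \<le> y \<longleftrightarrow> b dvd m \<and> real b \<le> y" if "m > 0" for b
  proof
    assume b: "b dvd q * m \<and> real b \<le> y"
    have "\<not> q dvd b"
    proof
      assume "q dvd b"
      moreover have "b > 0" using b that assms prime_gt_0_nat[of q] by (auto intro: gr0I)
      ultimately have "q \<le> b" by (intro dvd_imp_le)
      then show False using b assms by linarith
    qed
    then have "coprime b q" using assms prime_imp_coprime coprime_commute by blast
    then show "b dvd m \<and> real b \<le> y" using b coprime_dvd_mult_right_iff by blast
  qed auto
  then show ?thesis by (cases "m = 0") (auto simp: moebius_trunc_def)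
qed

lemma mangoldt_nonneg: "mangoldt n \<ge> (0::real)"
proof (cases "primepow n")
  case True
  then have "n > Suc 0" by (rule primepow_gt_Suc_0)
  then have "aprimedivisor n > Suc 0" by simp
  then show ?thesis using True by (simp add: mangoldt_def)
qed (simp add: mangoldt_def)

text \<open>Vaughan's identity before summation. The logarithm is the divisor sum of
  \<open>mangoldt\<close>, split into small divisors, large nonprimes and primes
  \<open>q > z\<close>. At the latter the weight at \<open>n\<close> equals the weight at
  \<open>n div q\<close>, which is 1 if \<open>q = n\<close> and 0 if
  \<open>1 < n div q \<le> y\<close>; so only the prime \<open>n\<close> itself and genuinely
  bilinear terms remain.\<close>

lemma moebius_trunc_ln_identity:
  fixes y z :: real
  assumes "1 \<le> y" "y \<le> z" "n > 0"
  shows "moebius_trunc y n * ln (real n) =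
     moebius_trunc y n * (\<Sum>c | c dvd n \<and> real c \<le> z. mangoldt c) +
     moebius_trunc y n * (\<Sum>c | c dvd n \<and> z < real c \<and> \<not> prime c. mangoldt c) +
     (if prime n \<and> z < real n then ln (real n) else 0) +
     (\<Sum>q | prime q \<and> q dvd n \<and> z < real q \<and> y < real (n div q). moebius_trunc y (n div q) * ln (real q))"
proof -
  let ?g = "moebius_trunc y"
  have fin: "finite {c. c dvd n}" using assms by simp
  have ff: "finite {c. c dvd n \<and> P c}" for P using fin by (rule rev_finite_subset) auto
  define A1 where "A1 = {c. c dvd n \<and> real c \<le> z}"
  define A2 where "A2 = {c. c dvd n \<and> z < real c \<and> \<not> prime c}"
  define A3 where "A3 = {q. prime q \<and> q dvd n \<and> z < real q}"
  have fA: "finite A1" "finite A2" "finite A3" unfolding A1_def A2_def A3_def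
    by (auto intro: rev_finite_subset[OF fin])
  have "{c. c dvd n} = A1 \<union> (A2 \<union> A3)" by (auto simp: A1_def A2_def A3_def)
  moreover have "A1 \<inter> (A2 \<union> A3) = {}" "A2 \<inter> A3 = {}" by (auto simp: A1_def A2_def A3_def)
  ultimately have "(\<Sum>c | c dvd n. mangoldt c) = sum mangoldt A1 + (sum mangoldt A2 + sum mangoldt A3 :: real)"
    using fA by (simp add: sum.union_disjoint)
  moreover have "(\<Sum>c | c dvd n. mangoldt c :: real) = ln (real n)" using mangoldt_sum[of n, where 'a = real] assms by simp
  ultimately have L: "ln (real n) = sum mangoldt A1 + (sum mangoldt A2 + sum mangoldt A3 :: real)" by simp
  have "?g n * (sum mangoldt A3 :: real) = (\<Sum>q\<in>A3. ?g (n div q) * ln (real q))"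
    unfolding sum_distrib_left
  proof (rule sum.cong[OF refl])
    fix q assume q: "q \<in> A3"
    then have "n = q * (n div q)" by (simp add: A3_def)
    moreover have "?g (q * (n div q)) = ?g (n div q)"
      using q assms by (intro moebius_trunc_prime_mult) (auto simp: A3_def)
    ultimately show "?g n * mangoldt q = ?g (n div q) * ln (real q)" using q by (simp add: A3_def)
  qed
  also have "\<dots> = (\<Sum>q\<in>A3. if y < real (n div q) then ?g (n div q) * ln (real q) else 0) +
      (\<Sum>q\<in>A3. if q = n then ln (real q) else 0)"
    unfolding sum.distrib[symmetric]
  proof (rule sum.cong[OF refl])
    fix q assume q: "q \<in> A3"
    have q0: "q > 0" "q dvd n" using q prime_gt_0_nat by (auto simp: A3_def)
    then have n: "n = q * (n div q)" by simp
    have m0: "n div q > 0" using n assms(3) by (metis gr0I mult_0_right less_irrefl)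
    show "?g (n div q) * ln (real q) = (if y < real (n div q) then ?g (n div q) * ln (real q) else 0) + (if q = n then ln (real q) else 0)"
    proof (cases "n div q = 1")
      case True
      then have "q = n" using n by simp
      then show ?thesis using True assms moebius_trunc_1[of y] by auto
    next
      case False
      then have "q \<noteq> n" using q0 by auto
      moreover have "?g (n div q) = 0" if "\<not> y < real (n div q)"
        using False m0 that by (intro moebius_trunc_eq_0) auto
      ultimately show ?thesis by auto
    qed
  qed
  also have "(\<Sum>q\<in>A3. if y < real (n div q) then ?g (n div q) * ln (real q) else 0) =
    (\<Sum>q | prime q \<and> q dvd n \<and> z < real q \<and> y < real (n div q). ?g (n div q) * ln (real q))"
    unfolding sum.inter_filter[OF fA(3), symmetric] by (rule sum.cong) (auto simp: A3_def)
  also have "(\<Sum>q\<in>A3. if q = n then ln (real q) else 0) = (if n \<in> A3 then ln (real n) else 0)"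
    using fA(3) by (simp add: sum.delta)
  also have "\<dots> = (if prime n \<and> z < real n then ln (real n) else 0)" by (auto simp: A3_def)
  finally show ?thesis unfolding L A1_def[symmetric] A2_def[symmetric] by (simp add: algebra_simps)
qed

section \<open>Summation by parts\<close>

lemma abel_summation:
  fixes b w :: "nat \<Rightarrow> real"
  shows "(\<Sum>n=1..Suc N. b n * w n) =
     (\<Sum>n=1..Suc N. b n) * w (Suc N) + (\<Sum>n=1..N. (\<Sum>k=1..n. b k) * (w n - w (Suc n)))"
proof (induction N)
  case (Suc N)
  have "(\<Sum>n=1..Suc (Suc N). b n * w n) = (\<Sum>n=1..Suc N. b n * w n) + b (Suc (Suc N)) * w (Suc (Suc N))"
    by simp
  also have "\<dots> = (\<Sum>n=1..Suc (Suc N). b n) * w (Suc (Suc N)) + (\<Sum>n=1..Suc N. (\<Sum>k=1..n. b k) * (w n - w (Suc n)))"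
    unfolding Suc.IH by (simp add: algebra_simps)
  finally show ?case .
qed simp

text \<open>The boundary term and the total variation of \<open>w\<close> contribute
  \<open>W * B\<close> each; monotonicity makes the variation telescope. Both directions occur
  later, with the weights \<open>ln\<close> and \<open>1 / ln\<close>.\<close>

lemma abel_bound:
  fixes b w :: "nat \<Rightarrow> real"
  assumes B: "\<And>n. n \<le> N \<Longrightarrow> \<bar>\<Sum>k=1..n. b k\<bar> \<le> B"
    and w: "\<And>n. 1 \<le> n \<Longrightarrow> n \<le> N \<Longrightarrow> 0 \<le> w n \<and> w n \<le> W"
    and mono: "(\<forall>n. 1 \<le> n \<and> n < N \<longrightarrow> w n \<le> w (Suc n)) \<or> (\<forall>n. 1 \<le> n \<and> n < N \<longrightarrow> w (Suc n) \<le> w n)"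
    and "W \<ge> 0"
  shows "\<bar>\<Sum>n=1..N. b n * w n\<bar> \<le> 2 * W * B"
proof (cases N)
  case 0
  then show ?thesis using B[of 0] assms(4) by simp
next
  case (Suc M)
  have B0: "B \<ge> 0" using B[of 0] by simp
  have tel: "(\<Sum>n=1..M. w n - w (Suc n)) = w 1 - w (Suc M)"
    by (induction M) auto
  have "(\<Sum>n=1..M. \<bar>w n - w (Suc n)\<bar>) \<le> W"
  proof (rule disjE[OF mono])
    assume h: "\<forall>n. 1 \<le> n \<and> n < N \<longrightarrow> w n \<le> w (Suc n)"
    then have "(\<Sum>n=1..M. \<bar>w n - w (Suc n)\<bar>) = (\<Sum>n=1..M. -(w n - w (Suc n)))"
      using Suc by (intro sum.cong) auto
    also have "\<dots> = w (Suc M) - w 1" unfolding sum_negf tel by simp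
    finally show ?thesis using w[of 1] w[of "Suc M"] Suc by auto
  next
    assume h: "\<forall>n. 1 \<le> n \<and> n < N \<longrightarrow> w (Suc n) \<le> w n"
    then have "(\<Sum>n=1..M. \<bar>w n - w (Suc n)\<bar>) = (\<Sum>n=1..M. w n - w (Suc n))"
      using Suc by (intro sum.cong) auto
    also have "\<dots> = w 1 - w (Suc M)" by (rule tel)
    finally show ?thesis using w[of 1] w[of "Suc M"] Suc by auto
  qed
  then have V: "B * (\<Sum>n=1..M. \<bar>w n - w (Suc n)\<bar>) \<le> B * W" using B0 by (intro mult_left_mono)
  have "\<bar>\<Sum>n=1..N. b n * w n\<bar> \<le> \<bar>(\<Sum>n=1..N. b n) * w N\<bar> + \<bar>\<Sum>n=1..M. (\<Sum>k=1..n. b k) * (w n - w (Suc n))\<bar>"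
    unfolding Suc abel_summation by (rule abs_triangle_ineq)
  also have "\<bar>(\<Sum>n=1..N. b n) * w N\<bar> \<le> B * W"
    unfolding abs_mult using B[of N] w[of N] Suc B0 by (intro mult_mono) auto
  also have "\<bar>\<Sum>n=1..M. (\<Sum>k=1..n. b k) * (w n - w (Suc n))\<bar> \<le> (\<Sum>n=1..M. \<bar>(\<Sum>k=1..n. b k) * (w n - w (Suc n))\<bar>)"
    by (rule sum_abs)
  also have "\<dots> \<le> (\<Sum>n=1..M. B * \<bar>w n - w (Suc n)\<bar>)"
    unfolding abs_mult using B Suc by (intro sum_mono mult_right_mono) auto
  also have "\<dots> = B * (\<Sum>n=1..M. \<bar>w n - w (Suc n)\<bar>)" by (simp add: sum_distrib_left)
  finally show ?thesis using V by (simp add: algebra_simps)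
qed

section \<open>Incomplete character sums\<close>

text \<open>A map injective modulo \<open>u\<close> permutes the residue classes; it serves shifts
  and multiplication by units alike.\<close>

lemma sum_residues_reindex:
  fixes u :: int and f :: "int \<Rightarrow> 'a :: comm_monoid_add"
  assumes "u > 0" "\<And>a. f (a mod u) = f a" "\<And>a b. u dvd h a - h b \<Longrightarrow> u dvd a - b"
  shows "(\<Sum>a\<in>{0..<u}. f (h a)) = (\<Sum>a\<in>{0..<u}. f a)"
proof -
  define k where "k = (\<lambda>a. h a mod u)"
  have inj: "inj_on k {0..<u}"
  proof (rule inj_onI)
    fix a b assume ab: "a \<in> {0..<u}" "b \<in> {0..<u}" "k a = k b"
    then have "u dvd a - b" using assms(3) by (simp add: k_def mod_eq_dvd_iff)
    then have "a mod u = b mod u" by (simp add: mod_eq_dvd_iff)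
    then show "a = b" using ab by simp
  qed
  have "k ` {0..<u} \<subseteq> {0..<u}" using assms(1) by (auto simp: k_def)
  then have im: "k ` {0..<u} = {0..<u}" using inj by (intro endo_inj_surj) auto
  have "(\<Sum>a\<in>{0..<u}. f a) = (\<Sum>a\<in>{0..<u}. f (k a))"
    using sum.reindex[OF inj, of f] im by simp
  then show ?thesis using assms(2) by (simp add: k_def)
qed

lemma sum_residues_shift:
  fixes u :: int and f :: "int \<Rightarrow> 'a :: comm_monoid_add"
  assumes "u > 0" "\<And>a. f (a mod u) = f a"
  shows "(\<Sum>a\<in>{0..<u}. f (a + c)) = (\<Sum>a\<in>{0..<u}. f a)"
  by (rule sum_residues_reindex[where h = "\<lambda>a. a + c"]) (use assms in auto)

lemma sum_residues_scale:
  fixes u :: int and f :: "int \<Rightarrow> 'a :: comm_monoid_add"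
  assumes "u > 0" "\<And>a. f (a mod u) = f a" "coprime m u"
  shows "(\<Sum>a\<in>{0..<u}. f (m * a)) = (\<Sum>a\<in>{0..<u}. f a)"
proof (rule sum_residues_reindex[where h = "\<lambda>a. m * a"])
  fix a b assume "u dvd m * a - m * b"
  then have "u dvd m * (a - b)" by (simp add: algebra_simps)
  then show "u dvd a - b" using assms(3) coprime_commute coprime_dvd_mult_right_iff by blast
qed (use assms in auto)

section \<open>Additive characters and geometric sums\<close>

definition add_char :: "int \<Rightarrow> int \<Rightarrow> complex" where
  "add_char u k = cis (2 * pi * of_int k / of_int u)"

lemma add_char_add: "add_char u (k + l) = add_char u k * add_char u l"
  by (simp add: add_char_def cis_mult add_divide_distrib[symmetric] algebra_simps)

lemma norm_add_char [simp]: "norm (add_char u k) = 1"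
  by (simp add: add_char_def)

lemma cnj_add_char: "cnj (add_char u k) = add_char u (- k)"
  by (simp add: add_char_def cis_cnj)

lemma add_char_0 [simp]: "add_char u 0 = 1"
  by (simp add: add_char_def)

lemma add_char_mult_mod:
  assumes "u > 0" shows "add_char u (u * k) = 1"
proof -
  have "add_char u (u * k) = cis (2 * pi * of_int k)" using assms by (simp add: add_char_def mult.assoc)
  also have "\<dots> = 1" by (rule cis_multiple_2pi) simp
  finally show ?thesis .
qed

lemma add_char_cong:
  assumes "u > 0" "u dvd k - l" shows "add_char u k = add_char u l"
proof -
  obtain t where "k - l = u * t" using assms by blast
  then have "k = l + u * t" by simp
  then show ?thesis using add_char_mult_mod[OF assms(1)] by (simp add: add_char_add)
qed

lemma add_char_eq_1_iff:
  assumes "u > 0" shows "add_char u k = 1 \<longleftrightarrow> u dvd k"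
proof
  assume "add_char u k = 1"
  then have "cos (2 * pi * of_int k / of_int u) = 1" by (simp add: add_char_def complex_eq_iff)
  then obtain t :: int where "2 * pi * of_int k / of_int u = of_int t * 2 * pi"
    by (auto simp: cos_one_2pi_int)
  then have "of_int k = real_of_int t * of_int u" using assms by (simp add: field_simps)
  then have "k = t * u" by (metis of_int_eq_iff of_int_mult)
  then show "u dvd k" by simp
next
  assume "u dvd k"
  then show "add_char u k = 1" using add_char_cong[OF assms, of k 0] by simp
qed

lemma sum_add_char:
  assumes "u > 0"
  shows "(\<Sum>n\<in>{0..<u}. add_char u (n * k)) = (if u dvd k then of_int u else 0)"
proof (cases "u dvd k")
  case True
  then have "add_char u (n * k) = 1" for n using add_char_eq_1_iff[OF assms] by simp
  then show ?thesis using True assms by simp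
next
  case False
  let ?S = "\<Sum>n\<in>{0..<u}. add_char u (n * k)"
  have "(\<Sum>n\<in>{0..<u}. add_char u ((n + 1) * k)) = ?S"
  proof (rule sum_residues_shift[OF assms])
    fix a
    have "u dvd a mod u - a" by (simp add: mod_eq_dvd_iff[symmetric])
    then have "u dvd (a mod u - a) * k" by simp
    then show "add_char u (a mod u * k) = add_char u (a * k)"
      by (intro add_char_cong[OF assms]) (simp add: algebra_simps)
  qed
  moreover have "(\<Sum>n\<in>{0..<u}. add_char u ((n + 1) * k)) = ?S * add_char u k"
    by (simp add: sum_distrib_right add_char_add distrib_right)
  ultimately have "?S * (add_char u k - 1) = 0" by (simp add: algebra_simps)
  then show ?thesis using False add_char_eq_1_iff[OF assms, of k] by simp
qed

lemma norm_one_minus_cis: "norm (1 - cis t) = 2 * \<bar>sin (t / 2)\<bar>"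
proof -
  have "(norm (1 - cis t))\<^sup>2 = (1 - cos t)\<^sup>2 + (sin t)\<^sup>2" by (simp add: cmod_power2)
  also have "\<dots> = 1 - 2 * cos t + ((cos t)\<^sup>2 + (sin t)\<^sup>2)" by (simp add: power2_eq_square algebra_simps)
  also have "\<dots> = 2 - 2 * cos t" using sin_cos_squared_add2[of t] by simp
  also have "cos t = 1 - 2 * (sin (t/2))\<^sup>2" using cos_double_sin[of "t/2"] by simp
  finally have "(norm (1 - cis t))\<^sup>2 = (2 * \<bar>sin (t/2)\<bar>)\<^sup>2" by (simp add: power_mult_distrib)
  then show ?thesis by (rule power2_eq_imp_eq) auto
qed

text \<open>Crude on purpose: the cubic Taylor error is at most \<open>x ^ 3 / 6\<close>, and
  \<open>x ^ 3 \<le> 4 * x\<close> on the interval leaves a third of \<open>x\<close>.\<close>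

lemma sin_lower_bound:
  assumes "0 \<le> x" "x \<le> (2::real)"
  shows "x / 3 \<le> sin x"
proof -
  have c: "(\<Sum>m<3. sin_coeff m * x ^ m) = x" by (simp add: numeral_3_eq_3 sin_coeff_def)
  have "\<bar>sin x - x\<bar> \<le> inverse (fact 3) * \<bar>x\<bar> ^ 3"
    using Maclaurin_sin_bound[of x 3] unfolding c .
  then have "\<bar>sin x - x\<bar> \<le> x ^ 3 / 6" using assms by (simp add: fact_numeral field_simps)
  moreover have "x ^ 3 \<le> 4 * x"
  proof -
    have "x * x \<le> 2 * 2" using assms by (intro mult_mono) auto
    then have "x * (x * x) \<le> x * 4" using assms by (intro mult_left_mono) auto
    then show ?thesis by (simp add: power3_eq_cube algebra_simps)
  qed
  ultimately show ?thesis by linarith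
qed

text \<open>The left side is the distance of \<open>n / u\<close> to the nearest integer. Reflecting
  \<open>n\<close> to \<open>u - n\<close> brings the angle below \<open>pi / 2\<close>, inside the
  range of \<open>sin_lower_bound\<close>.\<close>

lemma norm_one_minus_add_char:
  assumes "0 < n" "n < u"
  shows "of_int (min n (u - n)) / of_int u \<le> norm (1 - add_char u n)"
proof -
  have key: "real_of_int m / of_int u \<le> 2 * sin (pi * of_int m / of_int u)" if "0 < m" "2 * m \<le> u" for m
  proof -
    let ?x = "pi * of_int m / of_int u"
    have u: "real_of_int u > 0" using that by simp
    have "real_of_int (2 * m) \<le> of_int u" using that by linarith
    then have m2: "2 * real_of_int m / of_int u \<le> 1" using u by simp
    have "?x = (pi/2) * (2 * real_of_int m / of_int u)" by simp
    also have "\<dots> \<le> (pi/2) * 1" using m2 by (intro mult_left_mono) auto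
    finally have "?x \<le> 2" using pi_less_4 by linarith
    then have "?x / 3 \<le> sin ?x" using that u by (intro sin_lower_bound) auto
    moreover have "real_of_int m / of_int u * 2 \<le> real_of_int m / of_int u * pi"
      using that u pi_ge_two by (intro mult_left_mono) auto
    moreover have "real_of_int m / of_int u \<ge> 0" using that u by simp
    ultimately show ?thesis by (simp add: algebra_simps)
  qed
  have N: "norm (1 - add_char u n) = 2 * \<bar>sin (pi * of_int n / of_int u)\<bar>"
    unfolding add_char_def norm_one_minus_cis by simp
  show ?thesis
  proof (cases "2 * n \<le> u")
    case True
    then show ?thesis using key[of n] assms unfolding N by (simp add: min_def)
  next
    case False
    have "sin (pi * of_int (u - n) / of_int u) = sin (pi - pi * of_int n / of_int u)"
      using assms by (simp add: field_simps)
    also have "\<dots> = sin (pi * of_int n / of_int u)" by (rule sin_pi_minus)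
    finally show ?thesis using key[of "u - n"] False assms unfolding N by (simp add: min_def)
  qed
qed

lemma sum_int_telescope:
  fixes g :: "int \<Rightarrow> 'a :: ab_group_add"
  shows "(\<Sum>j\<in>{lo..<lo + int k}. g j - g (j + 1)) = g lo - g (lo + int k)"
proof (induction k)
  case (Suc k)
  have "{lo..<lo + int (Suc k)} = insert (lo + int k) {lo..<lo + int k}" by auto
  then show ?case using Suc by (simp add: algebra_simps)
qed simp

text \<open>Multiplying the geometric sum by \<open>1 - add_char u n\<close> makes it telescope to
  two terms. The reciprocal of the minimum is relaxed to a sum of two reciprocals, which is
  symmetric under \<open>n \<mapsto> u - n\<close>.\<close>

lemma norm_sum_add_char_le:
  assumes "0 < n" "n < u"
  shows "norm (\<Sum>j\<in>{lo..<hi}. add_char u (j * n)) \<le> 2 * of_int u * (1 / of_int n + 1 / of_int (u - n))"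
proof (cases "lo \<le> hi")
  case True
  let ?S = "\<Sum>j\<in>{lo..<hi}. add_char u (j * n)"
  obtain k where k: "hi = lo + int k" using True zle_iff_zadd by blast
  have "?S * (1 - add_char u n) = (\<Sum>j\<in>{lo..<hi}. add_char u (j * n) - add_char u ((j + 1) * n))"
    unfolding sum_distrib_right by (intro sum.cong refl) (simp add: algebra_simps add_char_add)
  also have "\<dots> = add_char u (lo * n) - add_char u (hi * n)"
    unfolding k by (rule sum_int_telescope)
  finally have "norm ?S * norm (1 - add_char u n) = norm (add_char u (lo * n) - add_char u (hi * n))"
    by (metis norm_mult)
  also have "\<dots> \<le> 2" using norm_triangle_ineq4[of "add_char u (lo * n)" "add_char u (hi * n)"] by simp
  finally have A: "norm ?S * norm (1 - add_char u n) \<le> 2" .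
  define m where "m = min n (u - n)"
  have m: "m > 0" using assms by (simp add: m_def)
  have "norm ?S * (of_int m / of_int u) \<le> norm ?S * norm (1 - add_char u n)"
    using norm_one_minus_add_char[OF assms] by (intro mult_left_mono) (auto simp: m_def)
  with A have "norm ?S * (of_int m / of_int u) \<le> 2" by linarith
  then have "norm ?S \<le> 2 * of_int u * (1 / of_int m)" using m assms by (simp add: field_simps)
  also have "1 / real_of_int m \<le> 1 / of_int n + 1 / of_int (u - n)"
    using assms by (auto simp: m_def min_def)
  finally show ?thesis using assms by (simp add: mult_left_mono)
next
  case False
  then show ?thesis using assms by simp
qed

section \<open>The discrete Fourier transform of the Jacobi symbol\<close>

definition fourier :: "int \<Rightarrow> (int \<Rightarrow> real) \<Rightarrow> int \<Rightarrow> complex" where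
  "fourier u f n = (\<Sum>a\<in>{0..<u}. of_real (f a) * add_char u (a * n))"

lemma fourier_inversion:
  assumes "u > 0" "\<And>a. f (a mod u) = f a"
  shows "of_int u * of_real (f j) = (\<Sum>n\<in>{0..<u}. fourier u f n * add_char u (- (j * n)))"
proof -
  have "(\<Sum>n\<in>{0..<u}. fourier u f n * add_char u (- (j * n))) =
     (\<Sum>n\<in>{0..<u}. \<Sum>a\<in>{0..<u}. of_real (f a) * add_char u (n * (a - j)))"
    unfolding fourier_def sum_distrib_right
    by (intro sum.cong refl) (simp add: mult.assoc add_char_add[symmetric] algebra_simps)
  also have "\<dots> = (\<Sum>a\<in>{0..<u}. of_real (f a) * (\<Sum>n\<in>{0..<u}. add_char u (n * (a - j))))"
    by (subst sum.swap) (simp add: sum_distrib_left)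
  also have "\<dots> = (\<Sum>a\<in>{0..<u}. if a = j mod u then of_real (f a) * of_int u else 0)"
  proof (rule sum.cong[OF refl])
    fix a assume a: "a \<in> {0..<u}"
    have "u dvd a - j \<longleftrightarrow> a = j mod u" using a by (auto simp: mod_eq_dvd_iff[symmetric])
    then show "of_real (f a) * (\<Sum>n\<in>{0..<u}. add_char u (n * (a - j))) =
       (if a = j mod u then of_real (f a) * of_int u else 0)"
      using sum_add_char[OF assms(1), of "a - j"] by simp
  qed
  also have "\<dots> = of_real (f (j mod u)) * of_int u"
    using assms(1) by (subst sum.delta) auto
  finally show ?thesis using assms(2) by simp
qed

lemma fourier_parseval:
  assumes "u > 0"
  shows "(\<Sum>n\<in>{0..<u}. (norm (fourier u f n))\<^sup>2) = of_int u * (\<Sum>a\<in>{0..<u}. (f a)\<^sup>2)"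
proof -
  have "complex_of_real (\<Sum>n\<in>{0..<u}. (norm (fourier u f n))\<^sup>2) =
     (\<Sum>n\<in>{0..<u}. fourier u f n * cnj (fourier u f n))"
    by (simp only: of_real_sum complex_norm_square)
  also have "\<dots> = (\<Sum>n\<in>{0..<u}. \<Sum>a\<in>{0..<u}. \<Sum>b\<in>{0..<u}. of_real (f a * f b) * add_char u (n * (a - b)))"
    unfolding fourier_def cnj_sum sum_product
    by (intro sum.cong refl) (simp add: cnj_add_char add_char_add[symmetric] algebra_simps flip: mult.assoc)
  also have "\<dots> = (\<Sum>a\<in>{0..<u}. \<Sum>b\<in>{0..<u}. \<Sum>n\<in>{0..<u}. of_real (f a * f b) * add_char u (n * (a - b)))"
  proof -
    have "(\<Sum>n\<in>{0..<u}. \<Sum>a\<in>{0..<u}. \<Sum>b\<in>{0..<u}. of_real (f a * f b) * add_char u (n * (a - b))) =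
       (\<Sum>a\<in>{0..<u}. \<Sum>n\<in>{0..<u}. \<Sum>b\<in>{0..<u}. of_real (f a * f b) * add_char u (n * (a - b)))"
      by (rule sum.swap)
    also have "\<dots> = (\<Sum>a\<in>{0..<u}. \<Sum>b\<in>{0..<u}. \<Sum>n\<in>{0..<u}. of_real (f a * f b) * add_char u (n * (a - b)))"
      by (intro sum.cong refl sum.swap)
    finally show ?thesis .
  qed
  also have "\<dots> = (\<Sum>a\<in>{0..<u}. \<Sum>b\<in>{0..<u}. if b = a then of_real (f a * f a) * of_int u else 0)"
  proof (intro sum.cong refl)
    fix a b assume ab: "a \<in> {0..<u}" "b \<in> {0..<u}"
    have "u dvd a - b \<longleftrightarrow> b = a" using ab by (auto simp: mod_eq_dvd_iff[symmetric])
    then show "(\<Sum>n\<in>{0..<u}. of_real (f a * f b) * add_char u (n * (a - b))) =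
       (if b = a then of_real (f a * f a) * of_int u else 0)"
      using sum_add_char[OF assms, of "a - b"] by (simp add: sum_distrib_left[symmetric])
  qed
  also have "\<dots> = of_real (of_int u * (\<Sum>a\<in>{0..<u}. (f a)\<^sup>2))"
    by (simp add: sum.delta sum_distrib_left power2_eq_square mult.commute)
  finally show ?thesis by (simp only: of_real_eq_iff)
qed

abbreviation jac :: "int \<Rightarrow> int \<Rightarrow> real" where
  "jac u a \<equiv> real_of_int (Jacobi a u)"

text \<open>Substituting \<open>m * a\<close> for \<open>a\<close> pulls out the symbol of the unit
  \<open>m\<close>, which is a sign.\<close>

lemma fourier_jac_scale:
  assumes "u > 0" "odd u" "coprime m u"
  shows "norm (fourier u (jac u) (m * n)) = norm (fourier u (jac u) n)"
proof -
  have per: "of_real (jac u (a mod u)) * add_char u (a mod u * n) = of_real (jac u a) * add_char u (a * n)" for a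
  proof -
    have "u dvd (a mod u - a) * n" by (simp add: mod_eq_dvd_iff[symmetric])
    then have "add_char u (a mod u * n) = add_char u (a * n)"
      by (intro add_char_cong[OF assms(1)]) (simp add: algebra_simps)
    then show ?thesis using Jacobi_mod[OF assms(1,2)] by simp
  qed
  have "fourier u (jac u) n = (\<Sum>a\<in>{0..<u}. of_real (jac u (m * a)) * add_char u (m * a * n))"
    unfolding fourier_def
    by (rule sum_residues_scale[where f = "\<lambda>a. of_real (jac u a) * add_char u (a * n)", symmetric])
      (use assms per in auto)
  also have "\<dots> = of_real (jac u m) * fourier u (jac u) (m * n)"
    unfolding fourier_def sum_distrib_left using assms
    by (intro sum.cong refl) (simp add: Jacobi_mult_top mult_ac)
  finally have "norm (fourier u (jac u) n) = \<bar>jac u m\<bar> * norm (fourier u (jac u) (m * n))"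
    by (simp add: norm_mult)
  moreover have "\<bar>jac u m\<bar> = 1"
    using Jacobi_eq_0_iff[OF assms(1,2), of m] Jacobi_abs_le_1[OF assms(1,2), of m] assms(3)
    by (cases "Jacobi m u = 0") auto
  ultimately show ?thesis by simp
qed

text \<open>With \<open>g = gcd n u\<close>, solutions agree modulo \<open>u div g\<close>; the
  quotient by \<open>u div g\<close> therefore separates them, and it takes at most \<open>g\<close>
  values.\<close>

lemma card_linear_congruence_le:
  fixes u :: int
  assumes "u > 0" 
  shows "card {m\<in>{0..<u}. (m * n) mod u = r} \<le> nat (gcd n u)"
proof -
  define g where "g = gcd n u"
  have g: "g > 0" "g dvd n" "g dvd u" using assms by (auto simp: g_def)
  define w where "w = u div g"
  have w: "u = g * w" using g by (simp add: w_def)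
  have w0: "w > 0" using assms g w by (simp add: zero_less_mult_iff)
  let ?M = "{m\<in>{0..<u}. (m * n) mod u = r}"
  have "inj_on (\<lambda>m. m div w) ?M"
  proof (rule inj_onI)
    fix a b assume ab: "a \<in> ?M" "b \<in> ?M" "a div w = b div w"
    then have "(a * n) mod u = (b * n) mod u" by simp
    then have "u dvd (a - b) * n" by (simp add: mod_eq_dvd_iff algebra_simps)
    moreover have "n = g * (n div g)" using g by simp
    ultimately have "g * w dvd g * ((a - b) * (n div g))" by (metis w mult.left_commute)
    then have "w dvd (a - b) * (n div g)" using g by simp
    moreover have "coprime w (n div g)"
      using assms div_gcd_coprime[of u n] by (simp add: w_def g_def gcd.commute)
    ultimately have "w dvd a - b" using coprime_dvd_mult_left_iff by blast
    then have "a mod w = b mod w" by (simp add: mod_eq_dvd_iff)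
    then show "a = b" using ab(3) by (metis div_mult_mod_eq)
  qed
  moreover have "(\<lambda>m. m div w) ` ?M \<subseteq> {0..<g}"
  proof
    fix x assume "x \<in> (\<lambda>m. m div w) ` ?M"
    then obtain m where m: "x = m div w" "0 \<le> m" "m < g * w" using w by auto
    have "m div w < g"
    proof (rule ccontr)
      assume "\<not> m div w < g"
      then have "g * w \<le> (m div w) * w" using w0 by (intro mult_right_mono) auto
      also have "\<dots> \<le> m" using w0 div_mult_mod_eq[of m w] pos_mod_sign[of w m] by linarith
      finally show False using m by simp
    qed
    then show "x \<in> {0..<g}" using m w0 by (simp add: pos_imp_zdiv_nonneg_iff)
  qed
  ultimately have "card ?M \<le> card {0..<g}" by (intro card_inj_on_le) auto
  then show ?thesis by (simp add: g_def)
qed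

text \<open>Parseval restricted to the orbit of \<open>n\<close> under multiplication by units replaces the
  evaluation of Gauss sums, and covers imprimitive symbols as well.\<close>
lemma fourier_jac_bound:
  assumes "u > 0" "odd u"
  shows "(norm (fourier u (jac u) n))\<^sup>2 \<le> real_of_int (gcd n u) * real_of_int u * real (divcount (nat u))"
proof -
  let ?F = "\<lambda>n. (norm (fourier u (jac u) n))\<^sup>2"
  have per: "?F (k mod u) = ?F k" for k
  proof -
    have "add_char u (a * (k mod u)) = add_char u (a * k)" for a
    proof -
      have "u dvd a * (k mod u - k)" by (simp add: mod_eq_dvd_iff[symmetric])
      then show ?thesis by (intro add_char_cong[OF assms(1)]) (simp add: algebra_simps)
    qed
    then show ?thesis by (simp add: fourier_def)
  qed
  define A where "A = {m\<in>{0..<u}. coprime m u}"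
  have cardA: "card A = totient (nat u)"
  proof (cases "u = 1")
    case True
    then have "A = {0}" by (auto simp: A_def)
    then show ?thesis using True by simp
  next
    case False
    then have u1: "u > 1" using assms by simp
    have "A = int ` totatives (nat u)"
    proof (rule equalityI; rule subsetI)
      fix m assume m: "m \<in> A"
      then have "m \<noteq> 0" using u1 by (auto simp: A_def)
      then have "nat m \<in> totatives (nat u)" "m = int (nat m)"
        using m by (auto simp: A_def totatives_def coprime_int_iff[symmetric])
      then show "m \<in> int ` totatives (nat u)" by blast
    next
      fix m assume "m \<in> int ` totatives (nat u)"
      then obtain k where k: "m = int k" "k \<in> totatives (nat u)" by blast
      then have "coprime k (nat u)" "k \<le> nat u" "k \<noteq> nat u" using u1 by (auto simp: totatives_def)
      then have "coprime (int k) (int (nat u))" by (simp only: coprime_int_iff)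
      then show "m \<in> A" using k \<open>k \<le> nat u\<close> \<open>k \<noteq> nat u\<close> u1 by (auto simp: A_def)
    qed
    then show ?thesis by (simp add: card_image totient_def)
  qed
  have "real (totient (nat u)) * ?F n = (\<Sum>m\<in>A. ?F (m * n))"
    using fourier_jac_scale[OF assms] cardA by (simp add: A_def)
  also have "\<dots> = (\<Sum>m\<in>A. ?F ((m * n) mod u))" using per by simp
  also have "\<dots> \<le> (\<Sum>m\<in>{0..<u}. ?F ((m * n) mod u))" by (intro sum_mono2) (auto simp: A_def)
  also have "\<dots> = (\<Sum>r\<in>{0..<u}. \<Sum>m | m \<in> {0..<u} \<and> (m * n) mod u = r. ?F ((m * n) mod u))"
    using assms(1) by (subst sum.group) auto
  also have "\<dots> = (\<Sum>r\<in>{0..<u}. real (card {m\<in>{0..<u}. (m * n) mod u = r}) * ?F r)"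
    by (intro sum.cong refl) simp
  also have "\<dots> \<le> (\<Sum>r\<in>{0..<u}. of_int (gcd n u) * ?F r)"
  proof (intro sum_mono mult_right_mono)
    fix r
    have "real (card {m\<in>{0..<u}. (m * n) mod u = r}) \<le> real (nat (gcd n u))"
      using card_linear_congruence_le[OF assms(1)] by (simp only: of_nat_le_iff)
    then show "real (card {m\<in>{0..<u}. (m * n) mod u = r}) \<le> of_int (gcd n u)" by simp
  qed auto
  also have "\<dots> = of_int (gcd n u) * (of_int u * (\<Sum>a\<in>{0..<u}. (jac u a)\<^sup>2))"
    by (simp add: sum_distrib_left[symmetric] fourier_parseval[OF assms(1)])
  also have "(\<Sum>a\<in>{0..<u}. (jac u a)\<^sup>2) \<le> (\<Sum>a\<in>{0..<u}. 1)"
  proof (rule sum_mono)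
    fix a
    show "(jac u a)\<^sup>2 \<le> 1" using Jacobi_values[OF assms, of a] by auto
  qed
  also have "(\<Sum>a\<in>{0..<u}. 1) = real_of_int u" using assms by simp
  finally have 1: "real (totient (nat u)) * ?F n \<le> of_int (gcd n u) * (of_int u * of_int u)"
    using assms by (simp add: mult_left_mono)
  \<comment> \<open>Trades the number of units for \<open>u\<close> itself: the divisor sum of
    \<open>totient\<close> equals \<open>u\<close>, and none of its terms exceeds
    \<open>totient (nat u)\<close>.\<close>
  have "nat u = (\<Sum>d | d dvd nat u. totient d)" by (rule totient_divisor_sum[symmetric])
  also have "\<dots> \<le> (\<Sum>d | d dvd nat u. totient (nat u))"
    using assms by (intro sum_mono totient_dvd_mono) auto
  also have "\<dots> = divcount (nat u) * totient (nat u)" by (simp add: divcount_def)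
  finally have "real (nat u) \<le> real (divcount (nat u)) * real (totient (nat u))"
    by (simp only: of_nat_le_iff of_nat_mult[symmetric])
  then have "real_of_int u * ?F n \<le> (real (divcount (nat u)) * real (totient (nat u))) * ?F n"
    using assms by (intro mult_right_mono) auto
  also have "\<dots> = real (divcount (nat u)) * (real (totient (nat u)) * ?F n)" by simp
  also have "\<dots> \<le> real (divcount (nat u)) * (of_int (gcd n u) * (of_int u * of_int u))"
    using 1 by (intro mult_left_mono) auto
  finally have "real_of_int u * ?F n \<le> of_int u * (of_int (gcd n u) * of_int u * divcount (nat u))"
    by (simp add: algebra_simps)
  then show ?thesis using assms by (simp add: mult_le_cancel_left)
qed

lemma harmonic_le: "N \<ge> 1 \<Longrightarrow> (\<Sum>k=1..N. 1 / real k) \<le> 1 + ln (real N)"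
proof (induction N rule: nat_induct_at_least)
  case (Suc N)
  have "1 / real (Suc N) \<le> ln (real (Suc N)) - ln (real N)"
  proof -
    have "ln (real N / real (Suc N)) \<le> real N / real (Suc N) - 1" using Suc by (intro ln_le_minus_one) auto
    moreover have "ln (real N / real (Suc N)) = ln (real N) - ln (real (Suc N))" using Suc by (simp add: ln_div)
    moreover have "real N / real (Suc N) - 1 = - (1 / real (Suc N))" by (simp add: field_simps)
    ultimately show ?thesis by linarith
  qed
  then show ?case using Suc by simp
qed simp

text \<open>The gcd is replaced by a sum over all divisors \<open>g\<close> of \<open>u\<close>
  dividing \<open>n\<close>. Writing \<open>n = g * k\<close> leaves
  \<open>sqrt g / g \<le> 1\<close> times a harmonic sum for each \<open>g\<close>.\<close>

lemma sum_sqrt_gcd_over_le: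
  assumes "u > (0::nat)"
  shows "(\<Sum>n=1..u. sqrt (real (gcd n u)) / real n) \<le> real (divcount u) * (1 + ln (real u))"
proof -
  have "(\<Sum>n=1..u. sqrt (real (gcd n u)) / real n) \<le>
     (\<Sum>n=1..u. \<Sum>g | g dvd u. if g dvd n then sqrt (real g) / real n else 0)"
  proof (rule sum_mono)
    fix n assume n: "n \<in> {1..u}"
    have "sqrt (real (gcd n u)) / real n = (\<Sum>g\<in>{gcd n u}. if g dvd n then sqrt (real g) / real n else 0)" by simp
    also have "\<dots> \<le> (\<Sum>g | g dvd u. if g dvd n then sqrt (real g) / real n else 0)"
      using assms by (intro sum_mono2) auto
    finally show "sqrt (real (gcd n u)) / real n \<le> \<dots>" .
  qed
  also have "\<dots> = (\<Sum>g | g dvd u. \<Sum>n=1..u. if g dvd n then sqrt (real g) / real n else 0)"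
    by (rule sum.swap)
  also have "\<dots> \<le> (\<Sum>g | g dvd u. 1 + ln (real u))"
  proof (rule sum_mono)
    fix g assume "g \<in> {g. g dvd u}"
    then have g: "g > 0" "g \<le> u" using assms by (auto intro: gr0I dvd_imp_le)
    have "(\<Sum>n=1..u. if g dvd n then sqrt (real g) / real n else 0) = (\<Sum>n | n \<in> {1..u} \<and> g dvd n. sqrt (real g) / real n)"
      by (subst sum.inter_filter[symmetric]) auto
    also have "\<dots> \<le> (\<Sum>n\<in>(*) g ` {1..u}. sqrt (real g) / real n)"
      by (intro sum_mono2) (use g in \<open>force elim!: dvdE intro: order_trans[rotated]\<close>)+
    also have "\<dots> = (\<Sum>k=1..u. sqrt (real g) / real (g * k))"
      using g by (subst sum.reindex) (auto intro: inj_onI)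
    also have "\<dots> = (sqrt (real g) / real g) * (\<Sum>k=1..u. 1 / real k)"
      by (simp add: sum_distrib_left)
    also have "\<dots> \<le> 1 * (1 + ln (real u))"
    proof (rule mult_mono)
      have "sqrt (real g) \<le> real g" using g by (intro real_le_lsqrt) (auto simp: power2_eq_square)
      then show "sqrt (real g) / real g \<le> 1" using g by simp
    qed (use harmonic_le[of u] assms in \<open>auto intro: sum_nonneg\<close>)
    finally show "(\<Sum>n=1..u. if g dvd n then sqrt (real g) / real n else 0) \<le> 1 + ln (real u)" by simp
  qed
  also have "\<dots> = real (divcount u) * (1 + ln (real u))" by (simp add: divcount_def)
  finally show ?thesis .
qed

text \<open>Multiplication by a unit of symbol -1, which a nonsquare modulus has, maps the sum to
  its negative.\<close>

lemma sum_jac_residues: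
  assumes "u > 0" "odd u" "\<not> is_square u"
  shows "(\<Sum>a\<in>{0..<u}. jac u a) = 0"
proof -
  obtain g where g: "Jacobi g u = -1" using exists_Jacobi_minus_1[OF assms] by blast
  then have "coprime g u" using Jacobi_eq_0_iff[OF assms(1,2), of g] by auto
  then have "(\<Sum>a\<in>{0..<u}. jac u (g * a)) = (\<Sum>a\<in>{0..<u}. jac u a)"
    by (intro sum_residues_scale[OF assms(1)]) (simp_all add: Jacobi_mod[OF assms(1,2)])
  then have "- (\<Sum>a\<in>{0..<u}. jac u a) = (\<Sum>a\<in>{0..<u}. jac u a)"
    by (simp add: Jacobi_mult_top[OF assms(1,2)] g sum_negf)
  then show ?thesis by linarith
qed

text \<open>Completion of the interval sum. The frequency 0 drops out because the full sum vanishes.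
  At frequency \<open>n\<close> the bound for the transform carries an extra
  \<open>sqrt (gcd n u)\<close>, the price of admitting imprimitive symbols, and the weighted
  harmonic sum absorbs it.\<close>

theorem Polya_Vinogradov_Jacobi:
  assumes "u > 0" "odd u" "\<not> is_square u"
  shows "\<bar>\<Sum>j\<in>{lo..<hi}. jac u j\<bar> \<le>
    4 * sqrt (real_of_int u * real (divcount (nat u))) * real (divcount (nat u)) * (1 + ln (real_of_int u))"
proof -
  let ?F = "fourier u (jac u)"
  let ?t = "real (divcount (nat u))"
  define K where "K = sqrt (of_int u * ?t)"
  have K0: "K \<ge> 0" using assms by (simp add: K_def)
  have F0: "?F 0 = 0"
    using sum_jac_residues[OF assms] unfolding fourier_def by (simp flip: of_real_sum of_int_sum)
  have Fb: "norm (?F n) \<le> K * sqrt (of_int (gcd n u))" for n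
  proof -
    have "norm (?F n) = sqrt ((norm (?F n))\<^sup>2)" by simp
    also have "\<dots> \<le> sqrt (real_of_int (gcd n u) * real_of_int u * ?t)"
      by (rule real_sqrt_le_mono[OF fourier_jac_bound[OF assms(1,2)]])
    finally show ?thesis by (simp add: K_def real_sqrt_mult mult_ac)
  qed
  have gcd_sum: "(\<Sum>n\<in>{1..<u}. sqrt (real_of_int (gcd n u)) / of_int n) \<le> ?t * (1 + ln (of_int u))"
  proof -
    have "(\<Sum>n\<in>{1..<u}. sqrt (real_of_int (gcd n u)) / of_int n) = (\<Sum>n\<in>{1..<nat u}. sqrt (real (gcd n (nat u))) / real n)"
    proof (rule sum.reindex_bij_witness[of _ int nat])
      fix n assume n: "n \<in> {1..<u}"
      have "real (gcd (nat n) (nat u)) = of_int (int (gcd (nat n) (nat u)))" by simp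
      also have "int (gcd (nat n) (nat u)) = gcd n u"
        unfolding gcd_int_int_eq[symmetric] using n by simp
      finally show "sqrt (real (gcd (nat n) (nat u))) / real (nat n) = sqrt (real_of_int (gcd n u)) / of_int n"
        using n by simp
    qed (use assms(1) in auto)
    also have "\<dots> \<le> (\<Sum>n=1..nat u. sqrt (real (gcd n (nat u))) / real n)" by (intro sum_mono2) auto
    also have "\<dots> \<le> ?t * (1 + ln (real (nat u)))" using assms by (intro sum_sqrt_gcd_over_le) auto
    finally show ?thesis using assms(1) by simp
  qed
  have "of_int u * complex_of_real (\<Sum>j\<in>{lo..<hi}. jac u j) = (\<Sum>j\<in>{lo..<hi}. of_int u * of_real (jac u j))"
    by (simp add: sum_distrib_left)
  also have "\<dots> = (\<Sum>j\<in>{lo..<hi}. \<Sum>n\<in>{0..<u}. ?F n * add_char u (- (j * n)))"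
    by (intro sum.cong refl fourier_inversion[OF assms(1)]) (simp add: Jacobi_mod[OF assms(1,2)])
  also have "\<dots> = (\<Sum>n\<in>{0..<u}. ?F n * (\<Sum>j\<in>{lo..<hi}. add_char u (- (j * n))))"
    by (subst sum.swap) (simp add: sum_distrib_left)
  also have "\<dots> = (\<Sum>n\<in>{1..<u}. ?F n * (\<Sum>j\<in>{lo..<hi}. add_char u (- (j * n))))"
  proof (rule sum.mono_neutral_right)
    show "\<forall>i\<in>{0..<u} - {1..<u}. ?F i * (\<Sum>j\<in>{lo..<hi}. add_char u (- (j * i))) = 0"
    proof
      fix i assume "i \<in> {0..<u} - {1..<u}"
      then have "i = 0" by auto
      then show "?F i * (\<Sum>j\<in>{lo..<hi}. add_char u (- (j * i))) = 0" using F0 by simp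
    qed
  qed auto
  finally have "norm (of_int u * complex_of_real (\<Sum>j\<in>{lo..<hi}. jac u j)) =
     norm (\<Sum>n\<in>{1..<u}. ?F n * (\<Sum>j\<in>{lo..<hi}. add_char u (- (j * n))))" by simp
  then have "of_int u * \<bar>\<Sum>j\<in>{lo..<hi}. jac u j\<bar> = norm (\<Sum>n\<in>{1..<u}. ?F n * (\<Sum>j\<in>{lo..<hi}. add_char u (- (j * n))))"
    using assms(1) unfolding norm_mult norm_of_real by simp
  also have "\<dots> \<le> (\<Sum>n\<in>{1..<u}. norm (?F n * (\<Sum>j\<in>{lo..<hi}. add_char u (- (j * n)))))" by (rule norm_sum)
  also have "\<dots> \<le> (\<Sum>n\<in>{1..<u}. (K * sqrt (of_int (gcd n u))) * (2 * of_int u * (1 / of_int n + 1 / of_int (u - n))))"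
  proof (rule sum_mono)
    fix n assume n: "n \<in> {1..<u}"
    have "(\<Sum>j\<in>{lo..<hi}. add_char u (- (j * n))) = cnj (\<Sum>j\<in>{lo..<hi}. add_char u (j * n))"
      by (simp add: cnj_add_char)
    then have "norm (\<Sum>j\<in>{lo..<hi}. add_char u (- (j * n))) = norm (\<Sum>j\<in>{lo..<hi}. add_char u (j * n))"
      by (simp only: complex_mod_cnj)
    also have "\<dots> \<le> 2 * of_int u * (1 / of_int n + 1 / of_int (u - n))"
      using n by (intro norm_sum_add_char_le) auto
    finally show "norm (?F n * (\<Sum>j\<in>{lo..<hi}. add_char u (- (j * n)))) \<le>
        (K * sqrt (of_int (gcd n u))) * (2 * of_int u * (1 / of_int n + 1 / of_int (u - n)))"
      unfolding norm_mult using Fb K0 by (intro mult_mono) auto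
  qed
  also have "\<dots> = 2 * of_int u * K * ((\<Sum>n\<in>{1..<u}. sqrt (of_int (gcd n u)) / of_int n) +
      (\<Sum>n\<in>{1..<u}. sqrt (of_int (gcd n u)) / of_int (u - n)))"
    unfolding sum.distrib[symmetric] sum_distrib_left by (intro sum.cong refl) (simp add: algebra_simps add_divide_distrib)
  \<comment> \<open>The reflection \<open>n \<mapsto> u - n\<close> preserves the gcd with
    \<open>u\<close>.\<close>
  also have "(\<Sum>n\<in>{1..<u}. sqrt (of_int (gcd n u)) / of_int (u - n)) = (\<Sum>n\<in>{1..<u}. sqrt (of_int (gcd n u)) / of_int n)"
  proof (rule sum.reindex_bij_witness[of _ "\<lambda>n. u - n" "\<lambda>n. u - n"])
    fix n assume "n \<in> {1..<u}"
    have "gcd (u - n) u = gcd n u" using gcd_diff2[of u n] by (simp add: gcd.commute)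
    then show "sqrt (real_of_int (gcd (u - n) u)) / of_int (u - n) = sqrt (real_of_int (gcd n u)) / of_int (u - n)"
      by simp
  qed auto
  also have "2 * real_of_int u * K * ((\<Sum>n\<in>{1..<u}. sqrt (of_int (gcd n u)) / of_int n) + (\<Sum>n\<in>{1..<u}. sqrt (of_int (gcd n u)) / of_int n))
     \<le> 2 * of_int u * K * (?t * (1 + ln (of_int u)) + ?t * (1 + ln (of_int u)))"
    using gcd_sum K0 assms(1) by (intro mult_left_mono add_mono) auto
  finally have "of_int u * \<bar>\<Sum>j\<in>{lo..<hi}. jac u j\<bar> \<le> of_int u * (4 * K * ?t * (1 + ln (of_int u)))"
    by (simp add: algebra_simps)
  then show ?thesis using assms(1) by (simp add: mult_le_cancel_left K_def)
qed

text \<open>As \<open>k\<close> is invertible modulo \<open>u\<close>, the progression is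
  \<open>k\<close> times an interval shifted by \<open>r / k\<close>, and the dilation only
  contributes the symbol of \<open>k\<close>.\<close>

corollary sum_jac_progression_bound:
  assumes "u > 0" "odd u" "\<not> is_square u" "coprime k u"
  shows "\<bar>\<Sum>j\<in>{lo..<hi}. jac u (r + k * j)\<bar> \<le>
    4 * sqrt (real_of_int u * real (divcount (nat u))) * real (divcount (nat u)) * (1 + ln (real_of_int u))"
proof -
  obtain c where c: "[k * c = r] (mod u)"
    using assms(4) cong_solve_coprime_int[of k u] by (metis cong_scalar_right mult.assoc mult_1)
  have "Jacobi (r + k * j) u = Jacobi k u * Jacobi (j + c) u" for j
  proof -
    have "[r + k * j = k * c + k * j] (mod u)" using c by (intro cong_add cong_refl) (rule cong_sym)
    then have "[r + k * j = k * (j + c)] (mod u)" by (simp add: algebra_simps)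
    then show ?thesis using assms by (subst Jacobi_mult_top[symmetric]) (auto intro: Jacobi_cong)
  qed
  then have "(\<Sum>j\<in>{lo..<hi}. jac u (r + k * j)) = jac u k * (\<Sum>j\<in>{lo..<hi}. jac u (j + c))"
    by (simp add: sum_distrib_left)
  also have "(\<Sum>j\<in>{lo..<hi}. jac u (j + c)) = (\<Sum>j\<in>{lo+c..<hi+c}. jac u j)"
    by (rule sum.reindex_bij_witness[of _ "\<lambda>j. j - c" "\<lambda>j. j + c"]) auto
  finally have "\<bar>\<Sum>j\<in>{lo..<hi}. jac u (r + k * j)\<bar> = \<bar>jac u k\<bar> * \<bar>\<Sum>j\<in>{lo+c..<hi+c}. jac u j\<bar>"
    by (simp add: abs_mult)
  also have "\<dots> \<le> 1 * \<bar>\<Sum>j\<in>{lo+c..<hi+c}. jac u j\<bar>"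
    using Jacobi_values[OF assms(1,2), of k] by (intro mult_right_mono) auto
  finally show ?thesis using Polya_Vinogradov_Jacobi[OF assms(1-3), of "lo+c" "hi+c"] by linarith
qed

section \<open>Sums of the first type\<close>

fun qnorm :: "int \<times> int \<Rightarrow> int" where
  "qnorm (u, v) = u\<^sup>2 - 2 * v\<^sup>2"

fun spin :: "int \<times> int \<Rightarrow> real" where
  "spin (u, v) = jac u v"

text \<open>A fundamental domain for multiplication by \<open>(1 + \<surd>2)^8 = 577 + 408 \<surd>2\<close> on the totally
  positive elements \<open>u + v \<surd>2\<close>; the slope \<open>12/17\<close> comes from \<open>(1 + \<surd>2)^4 = 17 + 12 \<surd>2\<close>.\<close>
definition fund_dom :: "(int \<times> int) set" where
  "fund_dom = {(u, v). 0 < u \<and> - 12 * u < 17 * v \<and> 17 * v \<le> 12 * u}"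

text \<open>Once \<open>u\<close> is 1 modulo 16, oddness of \<open>v\<close> is equivalent to the
  norm being -1 modulo 16, since odd squares are 1 modulo 8.\<close>

definition spin_set :: "(int \<times> int) set" where
  "spin_set = {(u, v) \<in> fund_dom. u mod 16 = 1 \<and> odd v}"

text \<open>From \<open>17^2 - 2 * 12^2 = 1\<close>: on the edge of the cone, 289 times the norm is
  exactly the square of \<open>u\<close>, and inside it is larger.\<close>

lemma fund_dom_sq_le:
  assumes "(u, v) \<in> fund_dom" shows "u\<^sup>2 \<le> 289 * qnorm (u, v)"
proof -
  have "\<bar>17 * v\<bar> \<le> \<bar>12 * u\<bar>" using assms by (auto simp: fund_dom_def)
  then have "(17 * v)\<^sup>2 \<le> (12 * u)\<^sup>2" by (simp only: abs_le_square_iff)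
  then show ?thesis by (simp add: power2_eq_square)
qed

lemma fund_dom_qnorm_pos:
  assumes "x \<in> fund_dom" shows "qnorm x > 0"
proof -
  obtain u v where x: "x = (u, v)" by force
  have "0 < u\<^sup>2" using assms x by (auto simp: fund_dom_def)
  also have "\<dots> \<le> 289 * qnorm x" using fund_dom_sq_le[of u v] assms x by blast
  finally show ?thesis by simp
qed

lemma fund_dom_bounds:
  assumes "(u, v) \<in> fund_dom" "qnorm (u, v) \<le> int N"
  shows "0 < u" "u \<le> int (nat \<lfloor>17 * sqrt (real N)\<rfloor>)" "\<bar>v\<bar> < u"
proof -
  show u: "0 < u" using assms(1) by (simp add: fund_dom_def)
  have "u\<^sup>2 \<le> 289 * int N" using fund_dom_sq_le[OF assms(1)] assms(2) by simp
  then have "real_of_int (u\<^sup>2) \<le> 289 * real N" using of_int_le_iff[of "u\<^sup>2" "289 * int N", where 'a = real] by simp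
  also have "\<dots> = (17 * sqrt (real N))\<^sup>2" by (simp add: power_mult_distrib)
  finally have "(real_of_int u)\<^sup>2 \<le> (17 * sqrt (real N))\<^sup>2" by simp
  then have "real_of_int u \<le> 17 * sqrt (real N)" by (rule power2_le_imp_le) simp
  then show "u \<le> int (nat \<lfloor>17 * sqrt (real N)\<rfloor>)" using u by linarith
  show "\<bar>v\<bar> < u" using assms(1) by (auto simp: fund_dom_def)
qed

lemma finite_fund_dom: "finite {x \<in> fund_dom. qnorm x \<le> int N}"
proof (rule finite_subset)
  let ?U = "int (nat \<lfloor>17 * sqrt (real N)\<rfloor>)"
  show "{x \<in> fund_dom. qnorm x \<le> int N} \<subseteq> {0..?U} \<times> {-?U..?U}"
  proof
    fix x assume x: "x \<in> {x \<in> fund_dom. qnorm x \<le> int N}"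
    obtain u v where uv: "x = (u, v)" by force
    show "x \<in> {0..?U} \<times> {-?U..?U}" using fund_dom_bounds[of u v N] x uv by auto
  qed
qed simp

lemma spin_abs_le_1: "0 < u \<Longrightarrow> odd u \<Longrightarrow> \<bar>spin (u, v)\<bar> \<le> 1"
  using Jacobi_values[of u v] by auto

text \<open>Intervals without named endpoints, because a condition such as a bound on
  \<open>v\<^sup>2\<close> is visibly convex while its endpoints would involve rounded square
  roots.\<close>

definition int_convex :: "int set \<Rightarrow> bool" where
  "int_convex I \<longleftrightarrow> (\<forall>a\<in>I. \<forall>b\<in>I. \<forall>c. a \<le> c \<and> c \<le> b \<longrightarrow> c \<in> I)"

lemma int_convex_interval:
  assumes "finite I" "int_convex I" obtains lo hi where "I = {lo..<hi}"
proof (cases "I = {}")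
  case True
  then show ?thesis using that[of 0 0] by simp
next
  case False
  have "I = {Min I..<Max I + 1}"
  proof (rule equalityI; rule subsetI)
    fix x assume "x \<in> I"
    then show "x \<in> {Min I..<Max I + 1}" using Min_le[OF assms(1)] Max_ge[OF assms(1)] by fastforce
  next
    fix x assume "x \<in> {Min I..<Max I + 1}"
    then show "x \<in> I" using assms(2) Min_in[OF assms(1) False] Max_in[OF assms(1) False]
      unfolding int_convex_def by (metis atLeastLessThan_iff zle_add1_eq_le)
  qed
  then show ?thesis using that by blast
qed

definition pv_bound :: "int \<Rightarrow> real" where
  "pv_bound u = 4 * sqrt (real_of_int u * real (divcount (nat u))) * real (divcount (nat u)) * (1 + ln (real_of_int u))"

lemma sum_jac_convex_progression:
  assumes "u > 0" "odd u" "\<not> is_square u" "coprime k u" "k > 0" "finite I" "int_convex I"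
  shows "\<bar>\<Sum>v | v \<in> I \<and> v mod k = r. jac u v\<bar> \<le> pv_bound u"
proof (cases "0 \<le> r \<and> r < k")
  case True
  define J where "J = {j. r + k * j \<in> I}"
  have "inj (\<lambda>j. r + k * j)" using assms by (auto intro: injI)
  then have fJ: "finite J" unfolding J_def using finite_vimageI[OF assms(6)] by (simp add: vimage_def)
  have cJ: "int_convex J" unfolding int_convex_def
  proof (intro ballI allI impI)
    fix a b c assume "a \<in> J" "b \<in> J" "a \<le> c \<and> c \<le> b"
    then have "r + k * a \<in> I" "r + k * b \<in> I" "r + k * a \<le> r + k * c" "r + k * c \<le> r + k * b"
      using assms by (auto simp: J_def)
    then show "c \<in> J" using assms(7) unfolding int_convex_def J_def by blast
  qed
  obtain lo hi where J: "J = {lo..<hi}" using int_convex_interval[OF fJ cJ] .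
  have "(\<Sum>v | v \<in> I \<and> v mod k = r. jac u v) = (\<Sum>j\<in>J. jac u (r + k * j))"
  proof (rule sum.reindex_bij_witness[of _ "\<lambda>j. r + k * j" "\<lambda>v. v div k"])
    fix v assume v: "v \<in> {v \<in> I. v mod k = r}"
    then show "r + k * (v div k) = v" using mult_div_mod_eq[of k v] by simp
    then show "v div k \<in> J" "jac u (r + k * (v div k)) = jac u v" using v by (auto simp: J_def)
  next
    fix j assume j: "j \<in> J"
    then show "(r + k * j) div k = j" "r + k * j \<in> {v \<in> I. v mod k = r}"
      using True by (auto simp: J_def)
  qed
  then show ?thesis using sum_jac_progression_bound[OF assms(1-4), of r lo hi] unfolding J pv_bound_def by simp
next
  case False
  then have e: "{v. v \<in> I \<and> v mod k = r} = {}" using assms(5) by auto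
  have "pv_bound u \<ge> 0" using assms(1) by (simp add: pv_bound_def)
  then show ?thesis unfolding e by simp
qed

definition type1_fibre :: "nat \<Rightarrow> nat \<Rightarrow> int \<Rightarrow> int set" where
  "type1_fibre d N u = {v. (u, v) \<in> fund_dom \<and> odd v \<and> qnorm (u, v) \<le> int N \<and> int d dvd qnorm (u, v)}"

lemma type1_fibre_subset: "type1_fibre d N u \<subseteq> {-u<..<u}"
  by (auto simp: type1_fibre_def fund_dom_def)

lemma type1_fibre_trivial:
  assumes "u > 0" "odd u"
  shows "\<bar>\<Sum>v\<in>type1_fibre d N u. jac u v\<bar> \<le> 2 * of_int u"
proof -
  have fin: "finite (type1_fibre d N u)" by (rule finite_subset[OF type1_fibre_subset]) simp
  have j: "\<bar>jac u v\<bar> \<le> 1" for v using Jacobi_values[OF assms, of v] by auto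
  have "\<bar>\<Sum>v\<in>type1_fibre d N u. jac u v\<bar> \<le> (\<Sum>v\<in>type1_fibre d N u. \<bar>jac u v\<bar>)" by (rule sum_abs)
  also have "\<dots> \<le> (\<Sum>v\<in>type1_fibre d N u. 1)" by (intro sum_mono j)
  also have "\<dots> = real (card (type1_fibre d N u))" by simp
  also have "\<dots> \<le> real (card {-u<..<u})"
    unfolding of_nat_le_iff by (intro card_mono type1_fibre_subset) simp
  also have "\<dots> = real (nat (2 * u - 1))" by simp
  also have "\<dots> \<le> 2 * of_int u" using assms(1) by linarith
  finally show ?thesis .
qed

text \<open>A common prime of \<open>d\<close> and \<open>u\<close> is odd and divides
  \<open>2 * v\<^sup>2\<close>, hence \<open>v\<close>, so every symbol vanishes. Otherwise the
  conditions on \<open>v\<close> confine it to at most \<open>2 d\<close> classes modulo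
  \<open>2 d\<close>, a modulus prime to \<open>u\<close>, and each class meets a difference of two
  intervals.\<close>

lemma type1_fibre_bound:
  assumes "u > 0" "odd u" "\<not> is_square u" "d > 0"
  shows "\<bar>\<Sum>v\<in>type1_fibre d N u. jac u v\<bar> \<le> 4 * real d * pv_bound u"
proof (cases "coprime (int d) u")
  case False
  have "jac u v = 0" if "v \<in> type1_fibre d N u" for v
  proof -
    have "gcd (int d) u \<noteq> 0" "\<not> is_unit (gcd (int d) u)" using False assms by (auto simp: coprime_iff_gcd_eq_1)
    then obtain l where "prime l" "l dvd gcd (int d) u" using prime_divisor_exists by blast
    then have l: "prime l" "l dvd int d" "l dvd u" by auto
    have "int d dvd u\<^sup>2 - 2 * v\<^sup>2" using that by (simp add: type1_fibre_def)
    with l(2) have "l dvd u\<^sup>2 - 2 * v\<^sup>2" by (rule dvd_trans)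
    moreover have "l dvd u\<^sup>2" using l by (simp add: power2_eq_square)
    ultimately have "l dvd u\<^sup>2 - (u\<^sup>2 - 2 * v\<^sup>2)" using dvd_diff by blast
    then have "l dvd 2 * v\<^sup>2" by simp
    moreover have "\<not> l dvd 2"
    proof
      assume "l dvd 2"
      then have "l = 2" using l(1) by (simp add: primes_dvd_imp_eq)
      then show False using l assms by simp
    qed
    ultimately have "l dvd v" using l(1) by (metis prime_dvd_mult_iff prime_dvd_power)
    then have "\<not> coprime v u" using l by (metis coprime_common_divisor not_prime_unit)
    then show ?thesis using Jacobi_eq_0_iff[OF assms(1,2)] by simp
  qed
  then have "(\<Sum>v\<in>type1_fibre d N u. jac u v) = 0" by simp
  moreover have "pv_bound u \<ge> 0" using assms(1) by (simp add: pv_bound_def)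
  ultimately show ?thesis by simp
next
  case True
  define k where "k = 2 * int d"
  define I1 where "I1 = {v. - 12 * u < 17 * v \<and> 17 * v \<le> 12 * u}"
  \<comment> \<open>The bound on the norm excludes small \<open>\<bar>v\<bar>\<close>, so the
    admissible set is the interval \<open>I1\<close> with a central interval removed, not an
    interval.\<close>
  define I2 where "I2 = {v \<in> I1. 2 * v\<^sup>2 < u\<^sup>2 - int N}"
  define R where "R = {r\<in>{0..<k}. odd r \<and> int d dvd u\<^sup>2 - 2 * r\<^sup>2}"
  have k: "k > 0" "coprime k u" using assms True by (auto simp: k_def coprime_left_2_iff_odd)
  have "I1 \<subseteq> {-u..u}" using assms by (auto simp: I1_def)
  then have f1: "finite I1" by (rule finite_subset) simp
  then have f2: "finite I2" by (simp add: I2_def)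
  have c1: "int_convex I1" by (auto simp: int_convex_def I1_def)
  have c2: "int_convex I2" unfolding int_convex_def
  proof (intro ballI allI impI)
    fix a b c assume h: "a \<in> I2" "b \<in> I2" "a \<le> c \<and> c \<le> b"
    have "\<bar>c\<bar> \<le> \<bar>a\<bar> \<or> \<bar>c\<bar> \<le> \<bar>b\<bar>" using h by auto
    then have "c\<^sup>2 \<le> a\<^sup>2 \<or> c\<^sup>2 \<le> b\<^sup>2" by (simp add: abs_le_square_iff)
    then show "c \<in> I2" using h by (auto simp: I2_def I1_def)
  qed
  have good: "odd v \<and> int d dvd u\<^sup>2 - 2 * v\<^sup>2 \<longleftrightarrow> v mod k \<in> R" for v
  proof -
    have r: "v mod k \<in> {0..<k}" using k by simp
    have "k dvd v mod k - v" by (simp add: mod_eq_dvd_iff[symmetric])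
    then have d: "2 dvd v mod k - v" "int d dvd v mod k - v" unfolding k_def by (metis dvd_mult_left, metis dvd_mult_right)
    have "odd (v mod k) \<longleftrightarrow> odd v" using d(1) by (metis dvd_diff_left_iff dvd_diff_right_iff)
    moreover have "int d dvd u\<^sup>2 - 2 * (v mod k)\<^sup>2 \<longleftrightarrow> int d dvd u\<^sup>2 - 2 * v\<^sup>2"
    proof -
      have "(u\<^sup>2 - 2 * v\<^sup>2) - (u\<^sup>2 - 2 * (v mod k)\<^sup>2) = (v mod k - v) * (2 * (v mod k + v))"
        by (simp add: power2_eq_square algebra_simps)
      then have "int d dvd (u\<^sup>2 - 2 * v\<^sup>2) - (u\<^sup>2 - 2 * (v mod k)\<^sup>2)" using d(2) by simp
      then show ?thesis by (metis dvd_diff_right_iff dvd_diff_left_iff)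
    qed
    ultimately show ?thesis using r by (simp add: R_def)
  qed
  have eq: "type1_fibre d N u = {v \<in> I1 - I2. v mod k \<in> R}"
    using assms(1) unfolding type1_fibre_def fund_dom_def good[symmetric] by (auto simp: I1_def I2_def)
  have fR: "finite R" by (rule finite_subset[of _ "{0..<k}"]) (auto simp: R_def)
  have "(\<Sum>v\<in>type1_fibre d N u. jac u v) = (\<Sum>r\<in>R. \<Sum>v | v \<in> I1 - I2 \<and> v mod k = r. jac u v)"
  proof -
    define S where "S = {v \<in> I1 - I2. v mod k \<in> R}"
    have fS: "finite S" using f1 by (simp add: S_def)
    have im: "(\<lambda>v. v mod k) ` S \<subseteq> R" by (auto simp: S_def)
    have "sum (jac u) S = (\<Sum>r\<in>R. \<Sum>v | v \<in> S \<and> v mod k = r. jac u v)"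
      by (rule sum.group[OF fS fR im, symmetric])
    also have "\<dots> = (\<Sum>r\<in>R. \<Sum>v | v \<in> I1 - I2 \<and> v mod k = r. jac u v)"
    proof (rule sum.cong[OF refl])
      fix r assume "r \<in> R"
      then have "{v. v \<in> S \<and> v mod k = r} = {v. v \<in> I1 - I2 \<and> v mod k = r}" by (auto simp: S_def)
      then show "(\<Sum>v | v \<in> S \<and> v mod k = r. jac u v) = (\<Sum>v | v \<in> I1 - I2 \<and> v mod k = r. jac u v)"
        by (rule arg_cong[where f = "sum (jac u)"])
    qed
    finally show ?thesis unfolding eq S_def .
  qed
  also have "\<dots> = (\<Sum>r\<in>R. (\<Sum>v | v \<in> I1 \<and> v mod k = r. jac u v) - (\<Sum>v | v \<in> I2 \<and> v mod k = r. jac u v))"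
  proof (rule sum.cong[OF refl])
    fix r
    have e: "{v. v \<in> I1 - I2 \<and> v mod k = r} = {v. v \<in> I1 \<and> v mod k = r} - {v. v \<in> I2 \<and> v mod k = r}" by auto
    show "(\<Sum>v | v \<in> I1 - I2 \<and> v mod k = r. jac u v) =
        (\<Sum>v | v \<in> I1 \<and> v mod k = r. jac u v) - (\<Sum>v | v \<in> I2 \<and> v mod k = r. jac u v)"
      unfolding e by (rule sum_diff) (use f1 in \<open>auto simp: I2_def\<close>)
  qed
  finally have S: "(\<Sum>v\<in>type1_fibre d N u. jac u v) = (\<Sum>r\<in>R. (\<Sum>v | v \<in> I1 \<and> v mod k = r. jac u v) - (\<Sum>v | v \<in> I2 \<and> v mod k = r. jac u v))" .
  have "\<bar>\<Sum>v\<in>type1_fibre d N u. jac u v\<bar> \<le>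
      (\<Sum>r\<in>R. \<bar>(\<Sum>v | v \<in> I1 \<and> v mod k = r. jac u v) - (\<Sum>v | v \<in> I2 \<and> v mod k = r. jac u v)\<bar>)"
    unfolding S by (rule sum_abs)
  also have "\<dots> \<le> (\<Sum>r\<in>R. 2 * pv_bound u)"
  proof (rule sum_mono)
    fix r
    show "\<bar>(\<Sum>v | v \<in> I1 \<and> v mod k = r. jac u v) - (\<Sum>v | v \<in> I2 \<and> v mod k = r. jac u v)\<bar> \<le> 2 * pv_bound u"
      using sum_jac_convex_progression[OF assms(1-3) k(2,1) f1 c1, of r]
        sum_jac_convex_progression[OF assms(1-3) k(2,1) f2 c2, of r] by linarith
  qed
  also have "\<dots> = real (card R) * (2 * pv_bound u)" by simp
  also have "\<dots> \<le> (2 * real d) * (2 * pv_bound u)"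
  proof (rule mult_right_mono)
    have "card R \<le> card {0..<k}" by (rule card_mono) (auto simp: R_def)
    then have "real (card R) \<le> real (card {0..<k})" by (simp only: of_nat_le_iff)
    then show "real (card R) \<le> 2 * real d" by (simp add: k_def)
  qed (use assms(1) in \<open>simp add: pv_bound_def\<close>)
  finally show ?thesis by simp
qed

lemma one_plus_ln_le_powr:
  assumes "x \<ge> (1::real)" "\<delta> > 0" shows "1 + ln x \<le> (1 + 1/\<delta>) * x powr \<delta>"
proof -
  have "ln x \<le> x powr \<delta> / \<delta>" using assms by (rule ln_powr_bound)
  moreover have "1 \<le> x powr \<delta>" using assms by (rule ge_one_powr_ge_zero[OF _ less_imp_le])
  ultimately show ?thesis by (simp add: algebra_simps)
qed

lemma pv_bound_powr:
  assumes "\<epsilon> > 0"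
  obtains C where "C > 0" "\<And>u. u > 0 \<Longrightarrow> pv_bound u \<le> C * of_int u powr (1/2 + \<epsilon>)"
proof -
  define \<delta> where "\<delta> = \<epsilon> / 3"
  have d: "\<delta> > 0" using assms by (simp add: \<delta>_def)
  obtain C where C: "C \<ge> 1" "\<And>n. n > 0 \<Longrightarrow> real (divcount n) \<le> C * real n powr \<delta>"
    using divcount_bound[OF d] by blast
  show ?thesis
  proof
    show "4 * C\<^sup>2 * (1 + 1/\<delta>) > 0" using C d by (simp add: add_pos_pos)
    fix u :: int assume u: "u > 0"
    define x where "x = real_of_int u"
    have x: "x \<ge> 1" using u by (simp add: x_def)
    have t: "real (divcount (nat u)) \<le> C * x powr \<delta>" using C(2)[of "nat u"] u by (simp add: x_def)
    have x1: "x powr \<delta> \<ge> 1" using x d by (simp add: ge_one_powr_ge_zero)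
    have "sqrt (x * real (divcount (nat u))) \<le> sqrt (x * (C * x powr \<delta>))"
      using t x by (intro real_sqrt_le_mono mult_left_mono) auto
    also have "\<dots> \<le> sqrt ((C * x powr (1/2 + \<delta>))\<^sup>2)"
    proof (rule real_sqrt_le_mono)
      have "x * (C * x powr \<delta>) \<le> x * (C\<^sup>2 * (x powr \<delta> * x powr \<delta>))"
        using x1 C(1) x by (intro mult_left_mono mult_mono) (auto simp: power2_eq_square)
      also have "\<dots> = C\<^sup>2 * (x powr 1 * (x powr \<delta> * x powr \<delta>))" using x by simp
      also have "\<dots> = (C * x powr (1/2 + \<delta>))\<^sup>2"
        unfolding power_mult_distrib power2_eq_square[of "x powr _"] powr_add[symmetric] by (simp add: algebra_simps)
      finally show "x * (C * x powr \<delta>) \<le> (C * x powr (1/2 + \<delta>))\<^sup>2" .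
    qed
    also have "\<dots> = C * x powr (1/2 + \<delta>)" using C by simp
    finally have s: "sqrt (x * real (divcount (nat u))) \<le> C * x powr (1/2 + \<delta>)" .
    have "pv_bound u = 4 * (sqrt (x * real (divcount (nat u))) * (real (divcount (nat u)) * (1 + ln x)))"
      by (simp add: pv_bound_def x_def mult_ac)
    also have "\<dots> \<le> 4 * ((C * x powr (1/2 + \<delta>)) * ((C * x powr \<delta>) * ((1 + 1/\<delta>) * x powr \<delta>)))"
      using s t one_plus_ln_le_powr[OF x d] x C d by (intro mult_left_mono mult_mono) auto
    also have "\<dots> = 4 * C\<^sup>2 * (1 + 1/\<delta>) * (x powr (1/2 + \<delta>) * (x powr \<delta> * x powr \<delta>))"
      by (simp add: power2_eq_square)
    also have "x powr (1/2 + \<delta>) * (x powr \<delta> * x powr \<delta>) = x powr (1/2 + \<epsilon>)"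
      unfolding powr_add[symmetric] by (simp add: \<delta>_def add.commute)
    finally show "pv_bound u \<le> 4 * C\<^sup>2 * (1 + 1/\<delta>) * of_int u powr (1/2 + \<epsilon>)" by (simp add: x_def)
  qed
qed

lemma card_squares_le: "real (card {u\<in>{1..int U}. is_square u}) \<le> sqrt (real U)"
proof -
  define S where "S = nat \<lfloor>sqrt (real U)\<rfloor>"
  have "{u\<in>{1..int U}. is_square u} \<subseteq> (\<lambda>s. (int s)\<^sup>2) ` {1..S}"
  proof
    fix u assume "u \<in> {u\<in>{1..int U}. is_square u}"
    then obtain s where s: "u = s\<^sup>2" "1 \<le> u" "u \<le> int U" by (auto elim: is_nth_powerE)
    define t where "t = nat \<bar>s\<bar>"
    have t: "(int t)\<^sup>2 = u" using s by (simp add: t_def)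
    then have "t\<^sup>2 \<le> U" using s(3) by (metis of_nat_le_iff of_nat_power)
    then have "(real t)\<^sup>2 \<le> real U" by (metis of_nat_le_iff of_nat_power)
    then have "real t \<le> sqrt (real U)" by (rule real_le_rsqrt)
    then have "t \<le> S" by (simp add: S_def le_nat_iff le_floor_iff)
    moreover have "t \<ge> 1" using t s by (cases "t = 0") auto
    ultimately show "u \<in> (\<lambda>s. (int s)\<^sup>2) ` {1..S}" using t by force
  qed
  then have "card {u\<in>{1..int U}. is_square u} \<le> card ((\<lambda>s. (int s)\<^sup>2) ` {1..S})" by (intro card_mono) auto
  also have "\<dots> \<le> S" using card_image_le[of "{1..S}" "\<lambda>s. (int s)\<^sup>2"] by simp
  finally have "real (card {u\<in>{1..int U}. is_square u}) \<le> real S" by simp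
  also have "\<dots> \<le> sqrt (real U)" by (simp add: S_def)
  finally show ?thesis .
qed

text \<open>The first coordinate runs up to about \<open>U = 17 * sqrt N\<close>. Nonsquare
  \<open>u\<close> contribute about \<open>sqrt U\<close> each by Polya-Vinogradov; square
  \<open>u\<close> have no cancellation but number at most \<open>sqrt U\<close>, at a trivial cost
  of \<open>2 U\<close> each. Both come to \<open>U\<close> to the power 3/2, that is,
  \<open>N\<close> to the power 3/4.\<close>

theorem type1_bound:
  assumes "\<epsilon> > 0"
  obtains C where "C > 0" "\<And>d N. d > 0 \<Longrightarrow> N > 0 \<Longrightarrow>
    \<bar>\<Sum>x | x \<in> spin_set \<and> qnorm x \<le> int N \<and> int d dvd qnorm x. spin x\<bar> \<le> C * real d * real N powr (3/4 + \<epsilon>)"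
proof -
  obtain K where K: "K > 0" "\<And>u. u > 0 \<Longrightarrow> pv_bound u \<le> K * of_int u powr (1/2 + \<epsilon>)"
    using pv_bound_powr[OF assms] by blast
  define C where "C = (4 * K + 2) * 17 powr (3/2 + \<epsilon>)"
  show ?thesis
  proof
    show "C > 0" using K by (simp add: C_def)
    fix d N :: nat assume d: "d > 0" and N: "N > 0"
    define U where "U = nat \<lfloor>17 * sqrt (real N)\<rfloor>"
    define T where "T = {u \<in> {1..int U}. u mod 16 = 1}"
    have fT: "finite T" by (rule finite_subset[of _ "{1..int U}"]) (auto simp: T_def)
    have sN: "sqrt (real N) \<ge> 1" using N by simp
    have "\<lfloor>17 * sqrt (real N)\<rfloor> \<ge> 17" using sN by (simp add: le_floor_iff)
    then have "U \<ge> 17" unfolding U_def by linarith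
    then have U1: "real U \<ge> 1" by simp
    have U: "real U \<le> 17 * sqrt (real N)" by (simp add: U_def)
    have ffib: "finite (type1_fibre d N u)" for u by (rule finite_subset[OF type1_fibre_subset]) simp
    have set_eq: "{x. x \<in> spin_set \<and> qnorm x \<le> int N \<and> int d dvd qnorm x} = Sigma T (type1_fibre d N)"
    proof (rule equalityI; rule subsetI)
      fix x assume x: "x \<in> {x. x \<in> spin_set \<and> qnorm x \<le> int N \<and> int d dvd qnorm x}"
      obtain u v where uv: "x = (u, v)" by force
      have h: "(u, v) \<in> fund_dom" "qnorm (u, v) \<le> int N" using x uv by (auto simp: spin_set_def)
      show "x \<in> Sigma T (type1_fibre d N)"
        using x uv h fund_dom_bounds(1,2)[OF h] by (auto simp: spin_set_def type1_fibre_def T_def U_def)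
    qed (auto simp: spin_set_def type1_fibre_def T_def)
    have "(\<Sum>x | x \<in> spin_set \<and> qnorm x \<le> int N \<and> int d dvd qnorm x. spin x) = (\<Sum>u\<in>T. \<Sum>v\<in>type1_fibre d N u. jac u v)"
      unfolding set_eq using fT ffib by (subst sum.Sigma) (auto intro!: sum.cong)
    then have "\<bar>\<Sum>x | x \<in> spin_set \<and> qnorm x \<le> int N \<and> int d dvd qnorm x. spin x\<bar> \<le> (\<Sum>u\<in>T. \<bar>\<Sum>v\<in>type1_fibre d N u. jac u v\<bar>)"
      by (simp only: sum_abs)
    also have "\<dots> \<le> (\<Sum>u\<in>T. 4 * real d * (K * real U powr (1/2 + \<epsilon>)) + (if is_square u then 2 * real U else 0))"
    proof (rule sum_mono)
      fix u assume u: "u \<in> T"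
      then have u0: "u > 0" and uo: "odd u" and uU: "real_of_int u \<le> real U" by (auto simp: T_def) presburger
      show "\<bar>\<Sum>v\<in>type1_fibre d N u. jac u v\<bar> \<le> 4 * real d * (K * real U powr (1/2 + \<epsilon>)) + (if is_square u then 2 * real U else 0)"
      proof (cases "is_square u")
        case True
        have "4 * real d * (K * real U powr (1/2 + \<epsilon>)) \<ge> 0" using K by simp
        moreover have "\<bar>\<Sum>v\<in>type1_fibre d N u. jac u v\<bar> \<le> 2 * real U"
          using type1_fibre_trivial[OF u0 uo, of d N] uU by linarith
        ultimately show ?thesis unfolding if_P[OF True] by linarith
      next
        case False
        have "pv_bound u \<le> K * of_int u powr (1/2 + \<epsilon>)" using K(2) u0 by blast
        also have "\<dots> \<le> K * real U powr (1/2 + \<epsilon>)" using K u0 uU assms by (intro mult_left_mono powr_mono2) auto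
        finally have "4 * real d * pv_bound u \<le> 4 * real d * (K * real U powr (1/2 + \<epsilon>))" by (intro mult_left_mono) auto
        then show ?thesis using type1_fibre_bound[OF u0 uo False d, of N] False by simp
      qed
    qed
    also have "\<dots> = real (card T) * (4 * real d * (K * real U powr (1/2 + \<epsilon>))) + (\<Sum>u\<in>T. if is_square u then 2 * real U else 0)"
      by (simp add: sum.distrib)
    also have "\<dots> \<le> real U * (4 * real d * (K * real U powr (1/2 + \<epsilon>))) + 2 * real U * sqrt (real U)"
    proof (intro add_mono mult_right_mono)
      have "card T \<le> card {1..int U}" by (rule card_mono) (auto simp: T_def)
      then show "real (card T) \<le> real U" by simp
      have "(\<Sum>u\<in>T. if is_square u then 2 * real U else 0) \<le> (\<Sum>u\<in>{1..int U}. if is_square u then 2 * real U else 0)"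
        by (rule sum_mono2) (auto simp: T_def)
      also have "\<dots> = 2 * real U * real (card {u\<in>{1..int U}. is_square u})"
        by (simp add: sum.inter_filter[symmetric])
      also have "\<dots> \<le> 2 * real U * sqrt (real U)" by (intro mult_left_mono card_squares_le) auto
      finally show "(\<Sum>u\<in>T. if is_square u then 2 * real U else 0) \<le> 2 * real U * sqrt (real U)" .
    qed (use K in auto)
    also have "2 * real U * sqrt (real U) \<le> 2 * real d * (real U * real U powr (1/2 + \<epsilon>))"
    proof -
      have "sqrt (real U) = real U powr (1/2)" by (simp add: powr_half_sqrt)
      also have "\<dots> \<le> real U powr (1/2 + \<epsilon>)" using U1 assms by (intro powr_mono) auto
      finally have "1 * (2 * (real U * sqrt (real U))) \<le> real d * (2 * (real U * real U powr (1/2 + \<epsilon>)))"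
        using d U1 by (intro mult_mono mult_left_mono) auto
      then show ?thesis by simp
    qed
    also have "real U * (4 * real d * (K * real U powr (1/2 + \<epsilon>))) + 2 * real d * (real U * real U powr (1/2 + \<epsilon>)) =
        (4 * K + 2) * real d * (real U powr 1 * real U powr (1/2 + \<epsilon>))"
      using U1 by (simp add: algebra_simps)
    also have "real U powr 1 * real U powr (1/2 + \<epsilon>) = real U powr (3/2 + \<epsilon>)" unfolding powr_add[symmetric] by simp
    also have "(4 * K + 2) * real d * real U powr (3/2 + \<epsilon>) \<le> (4 * K + 2) * real d * (17 * sqrt (real N)) powr (3/2 + \<epsilon>)"
      using U U1 K assms by (intro mult_left_mono powr_mono2) auto
    also have "(17 * sqrt (real N)) powr (3/2 + \<epsilon>) = 17 powr (3/2 + \<epsilon>) * real N powr (3/4 + \<epsilon>/2)"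
      by (simp add: powr_mult powr_half_sqrt[symmetric] powr_powr algebra_simps add_divide_distrib)
    also have "(4 * K + 2) * real d * (17 powr (3/2 + \<epsilon>) * real N powr (3/4 + \<epsilon>/2)) \<le>
        (4 * K + 2) * real d * (17 powr (3/2 + \<epsilon>) * real N powr (3/4 + \<epsilon>))"
      using N K assms by (intro mult_left_mono powr_mono) auto
    finally show "\<bar>\<Sum>x | x \<in> spin_set \<and> qnorm x \<le> int N \<and> int d dvd qnorm x. spin x\<bar> \<le> C * real d * real N powr (3/4 + \<epsilon>)"
      by (simp add: C_def mult_ac)
  qed
qed

section \<open>Twisted multiplicativity\<close>

fun qmul :: "int \<times> int \<Rightarrow> int \<times> int \<Rightarrow> int \<times> int" where
  "qmul (a, b) (c, d) = (a * c + 2 * b * d, a * d + b * c)"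

lemma qmul_commute: "qmul x y = qmul y x"
  by (cases x; cases y) (simp add: algebra_simps)

lemma qmul_assoc: "qmul (qmul x y) z = qmul x (qmul y z)"
  by (cases x; cases y; cases z) (simp add: algebra_simps)

lemma qmul_left_commute: "qmul x (qmul y z) = qmul y (qmul x z)"
  by (metis qmul_assoc qmul_commute)

lemma qnorm_qmul: "qnorm (qmul x y) = qnorm x * qnorm y"
  by (cases x; cases y) (simp add: algebra_simps power2_eq_square)

lemma qmul_1 [simp]: "qmul (1, 0) x = x"
  by (cases x) simp

text \<open>Multiplication by the conjugate \<open>(a, - b)\<close> of \<open>w\<close> turns
  equality of the products into equality after scaling by the norm.\<close>

lemma qmul_cancel:
  assumes "qnorm w \<noteq> 0" "qmul w x = qmul w y" shows "x = y"
proof -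
  obtain a b c d e f where [simp]: "w = (a, b)" "x = (c, d)" "y = (e, f)" by force
  have e: "a * c + 2 * b * d = a * e + 2 * b * f" "a * d + b * c = a * f + b * e" using assms(2) by auto
  have "(a\<^sup>2 - 2 * b\<^sup>2) * (c - e) = a * (a * c + 2 * b * d - (a * e + 2 * b * f)) - 2 * b * (a * d + b * c - (a * f + b * e))"
    by (simp add: algebra_simps power2_eq_square)
  moreover have "(a\<^sup>2 - 2 * b\<^sup>2) * (d - f) = a * (a * d + b * c - (a * f + b * e)) - b * (a * c + 2 * b * d - (a * e + 2 * b * f))"
    by (simp add: algebra_simps power2_eq_square)
  ultimately have "(a\<^sup>2 - 2 * b\<^sup>2) * (c - e) = 0" "(a\<^sup>2 - 2 * b\<^sup>2) * (d - f) = 0" using e by auto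
  then show ?thesis using assms(1) by simp
qed

lemma odd_if_mod_16: "(x::int) mod 16 = 1 \<Longrightarrow> odd x"
  by presburger

lemma Jacobi_power: "u > 0 \<Longrightarrow> odd u \<Longrightarrow> Jacobi (a ^ k) u = Jacobi a u ^ k"
  by (induction k) (simp_all add: Jacobi_mult_top)

definition signed_two_power :: "int \<Rightarrow> bool" where
  "signed_two_power s \<longleftrightarrow> (\<exists>j. s = 2 ^ j \<or> s = - (2 ^ j))"

text \<open>A Jacobi symbol needs an odd positive lower argument; the sign and the power of 2 set
  apart here are governed by the supplementary laws.\<close>

lemma signed_two_power_decomp:
  assumes "b \<noteq> (0::int)"
  obtains s b' where "b = s * b'" "b' > 0" "odd b'" "signed_two_power s"
proof -
  have "\<not> is_unit (2::int)" by simp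
  then obtain y where y: "b = 2 ^ multiplicity 2 b * y" "\<not> 2 dvd y"
    using multiplicity_decompose'[of b 2] assms by blast
  show ?thesis
  proof (cases "y > 0")
    case True
    then show ?thesis using that[of "2 ^ multiplicity 2 b" y] y by (auto simp: signed_two_power_def)
  next
    case False
    then have "- y > 0" using y by (metis dvd_0_right neg_0_less_iff_less not_less_iff_gr_or_eq)
    moreover have "b = - (2 ^ multiplicity 2 b) * (- y)" using y by simp
    ultimately show ?thesis using that[of "- (2 ^ multiplicity 2 b)" "- y"] y by (auto simp: signed_two_power_def)
  qed
qed

lemma Jacobi_signed_two_power_cong:
  assumes "signed_two_power s" "n > 0" "odd n" "m > 0" "odd m" "n mod 8 = m mod 8"
  shows "Jacobi s n = Jacobi s m"
proof -
  have 2: "Jacobi 2 n = Jacobi 2 m" using assms Jacobi_2 by simp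
  have "n mod 4 = m mod 4" using assms(6) mod_mod_cancel[of 4 8 n] mod_mod_cancel[of 4 8 m] by simp
  then have 1: "Jacobi (-1) n = Jacobi (-1) m" using assms Jacobi_minus_1 by simp
  obtain j where "s = 2 ^ j \<or> s = (-1) * 2 ^ j" using assms(1) by (auto simp: signed_two_power_def)
  then show ?thesis
  proof
    assume s: "s = (-1) * 2 ^ j"
    show ?thesis unfolding s Jacobi_mult_top[OF assms(2,3)] Jacobi_mult_top[OF assms(4,5)]
      Jacobi_power[OF assms(2,3)] Jacobi_power[OF assms(4,5)] 1 2 ..
  qed (use assms 2 Jacobi_power in simp)
qed

lemma coprime_signed_two_power: "signed_two_power s \<Longrightarrow> odd n \<Longrightarrow> coprime s n"
  by (auto simp: signed_two_power_def)

lemma sq1_cancel: "x * x = (1::int) \<Longrightarrow> x * y = z \<Longrightarrow> y = x * z"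
  by (metis mult.assoc mult_1)

text \<open>The twisted multiplicativity of the symbol \<open>(v/u)\<close>. When \<open>b'\<close> and \<open>c\<close> are coprime it follows
  from \<open>c v \<equiv> b m (mod u)\<close>; the general case divides \<open>b'\<close>, \<open>c\<close> and \<open>u\<close> by \<open>h = gcd b' c\<close> first.\<close>
lemma Jacobi_twisted_mult:
  fixes a b c d s b' :: int
  defines "u \<equiv> a * c + 2 * b * d" and "v \<equiv> a * d + b * c" and "m \<equiv> c\<^sup>2 - 2 * d\<^sup>2"
  assumes u: "u > 0" "u mod 16 = 1" and c: "c > 0" "odd c" "coprime c d"
    and b: "b = s * b'" "b' > 0" "odd b'" "signed_two_power s"
  shows "Jacobi v u = Jacobi a b' * Jacobi d c * recip_sign b' c * Jacobi 2 c * Jacobi s c * Jacobi m u"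
proof -
  define h where "h = gcd b' c"
  have h: "h > 0" using c by (simp add: h_def)
  define b1 where "b1 = b' div h"
  define c1 where "c1 = c div h"
  have b1: "b' = h * b1" and c1: "c = h * c1" by (simp_all add: h_def b1_def c1_def)
  define u1 where "u1 = a * c1 + 2 * s * b1 * d"
  have uu: "u = h * u1" by (simp add: u_def u1_def b b1 c1 algebra_simps)
  have odds: "odd h" "odd b1" "odd c1" using b(3) c(2) b1 c1 by auto
  have "odd u" using u(2) by presburger
  then have "odd u1" using uu by simp
  have pos: "b1 > 0" "c1 > 0" "u1 > 0" using h b(2) c(1) u(1) b1 c1 uu
    by (auto simp: zero_less_mult_iff)
  have cop: "coprime b1 c1" using c(1) unfolding b1_def c1_def h_def by (intro div_gcd_coprime) auto
  have cd: "coprime c1 d" "coprime h d" using c(3) c1 by auto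
  have sc: "coprime s c1" "coprime s h" "coprime s u1" using b(4) odds \<open>odd u1\<close> coprime_signed_two_power by auto
  have c1u1: "coprime c1 u1"
  proof -
    have "coprime c1 (2 * s * b1 * d)"
      using odds cop cd sc by (simp add: coprime_commute coprime_right_2_iff_odd)
    moreover have "u1 = a * c1 + 2 * s * b1 * d" by (simp add: u1_def)
    ultimately show ?thesis by (simp only: coprime_iff_gcd_eq_1 gcd_add_mult)
  qed
  note J = Jacobi_mult_top Jacobi_mult_bot
  have u8: "u mod 8 = 1" "u mod 4 = 1" using u(2) mod_mod_cancel[of 8 16 u] mod_mod_cancel[of 4 16 u] by auto
  \<comment> \<open>As \<open>h * u1\<close> is 1 modulo 4, the two factors agree there, and every
    reciprocity sign against \<open>u1\<close> becomes one against \<open>h\<close>.\<close>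
  have uh: "u1 mod 4 = h mod 4"
  proof -
    have "(h * u1) mod 4 = 1" using u8 uu by simp
    then have "((h mod 4) * (u1 mod 4)) mod 4 = 1" by (simp only: mod_mult_eq)
    then show ?thesis using odd_mod4[OF odds(1)] odd_mod4[OF \<open>odd u1\<close>] by auto
  qed
  have rs: "recip_sign x u1 = recip_sign x h" for x using uh by (simp add: recip_sign_def)
  have vh: "Jacobi v h = Jacobi a h * Jacobi d h"
  proof -
    have "[v = a * d] (mod h)" by (simp add: v_def b b1 cong_iff_dvd_diff)
    then show ?thesis using h odds Jacobi_cong[of h v "a*d"] by (simp add: J)
  qed
  have vu1: "Jacobi c1 u1 * Jacobi v u1 = Jacobi s u1 * Jacobi b1 u1 * Jacobi m u1"
  proof -
    \<comment> \<open>The identity \<open>c * v - b * m = d * u\<close>, divided by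
      \<open>h\<close>, is the source of the whole evaluation.\<close>
    have "c1 * v - s * b1 * m = d * u1"
      by (simp add: v_def m_def u1_def b b1 c1 power2_eq_square algebra_simps)
    then have "u1 dvd c1 * v - s * b1 * m" by simp
    then have "[c1 * v = s * b1 * m] (mod u1)" by (simp add: cong_iff_dvd_diff)
    then have "Jacobi (c1 * v) u1 = Jacobi (s * b1 * m) u1" using pos \<open>odd u1\<close> by (intro Jacobi_cong)
    then show ?thesis using pos \<open>odd u1\<close> by (simp add: J)
  qed
  have vu1': "Jacobi v u1 = Jacobi c1 u1 * (Jacobi s u1 * Jacobi b1 u1 * Jacobi m u1)"
    using Jacobi_square[OF pos(3) \<open>odd u1\<close> c1u1] vu1 by (rule sq1_cancel)
  have su: "Jacobi s u1 = Jacobi s h"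
  proof -
    \<comment> \<open>Here \<open>u\<close> being 1 modulo 8 makes the symbol of \<open>s\<close> at
      \<open>u\<close> trivial, so its values at \<open>h\<close> and at \<open>u1\<close>
      coincide.\<close>
    have "Jacobi s u = Jacobi s 1" using u u8 \<open>odd u\<close> by (intro Jacobi_signed_two_power_cong[OF b(4)]) auto
    then have "Jacobi s h * Jacobi s u1 = 1" using uu h pos by (simp add: J)
    then show ?thesis using sq1_cancel[OF Jacobi_square[OF h odds(1) sc(2)], of "Jacobi s u1" 1] by simp
  qed
  have cu: "Jacobi c1 u1 = recip_sign c1 h * (Jacobi 2 c1 * Jacobi s c1 * Jacobi b1 c1 * Jacobi d c1)"
  proof -
    have "[u1 = 2 * s * b1 * d] (mod c1)" by (simp add: u1_def cong_iff_dvd_diff)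
    then have "Jacobi u1 c1 = Jacobi (2 * s * b1 * d) c1" using pos odds by (intro Jacobi_cong)
    then show ?thesis using Jacobi_reciprocity[of c1 u1] pos odds \<open>odd u1\<close> by (simp add: J rs)
  qed
  have bu: "Jacobi b1 u1 = recip_sign b1 h * (Jacobi a b1 * Jacobi c1 b1)"
  proof -
    have "[u1 = a * c1] (mod b1)" by (simp add: u1_def cong_iff_dvd_diff)
    then have "Jacobi u1 b1 = Jacobi (a * c1) b1" using pos odds by (intro Jacobi_cong)
    then show ?thesis using Jacobi_reciprocity[of b1 u1] pos odds \<open>odd u1\<close> by (simp add: J rs)
  qed
  have bc: "Jacobi b1 c1 * Jacobi c1 b1 = recip_sign b1 c1"
  proof -
    have "Jacobi c1 b1 * Jacobi c1 b1 = 1" using pos odds cop by (intro Jacobi_square) (auto simp: coprime_commute)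
    then show ?thesis using Jacobi_reciprocity[of b1 c1] pos odds by simp
  qed
  have mh: "Jacobi m u1 = Jacobi (-1) h * Jacobi 2 h * Jacobi m u"
  proof -
    \<comment> \<open>Modulo \<open>h\<close>, a divisor of \<open>c\<close>, only the
      \<open>d\<close> part of the norm is left, and \<open>d\<close> is a unit there.\<close>
    have "[m = (-1) * 2 * (d * d)] (mod h)" by (simp add: m_def c1 cong_iff_dvd_diff power2_eq_square)
    then have "Jacobi m h = Jacobi ((-1) * 2 * (d * d)) h" using h odds by (intro Jacobi_cong)
    also have "\<dots> = Jacobi (-1) h * Jacobi 2 h * (Jacobi d h * Jacobi d h)" by (simp only: Jacobi_mult_top[OF h odds(1)])
    also have "Jacobi d h * Jacobi d h = 1" using h odds cd by (intro Jacobi_square) (auto simp: coprime_commute)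
    finally have mh: "Jacobi m h = Jacobi (-1) h * Jacobi 2 h" by simp
    have "Jacobi m h * Jacobi m h = 1" unfolding mh using h odds Jacobi_2[OF h odds(1)] Jacobi_minus_1[OF h odds(1)] by simp
    moreover have "Jacobi m h * Jacobi m u1 = Jacobi m u" using uu h pos by (simp add: J)
    ultimately have "Jacobi m u1 = Jacobi m h * Jacobi m u" by (rule sq1_cancel)
    then show ?thesis using mh by simp
  qed
  have "Jacobi v u = Jacobi a h * Jacobi d h * Jacobi v u1" using uu h pos vh by (simp add: J)
  also have "\<dots> = Jacobi a h * Jacobi d h * (recip_sign c1 h * (Jacobi 2 c1 * Jacobi s c1 * Jacobi b1 c1 * Jacobi d c1)
      * (Jacobi s h * (recip_sign b1 h * (Jacobi a b1 * Jacobi c1 b1)) * (Jacobi (-1) h * Jacobi 2 h * Jacobi m u)))"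
    unfolding vu1' su cu bu mh ..
  also have "\<dots> = (Jacobi a h * Jacobi a b1) * (Jacobi d h * Jacobi d c1) * (Jacobi 2 h * Jacobi 2 c1) * (Jacobi s h * Jacobi s c1)
      * ((Jacobi b1 c1 * Jacobi c1 b1) * recip_sign c1 h * recip_sign b1 h * Jacobi (-1) h) * Jacobi m u"
    by (simp only: mult_ac)
  also have "Jacobi a h * Jacobi a b1 = Jacobi a b'" using h pos b1 by (simp add: J)
  also have "Jacobi d h * Jacobi d c1 = Jacobi d c" using h pos c1 by (simp add: J)
  also have "Jacobi 2 h * Jacobi 2 c1 = Jacobi 2 c" using h pos c1 by (simp add: J)
  also have "Jacobi s h * Jacobi s c1 = Jacobi s c" using h pos c1 by (simp add: J)
  also have "(Jacobi b1 c1 * Jacobi c1 b1) * recip_sign c1 h * recip_sign b1 h * Jacobi (-1) h = recip_sign b' c"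
  proof -
    have e: "recip_sign h h = Jacobi (-1) h" using h odds odd_mod4[OF odds(1)]
      by (auto simp: Jacobi_minus_1 recip_sign_def)
    have "recip_sign b' c = recip_sign h c * recip_sign b1 c" using b1 odds by (simp add: recip_sign_mult)
    also have "recip_sign h c = recip_sign h h * recip_sign c1 h"
      using c1 odds by (simp add: recip_sign_mult recip_sign_sym[of h "h * c1"])
    also have "recip_sign b1 c = recip_sign b1 h * recip_sign b1 c1"
      using c1 odds by (simp add: recip_sign_mult recip_sign_sym[of b1])
    finally show ?thesis unfolding bc e by (simp only: mult_ac)
  qed
  finally show ?thesis by (simp only: mult_ac)
qed

text \<open>For primitive \<open>z = (c, d)\<close> this is the quotient of \<open>c\<close> by
  \<open>d\<close> modulo the norm, a square root of 2. Mapping the square root of 2 to it sends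
  \<open>(c, - d)\<close> to 0.\<close>

definition qroot :: "int \<times> int \<Rightarrow> int" where
  "qroot z = (SOME r. [r * snd z = fst z] (mod qnorm z))"

lemma coprime_snd_qnorm: "coprime c d \<Longrightarrow> coprime d (c\<^sup>2 - 2 * d\<^sup>2 :: int)"
proof -
  assume cd: "coprime c d"
  have "gcd d ((- (2 * d)) * d + c\<^sup>2) = gcd d (c\<^sup>2)" by (rule gcd_add_mult)
  moreover have "(- (2 * d)) * d + c\<^sup>2 = c\<^sup>2 - 2 * d\<^sup>2" by (simp add: power2_eq_square)
  moreover have "gcd d (c\<^sup>2) = 1" using cd by (simp add: coprime_commute coprime_iff_gcd_eq_1[symmetric])
  ultimately show ?thesis by (simp only: coprime_iff_gcd_eq_1)
qed

lemma qroot_cong: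
  assumes "coprime c d"
  shows "[qroot (c, d) * d = c] (mod (c\<^sup>2 - 2 * d\<^sup>2))" "[(qroot (c, d))\<^sup>2 = 2] (mod (c\<^sup>2 - 2 * d\<^sup>2))"
    "[qroot (c, d) * c = 2 * d] (mod (c\<^sup>2 - 2 * d\<^sup>2))"
proof -
  let ?m = "c\<^sup>2 - 2 * d\<^sup>2" and ?r = "qroot (c, d)"
  have dm: "coprime d ?m" using assms by (rule coprime_snd_qnorm)
  obtain x where "[d * x = 1] (mod ?m)" using cong_solve_coprime_int[OF dm] by blast
  then have "[d * x * c = 1 * c] (mod ?m)" by (rule cong_scalar_right)
  then have "[(x * c) * d = c] (mod ?m)" by (simp add: mult_ac)
  then have "\<exists>r. [r * d = c] (mod ?m)" by blast
  then show 1: "[?r * d = c] (mod ?m)" unfolding qroot_def fst_conv snd_conv qnorm.simps by (rule someI_ex)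
  have cc: "[c * c = 2 * d * d] (mod ?m)" by (simp add: cong_iff_dvd_diff power2_eq_square mult.assoc)
  have "[(?r * d) * (?r * d) = c * c] (mod ?m)" using 1 1 by (rule cong_mult)
  then have "[(?r * d) * (?r * d) = 2 * d * d] (mod ?m)" using cc cong_trans by blast
  then have "[?r\<^sup>2 * (d * d) = 2 * (d * d)] (mod ?m)" by (simp add: power2_eq_square mult_ac)
  moreover have "coprime (d * d) ?m" using dm by simp
  ultimately show "[?r\<^sup>2 = 2] (mod ?m)" using cong_mult_rcancel by blast
  have "[(?r * d) * c = c * c] (mod ?m)" using 1 by (rule cong_scalar_right)
  then have "[(?r * d) * c = 2 * d * d] (mod ?m)" using cc cong_trans by blast
  then have "[(?r * c) * d = (2 * d) * d] (mod ?m)" by (simp add: mult_ac)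
  then show "[?r * c = 2 * d] (mod ?m)" using dm cong_mult_rcancel by blast
qed

text \<open>The quadratic residue symbol of \<open>a + b \<surd>2\<close> modulo the primitive element \<open>z\<close>: reduction modulo
  \<open>z\<close> is the ring homomorphism to \<open>\<int>/m\<int>\<close> sending \<open>\<surd>2\<close> to \<open>qroot z\<close>, where \<open>m = qnorm z\<close>.\<close>
fun qchar :: "int \<times> int \<Rightarrow> int \<times> int \<Rightarrow> int" where
  "qchar z (a, b) = Jacobi (a + b * qroot z) (qnorm z)"

definition primitive :: "int \<times> int \<Rightarrow> bool" where
  "primitive z \<longleftrightarrow> coprime (fst z) (snd z)"

text \<open>Because the square of \<open>qroot z\<close> is 2 modulo the norm, evaluation there is a
  ring homomorphism, and the Jacobi symbol is multiplicative on its values.\<close>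

lemma qchar_mult:
  assumes "primitive z" "qnorm z > 0" "odd (qnorm z)"
  shows "qchar z (qmul x y) = qchar z x * qchar z y"
proof -
  obtain c d where z: "z = (c, d)" by force
  obtain a b e f where x: "x = (a, b)" and y: "y = (e, f)" by force
  let ?r = "qroot z"
  have "[?r\<^sup>2 = 2] (mod qnorm z)" using qroot_cong(2)[of c d] assms(1) by (simp add: z primitive_def)
  then have "qnorm z dvd ?r\<^sup>2 - 2" by (simp only: cong_iff_dvd_diff)
  then have "qnorm z dvd (?r\<^sup>2 - 2) * (b * f)" by (rule dvd_mult2)
  moreover have "(a + b * ?r) * (e + f * ?r) - (a * e + 2 * b * f + (a * f + b * e) * ?r) = (?r\<^sup>2 - 2) * (b * f)"
    by (simp add: power2_eq_square algebra_simps)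
  ultimately have "[(a + b * ?r) * (e + f * ?r) = a * e + 2 * b * f + (a * f + b * e) * ?r] (mod qnorm z)"
    by (simp only: cong_iff_dvd_diff)
  then have "Jacobi ((a + b * ?r) * (e + f * ?r)) (qnorm z) = Jacobi (a * e + 2 * b * f + (a * f + b * e) * ?r) (qnorm z)"
    using assms by (intro Jacobi_cong)
  then show ?thesis by (simp only: x y qmul.simps qchar.simps Jacobi_mult_top[OF assms(2,3)])
qed

text \<open>Reciprocity has sign 1, as the first coordinate of the product is 1 modulo 4. Modulo the
  norm, \<open>2 * d\<close> is \<open>qroot (c, d) * c\<close>, so that coordinate factors as
  \<open>c\<close> times the value of \<open>a + b \<surd>2\<close> at the root.\<close>

lemma Jacobi_qnorm_first:
  assumes "coprime c d" "c\<^sup>2 - 2 * d\<^sup>2 > 0" "odd c" "a * c + 2 * b * d > 0" "(a * c + 2 * b * d) mod 16 = 1"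
  shows "Jacobi (c\<^sup>2 - 2 * d\<^sup>2) (a * c + 2 * b * d) = Jacobi c (c\<^sup>2 - 2 * d\<^sup>2) * qchar (c, d) (a, b)"
proof -
  let ?m = "c\<^sup>2 - 2 * d\<^sup>2" and ?u = "a * c + 2 * b * d" and ?r = "qroot (c, d)"
  have om: "odd ?m" using assms(3) by simp
  have "?u mod 4 = 1" using assms(5) mod_mod_cancel[of 4 16 ?u] by simp
  moreover have "odd ?u" using assms(5) by (rule odd_if_mod_16)
  ultimately have "Jacobi ?m ?u = Jacobi ?u ?m"
    using Jacobi_reciprocity[OF assms(2) om assms(4)] by (simp add: recip_sign_def)
  also have "[b * (?r * c) = b * (2 * d)] (mod ?m)" using qroot_cong(3)[OF assms(1)] by (rule cong_scalar_left)
  then have "[a * c + b * (?r * c) = a * c + b * (2 * d)] (mod ?m)" by (rule cong_add[OF cong_refl])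
  then have "[?u = c * (a + b * ?r)] (mod ?m)" by (simp add: algebra_simps cong_sym_eq)
  then have "Jacobi ?u ?m = Jacobi (c * (a + b * ?r)) ?m" using assms(2) om by (intro Jacobi_cong)
  finally show ?thesis using assms(2) om by (simp add: Jacobi_mult_top)
qed

lemma spin_not_primitive:
  assumes "u > 0" "odd u" "\<not> coprime u v" shows "spin (u, v) = 0"
  using Jacobi_eq_0_iff[OF assms(1,2), of v] assms(3) by (simp add: coprime_commute)

text \<open>For fixed \<open>w\<close>, the spin of \<open>w z\<close> is the product of a function of \<open>z\<close>, a function of the class
  of \<open>z\<close> modulo 8, and \<open>qchar z w\<close>.\<close>
lemma spin_qmul:
  fixes a b :: int
  assumes "b \<noteq> 0"
  obtains F :: "int \<Rightarrow> real" where "\<And>r. \<bar>F r\<bar> \<le> 1"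
    "\<And>c d. c > 0 \<Longrightarrow> odd c \<Longrightarrow> coprime c d \<Longrightarrow> qnorm (c, d) > 0 \<Longrightarrow>
      fst (qmul (a, b) (c, d)) > 0 \<Longrightarrow> fst (qmul (a, b) (c, d)) mod 16 = 1 \<Longrightarrow>
      spin (qmul (a, b) (c, d)) = F (c mod 8) * of_int (Jacobi d c * Jacobi c (qnorm (c, d))) * of_int (qchar (c, d) (a, b))"
proof -
  obtain s b' where b: "b = s * b'" "b' > 0" "odd b'" "signed_two_power s"
    using signed_two_power_decomp[OF assms] by blast
  define G where "G = (\<lambda>r. Jacobi a b' * recip_sign b' r * Jacobi 2 r * Jacobi s r)"
  define F where "F = (\<lambda>r. if r > 0 \<and> odd r then real_of_int (G r) else 0)"
  show ?thesis
  proof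
    fix r
    have "\<bar>G r\<bar> \<le> 1" if "r > 0" "odd r"
      using Jacobi_values[OF b(2,3), of a] Jacobi_values[OF that, of 2] Jacobi_values[OF that, of s]
      by (auto simp: G_def recip_sign_def)
    then show "\<bar>F r\<bar> \<le> 1" by (auto simp: F_def simp flip: of_int_abs)
  next
    fix c d assume c: "c > 0" "odd c" "coprime c d" "qnorm (c, d) > 0"
      and u: "fst (qmul (a, b) (c, d)) > 0" "fst (qmul (a, b) (c, d)) mod 16 = 1"
    have r: "c mod 8 > 0" "odd (c mod 8)" using c(2) by presburger+
    have "c mod 4 = c mod 8 mod 4" using mod_mod_cancel[of 4 8 c] by simp
    then have g: "recip_sign b' c = recip_sign b' (c mod 8)" by (simp add: recip_sign_def)
    have g2: "Jacobi 2 c = Jacobi 2 (c mod 8)" using Jacobi_2 c r by simp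
    have g3: "Jacobi s c = Jacobi s (c mod 8)" using b(4) c r by (intro Jacobi_signed_two_power_cong) auto
    have "Jacobi (a * d + b * c) (a * c + 2 * b * d) =
       Jacobi a b' * Jacobi d c * recip_sign b' c * Jacobi 2 c * Jacobi s c * Jacobi (c\<^sup>2 - 2 * d\<^sup>2) (a * c + 2 * b * d)"
      using u by (intro Jacobi_twisted_mult[OF _ _ c(1-3) b]) auto
    also have "Jacobi (c\<^sup>2 - 2 * d\<^sup>2) (a * c + 2 * b * d) = Jacobi c (c\<^sup>2 - 2 * d\<^sup>2) * qchar (c, d) (a, b)"
      using u c by (intro Jacobi_qnorm_first) auto
    finally have "Jacobi (a * d + b * c) (a * c + 2 * b * d) = G (c mod 8) * (Jacobi d c * Jacobi c (c\<^sup>2 - 2 * d\<^sup>2)) * qchar (c, d) (a, b)"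
      unfolding G_def g g2 g3 by (simp only: mult_ac)
    then have "real_of_int (Jacobi (a * d + b * c) (a * c + 2 * b * d)) =
        of_int (G (c mod 8) * (Jacobi d c * Jacobi c (c\<^sup>2 - 2 * d\<^sup>2)) * qchar (c, d) (a, b))" by (simp only:)
    then show "spin (qmul (a, b) (c, d)) = F (c mod 8) * of_int (Jacobi d c * Jacobi c (qnorm (c, d))) * of_int (qchar (c, d) (a, b))"
      using r by (simp add: F_def del: qchar.simps)
  qed
qed

text \<open>The eighth power of \<open>1 + \<surd>2\<close> rather than the fourth: the fourth power
  \<open>17 + 12 \<surd>2\<close> maps \<open>u\<close> to \<open>17 u + 24 v\<close>, which for odd
  \<open>v\<close> is \<open>u + 8\<close> modulo 16.\<close>

definition unit_eta :: "int \<times> int" where "unit_eta = (577, 408)"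

lemma qnorm_unit_eta [simp]: "qnorm unit_eta = 1"
  by (simp add: unit_eta_def)

lemma tot_pos_sqrt2: "u > 0 \<Longrightarrow> qnorm (u, v) > 0 \<Longrightarrow> 2 * (v * v) < u * (u::int)"
  by (simp add: power2_eq_square)

text \<open>Each first coordinate exceeds \<open>\<surd>2\<close> times the absolute value of the
  second, so \<open>a * c\<close> dominates \<open>2 * b * d\<close>; squaring avoids real
  numbers.\<close>

lemma tot_pos_fst_pos:
  assumes "a > 0" "qnorm (a, b) > 0" "c > 0" "qnorm (c, d) > 0"
  shows "a * c + 2 * b * d > 0"
proof (rule ccontr)
  assume "\<not> ?thesis"
  then have "a * c \<le> - (2 * b * d)" by simp
  then have "(a * c) * (a * c) \<le> (2 * b * d) * (2 * b * d)"
    using assms(1,3) mult_mono[of "a*c" "-(2*b*d)" "a*c" "-(2*b*d)"] by simp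
  moreover have "(2 * (b * b)) * (2 * (d * d)) \<le> (2 * (b * b)) * (c * c)"
    using tot_pos_sqrt2[OF assms(3,4)] by (intro mult_left_mono) auto
  moreover have "(2 * (b * b)) * (c * c) < (a * a) * (c * c)"
    using tot_pos_sqrt2[OF assms(1,2)] assms(3) by (intro mult_strict_right_mono) auto
  ultimately show False by (simp add: mult_ac)
qed

text \<open>Twisted multiplicativity with \<open>408 = 8 * 51\<close> leaves factors that are all 1:
  577 is 16 modulo 51, a square; \<open>c\<close> is 1 modulo 16; the norm is \<open>- 2 d^2\<close>
  modulo \<open>c\<close>; and \<open>unit_eta\<close> is a square of a unit.\<close>

lemma spin_unit_eta:
  assumes "c > 0" "c mod 16 = 1" "odd d" "qnorm (c, d) > 0"
  shows "spin (qmul unit_eta (c, d)) = spin (c, d)"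
proof -
  let ?m = "c\<^sup>2 - 2 * d\<^sup>2" and ?u = "577 * c + 2 * 408 * d" and ?v = "577 * d + 408 * c"
  have oc: "odd c" using assms(2) by presburger
  have u0: "?u > 0" using tot_pos_fst_pos[of 577 408 c d] assms by simp
  have "?u = c + 16 * (36 * c + 51 * d)" by simp
  then have u16: "?u mod 16 = 1" using assms(2) by (metis mod_mult_self2)
  have ou: "odd ?u" using oc by simp
  show ?thesis
  proof (cases "coprime c d")
    case False
    then obtain g where g: "g dvd c" "g dvd d" "\<not> is_unit g" by (auto simp: coprime_def)
    then have "g dvd ?u" "g dvd ?v" by auto
    then have "\<not> coprime ?u ?v" using g(3) coprime_common_divisor by blast
    then show ?thesis using False u0 ou assms oc
      by (simp add: unit_eta_def spin_not_primitive del: spin.simps)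
  next
    case True
    have c8: "c mod 8 = 1" "c mod 4 = 1" using assms(2) mod_mod_cancel[of 8 16 c] mod_mod_cancel[of 4 16 c] by auto
    have s8: "signed_two_power 8" unfolding signed_two_power_def by (intro exI[of _ 3]) simp
    have om: "odd ?m" using oc by simp
    have m0: "?m > 0" using assms by simp
    have J8: "Jacobi 8 c = 1" "Jacobi 2 c = 1"
      using Jacobi_signed_two_power_cong[OF s8 assms(1) oc, of 1] Jacobi_2[OF assms(1) oc] c8 by auto
    have "Jacobi 577 51 = Jacobi (4 * 4) 51" by (rule Jacobi_cong) (auto simp: cong_def)
    also have "\<dots> = Jacobi 4 51 * Jacobi 4 51" by (rule Jacobi_mult_top) auto
    also have "coprime (2::int) 51" by (simp add: coprime_left_2_iff_odd)
    then have "coprime (2 * 2 :: int) 51" by (simp only: coprime_mult_left_iff)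
    then have "Jacobi 4 51 * Jacobi 4 51 = 1" by (intro Jacobi_square) auto
    finally have J51: "Jacobi 577 51 = 1" .
    have "Jacobi ?v ?u = Jacobi 577 51 * Jacobi d c * recip_sign 51 c * Jacobi 2 c * Jacobi 8 c * Jacobi ?m ?u"
      using u0 u16 assms(1) oc True s8 by (intro Jacobi_twisted_mult) auto
    also have "recip_sign 51 c = 1" using c8 by (simp add: recip_sign_def)
    also have "Jacobi ?m ?u = Jacobi c ?m * qchar (c, d) (577, 408)"
      using True m0 oc u0 u16 by (rule Jacobi_qnorm_first)
    also have "Jacobi c ?m = 1"
    proof -
      have "[?m = (-1) * 2 * (d * d)] (mod c)" by (simp add: cong_iff_dvd_diff power2_eq_square)
      then have "Jacobi ?m c = Jacobi ((-1) * 2 * (d * d)) c" using assms(1) oc by (intro Jacobi_cong)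
      also have "\<dots> = Jacobi (-1) c * Jacobi 2 c * (Jacobi d c * Jacobi d c)" by (simp only: Jacobi_mult_top[OF assms(1) oc])
      also have "Jacobi d c * Jacobi d c = 1" using assms(1) oc True by (intro Jacobi_square) (auto simp: coprime_commute)
      also have "Jacobi (-1) c = 1" using Jacobi_minus_1[OF assms(1) oc] c8 by simp
      finally have "Jacobi ?m c = 1" using J8 by simp
      then show ?thesis using Jacobi_reciprocity[OF assms(1) oc m0 om] c8 by (simp add: recip_sign_def)
    qed
    also have "qchar (c, d) (577, 408) = 1"
    proof -
      have P: "primitive (c, d)" "qnorm (c, d) > 0" "odd (qnorm (c, d))" using True m0 om by (auto simp: primitive_def)
      \<comment> \<open>The inverse of \<open>(17, 12)\<close> is \<open>(17, - 12)\<close>, so its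
        symbol is a sign, and \<open>(577, 408)\<close> is its square.\<close>
      have "qchar (c, d) (17, 12) * qchar (c, d) (17, - 12) = qchar (c, d) (1, 0)"
        using qchar_mult[OF P, of "(17, 12)" "(17, -12)"] by (simp del: qchar.simps)
      also have "\<dots> = 1" using m0 om by simp
      finally have "qchar (c, d) (17, 12) = 1 \<or> qchar (c, d) (17, 12) = -1" by (simp only: zmult_eq_1_iff) blast
      then have "qchar (c, d) (17, 12) * qchar (c, d) (17, 12) = 1" by auto
      moreover have "qmul (17, 12) (17, 12) = (577, 408)" by simp
      ultimately show ?thesis using qchar_mult[OF P, of "(17, 12)" "(17, 12)"] by (simp only:)
    qed
    finally show ?thesis using J8 J51 by (simp add: unit_eta_def)
  qed
qed

section \<open>Arithmetic of totally positive elements\<close>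

text \<open>The two conditions say that both real embeddings of \<open>u + v \<surd>2\<close> are
  positive.\<close>

definition tot_pos :: "(int \<times> int) set" where
  "tot_pos = {x. fst x > 0 \<and> qnorm x > 0}"

text \<open>Nonnegative powers on both sides stand for one integer exponent, so no inverse of
  \<open>unit_eta\<close> enters the definition.\<close>

definition eta_equiv :: "int \<times> int \<Rightarrow> int \<times> int \<Rightarrow> bool" where
  "eta_equiv x y \<longleftrightarrow> (\<exists>n m. (qmul unit_eta ^^ n) x = (qmul unit_eta ^^ m) y)"

lemma fund_dom_tot_pos: "x \<in> fund_dom \<Longrightarrow> x \<in> tot_pos"
  using fund_dom_qnorm_pos[of x] by (auto simp: tot_pos_def fund_dom_def)

lemma tot_pos_qmul:
  assumes "x \<in> tot_pos" "y \<in> tot_pos" shows "qmul x y \<in> tot_pos"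
proof -
  obtain a b c d where xy: "x = (a, b)" "y = (c, d)" by force
  have "a * c + 2 * b * d > 0" using assms xy by (intro tot_pos_fst_pos) (auto simp: tot_pos_def)
  then have "fst (qmul x y) > 0" by (simp add: xy)
  moreover have "qnorm (qmul x y) > 0" using assms unfolding qnorm_qmul by (simp add: tot_pos_def)
  ultimately show ?thesis by (simp add: tot_pos_def)
qed

lemma unit_eta_tot_pos: "unit_eta \<in> tot_pos"
  by (simp add: tot_pos_def unit_eta_def)

lemma funpow_qmul_commute: "(qmul e ^^ n) (qmul w z) = qmul w ((qmul e ^^ n) z)"
  by (induction n) (simp_all add: qmul_left_commute)

lemma qnorm_funpow_eta: "qnorm ((qmul unit_eta ^^ n) x) = qnorm x"
  by (induction n) (simp_all add: qnorm_qmul)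

lemma funpow_eta_inj: "(qmul unit_eta ^^ n) x = (qmul unit_eta ^^ n) y \<Longrightarrow> x = y"
  by (induction n) (auto dest: qmul_cancel[rotated])

lemma eta_equiv_sym: "eta_equiv x y \<Longrightarrow> eta_equiv y x"
  by (auto simp: eta_equiv_def) metis

lemma eta_equiv_trans:
  assumes "eta_equiv x y" "eta_equiv y z" shows "eta_equiv x z"
proof -
  let ?f = "qmul unit_eta"
  obtain n m k l where h: "(?f ^^ n) x = (?f ^^ m) y" "(?f ^^ k) y = (?f ^^ l) z"
    using assms by (auto simp: eta_equiv_def)
  have "(?f ^^ (k + n)) x = (?f ^^ (k + m)) y" using h by (simp add: funpow_add)
  also have "\<dots> = (?f ^^ (m + k)) y" by (simp add: add.commute)
  also have "\<dots> = (?f ^^ (m + l)) z" using h by (simp add: funpow_add)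
  finally show ?thesis by (auto simp: eta_equiv_def)
qed

lemma eta_equiv_qmul: "eta_equiv x y \<Longrightarrow> eta_equiv (qmul w x) (qmul w y)"
  unfolding eta_equiv_def funpow_qmul_commute by metis

lemma eta_equiv_qmul_cancel: "qnorm w \<noteq> 0 \<Longrightarrow> eta_equiv (qmul w x) (qmul w y) \<Longrightarrow> eta_equiv x y"
  unfolding eta_equiv_def funpow_qmul_commute using qmul_cancel by blast

lemma eta_equiv_qnorm: "eta_equiv x y \<Longrightarrow> qnorm x = qnorm y"
  unfolding eta_equiv_def using qnorm_funpow_eta by metis

lemma eta_equiv_step: "eta_equiv (qmul unit_eta x) x"
  unfolding eta_equiv_def by (rule exI[of _ 0], rule exI[of _ 1]) simp

lemma eta_equiv_refl: "eta_equiv x x"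
  unfolding eta_equiv_def by blast

text \<open>Descent on the first coordinate: strictly above the cone, multiplication by the inverse
  of \<open>unit_eta\<close> lowers it, and strictly below the cone, multiplication by
  \<open>unit_eta\<close> does.\<close>

lemma fund_dom_representative:
  assumes "x \<in> tot_pos" shows "\<exists>y\<in>fund_dom. eta_equiv x y"
proof -
  have "\<forall>x\<in>tot_pos. nat (fst x) = k \<longrightarrow> (\<exists>y\<in>fund_dom. eta_equiv x y)" for k
  proof (induction k rule: less_induct)
    case (less k)
    show ?case
    proof (intro ballI impI)
      fix x assume x: "x \<in> tot_pos" "nat (fst x) = k"
      obtain u v where uv: "x = (u, v)" by force
      have u: "u > 0" using x uv by (simp add: tot_pos_def)
      consider "x \<in> fund_dom" | "17 * v > 12 * u" | "17 * v < - 12 * u" | "17 * v = - 12 * u"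
        using u uv by (fastforce simp: fund_dom_def)
      then show "\<exists>y\<in>fund_dom. eta_equiv x y"
      proof cases
        case 1
        then show ?thesis using eta_equiv_refl by blast
      next
        case 2
        define x' where "x' = qmul (577, -408) x"
        have "(577, -408) \<in> tot_pos" by (simp add: tot_pos_def)
        then have t: "x' \<in> tot_pos" using x tot_pos_qmul by (simp add: x'_def)
        have "fst x' < u" using 2 by (simp add: x'_def uv)
        moreover have "fst x' > 0" using t by (simp add: tot_pos_def)
        ultimately have "nat (fst x') < k" using x uv by simp
        then obtain y where y: "y \<in> fund_dom" "eta_equiv x' y" using less.IH t by blast
        have "qmul unit_eta x' = x" unfolding x'_def qmul_assoc[symmetric] by (simp add: unit_eta_def uv)
        then have "eta_equiv x x'" using eta_equiv_step[of x'] by simp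
        then show ?thesis using y eta_equiv_trans by blast
      next
        case 3
        define x' where "x' = qmul unit_eta x"
        have t: "x' \<in> tot_pos" using x tot_pos_qmul unit_eta_tot_pos by (simp add: x'_def)
        have "fst x' < u" using 3 by (simp add: x'_def uv unit_eta_def)
        moreover have "fst x' > 0" using t by (simp add: tot_pos_def)
        ultimately have "nat (fst x') < k" using x uv by simp
        then obtain y where y: "y \<in> fund_dom" "eta_equiv x' y" using less.IH t by blast
        have "eta_equiv x x'" using eta_equiv_sym[OF eta_equiv_step[of x]] by (simp add: x'_def)
        then show ?thesis using y eta_equiv_trans by blast
      next
        \<comment> \<open>The excluded lower edge of the half-open cone: \<open>unit_eta\<close>
          carries it onto the included upper edge.\<close>
        case 4
        then have "qmul unit_eta x \<in> fund_dom" using u by (simp add: uv unit_eta_def fund_dom_def)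
        then show ?thesis using eta_equiv_sym[OF eta_equiv_step] by blast
      qed
    qed
  qed
  then show ?thesis using assms by blast
qed

text \<open>Every positive power of \<open>unit_eta\<close> moves the cone strictly above its upper
  edge, so powers can agree on points of the cone only when the exponents do.\<close>

lemma fund_dom_unique:
  assumes "x \<in> fund_dom" "y \<in> fund_dom" "eta_equiv x y" shows "x = y"
proof -
  have out: "(qmul unit_eta ^^ Suc k) x \<notin> fund_dom" if "x \<in> fund_dom" for x k
  proof -
    have "fst ((qmul unit_eta ^^ Suc k) x) > 0 \<and> 17 * snd ((qmul unit_eta ^^ Suc k) x) > 12 * fst ((qmul unit_eta ^^ Suc k) x)"
    proof (induction k)
      case 0
      obtain u v where "x = (u, v)" by force
      then show ?case using that by (auto simp: fund_dom_def unit_eta_def)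
    next
      case (Suc k)
      obtain u v where "(qmul unit_eta ^^ Suc k) x = (u, v)" by force
      then show ?case using Suc by (auto simp: unit_eta_def)
    qed
    then show ?thesis by (auto simp: fund_dom_def)
  qed
  have main: "x = y" if "x \<in> fund_dom" "y \<in> fund_dom" "(qmul unit_eta ^^ n) x = (qmul unit_eta ^^ m) y" "m \<le> n" for x y n m
  proof -
    have "(qmul unit_eta ^^ (m + (n - m))) x = (qmul unit_eta ^^ m) y" using that by simp
    then have "(qmul unit_eta ^^ (n - m)) x = y" unfolding funpow_add o_def by (rule funpow_eta_inj)
    then show ?thesis using that out[OF that(1)] by (cases "n - m") (auto simp del: funpow.simps(2))
  qed
  obtain n m where "(qmul unit_eta ^^ n) x = (qmul unit_eta ^^ m) y" using assms by (auto simp: eta_equiv_def)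
  then show ?thesis using main[OF assms(1,2), of n m] main[OF assms(2,1), of m n] by (cases "m \<le> n") auto
qed

definition spin_cond :: "int \<times> int \<Rightarrow> bool" where
  "spin_cond x \<longleftrightarrow> fst x mod 16 = 1 \<and> odd (snd x)"

lemma spin_set_iff: "x \<in> spin_set \<longleftrightarrow> x \<in> fund_dom \<and> spin_cond x"
  by (auto simp: spin_set_def spin_cond_def)

lemma spin_cond_eta: "spin_cond (qmul unit_eta x) \<longleftrightarrow> spin_cond x"
proof -
  obtain u v where x: "x = (u, v)" by force
  have "577 * u + 816 * v = u + 16 * (36 * u + 51 * v)" by simp
  then have "(577 * u + 816 * v) mod 16 = u mod 16" by (metis mod_mult_self2)
  then show ?thesis by (simp add: x spin_cond_def unit_eta_def)
qed

lemma spin_funpow_eta: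
  assumes "x \<in> tot_pos"
  shows "(spin_cond ((qmul unit_eta ^^ n) x) \<longleftrightarrow> spin_cond x) \<and> (spin_cond x \<longrightarrow> spin ((qmul unit_eta ^^ n) x) = spin x)
    \<and> (qmul unit_eta ^^ n) x \<in> tot_pos"
proof (induction n)
  case (Suc n)
  obtain c d where y: "(qmul unit_eta ^^ n) x = (c, d)" by force
  have t: "(c, d) \<in> tot_pos" using Suc y by simp
  have "spin (qmul unit_eta (c, d)) = spin (c, d)" if "spin_cond (c, d)"
    using t that by (intro spin_unit_eta) (auto simp: tot_pos_def spin_cond_def)
  then show ?case using Suc y t spin_cond_eta tot_pos_qmul[OF unit_eta_tot_pos t] by auto
qed (use assms in simp)

lemma spin_eta_equiv:
  assumes "x \<in> tot_pos" "y \<in> tot_pos" "eta_equiv x y"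
  shows "spin_cond x \<longleftrightarrow> spin_cond y" "spin_cond x \<Longrightarrow> spin x = spin y"
proof -
  obtain n m where nm: "(qmul unit_eta ^^ n) x = (qmul unit_eta ^^ m) y" using assms by (auto simp: eta_equiv_def)
  show "spin_cond x \<longleftrightarrow> spin_cond y" using spin_funpow_eta[OF assms(1), of n] spin_funpow_eta[OF assms(2), of m] nm by simp
  then show "spin_cond x \<Longrightarrow> spin x = spin y"
    using spin_funpow_eta[OF assms(1), of n] spin_funpow_eta[OF assms(2), of m] nm by simp
qed

definition eta_rep :: "int \<times> int \<Rightarrow> int \<times> int" where
  "eta_rep x = (SOME y. y \<in> fund_dom \<and> eta_equiv x y)"

lemma eta_rep:
  assumes "x \<in> tot_pos" shows "eta_rep x \<in> fund_dom" "eta_equiv x (eta_rep x)"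
proof -
  have "\<exists>y. y \<in> fund_dom \<and> eta_equiv x y" using fund_dom_representative[OF assms] by blast
  from someI_ex[OF this] show "eta_rep x \<in> fund_dom" "eta_equiv x (eta_rep x)" by (auto simp: eta_rep_def)
qed

lemma eta_rep_eqI: "x \<in> tot_pos \<Longrightarrow> y \<in> fund_dom \<Longrightarrow> eta_equiv x y \<Longrightarrow> eta_rep x = y"
  using eta_rep[of x] fund_dom_unique eta_equiv_sym eta_equiv_trans by metis

section \<open>Divisibility of quadratic integers and generators of prime norm\<close>

definition qdvd :: "int \<times> int \<Rightarrow> int \<times> int \<Rightarrow> bool" where
  "qdvd w x \<longleftrightarrow> (\<exists>z. x = qmul w z)"

lemma qdvdI: "qdvd w (qmul w z)"
  unfolding qdvd_def by (rule exI, rule refl)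

lemma qdvd_eta_equiv:
  assumes "qdvd w x" "x \<in> tot_pos" "eta_equiv x y" shows "qdvd w y"
proof -
  define e' :: "int \<times> int" where "e' = (577, - 408)"
  have e: "qmul e' unit_eta = (1, 0)" by (simp add: e'_def unit_eta_def)
  have inv: "(qmul e' ^^ m) ((qmul unit_eta ^^ m) z) = z" for m z
  proof (induction m arbitrary: z)
    case (Suc m)
    have "(qmul e' ^^ Suc m) ((qmul unit_eta ^^ Suc m) z) = (qmul e' ^^ m) (qmul e' (qmul unit_eta ((qmul unit_eta ^^ m) z)))"
      by (simp add: funpow_swap1)
    also have "\<dots> = (qmul e' ^^ m) ((qmul unit_eta ^^ m) z)" using e by (simp add: qmul_assoc[symmetric] del: qmul.simps)
    finally show ?case using Suc by simp
  qed simp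
  obtain z where z: "x = qmul w z" using assms(1) by (auto simp: qdvd_def)
  obtain n m where nm: "(qmul unit_eta ^^ n) x = (qmul unit_eta ^^ m) y" using assms by (auto simp: eta_equiv_def)
  have "y = (qmul e' ^^ m) ((qmul unit_eta ^^ n) x)" unfolding nm inv ..
  also have "\<dots> = qmul w ((qmul e' ^^ m) ((qmul unit_eta ^^ n) z))" by (simp add: z funpow_qmul_commute)
  finally show ?thesis by (simp only: qdvdI)
qed

text \<open>The norm of \<open>z\<close> is positive by multiplicativity; were its first coordinate
  negative, \<open>w\<close> times \<open>- z\<close> would be totally positive as well.\<close>

lemma tot_pos_quotient:
  assumes "w \<in> tot_pos" "qmul w z \<in> tot_pos" shows "z \<in> tot_pos"
proof -
  have N: "qnorm z > 0" using assms by (auto simp: tot_pos_def qnorm_qmul zero_less_mult_iff)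
  obtain a b c d where [simp]: "w = (a, b)" "z = (c, d)" by force
  have "fst z > 0"
  proof (rule ccontr)
    assume "\<not> ?thesis"
    moreover have "c \<noteq> 0" using N by (auto simp: power2_eq_square)
    ultimately have "- c > 0" by simp
    then have "(- c, - d) \<in> tot_pos" using N by (simp add: tot_pos_def)
    then have "qmul w (- c, - d) \<in> tot_pos" using assms(1) tot_pos_qmul by blast
    then show False using assms(2) by (simp add: tot_pos_def)
  qed
  then show ?thesis using N by (simp add: tot_pos_def)
qed

text \<open>Multiplication by \<open>w\<close> followed by reduction to the fundamental domain decouples the cone
  condition on \<open>w z\<close> from \<open>w\<close>.\<close>
lemma spin_sum_multiples:
  assumes w: "w \<in> tot_pos" "qnorm w = int q" and q: "q > 0"
  shows "(\<Sum>x | x \<in> spin_set \<and> qnorm x \<le> int N \<and> qdvd w x. spin x * h (qnorm x div int q)) =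
    (\<Sum>z | z \<in> fund_dom \<and> int q * qnorm z \<le> int N \<and> spin_cond (qmul w z). spin (qmul w z) * h (qnorm z))"
    (is "sum ?f ?X = sum ?g ?Z")
proof -
  have wz: "qmul w z \<in> tot_pos" if "z \<in> fund_dom" for z
    using that tot_pos_qmul w fund_dom_tot_pos by blast
  have inj: "inj_on (\<lambda>z. eta_rep (qmul w z)) ?Z"
  proof (rule inj_onI)
    fix z z' assume z: "z \<in> ?Z" "z' \<in> ?Z" "eta_rep (qmul w z) = eta_rep (qmul w z')"
    have "eta_equiv (qmul w z) (qmul w z')"
    proof -
      have zf: "z \<in> fund_dom" "z' \<in> fund_dom" using z by auto
      have "eta_equiv (eta_rep (qmul w z)) (qmul w z')"
        using eta_equiv_sym[OF eta_rep(2)[OF wz[OF zf(2)]]] z(3) by simp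
      with eta_rep(2)[OF wz[OF zf(1)]] show ?thesis by (rule eta_equiv_trans)
    qed
    moreover have "qnorm w \<noteq> 0" using w(2) q by simp
    ultimately have "eta_equiv z z'" using eta_equiv_qmul_cancel by blast
    then show "z = z'" using z fund_dom_unique by auto
  qed
  have img: "(\<lambda>z. eta_rep (qmul w z)) ` ?Z = ?X"
  proof (rule equalityI; rule subsetI)
    fix x assume "x \<in> (\<lambda>z. eta_rep (qmul w z)) ` ?Z"
    then obtain z where z: "z \<in> ?Z" "x = eta_rep (qmul w z)" by blast
    have zf: "z \<in> fund_dom" using z by simp
    note r = eta_rep[OF wz[OF zf]]
    have "qnorm x = int q * qnorm z" using eta_equiv_qnorm[OF r(2)] w z by (simp add: qnorm_qmul)
    moreover have "spin_cond x" using spin_eta_equiv(1)[OF wz[OF zf] fund_dom_tot_pos[OF r(1)] r(2)] z by simp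
    moreover have "qdvd w (qmul w z)" by (rule qdvdI)
    then have "qdvd w x" using qdvd_eta_equiv[OF _ wz[OF zf] r(2), of w] z(2) by simp
    ultimately show "x \<in> ?X" using z r by (simp add: spin_set_iff)
  next
    fix x assume x: "x \<in> ?X"
    then obtain z0 where z0: "x = qmul w z0" by (auto simp: qdvd_def)
    have xf: "x \<in> fund_dom" "spin_cond x" using x by (auto simp: spin_set_iff)
    have z0t: "z0 \<in> tot_pos" using tot_pos_quotient[OF w(1)] fund_dom_tot_pos[OF xf(1)] z0 by simp
    define z where "z = eta_rep z0"
    have z: "z \<in> fund_dom" "eta_equiv z0 z" using eta_rep[OF z0t] by (auto simp: z_def)
    have e: "eta_equiv x (qmul w z)" using z(2) eta_equiv_qmul z0 by simp
    have "int q * qnorm z = qnorm x" using eta_equiv_qnorm[OF e] w by (simp add: qnorm_qmul)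
    moreover have "spin_cond (qmul w z)" using spin_eta_equiv(1)[OF fund_dom_tot_pos[OF xf(1)] wz[OF z(1)] e] xf by simp
    ultimately have "z \<in> ?Z" using x z by simp
    moreover have "eta_rep (qmul w z) = x" using eta_rep_eqI[OF wz[OF z(1)] xf(1) eta_equiv_sym[OF e]] .
    ultimately show "x \<in> (\<lambda>z. eta_rep (qmul w z)) ` ?Z" by (intro image_eqI[of _ _ z]) auto
  qed
  have "sum ?f ?X = (\<Sum>z\<in>?Z. ?f (eta_rep (qmul w z)))"
    unfolding img[symmetric] by (subst sum.reindex[OF inj]) simp
  also have "\<dots> = sum ?g ?Z"
  proof (rule sum.cong[OF refl])
    fix z assume z: "z \<in> ?Z"
    then have zf: "z \<in> fund_dom" by simp
    note r = eta_rep[OF wz[OF zf]]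
    have "qnorm (eta_rep (qmul w z)) = int q * qnorm z" using eta_equiv_qnorm[OF r(2)] w by (simp add: qnorm_qmul)
    moreover have "spin (eta_rep (qmul w z)) = spin (qmul w z)"
      using spin_eta_equiv(2)[OF wz[OF zf] fund_dom_tot_pos[OF r(1)] r(2)] z by simp
    ultimately show "?f (eta_rep (qmul w z)) = ?g z" using q by simp
  qed
  finally show ?thesis .
qed

lemma square_eq_twice_square:
  assumes "a\<^sup>2 = 2 * (b::int)\<^sup>2" shows "b = 0"
proof -
  have "\<forall>a b::nat. a\<^sup>2 = 2 * b\<^sup>2 \<longrightarrow> a = k \<longrightarrow> b = 0" for k
  proof (induction k rule: less_induct)
    case (less k)
    show ?case
    proof (intro allI impI)
      fix a b :: nat assume h: "a\<^sup>2 = 2 * b\<^sup>2" "a = k"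
      show "b = 0"
      proof (cases "a = 0")
        case False
        have "even (a\<^sup>2)" using h by simp
        then obtain c where c: "a = 2 * c" by (auto elim: evenE)
        then have b2: "b\<^sup>2 = 2 * c\<^sup>2" using h by (simp add: power2_eq_square)
        have "b < a"
        proof (rule ccontr)
          assume "\<not> b < a"
          then have "a\<^sup>2 \<le> b\<^sup>2" by (intro power_mono) auto
          then have "b\<^sup>2 = 0" using h(1) by linarith
          then show False using h(1) False by simp
        qed
        then have "c = 0" using less.IH b2 h by blast
        then show ?thesis using c False by simp
      qed (use h in auto)
    qed
  qed
  moreover have "(nat \<bar>a\<bar>)\<^sup>2 = 2 * (nat \<bar>b\<bar>)\<^sup>2"
  proof -
    have "int ((nat \<bar>a\<bar>)\<^sup>2) = int (2 * (nat \<bar>b\<bar>)\<^sup>2)" using assms by simp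
    then show ?thesis by (simp only: of_nat_eq_iff)
  qed
  ultimately have "nat \<bar>b\<bar> = 0" by blast
  then show ?thesis by simp
qed

text \<open>There are more pairs with entries between 0 and \<open>s\<close> than residues modulo
  \<open>q\<close>, so two of them share the value of \<open>i - r * j\<close>; their difference is
  the solution.\<close>

lemma Thue_pigeonhole:
  assumes "q > (0::nat)" "s\<^sup>2 \<le> q" "q < (s + 1)\<^sup>2"
  obtains a b :: int where "(a, b) \<noteq> (0, 0)" "\<bar>a\<bar> \<le> int s" "\<bar>b\<bar> \<le> int s" "int q dvd a - r * b"
proof -
  define f where "f = (\<lambda>(i::int, j::int). (i - r * j) mod int q)"
  let ?S = "{0..int s} \<times> {0..int s}"
  have "f ` ?S \<subseteq> {0..<int q}" using assms(1) by (auto simp: f_def)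
  then have "card (f ` ?S) \<le> card {0..<int q}" by (intro card_mono) auto
  also have "\<dots> = q" by simp
  also have "\<dots> < card ?S" using assms(3) by (simp add: card_cartesian_product power2_eq_square nat_add_distrib)
  finally have "\<not> inj_on f ?S" by (rule pigeonhole)
  then obtain i j i' j' where h: "(i, j) \<in> ?S" "(i', j') \<in> ?S" "(i, j) \<noteq> (i', j')" "f (i, j) = f (i', j')"
    by (auto simp: inj_on_def)
  then have "int q dvd (i - r * j) - (i' - r * j')" by (simp add: f_def mod_eq_dvd_iff)
  then have "int q dvd (i - i') - r * (j - j')" by (simp add: algebra_simps)
  then show ?thesis using that[of "i - i'" "j - j'"] h by auto
qed

text \<open>Thue's argument with a square root \<open>r\<close> of 2 modulo \<open>q\<close>. The
  small solution has norm a multiple of \<open>q\<close> strictly between \<open>- 2 q\<close> and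
  \<open>q\<close>, and nonzero by the irrationality of \<open>\<surd>2\<close>, hence equal to
  \<open>- q\<close>.\<close>

lemma prime_norm_exists:
  assumes q: "prime q" and x: "coprime u v" "int q dvd u\<^sup>2 - 2 * v\<^sup>2"
  obtains A B where "A > 0" "B \<noteq> 0" "A\<^sup>2 - 2 * B\<^sup>2 = int q" "A\<^sup>2 \<le> 9 * int q"
proof -
  have pq: "prime (int q)" using q by simp
  have q0: "q > 0" using q prime_gt_0_nat by blast
  have nsq: "k\<^sup>2 \<noteq> int q" for k :: int
  proof
    assume "k\<^sup>2 = int q"
    then have "prime (k ^ 2)" using pq by simp
    then show False using prime_power_iff[of k 2] by simp
  qed
  have "\<not> int q dvd v"
  proof
    assume v: "int q dvd v"
    then have "int q dvd (u\<^sup>2 - 2 * v\<^sup>2) + 2 * v * v" using x(2) by simp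
    then have "int q dvd u\<^sup>2" by (simp add: power2_eq_square)
    then have "int q dvd u" using pq prime_dvd_power by blast
    then show False using v x(1) pq by (metis coprime_common_divisor not_prime_unit)
  qed
  then have "coprime v (int q)" using pq prime_imp_coprime coprime_commute by blast
  then obtain t where t: "[v * t = 1] (mod int q)" using cong_solve_coprime_int by blast
  define r where "r = u * t"
  have r2: "int q dvd r\<^sup>2 - 2"
  proof -
    have d1: "int q dvd (u\<^sup>2 - 2 * v\<^sup>2) * t\<^sup>2" using x(2) by simp
    have d2: "int q dvd (v * t - 1) * (2 * (v * t + 1))" using t by (simp add: cong_iff_dvd_diff)
    have "r\<^sup>2 - 2 = (u\<^sup>2 - 2 * v\<^sup>2) * t\<^sup>2 + (v * t - 1) * (2 * (v * t + 1))"
      by (simp add: r_def power2_eq_square algebra_simps)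
    then show ?thesis using d1 d2 by simp
  qed
  define s where "s = nat \<lfloor>sqrt (real q)\<rfloor>"
  have s1: "s\<^sup>2 \<le> q"
  proof -
    have "real s \<le> sqrt (real q)" by (simp add: s_def)
    then have "(real s)\<^sup>2 \<le> (sqrt (real q))\<^sup>2" by (intro power_mono) auto
    then have "real (s\<^sup>2) \<le> real q" by simp
    then show ?thesis by (simp only: of_nat_le_iff)
  qed
  have s2: "q < (s + 1)\<^sup>2"
  proof -
    have "sqrt (real q) < real s + 1" unfolding s_def by linarith
    then have "(sqrt (real q))\<^sup>2 < (real s + 1)\<^sup>2" by (intro power_strict_mono) auto
    then have "real q < real ((s + 1)\<^sup>2)" by (simp add: add.commute)
    then show ?thesis by (simp only: of_nat_less_iff)
  qed
  obtain a b where ab: "(a, b) \<noteq> (0, 0)" "\<bar>a\<bar> \<le> int s" "\<bar>b\<bar> \<le> int s" "int q dvd a - r * b"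
    using Thue_pigeonhole[OF q0 s1 s2] by blast
  have sq: "k\<^sup>2 < int q" if "\<bar>k\<bar> \<le> int s" for k
  proof -
    have "\<bar>k\<bar>\<^sup>2 \<le> (int s)\<^sup>2" using that by (intro power_mono) auto
    also have "\<dots> \<le> int q" using s1 by (metis of_nat_le_iff of_nat_power)
    finally show ?thesis using nsq[of k] by simp
  qed
  have "int q dvd (a - r * b) * (a + r * b) + (r\<^sup>2 - 2) * b\<^sup>2" using ab(4) r2 by simp
  then have dv: "int q dvd a\<^sup>2 - 2 * b\<^sup>2" by (simp add: power2_eq_square algebra_simps)
  have up: "a\<^sup>2 - 2 * b\<^sup>2 < int q" using sq[OF ab(2)] zero_le_power2[of b] by linarith
  have lo: "a\<^sup>2 - 2 * b\<^sup>2 > - 2 * int q" using sq[OF ab(3)] zero_le_power2[of a] by linarith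
  obtain k where k: "a\<^sup>2 - 2 * b\<^sup>2 = int q * k" using dv by blast
  have "k < 1" using up q0 unfolding k by (metis mult.right_neutral mult_less_cancel_left_pos of_nat_0_less_iff)
  moreover have "k > - 2"
  proof (rule ccontr)
    assume "\<not> k > - 2"
    then have "int q * k \<le> int q * (- 2)" by (intro mult_left_mono) auto
    then show False using lo k by simp
  qed
  moreover have "k \<noteq> 0"
  proof
    assume "k = 0"
    then have "a\<^sup>2 = 2 * b\<^sup>2" using k by simp
    moreover from this have "b = 0" by (rule square_eq_twice_square)
    ultimately show False using ab(1) by simp
  qed
  ultimately have "k = -1" by simp
  then have nq: "a\<^sup>2 - 2 * b\<^sup>2 = - int q" using k by simp
  \<comment> \<open>Multiplication by \<open>1 + \<surd>2\<close>, of norm -1, corrects the sign of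
    the norm; the factor 9 in the size bound comes from
    \<open>\<bar>a + 2 * b\<bar> \<le> 3 * s\<close>.\<close>
  define A where "A = \<bar>a + 2 * b\<bar>"
  define B where "B = a + b"
  have n: "A\<^sup>2 - 2 * B\<^sup>2 = int q" using nq by (simp add: A_def B_def power2_eq_square algebra_simps)
  show ?thesis
  proof (rule that[of A B])
    have "A \<noteq> 0" using n q0 zero_le_power2[of B] by (intro notI) simp
    then show "A > 0" by (simp add: A_def)
    show "B \<noteq> 0" using n nsq[of A] by (intro notI) simp
    show "A\<^sup>2 - 2 * B\<^sup>2 = int q" by (rule n)
    have "\<bar>A\<bar> \<le> 3 * int s" using ab by (simp add: A_def)
    then have "A\<^sup>2 \<le> (3 * int s)\<^sup>2" using abs_le_square_iff[of A "3 * int s"] by simp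
    also have "\<dots> = 9 * (int s)\<^sup>2" by (simp add: power_mult_distrib)
    also have "\<dots> \<le> 9 * int q" using s1 by (metis mult_left_mono of_nat_le_iff of_nat_power zero_le_numeral)
    finally show "A\<^sup>2 \<le> 9 * int q" .
  qed
qed

definition prime_gen :: "nat \<Rightarrow> int \<times> int" where
  "prime_gen q = (SOME w. fst w > 0 \<and> snd w \<noteq> 0 \<and> qnorm w = int q \<and> (fst w)\<^sup>2 \<le> 9 * int q)"

text \<open>A generator and its conjugate stand for the two primes above \<open>q\<close>. They are
  chosen small rather than in the cone: the size bound controls the box of products, and the nonzero
  second coordinate is what \<open>spin_qmul\<close> asks for.\<close>

definition primes_over :: "nat \<Rightarrow> (int \<times> int) set" where
  "primes_over q = (if \<exists>w. fst w > 0 \<and> snd w \<noteq> 0 \<and> qnorm w = int q \<and> (fst w)\<^sup>2 \<le> 9 * int q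
     then {prime_gen q, (fst (prime_gen q), - snd (prime_gen q))} else {})"

lemma primes_over_props:
  assumes "w \<in> primes_over q"
  shows "fst w > 0" "snd w \<noteq> 0" "qnorm w = int q" "(fst w)\<^sup>2 \<le> 9 * int q"
proof -
  let ?P = "\<lambda>w. fst w > 0 \<and> snd w \<noteq> 0 \<and> qnorm w = int q \<and> (fst w)\<^sup>2 \<le> 9 * int q"
  have ex: "\<exists>w. ?P w" using assms by (auto simp: primes_over_def split: if_splits)
  have g: "?P (prime_gen q)" unfolding prime_gen_def by (rule someI_ex[OF ex])
  have "w = prime_gen q \<or> w = (fst (prime_gen q), - snd (prime_gen q))"
    using assms by (auto simp: primes_over_def split: if_splits)
  then have "?P w" using g by (cases "prime_gen q") auto
  then show "fst w > 0" "snd w \<noteq> 0" "qnorm w = int q" "(fst w)\<^sup>2 \<le> 9 * int q" by auto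
qed

lemma finite_primes_over: "finite (primes_over q)"
  by (simp add: primes_over_def)

lemma card_primes_over: "card (primes_over q) \<le> 2"
  by (auto simp: primes_over_def card_insert_if)

lemma primes_over_tot_pos: "q > 0 \<Longrightarrow> w \<in> primes_over q \<Longrightarrow> w \<in> tot_pos"
  using primes_over_props[of w q] by (auto simp: tot_pos_def)

lemma odd_prime_not_dvd_2:
  assumes "prime (q::int)" "odd q" shows "\<not> q dvd 2"
proof
  assume "q dvd 2"
  then have "q = 2" using assms(1) by (simp add: primes_dvd_imp_eq)
  then show False using assms(2) by simp
qed

lemma prime_norm_not_dvd:
  assumes "prime (q::int)" "odd q" "A\<^sup>2 - 2 * B\<^sup>2 = q" shows "\<not> q dvd A" "\<not> q dvd B"
proof -
  have q1: "q > 1" using assms(1) prime_gt_1_int by blast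
  have both: False if "q dvd A" "q dvd B"
  proof -
    have "q * q dvd A\<^sup>2 - 2 * B\<^sup>2" unfolding power2_eq_square
      by (rule dvd_diff[OF mult_dvd_mono[OF that(1,1)] dvd_mult[OF mult_dvd_mono[OF that(2,2)]]])
    then have "q * q \<le> q" using assms(3) q1 by (intro zdvd_imp_le) auto
    then show False using q1 by simp
  qed
  have ab: "q dvd A \<longleftrightarrow> q dvd B"
  proof
    assume "q dvd A"
    then have "q dvd A * A" by simp
    moreover have "q dvd A\<^sup>2 - 2 * B\<^sup>2" using assms(3) by simp
    ultimately have "q dvd A * A - (A\<^sup>2 - 2 * B\<^sup>2)" by (rule dvd_diff)
    then have "q dvd A\<^sup>2 - (A\<^sup>2 - 2 * B\<^sup>2)" by (simp only: power2_eq_square)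
    then have "q dvd 2 * B\<^sup>2" by simp
    moreover have "\<not> q dvd 2" using assms odd_prime_not_dvd_2 by blast
    ultimately show "q dvd B" using assms(1) by (metis prime_dvd_mult_iff prime_dvd_power)
  next
    assume "q dvd B"
    then have "q dvd 2 * B\<^sup>2" by (simp add: power2_eq_square)
    moreover have "q dvd A\<^sup>2 - 2 * B\<^sup>2" using assms(3) by simp
    ultimately have "q dvd (A\<^sup>2 - 2 * B\<^sup>2) + 2 * B\<^sup>2" by (intro dvd_add)
    then have "q dvd A\<^sup>2" by (simp only: diff_add_cancel)
    then show "q dvd A" using assms(1) prime_dvd_power by blast
  qed
  show "\<not> q dvd A" "\<not> q dvd B" using both ab by auto
qed

text \<open>Multiplying \<open>(u, v)\<close> by the conjugate of \<open>(A, B)\<close>, both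
  coordinates must be divisible by \<open>q\<close>; divisibility of the second one implies that of
  the first.\<close>

lemma qdvd_iff:
  assumes "prime (q::int)" "odd q" "A\<^sup>2 - 2 * B\<^sup>2 = q"
  shows "qdvd (A, B) (u, v) \<longleftrightarrow> q dvd v * A - u * B"
proof
  assume "qdvd (A, B) (u, v)"
  then obtain c d where cd: "u = A * c + 2 * B * d" "v = A * d + B * c" by (auto simp: qdvd_def)
  have "v * A - u * B = (A\<^sup>2 - 2 * B\<^sup>2) * d" by (simp add: cd power2_eq_square algebra_simps)
  then show "q dvd v * A - u * B" using assms(3) by simp
next
  assume d: "q dvd v * A - u * B"
  have "q dvd A * (v * A - u * B) - v * (A\<^sup>2 - 2 * B\<^sup>2)" using d assms(3) by (intro dvd_diff) auto
  then have "q dvd B * (2 * v * B - u * A)" by (simp add: power2_eq_square algebra_simps)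
  then have "q dvd 2 * v * B - u * A" using prime_norm_not_dvd[OF assms] assms(1) prime_dvd_mult_iff by blast
  then have "q dvd u * A - 2 * v * B" by (subst dvd_minus_iff[symmetric]) simp
  then obtain c where c: "u * A - 2 * v * B = q * c" by blast
  obtain e where e: "v * A - u * B = q * e" using d by blast
  have "q * (A * c + 2 * B * e) = A * (q * c) + 2 * B * (q * e)" by (simp add: algebra_simps)
  also have "\<dots> = (A\<^sup>2 - 2 * B\<^sup>2) * u" unfolding c[symmetric] e[symmetric] by (simp add: power2_eq_square algebra_simps)
  finally have 1: "A * c + 2 * B * e = u" using assms by auto
  have "q * (A * e + B * c) = A * (q * e) + B * (q * c)" by (simp add: algebra_simps)
  also have "\<dots> = (A\<^sup>2 - 2 * B\<^sup>2) * v" unfolding c[symmetric] e[symmetric] by (simp add: power2_eq_square algebra_simps)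
  finally have 2: "A * e + B * c = v" using assms by auto
  show "qdvd (A, B) (u, v)" unfolding qdvd_def using 1 2 by (intro exI[of _ "(c, e)"]) simp
qed

text \<open>The product of the two divisibility tests is
  \<open>q * v^2 - B^2 * qnorm (u, v)\<close>, a multiple of \<open>q\<close>, so one test succeeds.
  If both did, \<open>q\<close> would divide \<open>u\<close> and \<open>v\<close>.\<close>

lemma card_primes_over_dvd:
  assumes "prime q" "odd q" "coprime u v" "int q dvd qnorm (u, v)"
  shows "card {w \<in> primes_over q. qdvd w (u, v)} = 1"
proof -
  have pq: "prime (int q)" "odd (int q)" using assms by auto
  obtain A0 B0 where "A0 > 0" "B0 \<noteq> 0" "A0\<^sup>2 - 2 * B0\<^sup>2 = int q" "A0\<^sup>2 \<le> 9 * int q"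
    using prime_norm_exists[OF assms(1,3)] assms(4) by (metis qnorm.simps)
  then have ex: "\<exists>w. fst w > 0 \<and> snd w \<noteq> 0 \<and> qnorm w = int q \<and> (fst w)\<^sup>2 \<le> 9 * int q"
    by (intro exI[of _ "(A0, B0)"]) simp
  obtain A B where g: "prime_gen q = (A, B)" by force
  have po: "primes_over q = {(A, B), (A, - B)}" using ex g by (simp add: primes_over_def)
  then have n: "A\<^sup>2 - 2 * B\<^sup>2 = int q" and B0: "B \<noteq> 0" using primes_over_props[of "(A, B)" q] by auto
  have n': "A\<^sup>2 - 2 * (- B)\<^sup>2 = int q" using n by simp
  note nd = prime_norm_not_dvd[OF pq n]
  have "int q dvd int q * v\<^sup>2 - B\<^sup>2 * (u\<^sup>2 - 2 * v\<^sup>2)" using assms(4) by (intro dvd_diff) auto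
  moreover have "int q * v\<^sup>2 - B\<^sup>2 * (u\<^sup>2 - 2 * v\<^sup>2) = (v * A - u * B) * (v * A - u * (- B))"
    unfolding n[symmetric] by (simp add: power2_eq_square algebra_simps)
  ultimately have one: "int q dvd v * A - u * B \<or> int q dvd v * A - u * (- B)"
    using pq prime_dvd_mult_iff by metis
  have notboth: "\<not> (int q dvd v * A - u * B \<and> int q dvd v * A - u * (- B))"
  proof
    assume b: "int q dvd v * A - u * B \<and> int q dvd v * A - u * (- B)"
    then have "int q dvd (v * A - u * B) + (v * A - u * (- B))" "int q dvd (v * A - u * (- B)) - (v * A - u * B)"
      using dvd_add dvd_diff by blast+
    then have "int q dvd 2 * (v * A)" "int q dvd 2 * (u * B)" by (simp_all add: algebra_simps)
    moreover have "\<not> int q dvd 2" using pq odd_prime_not_dvd_2 by blast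
    ultimately have "int q dvd v" "int q dvd u" using nd pq prime_dvd_mult_iff by blast+
    then show False using assms(3) pq by (metis coprime_common_divisor not_prime_unit)
  qed
  have "qdvd (A, B) (u, v) \<longleftrightarrow> int q dvd v * A - u * B" by (rule qdvd_iff[OF pq n])
  moreover have "qdvd (A, - B) (u, v) \<longleftrightarrow> int q dvd v * A - u * (- B)" by (rule qdvd_iff[OF pq n'])
  ultimately consider "qdvd (A, B) (u, v)" "\<not> qdvd (A, - B) (u, v)" | "qdvd (A, - B) (u, v)" "\<not> qdvd (A, B) (u, v)"
    using one notboth by blast
  then show ?thesis
  proof cases
    case 1
    then have "{w \<in> primes_over q. qdvd w (u, v)} = {(A, B)}" using po by auto
    then show ?thesis by simp
  next
    case 2
    then have "{w \<in> primes_over q. qdvd w (u, v)} = {(A, - B)}" using po by auto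
    then show ?thesis by simp
  qed
qed

text \<open>Converts a sum over rational primes dividing the norm into one over their quadratic
  divisors: a primitive \<open>x\<close> has exactly one of these, and the others have spin
  0.\<close>

lemma spin_sum_over_prime:
  assumes "prime q" "odd q"
  shows "(\<Sum>x | x \<in> spin_set \<and> qnorm x \<le> int N \<and> int q dvd qnorm x. spin x * h (qnorm x div int q)) =
    (\<Sum>w\<in>primes_over q. \<Sum>z | z \<in> fund_dom \<and> int q * qnorm z \<le> int N \<and> spin_cond (qmul w z).
       spin (qmul w z) * h (qnorm z))"
proof -
  have q0: "q > 0" using assms prime_gt_0_nat by blast
  let ?X = "{x. x \<in> spin_set \<and> qnorm x \<le> int N \<and> int q dvd qnorm x}"
  let ?f = "\<lambda>x. spin x * h (qnorm x div int q)"
  have fX: "finite ?X" by (rule finite_subset[OF _ finite_fund_dom[of N]]) (auto simp: spin_set_iff)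
  have "sum ?f ?X = (\<Sum>x\<in>?X. \<Sum>w\<in>primes_over q. if qdvd w x then ?f x else 0)"
  proof (rule sum.cong[OF refl])
    fix x assume x: "x \<in> ?X"
    obtain u v where uv: "x = (u, v)" by force
    have e: "(\<Sum>w\<in>primes_over q. if qdvd w x then ?f x else 0) = real (card {w \<in> primes_over q. qdvd w x}) * ?f x"
      using finite_primes_over by (simp add: sum.inter_filter[symmetric])
    show "?f x = (\<Sum>w\<in>primes_over q. if qdvd w x then ?f x else 0)"
    proof (cases "coprime u v")
      case True
      then show ?thesis unfolding e using card_primes_over_dvd[OF assms True] x uv by simp
    next
      case False
      have "u > 0" "odd u" using x uv by (auto simp: spin_set_iff fund_dom_def spin_cond_def odd_if_mod_16)
      then have "spin x = 0" using False uv spin_not_primitive by simp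
      then have "(\<Sum>w\<in>primes_over q. if qdvd w x then ?f x else 0) = 0" by (intro sum.neutral) simp
      then show ?thesis using \<open>spin x = 0\<close> by simp
    qed
  qed
  also have "\<dots> = (\<Sum>w\<in>primes_over q. \<Sum>x\<in>?X. if qdvd w x then ?f x else 0)" by (rule sum.swap)
  also have "\<dots> = (\<Sum>w\<in>primes_over q. \<Sum>x | x \<in> spin_set \<and> qnorm x \<le> int N \<and> qdvd w x. ?f x)"
  proof (rule sum.cong[OF refl])
    fix w assume w: "w \<in> primes_over q"
    have "int q dvd qnorm x" if "qdvd w x" for x
      using that primes_over_props(3)[OF w] by (auto simp: qdvd_def qnorm_qmul)
    then have "{x \<in> ?X. qdvd w x} = {x. x \<in> spin_set \<and> qnorm x \<le> int N \<and> qdvd w x}" by auto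
    then show "(\<Sum>x\<in>?X. if qdvd w x then ?f x else 0) = (\<Sum>x | x \<in> spin_set \<and> qnorm x \<le> int N \<and> qdvd w x. ?f x)"
      unfolding sum.inter_filter[OF fX, symmetric] by (rule arg_cong)
  qed
  also have "\<dots> = (\<Sum>w\<in>primes_over q. \<Sum>z | z \<in> fund_dom \<and> int q * qnorm z \<le> int N \<and> spin_cond (qmul w z). spin (qmul w z) * h (qnorm z))"
  proof (rule sum.cong[OF refl])
    fix w assume w: "w \<in> primes_over q"
    show "(\<Sum>x | x \<in> spin_set \<and> qnorm x \<le> int N \<and> qdvd w x. ?f x) =
      (\<Sum>z | z \<in> fund_dom \<and> int q * qnorm z \<le> int N \<and> spin_cond (qmul w z). spin (qmul w z) * h (qnorm z))"
      by (rule spin_sum_multiples[OF primes_over_tot_pos[OF q0 w] primes_over_props(3)[OF w] q0])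
  qed
  finally show ?thesis .
qed

text \<open>Relative to one root \<open>r0\<close>, a root \<open>r\<close> is recovered from
  \<open>g = gcd m (r - r0)\<close>: it is \<open>r0\<close> modulo \<open>g\<close> and
  \<open>- r0\<close> modulo \<open>m div g\<close>, and these moduli are coprime because a common
  prime would divide \<open>2 * r0\<close> and hence 2.\<close>

lemma card_square_roots_of_2:
  fixes m :: int
  assumes "m > 0" "odd m"
  shows "card {r\<in>{0..<m}. m dvd r\<^sup>2 - 2} \<le> divcount (nat m)"
proof (cases "{r\<in>{0..<m}. m dvd r\<^sup>2 - 2} = {}")
  case False
  let ?R = "{r\<in>{0..<m}. m dvd r\<^sup>2 - 2}"
  obtain r0 where r0: "m dvd r0\<^sup>2 - 2" using False by blast
  have split: "m div gcd m (r - r0) dvd r + r0" if "m dvd r\<^sup>2 - 2" for r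
  proof -
    let ?g = "gcd m (r - r0)"
    have g: "?g > 0" using assms by simp
    have "m dvd (r\<^sup>2 - 2) - (r0\<^sup>2 - 2)" using that r0 by (rule dvd_diff)
    moreover have "(r\<^sup>2 - 2) - (r0\<^sup>2 - 2) = (r - r0) * (r + r0)" by (simp add: power2_eq_square algebra_simps)
    moreover have "m = ?g * (m div ?g)" "r - r0 = ?g * ((r - r0) div ?g)" by simp_all
    ultimately have "?g * (m div ?g) dvd ?g * (((r - r0) div ?g) * (r + r0))" by (metis mult.assoc)
    moreover have "?g \<noteq> 0" using g by linarith
    ultimately have "m div ?g dvd ((r - r0) div ?g) * (r + r0)" using dvd_times_left_cancel_iff by blast
    moreover have "coprime (m div ?g) ((r - r0) div ?g)" using assms by (intro div_gcd_coprime) auto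
    ultimately show ?thesis using coprime_dvd_mult_right_iff by blast
  qed
  have "inj_on (\<lambda>r. nat (gcd m (r - r0))) ?R"
  proof (rule inj_onI)
    fix r r' assume r: "r \<in> ?R" "r' \<in> ?R" "nat (gcd m (r - r0)) = nat (gcd m (r' - r0))"
    define g where "g = gcd m (r - r0)"
    have g': "g = gcd m (r' - r0)" using r(3) unfolding g_def by (simp add: nat_eq_iff)
    have g1: "g dvd r - r0" "g dvd m" by (auto simp: g_def)
    have g2: "g dvd r' - r0" by (auto simp: g')
    have s: "m div g dvd r + r0" using split[of r] r(1) by (simp add: g_def)
    have s': "m div g dvd r' + r0" using split[of r'] r(2) by (simp add: g')
    have "g dvd (r - r0) - (r' - r0)" using g1(1) g2 by (rule dvd_diff)
    then have d1: "g dvd r - r'" by simp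
    have "m div g dvd (r + r0) - (r' + r0)" using s s' by (rule dvd_diff)
    then have d2: "m div g dvd r - r'" by simp
    have "coprime g (m div g)"
    proof (rule ccontr)
      assume nc: "\<not> coprime g (m div g)"
      have "g \<noteq> 0" using assms by (simp add: g_def)
      then have "gcd g (m div g) \<noteq> 0" "\<not> is_unit (gcd g (m div g))" using nc by (auto simp: coprime_iff_gcd_eq_1)
      then obtain l where "prime l" "l dvd gcd g (m div g)" using prime_divisor_exists by blast
      then have l: "prime l" "l dvd g" "l dvd m div g" by auto
      have lm: "l dvd m" using l(2) g1(2) by (rule dvd_trans)
      have l2: "\<not> l dvd 2"
      proof
        assume "l dvd 2"
        then have "l = 2" using l(1) by (simp add: primes_dvd_imp_eq)
        then show False using lm assms by simp
      qed
      have "l dvd (r + r0) - (r - r0)"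
        by (rule dvd_diff[OF dvd_trans[OF l(3) s] dvd_trans[OF l(2) g1(1)]])
      then have "l dvd 2 * r0" by simp
      then have "l dvd r0" using l2 l(1) prime_dvd_mult_iff by blast
      moreover have "l dvd r0\<^sup>2 - 2" using lm r0 by (rule dvd_trans)
      moreover from calculation(1) have "l dvd r0\<^sup>2" by (simp add: power2_eq_square)
      ultimately have "l dvd r0\<^sup>2 - (r0\<^sup>2 - 2)" using dvd_diff by blast
      then show False using l2 by simp
    qed
    then have "g * (m div g) dvd r - r'" using d1 d2 by (rule divides_mult[rotated 2])
    then have "m dvd r - r'" using g1 by simp
    then have "r mod m = r' mod m" by (simp add: mod_eq_dvd_iff)
    then show "r = r'" using r by simp
  qed
  moreover have "(\<lambda>r. nat (gcd m (r - r0))) ` ?R \<subseteq> {d. d dvd nat m}"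
    using assms by (auto simp: nat_dvd_iff)
  moreover have "finite {d. d dvd nat m}" using assms by simp
  ultimately show ?thesis unfolding divcount_def by (intro card_inj_on_le)
next
  case True
  then show ?thesis by (simp only: card.empty)
qed

text \<open>Two primitive elements of norm \<open>m\<close> with the same root of 2 differ by a unit
  \<open>e + f \<surd>2\<close> of norm 1 with \<open>e > 0\<close>. The cone forces
  \<open>\<bar>f\<bar> \<le> 408\<close>, and \<open>f\<close> determines \<open>e\<close>; hence
  817 elements for each root.\<close>

lemma card_fund_dom_norm:
  fixes m :: int
  assumes "m > 0" "odd m"
  shows "card {z \<in> fund_dom. primitive z \<and> qnorm z = m} \<le> 817 * divcount (nat m)"
proof -
  let ?S = "{z \<in> fund_dom. primitive z \<and> qnorm z = m}"
  let ?R = "{r\<in>{0..<m}. m dvd r\<^sup>2 - 2}"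
  have fS: "finite ?S" by (rule finite_subset[OF _ finite_fund_dom[of "nat m"]]) (use assms in auto)
  have fR: "finite ?R" by (rule finite_subset[of _ "{0..<m}"]) auto
  have root: "[qroot z mod m * snd z = fst z] (mod m) \<and> m dvd (qroot z mod m)\<^sup>2 - 2" if "z \<in> ?S" for z
  proof -
    obtain c d where z: "z = (c, d)" by force
    have cd: "coprime c d" "c\<^sup>2 - 2 * d\<^sup>2 = m" using that z by (auto simp: primitive_def)
    have 1: "[qroot z * d = c] (mod m)" "[(qroot z)\<^sup>2 = 2] (mod m)" using qroot_cong[OF cd(1)] cd z by auto
    have r: "[qroot z mod m = qroot z] (mod m)" by (simp add: cong_def)
    have "[qroot z mod m * d = qroot z * d] (mod m)" using r by (rule cong_scalar_right)
    moreover have "[(qroot z mod m)\<^sup>2 = (qroot z)\<^sup>2] (mod m)" using r by (rule cong_pow)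
    ultimately show ?thesis using 1 z cong_trans cong_iff_dvd_diff by (metis snd_conv fst_conv)
  qed
  have fib: "card {z \<in> ?S. qroot z mod m = r} \<le> 817" for r
  proof (cases "{z \<in> ?S. qroot z mod m = r} = {}")
    case False
    let ?F = "{z \<in> ?S. qroot z mod m = r}"
    obtain zz where zz: "zz \<in> ?F" using False by blast
    obtain c' d' where "zz = (c', d')" by force
    with zz have z': "(c', d') \<in> ?F" by (simp only:)
    have R': "[r * d' = c'] (mod m)" "m dvd r\<^sup>2 - 2" using root[of "(c', d')"] z' by auto
    have key: "\<exists>e. fst z * c' - 2 * snd z * d' = m * e \<and> e > 0 \<and> snd z * c' - fst z * d' = m * ((snd z * c' - fst z * d') div m)
        \<and> \<bar>(snd z * c' - fst z * d') div m\<bar> \<le> 408 \<and> e\<^sup>2 = 1 + 2 * ((snd z * c' - fst z * d') div m)\<^sup>2" if z: "z \<in> ?F" for z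
    proof -
      obtain c d where cd: "z = (c, d)" by force
      have R: "[r * d = c] (mod m)" using root[of "(c, d)"] z cd by auto
      have D: "m dvd r * d - c" "m dvd r * d' - c'" using R R' by (auto simp: cong_iff_dvd_diff)
      have "m dvd (r * d - c) * d' - (r * d' - c') * d" by (rule dvd_diff[OF dvd_mult2[OF D(1)] dvd_mult2[OF D(2)]])
      then have f: "m dvd d * c' - c * d'" by (simp add: algebra_simps)
      have "m dvd (r\<^sup>2 - 2) * (d * d') - (r * d - c) * (r * d') - (r * d' - c') * c"
        by (rule dvd_diff[OF dvd_diff[OF dvd_mult2[OF R'(2)] dvd_mult2[OF D(1)]] dvd_mult2[OF D(2)]])
      then have e: "m dvd c * c' - 2 * d * d'" by (simp add: power2_eq_square algebra_simps)
      obtain e where e: "c * c' - 2 * d * d' = m * e" using e by blast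
      obtain f where f: "d * c' - c * d' = m * f" using f by blast
      have n: "c\<^sup>2 - 2 * d\<^sup>2 = m" "c'\<^sup>2 - 2 * d'\<^sup>2 = m" using z z' cd by auto
      have fd: "(c, d) \<in> fund_dom" "(c', d') \<in> fund_dom" using z z' cd by auto
      have "c * c' + 2 * d * (- d') > 0"
        using fd fund_dom_qnorm_pos[OF fd(1)] fund_dom_qnorm_pos[OF fd(2)]
        by (intro tot_pos_fst_pos) (auto simp: fund_dom_def)
      then have "m * e > 0" using e by simp
      then have e0: "e > 0" using assms(1) by (simp add: zero_less_mult_iff)
      have "m\<^sup>2 * (e\<^sup>2 - 2 * f\<^sup>2) = (m * e)\<^sup>2 - 2 * (m * f)\<^sup>2" by (simp add: power2_eq_square algebra_simps)
      also have "\<dots> = (c\<^sup>2 - 2 * d\<^sup>2) * (c'\<^sup>2 - 2 * d'\<^sup>2)"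
        unfolding e[symmetric] f[symmetric] by (simp add: power2_eq_square algebra_simps)
      also have "\<dots> = m\<^sup>2 * 1" using n by (simp add: power2_eq_square)
      finally have ef: "e\<^sup>2 - 2 * f\<^sup>2 = 1" using assms(1) by simp
      have cc: "c * c' \<le> 289 * m"
      proof -
        have "c\<^sup>2 \<le> 289 * m" "c'\<^sup>2 \<le> 289 * m" using fund_dom_sq_le[OF fd(1)] fund_dom_sq_le[OF fd(2)] n by auto
        moreover have "0 \<le> (c - c')\<^sup>2" by simp
        ultimately show ?thesis by (simp add: power2_eq_square algebra_simps)
      qed
      have b: "\<bar>17 * d\<bar> \<le> 12 * c" "\<bar>17 * d'\<bar> \<le> 12 * c'" "c > 0" "c' > 0" using fd by (auto simp: fund_dom_def)
      have "17 * \<bar>m * f\<bar> = \<bar>(17 * d) * c' - c * (17 * d')\<bar>" 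
      proof -
        have "(17 * d) * c' - c * (17 * d') = 17 * (m * f)" unfolding f[symmetric] by (simp add: algebra_simps)
        then show ?thesis by (simp add: abs_mult)
      qed
      also have "\<dots> \<le> \<bar>17 * d\<bar> * c' + c * \<bar>17 * d'\<bar>"
        using abs_triangle_ineq4[of "(17 * d) * c'" "c * (17 * d')"] b by (simp only: abs_mult abs_of_pos)
      also have "\<dots> \<le> (12 * c) * c' + c * (12 * c')" using b by (intro add_mono mult_mono) auto
      also have "\<dots> = 24 * (c * c')" by simp
      also have "\<dots> \<le> 24 * (289 * m)" using cc by (intro mult_left_mono) auto
      finally have "m * \<bar>f\<bar> \<le> m * 408" using assms(1) by (simp add: abs_mult)
      then have "\<bar>f\<bar> \<le> 408" using assms(1) by simp
      moreover have "(d * c' - c * d') div m = f" using f assms(1) by simp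
      ultimately show ?thesis using e e0 ef f cd by auto
    qed
    have "inj_on (\<lambda>z. (snd z * c' - fst z * d') div m) ?F"
    proof (rule inj_onI)
      fix x y assume xy: "x \<in> ?F" "y \<in> ?F" "(snd x * c' - fst x * d') div m = (snd y * c' - fst y * d') div m"
      obtain e where e: "fst x * c' - 2 * snd x * d' = m * e" "e > 0" "snd x * c' - fst x * d' = m * ((snd x * c' - fst x * d') div m)"
        "e\<^sup>2 = 1 + 2 * ((snd x * c' - fst x * d') div m)\<^sup>2" using key[OF xy(1)] by blast
      obtain e' where e': "fst y * c' - 2 * snd y * d' = m * e'" "e' > 0" "snd y * c' - fst y * d' = m * ((snd y * c' - fst y * d') div m)"
        "e'\<^sup>2 = 1 + 2 * ((snd y * c' - fst y * d') div m)\<^sup>2" using key[OF xy(2)] by blast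
      have "e\<^sup>2 = e'\<^sup>2" using e(4) e'(4) xy(3) by simp
      then have "e = e'" using e(2) e'(2) by (simp add: power2_eq_iff_nonneg)
      then have "qmul (c', - d') x = qmul (c', - d') y"
        using e(1,3) e'(1,3) xy(3) by (cases x; cases y) (simp add: algebra_simps)
      moreover have "qnorm (c', - d') \<noteq> 0" using z' assms(1) by simp
      ultimately show "x = y" using qmul_cancel by blast
    qed
    moreover have "(\<lambda>z. (snd z * c' - fst z * d') div m) ` ?F \<subseteq> {-408..408}" using key by fastforce
    ultimately have "card ?F \<le> card {-408..408::int}" by (intro card_inj_on_le) auto
    then show ?thesis by simp
  next
    case True
    then show ?thesis by (simp only: card.empty)
  qed
  have im: "(\<lambda>z. qroot z mod m) ` ?S \<subseteq> ?R" using root assms(1) by auto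
  have "card ?S = (\<Sum>z\<in>?S. 1)" by simp
  also have "\<dots> = (\<Sum>r\<in>?R. \<Sum>z | z \<in> ?S \<and> qroot z mod m = r. 1)"
    by (rule sum.group[OF fS fR im, symmetric])
  also have "\<dots> = (\<Sum>r\<in>?R. card {z \<in> ?S. qroot z mod m = r})" by simp
  also have "\<dots> \<le> (\<Sum>r\<in>?R. 817)" by (intro sum_mono fib)
  also have "\<dots> = 817 * card ?R" by simp
  also have "\<dots> \<le> 817 * divcount (nat m)" using card_square_roots_of_2[OF assms] by simp
  finally show ?thesis .
qed

section \<open>Bilinear forms\<close>

text \<open>Chebyshev's inequality: \<open>t\<close> and its \<open>k\<close>-th power are ordered
  alike, so the double sum of the products of their differences is nonnegative.\<close>

lemma Chebyshev_power_sum: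
  fixes t :: "'a \<Rightarrow> real"
  assumes "finite W" "\<And>z. z \<in> W \<Longrightarrow> t z \<ge> 0"
  shows "(\<Sum>z\<in>W. t z) * (\<Sum>z\<in>W. t z ^ k) \<le> real (card W) * (\<Sum>z\<in>W. t z ^ Suc k)"
proof -
  have "0 \<le> (\<Sum>x\<in>W. \<Sum>y\<in>W. (t x - t y) * (t x ^ k - t y ^ k))"
  proof (intro sum_nonneg)
    fix x y assume xy: "x \<in> W" "y \<in> W"
    show "0 \<le> (t x - t y) * (t x ^ k - t y ^ k)"
    proof (cases "t x \<le> t y")
      case True
      then have "t x ^ k \<le> t y ^ k" using assms xy by (intro power_mono) auto
      then show ?thesis using True by (intro mult_nonpos_nonpos) auto
    next
      case False
      then have "t y ^ k \<le> t x ^ k" using assms xy by (intro power_mono) auto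
      then show ?thesis using False by (intro mult_nonneg_nonneg) auto
    qed
  qed
  also have "\<dots> = (\<Sum>x\<in>W. \<Sum>y\<in>W. t x ^ Suc k) - (\<Sum>x\<in>W. \<Sum>y\<in>W. t x * t y ^ k)
      - (\<Sum>x\<in>W. \<Sum>y\<in>W. t y * t x ^ k) + (\<Sum>x\<in>W. \<Sum>y\<in>W. t y ^ Suc k)"
  proof -
    have "(t x - t y) * (t x ^ k - t y ^ k) = t x ^ Suc k - t x * t y ^ k - t y * t x ^ k + t y ^ Suc k" for x y
      by (simp add: algebra_simps)
    then show ?thesis by (simp only: sum.distrib sum_subtractf)
  qed
  also have "(\<Sum>x\<in>W. \<Sum>y\<in>W. t x ^ Suc k) = real (card W) * (\<Sum>z\<in>W. t z ^ Suc k)"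
    by (simp add: sum_distrib_left)
  also have "(\<Sum>x\<in>W. \<Sum>y\<in>W. t y ^ Suc k) = real (card W) * (\<Sum>z\<in>W. t z ^ Suc k)"
    by simp
  also have "(\<Sum>x\<in>W. \<Sum>y\<in>W. t x * t y ^ k) = (\<Sum>z\<in>W. t z) * (\<Sum>z\<in>W. t z ^ k)"
    by (simp add: sum_product)
  also have "(\<Sum>x\<in>W. \<Sum>y\<in>W. t y * t x ^ k) = (\<Sum>x\<in>W. \<Sum>y\<in>W. t x * t y ^ k)"
    by (rule sum.swap)
  also have "\<dots> = (\<Sum>z\<in>W. t z) * (\<Sum>z\<in>W. t z ^ k)"
    by (simp add: sum_product)
  finally show ?thesis by simp
qed

text \<open>Hoelder's inequality with equal weights, by induction on the exponent.\<close>

lemma power_mean_sum: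
  fixes t :: "'a \<Rightarrow> real"
  assumes "finite W" "\<And>z. z \<in> W \<Longrightarrow> t z \<ge> 0"
  shows "(\<Sum>z\<in>W. t z) ^ Suc k \<le> real (card W) ^ k * (\<Sum>z\<in>W. t z ^ Suc k)"
proof (induction k)
  case (Suc k)
  have s: "(\<Sum>z\<in>W. t z) \<ge> 0" using assms by (intro sum_nonneg)
  have "(\<Sum>z\<in>W. t z) ^ Suc (Suc k) = (\<Sum>z\<in>W. t z) * (\<Sum>z\<in>W. t z) ^ Suc k" by simp
  also have "\<dots> \<le> (\<Sum>z\<in>W. t z) * (real (card W) ^ k * (\<Sum>z\<in>W. t z ^ Suc k))"
    by (rule mult_left_mono[OF Suc s])
  also have "\<dots> = real (card W) ^ k * ((\<Sum>z\<in>W. t z) * (\<Sum>z\<in>W. t z ^ Suc k))" by (simp only: mult_ac)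
  also have "\<dots> \<le> real (card W) ^ k * (real (card W) * (\<Sum>z\<in>W. t z ^ Suc (Suc k)))"
    using Chebyshev_power_sum[OF assms, where k = "Suc k"] by (intro mult_left_mono) auto
  finally show ?case by (simp only: power_Suc mult_ac)
qed simp

section \<open>Tuples, their products and sums over boxes\<close>

definition tuples :: "'a set \<Rightarrow> nat \<Rightarrow> 'a list set" where
  "tuples A k = {xs. set xs \<subseteq> A \<and> length xs = k}"

lemma finite_tuples: "finite A \<Longrightarrow> finite (tuples A k)"
  unfolding tuples_def by (rule finite_lists_length_eq)

lemma card_tuples: "finite A \<Longrightarrow> card (tuples A k) = card A ^ k"
  unfolding tuples_def by (rule card_lists_length_eq)

lemma sum_tuples_Suc:
  assumes "finite A"
  shows "(\<Sum>xs\<in>tuples A (Suc k). g xs) = (\<Sum>x\<in>A. \<Sum>xs\<in>tuples A k. g (x # xs))"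
proof -
  have "tuples A (Suc k) = (\<lambda>(x, xs). x # xs) ` (A \<times> tuples A k)"
    by (auto simp: tuples_def length_Suc_conv image_iff)
  then have "(\<Sum>xs\<in>tuples A (Suc k). g xs) = (\<Sum>(x, xs)\<in>A \<times> tuples A k. g (x # xs))"
    by (simp add: sum.reindex inj_on_def case_prod_unfold prod_eq_iff)
  then show ?thesis using assms finite_tuples by (simp add: sum.cartesian_product)
qed

lemma power_sum_tuples:
  fixes f :: "'a \<Rightarrow> real"
  assumes "finite A"
  shows "(\<Sum>x\<in>A. f x) ^ k = (\<Sum>xs\<in>tuples A k. prod_list (map f xs))"
proof (induction k)
  case 0
  have "tuples A 0 = {[]}" by (auto simp: tuples_def)
  then show ?case by simp
next
  case (Suc k)
  then show ?case using assms by (simp add: sum_tuples_Suc sum_product)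
qed

definition qprod :: "(int \<times> int) list \<Rightarrow> int \<times> int" where
  "qprod xs = foldr qmul xs (1, 0)"

lemma prod_list_map_mult: "prod_list (map (\<lambda>x. f x * g x) xs) = prod_list (map f xs) * (prod_list (map g xs) :: real)"
  by (induction xs) simp_all

lemma qprod_simps [simp]: "qprod [] = (1, 0)" "qprod (x # xs) = qmul x (qprod xs)"
  by (simp_all add: qprod_def)

lemma qchar_qprod:
  assumes "primitive z" "qnorm z > 0" "odd (qnorm z)"
  shows "real_of_int (qchar z (qprod xs)) = prod_list (map (\<lambda>w. real_of_int (qchar z w)) xs)"
proof (induction xs)
  case Nil
  then show ?case using assms by simp
next
  case (Cons x xs)
  then show ?case using qchar_mult[OF assms, of x "qprod xs"] by simp
qed

text \<open>The weight 2 on the second coordinate makes this size submultiplicative, so products of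
  tuples stay in a box of controlled side.\<close>

fun qsize :: "int \<times> int \<Rightarrow> int" where
  "qsize (a, b) = \<bar>a\<bar> + 2 * \<bar>b\<bar>"

lemma qsize_qmul: "qsize (qmul x y) \<le> qsize x * qsize y"
proof -
  obtain a b c d where [simp]: "x = (a, b)" "y = (c, d)" by force
  have "\<bar>a * c + 2 * b * d\<bar> \<le> \<bar>a * c\<bar> + \<bar>2 * b * d\<bar>" "\<bar>a * d + b * c\<bar> \<le> \<bar>a * d\<bar> + \<bar>b * c\<bar>"
    by (rule abs_triangle_ineq)+
  moreover have "\<bar>2 * b * d\<bar> = 2 * (\<bar>b\<bar> * \<bar>d\<bar>)" "\<bar>a * c\<bar> = \<bar>a\<bar> * \<bar>c\<bar>" "\<bar>a * d\<bar> = \<bar>a\<bar> * \<bar>d\<bar>" "\<bar>b * c\<bar> = \<bar>b\<bar> * \<bar>c\<bar>"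
    by (simp_all add: abs_mult)
  moreover have "0 \<le> \<bar>b\<bar> * \<bar>d\<bar>" by simp
  ultimately have "\<bar>a * c + 2 * b * d\<bar> + 2 * \<bar>a * d + b * c\<bar> \<le>
     \<bar>a\<bar> * \<bar>c\<bar> + 4 * (\<bar>b\<bar> * \<bar>d\<bar>) + 2 * (\<bar>a\<bar> * \<bar>d\<bar>) + 2 * (\<bar>b\<bar> * \<bar>c\<bar>)"
    by linarith
  then show ?thesis by (simp add: algebra_simps)
qed

lemma qsize_nonneg: "qsize x \<ge> 0"
  by (cases x) simp

lemma qsize_qprod:
  assumes "\<And>x. x \<in> set xs \<Longrightarrow> real_of_int (qsize x) \<le> H" "H \<ge> 0"
  shows "real_of_int (qsize (qprod xs)) \<le> H ^ length xs"
  using assms(1)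
proof (induction xs)
  case (Cons x xs)
  have "real_of_int (qsize (qprod (x # xs))) \<le> of_int (qsize x * qsize (qprod xs))"
    unfolding qprod_simps of_int_le_iff by (rule qsize_qmul)
  also have "\<dots> \<le> H * H ^ length xs"
    using Cons assms(2) qsize_nonneg unfolding of_int_mult by (intro mult_mono) auto
  finally show ?case by simp
qed simp

definition qbox :: "nat \<Rightarrow> (int \<times> int) set" where
  "qbox L = {- int L..int L} \<times> {- int L..int L}"

lemma card_qbox: "card (qbox L) = (2 * L + 1)\<^sup>2"
  by (simp add: qbox_def card_cartesian_product power2_eq_square nat_add_distrib nat_mult_distrib algebra_simps)

lemma qbox_memI: "qsize x \<le> int L \<Longrightarrow> x \<in> qbox L"
  by (cases x) (auto simp: qbox_def)

lemma sum_periodic_blocks: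
  fixes f :: "int \<Rightarrow> real"
  assumes "Q > 0" "\<And>a. f (a mod Q) = f a"
  shows "(\<Sum>a\<in>{lo..<lo + Q * int t}. f a) = real t * (\<Sum>a\<in>{0..<Q}. f a)"
proof (induction t)
  case (Suc t)
  have "{lo..<lo + Q * int (Suc t)} = {lo..<lo + Q * int t} \<union> {lo + Q * int t..<lo + Q * int t + Q}"
  proof -
    have "Q * int t \<ge> 0" using assms(1) by simp
    moreover have "lo + Q * int (Suc t) = lo + Q * int t + Q" by (simp add: algebra_simps)
    ultimately show ?thesis using assms(1) by (simp only:) (rule ivl_disj_un_two(3)[symmetric], auto)
  qed
  moreover have "(\<Sum>a\<in>{lo + Q * int t..<lo + Q * int t + Q}. f a) = (\<Sum>a\<in>{0..<Q}. f (a + (lo + Q * int t)))"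
    by (rule sum.reindex_bij_witness[of _ "\<lambda>a. a + (lo + Q * int t)" "\<lambda>a. a - (lo + Q * int t)"]) auto
  moreover have "(\<Sum>a\<in>{0..<Q}. f (a + (lo + Q * int t))) = (\<Sum>a\<in>{0..<Q}. f a)"
    by (rule sum_residues_shift[where f = f]) (use assms in auto)
  ultimately show ?case using Suc by (simp add: sum.union_disjoint algebra_simps)
qed simp

text \<open>Over a box, a function of two integers that is periodic modulo \<open>Q\<close> and sums to zero over a
  full period only contributes along the boundary.\<close>
lemma sum_box_periodic:
  fixes f :: "int \<times> int \<Rightarrow> real"
  assumes Q: "Q > 0" and p1: "\<And>a b. f (a mod Q, b) = f (a, b)" and p2: "\<And>a b. f (a, b mod Q) = f (a, b)"
    and b1: "\<And>x. \<bar>f x\<bar> \<le> 1" and z: "(\<Sum>a\<in>{0..<Q}. \<Sum>b\<in>{0..<Q}. f (a, b)) = 0"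
  shows "\<bar>\<Sum>x\<in>qbox L. f x\<bar> \<le> 2 * real (2 * L + 1) * of_int Q"
proof -
  define n where "n = 2 * L + 1"
  define t where "t = n div nat Q"
  define A where "A = {- int L..<- int L + Q * int t}"
  have nQ: "int n = Q * int t + int n mod Q"
    using Q mult_div_mod_eq[of Q "int n"] by (simp add: t_def zdiv_int)
  have r: "0 \<le> int n mod Q" "int n mod Q < Q" using Q by auto
  have AL: "A \<subseteq> {- int L..int L}" unfolding A_def using nQ r by (auto simp: n_def)
  have cA: "card A = nat (Q * int t)" by (simp add: A_def)
  have cA': "real (card A) = of_int (Q * int t)" using Q by (simp add: cA)
  have "(\<Sum>x\<in>A \<times> A. f x) = (\<Sum>a\<in>A. \<Sum>b\<in>A. f (a, b))" by (simp add: sum.cartesian_product)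
  also have "\<dots> = (\<Sum>a\<in>A. real t * (\<Sum>b\<in>{0..<Q}. f (a, b)))"
    unfolding A_def using Q p2 by (intro sum.cong refl sum_periodic_blocks) auto
  also have "\<dots> = real t * (\<Sum>a\<in>A. \<Sum>b\<in>{0..<Q}. f (a, b))"
    by (simp only: sum_distrib_left[symmetric])
  also have "(\<Sum>a\<in>A. \<Sum>b\<in>{0..<Q}. f (a, b)) = (\<Sum>b\<in>{0..<Q}. \<Sum>a\<in>A. f (a, b))"
    by (rule sum.swap)
  also have "real t * (\<Sum>b\<in>{0..<Q}. \<Sum>a\<in>A. f (a, b)) = real t * (\<Sum>b\<in>{0..<Q}. real t * (\<Sum>a\<in>{0..<Q}. f (a, b)))"
  proof -
    have "(\<Sum>a\<in>A. f (a, b)) = real t * (\<Sum>a\<in>{0..<Q}. f (a, b))" for b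
      unfolding A_def by (rule sum_periodic_blocks[where f = "\<lambda>a. f (a, b)"]) (use Q p1 in auto)
    then show ?thesis by (simp only:)
  qed
  also have "\<dots> = real t * real t * (\<Sum>b\<in>{0..<Q}. \<Sum>a\<in>{0..<Q}. f (a, b))"
    by (simp only: sum_distrib_left[symmetric] mult.assoc)
  also have "(\<Sum>b\<in>{0..<Q}. \<Sum>a\<in>{0..<Q}. f (a, b)) = (\<Sum>a\<in>{0..<Q}. \<Sum>b\<in>{0..<Q}. f (a, b))"
    by (rule sum.swap)
  finally have AA: "(\<Sum>x\<in>A \<times> A. f x) = 0" using z by simp
  have sub: "A \<times> A \<subseteq> qbox L" using AL by (auto simp: qbox_def)
  have fin: "finite (qbox L)" by (simp add: qbox_def)
  have "(\<Sum>x\<in>qbox L. f x) = (\<Sum>x\<in>qbox L - A \<times> A. f x)"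
    using sum.subset_diff[OF sub fin, of f] AA by simp
  also have "\<bar>\<dots>\<bar> \<le> (\<Sum>x\<in>qbox L - A \<times> A. \<bar>f x\<bar>)" by (rule sum_abs)
  also have "\<dots> \<le> (\<Sum>x\<in>qbox L - A \<times> A. 1)" by (intro sum_mono b1)
  also have "\<dots> = real (card (qbox L)) - real (card (A \<times> A))"
    using card_Diff_subset[OF finite_subset[OF sub fin] sub] card_mono[OF fin sub] by (simp add: of_nat_diff)
  also have "\<dots> = (real n)\<^sup>2 - (of_int (Q * int t))\<^sup>2"
  proof -
    have "real (card (qbox L)) = (real n)\<^sup>2" unfolding card_qbox n_def by simp
    moreover have "real (card (A \<times> A)) = (of_int (Q * int t))\<^sup>2" unfolding card_cartesian_product of_nat_mult cA' by (simp only: power2_eq_square)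
    ultimately show ?thesis by (simp only:)
  qed
  also have "\<dots> \<le> 2 * real n * of_int Q"
  proof -
    have e: "real n = of_int (Q * int t) + of_int (int n mod Q)" using nQ by (metis of_int_add of_int_of_nat_eq)
    have rr: "0 \<le> real_of_int (int n mod Q)" "real_of_int (int n mod Q) \<le> of_int Q" using r by auto
    have "(real n)\<^sup>2 - (of_int (Q * int t))\<^sup>2 = of_int (int n mod Q) * (real n + of_int (Q * int t))"
      unfolding e by (simp add: power2_eq_square algebra_simps)
    also have "\<dots> \<le> of_int Q * (real n + real n)" using rr e Q by (intro mult_mono) auto
    finally show ?thesis by (simp add: mult_ac)
  qed
  finally show ?thesis by (simp add: n_def)
qed

lemma Jacobi_cong_linear:
  assumes "m > 0" "odd m" "m dvd Q"
  shows "Jacobi (a mod Q + b * r) m = Jacobi (a + b * r) m" "Jacobi (a + (b mod Q) * r) m = Jacobi (a + b * r) m"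
proof -
  have c: "[x mod Q = x] (mod m)" for x using assms(3) by (simp add: cong_def mod_mod_cancel)
  show "Jacobi (a mod Q + b * r) m = Jacobi (a + b * r) m"
    using assms c by (intro Jacobi_cong cong_add cong_refl)
  show "Jacobi (a + (b mod Q) * r) m = Jacobi (a + b * r) m"
    using assms c by (intro Jacobi_cong cong_add cong_refl cong_scalar_right)
qed

text \<open>Scaling both coordinates by an integer \<open>g\<close> multiplies the correlation by
  the symbol of \<open>g\<close> modulo the product of the norms. For a nonsquare product some
  \<open>g\<close> gives -1 and the complete sum vanishes; common factors of the two norms and the
  positions of the two roots do not enter.\<close>

lemma qchar_correlation_box:
  assumes z: "qnorm z > 0" "odd (qnorm z)" and z': "qnorm z' > 0" "odd (qnorm z')"
    and ns: "\<not> is_square (qnorm z * qnorm z')"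
  shows "\<bar>\<Sum>x\<in>qbox L. real_of_int (qchar z x * qchar z' x)\<bar> \<le> 2 * real (2 * L + 1) * of_int (qnorm z * qnorm z')"
proof -
  define Q where "Q = qnorm z * qnorm z'"
  have Q: "Q > 0" "odd Q" using z z' by (auto simp: Q_def)
  have dv: "qnorm z dvd Q" "qnorm z' dvd Q" by (auto simp: Q_def)
  let ?f = "\<lambda>x. real_of_int (qchar z x * qchar z' x)"
  have p1: "?f (a mod Q, b) = ?f (a, b)" for a b using Jacobi_cong_linear(1)[OF z dv(1)] Jacobi_cong_linear(1)[OF z' dv(2)] by simp
  have p2: "?f (a, b mod Q) = ?f (a, b)" for a b using Jacobi_cong_linear(2)[OF z dv(1)] Jacobi_cong_linear(2)[OF z' dv(2)] by simp
  have b1: "\<bar>?f x\<bar> \<le> 1" for x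
  proof -
    obtain a b where "x = (a, b)" by force
    then show ?thesis using Jacobi_values[OF z, of "a + b * qroot z"] Jacobi_values[OF z', of "a + b * qroot z'"] by auto
  qed
  obtain g where g: "Jacobi g Q = -1" using exists_Jacobi_minus_1[OF Q] ns by (auto simp: Q_def)
  have gQ: "coprime g Q" using Jacobi_eq_0_iff[OF Q, of g] g by auto
  have gg: "Jacobi g (qnorm z) * Jacobi g (qnorm z') = -1" using g z z' by (simp add: Q_def Jacobi_mult_bot)
  have sc: "?f (g * a, g * b) = - ?f (a, b)" for a b
  proof -
    have "Jacobi (g * a + g * b * qroot z) (qnorm z) = Jacobi g (qnorm z) * Jacobi (a + b * qroot z) (qnorm z)"
      by (subst Jacobi_mult_top[OF z, symmetric]) (simp add: algebra_simps)
    moreover have "Jacobi (g * a + g * b * qroot z') (qnorm z') = Jacobi g (qnorm z') * Jacobi (a + b * qroot z') (qnorm z')"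
      by (subst Jacobi_mult_top[OF z', symmetric]) (simp add: algebra_simps)
    ultimately have "qchar z (g * a, g * b) * qchar z' (g * a, g * b) =
        (Jacobi g (qnorm z) * Jacobi g (qnorm z')) * (qchar z (a, b) * qchar z' (a, b))" by simp
    then show ?thesis unfolding gg by simp
  qed
  have "(\<Sum>a\<in>{0..<Q}. \<Sum>b\<in>{0..<Q}. ?f (a, b)) = (\<Sum>a\<in>{0..<Q}. \<Sum>b\<in>{0..<Q}. ?f (g * a, b))"
    by (rule sum_residues_scale[where f = "\<lambda>a. \<Sum>b\<in>{0..<Q}. ?f (a, b)", symmetric]) (use Q p1 gQ in auto)
  also have "\<dots> = (\<Sum>a\<in>{0..<Q}. \<Sum>b\<in>{0..<Q}. ?f (g * a, g * b))"
  proof (rule sum.cong[OF refl])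
    fix a
    show "(\<Sum>b\<in>{0..<Q}. ?f (g * a, b)) = (\<Sum>b\<in>{0..<Q}. ?f (g * a, g * b))"
      by (rule sum_residues_scale[where f = "\<lambda>b. ?f (g * a, b)", symmetric]) (use Q p2 gQ in auto)
  qed
  also have "\<dots> = - (\<Sum>a\<in>{0..<Q}. \<Sum>b\<in>{0..<Q}. ?f (a, b))" unfolding sc by (simp only: sum_negf)
  finally have "(\<Sum>a\<in>{0..<Q}. \<Sum>b\<in>{0..<Q}. ?f (a, b)) = 0" by linarith
  then show ?thesis using sum_box_periodic[where f = ?f, OF Q(1) p1 p2 b1] unfolding Q_def by blast
qed

text \<open>Hoelder in \<open>z\<close> opens the \<open>w\<close>-sum into products of \<open>k\<close> factors, which fill a box; Cauchy-Schwarz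
  over the box then leads to complete character sums.\<close>
lemma bilinear_Hoelder:
  fixes \<beta> :: "int \<times> int \<Rightarrow> real"
  assumes W: "finite W" "\<And>z. z \<in> W \<Longrightarrow> primitive z \<and> qnorm z > 0 \<and> odd (qnorm z) \<and> real_of_int (qnorm z) \<le> Y"
    and P: "finite P" "\<And>w. w \<in> P \<Longrightarrow> real_of_int (qsize w) \<le> H" "H \<ge> 0" "H ^ Suc k \<le> real L"
    and \<beta>: "\<And>w. \<bar>\<beta> w\<bar> \<le> 1"
    and R: "\<And>x. real (card {xs \<in> tuples P (Suc k). qprod xs = x}) \<le> R"
    and B: "real (card {(z, z') \<in> W \<times> W. is_square (qnorm z * qnorm z')}) \<le> B"
  shows "(\<Sum>z\<in>W. \<bar>\<Sum>w\<in>P. \<beta> w * of_int (qchar z w)\<bar>) ^ (2 * Suc k) \<le>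
    real (card W) ^ (2 * k) * R\<^sup>2 * (real (2 * L + 1))\<^sup>2 *
      (B * (real (2 * L + 1))\<^sup>2 + (real (card W))\<^sup>2 * (2 * real (2 * L + 1) * Y\<^sup>2))"
proof -
  define T where "T = (\<lambda>z. \<Sum>w\<in>P. \<beta> w * of_int (qchar z w))"
  \<comment> \<open>The sign to the power \<open>Suc k\<close> replaces the absolute value, so that
    the \<open>Suc k\<close>-th power becomes linear in the characters of the products.\<close>
  define \<sigma> where "\<sigma> = (\<lambda>z. sgn (T z) ^ Suc k)"
  define n where "n = real (2 * L + 1)"
  define c where "c = (\<lambda>x. \<Sum>xs | xs \<in> tuples P (Suc k) \<and> qprod xs = x. prod_list (map \<beta> xs))"
  define X where "X = (\<lambda>x. \<Sum>z\<in>W. \<sigma> z * of_int (qchar z x))"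
  have R0: "R \<ge> 0" using R[of undefined] by (meson of_nat_0_le_iff order_trans)
  have fT: "finite (tuples P (Suc k))" by (rule finite_tuples[OF P(1)])
  have fB: "finite (qbox L)" by (simp add: qbox_def)
  have \<sigma>1: "\<bar>\<sigma> z\<bar> \<le> 1" for z unfolding \<sigma>_def power_abs by (rule power_le_one) (auto simp: sgn_if)
  have TS: "\<bar>T z\<bar> ^ Suc k = \<sigma> z * T z ^ Suc k" for z
  proof -
    have "\<bar>T z\<bar> = sgn (T z) * T z" by (simp add: sgn_if)
    then show ?thesis unfolding \<sigma>_def by (simp only: power_mult_distrib)
  qed
  have in_box: "qprod xs \<in> qbox L" if "xs \<in> tuples P (Suc k)" for xs
  proof -
    have "real_of_int (qsize (qprod xs)) \<le> H ^ length xs"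
      by (rule qsize_qprod) (use that P in \<open>auto simp: tuples_def\<close>)
    also have "\<dots> \<le> real L" using that P(4) by (simp add: tuples_def)
    finally have "qsize (qprod xs) \<le> int L" by linarith
    then show ?thesis by (rule qbox_memI)
  qed
  \<comment> \<open>Tuples are collected by their product: \<open>c x\<close> is the total weight of
    the tuples with product \<open>x\<close>, at most their number, hence at most
    \<open>R\<close>.\<close>
  have expand: "T z ^ Suc k = (\<Sum>x\<in>qbox L. c x * of_int (qchar z x))" if z: "z \<in> W" for z
  proof -
    have zp: "primitive z" "qnorm z > 0" "odd (qnorm z)" using W(2)[OF z] by auto
    have "T z ^ Suc k = (\<Sum>xs\<in>tuples P (Suc k). prod_list (map (\<lambda>w. \<beta> w * of_int (qchar z w)) xs))"
      unfolding T_def by (rule power_sum_tuples[OF P(1)])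
    also have "\<dots> = (\<Sum>xs\<in>tuples P (Suc k). prod_list (map \<beta> xs) * of_int (qchar z (qprod xs)))"
      by (intro sum.cong refl) (simp only: qchar_qprod[OF zp] prod_list_map_mult)
    also have "\<dots> = (\<Sum>x\<in>qbox L. \<Sum>xs | xs \<in> tuples P (Suc k) \<and> qprod xs = x. prod_list (map \<beta> xs) * of_int (qchar z (qprod xs)))"
      using in_box by (intro sum.group[OF fT fB, symmetric]) auto
    also have "\<dots> = (\<Sum>x\<in>qbox L. c x * of_int (qchar z x))"
      unfolding c_def sum_distrib_right by (intro sum.cong refl) auto
    finally show ?thesis .
  qed
  have cR: "\<bar>c x\<bar> \<le> R" for x
  proof -
    have pb: "\<bar>prod_list (map \<beta> xs)\<bar> \<le> 1" for xs
    proof (induction xs)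
      case (Cons a xs)
      then show ?case using \<beta>[of a] by (simp add: abs_mult mult_le_one)
    qed simp
    have "\<bar>c x\<bar> \<le> (\<Sum>xs | xs \<in> tuples P (Suc k) \<and> qprod xs = x. \<bar>prod_list (map \<beta> xs)\<bar>)"
      unfolding c_def by (rule sum_abs)
    also have "\<dots> \<le> (\<Sum>xs | xs \<in> tuples P (Suc k) \<and> qprod xs = x. 1)" by (intro sum_mono pb)
    also have "\<dots> \<le> R" using R[of x] by simp
    finally show ?thesis .
  qed
  have "(\<Sum>z\<in>W. \<bar>T z\<bar> ^ Suc k) = (\<Sum>z\<in>W. \<Sum>x\<in>qbox L. c x * (\<sigma> z * of_int (qchar z x)))"
    by (intro sum.cong refl) (simp only: TS expand sum_distrib_left mult_ac)
  also have "\<dots> = (\<Sum>x\<in>qbox L. c x * X x)"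
    unfolding X_def sum_distrib_left by (rule sum.swap)
  also have "\<dots> \<le> (\<Sum>x\<in>qbox L. R * \<bar>X x\<bar>)"
  proof (rule sum_mono)
    fix x
    have "c x * X x \<le> \<bar>c x\<bar> * \<bar>X x\<bar>" by (simp add: abs_mult[symmetric])
    also have "\<dots> \<le> R * \<bar>X x\<bar>" using cR by (intro mult_right_mono) auto
    finally show "c x * X x \<le> R * \<bar>X x\<bar>" .
  qed
  finally have E1: "(\<Sum>z\<in>W. \<bar>T z\<bar> ^ Suc k) \<le> R * (\<Sum>x\<in>qbox L. \<bar>X x\<bar>)" by (simp add: sum_distrib_left)
  have E2: "(\<Sum>x\<in>qbox L. \<bar>X x\<bar>)\<^sup>2 \<le> n\<^sup>2 * (\<Sum>x\<in>qbox L. (X x)\<^sup>2)"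
  proof -
    have "(\<Sum>x\<in>qbox L. \<bar>X x\<bar>) ^ Suc 1 \<le> real (card (qbox L)) ^ 1 * (\<Sum>x\<in>qbox L. \<bar>X x\<bar> ^ Suc 1)"
      by (rule power_mean_sum[OF fB]) simp
    moreover have "real (card (qbox L)) = n\<^sup>2" unfolding card_qbox n_def by simp
    ultimately show ?thesis by (simp add: power2_eq_square)
  qed
  have E3: "(\<Sum>x\<in>qbox L. (X x)\<^sup>2) \<le> B * n\<^sup>2 + (real (card W))\<^sup>2 * (2 * n * Y\<^sup>2)"
  proof -
    let ?S = "{(z, z') \<in> W \<times> W. is_square (qnorm z * qnorm z')}"
    have "(\<Sum>x\<in>qbox L. (X x)\<^sup>2) = (\<Sum>x\<in>qbox L. \<Sum>p\<in>W \<times> W. \<sigma> (fst p) * \<sigma> (snd p) * of_int (qchar (fst p) x * qchar (snd p) x))"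
      unfolding X_def power2_eq_square sum_product
      by (intro sum.cong refl) (simp add: sum.cartesian_product case_prod_unfold mult_ac)
    also have "\<dots> = (\<Sum>p\<in>W \<times> W. \<sigma> (fst p) * \<sigma> (snd p) * (\<Sum>x\<in>qbox L. of_int (qchar (fst p) x * qchar (snd p) x)))"
      unfolding sum_distrib_left by (rule sum.swap)
    \<comment> \<open>Pairs whose norms multiply to a square get the trivial bound, the size of the
      box; all others contribute only along the boundary of the box.\<close>
    also have "\<dots> \<le> (\<Sum>p\<in>W \<times> W. (if p \<in> ?S then n\<^sup>2 else 0) + 2 * n * Y\<^sup>2)"
    proof (rule sum_mono)
      fix p assume p: "p \<in> W \<times> W"
      obtain z z' where zz: "p = (z, z')" by (cases p) blast
      let ?I = "\<Sum>x\<in>qbox L. real_of_int (qchar z x * qchar z' x)"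
      have z: "qnorm z > 0" "odd (qnorm z)" "real_of_int (qnorm z) \<le> Y" using W(2)[of z] p zz by auto
      have z': "qnorm z' > 0" "odd (qnorm z')" "real_of_int (qnorm z') \<le> Y" using W(2)[of z'] p zz by auto
      have n0: "n \<ge> 0" by (simp add: n_def)
      have "\<sigma> z * \<sigma> z' * ?I \<le> \<bar>\<sigma> z\<bar> * \<bar>\<sigma> z'\<bar> * \<bar>?I\<bar>" by (simp add: abs_mult[symmetric])
      also have "\<dots> \<le> 1 * 1 * \<bar>?I\<bar>" using \<sigma>1 by (intro mult_mono mult_right_mono) auto
      finally have 1: "\<sigma> z * \<sigma> z' * ?I \<le> \<bar>?I\<bar>" by simp
      show "\<sigma> (fst p) * \<sigma> (snd p) * (\<Sum>x\<in>qbox L. of_int (qchar (fst p) x * qchar (snd p) x)) \<le> (if p \<in> ?S then n\<^sup>2 else 0) + 2 * n * Y\<^sup>2"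
      proof (cases "p \<in> ?S")
        case True
        have q1: "\<bar>real_of_int (qchar z x * qchar z' x)\<bar> \<le> 1" for x
        proof -
          obtain a b where "x = (a, b)" by force
          then show ?thesis using Jacobi_values[OF z(1,2), of "a + b * qroot z"] Jacobi_values[OF z'(1,2), of "a + b * qroot z'"] by auto
        qed
        have "\<bar>?I\<bar> \<le> (\<Sum>x\<in>qbox L. \<bar>real_of_int (qchar z x * qchar z' x)\<bar>)" by (rule sum_abs)
        also have "\<dots> \<le> (\<Sum>x\<in>qbox L. 1)" by (intro sum_mono q1)
        also have "\<dots> = real (card (qbox L))" by simp
        also have "\<dots> = n\<^sup>2" unfolding card_qbox n_def by simp
        finally have "\<bar>?I\<bar> \<le> n\<^sup>2" .
        moreover have "2 * n * Y\<^sup>2 \<ge> 0" using n0 by simp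
        ultimately have "\<sigma> z * \<sigma> z' * ?I \<le> n\<^sup>2 + 2 * n * Y\<^sup>2" using 1 by linarith
        then show ?thesis unfolding if_P[OF True] unfolding zz fst_conv snd_conv .
      next
        case False
        then have "\<not> is_square (qnorm z * qnorm z')" using p zz by auto
        then have "\<bar>?I\<bar> \<le> 2 * n * of_int (qnorm z * qnorm z')"
          unfolding n_def by (rule qchar_correlation_box[OF z(1,2) z'(1,2)])
        also have "\<dots> \<le> 2 * n * Y\<^sup>2"
          unfolding of_int_mult power2_eq_square using z z' n0 by (intro mult_left_mono mult_mono) auto
        finally have "\<sigma> z * \<sigma> z' * ?I \<le> 0 + 2 * n * Y\<^sup>2" using 1 by linarith
        then show ?thesis unfolding if_not_P[OF False] unfolding zz fst_conv snd_conv .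
      qed
    qed
    also have "\<dots> = real (card ?S) * n\<^sup>2 + real (card (W \<times> W)) * (2 * n * Y\<^sup>2)"
    proof -
      have "{p \<in> W \<times> W. p \<in> ?S} = ?S" by auto
      then show ?thesis using W(1) by (simp add: sum.distrib sum.inter_filter[symmetric])
    qed
    also have "\<dots> \<le> B * n\<^sup>2 + (real (card W))\<^sup>2 * (2 * n * Y\<^sup>2)"
    proof -
      have e: "real (card (W \<times> W)) = (real (card W))\<^sup>2" by (simp add: card_cartesian_product power2_eq_square)
      show ?thesis unfolding e using B by (intro add_mono mult_right_mono order_refl) auto
    qed
    finally show ?thesis .
  qed
  have "(\<Sum>z\<in>W. \<bar>T z\<bar>) ^ Suc k \<le> real (card W) ^ k * (\<Sum>z\<in>W. \<bar>T z\<bar> ^ Suc k)"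
    by (rule power_mean_sum[OF W(1)]) simp
  also have "\<dots> \<le> real (card W) ^ k * (R * (\<Sum>x\<in>qbox L. \<bar>X x\<bar>))"
    using E1 by (intro mult_left_mono) auto
  finally have "((\<Sum>z\<in>W. \<bar>T z\<bar>) ^ Suc k)\<^sup>2 \<le> (real (card W) ^ k * (R * (\<Sum>x\<in>qbox L. \<bar>X x\<bar>)))\<^sup>2"
    by (intro power_mono) (auto intro!: zero_le_power sum_nonneg)
  also have "\<dots> = real (card W) ^ (2 * k) * R\<^sup>2 * (\<Sum>x\<in>qbox L. \<bar>X x\<bar>)\<^sup>2"
    by (simp add: power_mult_distrib power_mult[symmetric] mult.commute)
  also have "\<dots> \<le> real (card W) ^ (2 * k) * R\<^sup>2 * (n\<^sup>2 * (B * n\<^sup>2 + (real (card W))\<^sup>2 * (2 * n * Y\<^sup>2)))"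
    using E2 E3 by (intro mult_left_mono order_trans[OF E2]) auto
  finally show ?thesis unfolding T_def n_def by (simp only: power_mult[symmetric] mult_ac)
qed

section \<open>Counting equal products and pairs of norms with square product\<close>

lemma prime_dvd_prod_list:
  "prime (p::int) \<Longrightarrow> p dvd prod_list xs \<Longrightarrow> \<exists>x\<in>set xs. p dvd x"
  by (induction xs) (auto simp: prime_dvd_mult_iff)

lemma qnorm_qprod: "qnorm (qprod xs) = prod_list (map qnorm xs)"
  by (induction xs) (simp_all add: qnorm_qmul)

text \<open>Comparing norms with one fixed tuple of the same product, every entry lies over one of
  its at most \<open>k\<close> rational primes, and each prime has at most two elements.
  Factorisation of integers suffices.\<close>

lemma card_tuples_qprod:
  assumes fin: "finite P" and P: "\<And>w. w \<in> P \<Longrightarrow> \<exists>q. prime q \<and> w \<in> primes_over q"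
  shows "card {xs \<in> tuples P k. qprod xs = x} \<le> (2 * k) ^ k"
proof (cases "{xs \<in> tuples P k. qprod xs = x} = {}")
  case False
  then obtain ys where ys: "ys \<in> tuples P k" "qprod ys = x" by blast
  define A where "A = (\<Union>q\<in>(\<lambda>w. nat (qnorm w)) ` set ys. primes_over q)"
  have fA: "finite A" by (simp add: A_def finite_primes_over)
  have "card A \<le> (\<Sum>q\<in>(\<lambda>w. nat (qnorm w)) ` set ys. card (primes_over q))"
    unfolding A_def by (rule card_UN_le) simp
  also have "\<dots> \<le> (\<Sum>q\<in>(\<lambda>w. nat (qnorm w)) ` set ys. 2)" by (intro sum_mono card_primes_over)
  also have "\<dots> = 2 * card ((\<lambda>w. nat (qnorm w)) ` set ys)" by simp
  also have "\<dots> \<le> 2 * k" using card_image_le[of "set ys" "\<lambda>w. nat (qnorm w)"] card_length[of ys] ys by (simp add: tuples_def)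
  finally have cA: "card A \<le> 2 * k" .
  have "{xs \<in> tuples P k. qprod xs = x} \<subseteq> tuples A k"
  proof
    fix xs assume xs: "xs \<in> {xs \<in> tuples P k. qprod xs = x}"
    have "w \<in> A" if w: "w \<in> set xs" for w
    proof -
      have "w \<in> P" using w xs by (auto simp: tuples_def)
      then obtain q where q: "prime q" "w \<in> primes_over q" using P by blast
      have nw: "qnorm w = int q" using primes_over_props(3)[OF q(2)] .
      have "qnorm w dvd qnorm (qprod xs)" unfolding qnorm_qprod using w by (intro prod_list_dvd) auto
      also have "qnorm (qprod xs) = prod_list (map qnorm ys)" using xs ys qnorm_qprod[of ys] by simp
      finally have "int q dvd prod_list (map qnorm ys)" using nw by simp
      then obtain v where v: "v \<in> set ys" "int q dvd qnorm v"
        using prime_dvd_prod_list[of "int q" "map qnorm ys"] q(1) by auto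
      have "v \<in> P" using v ys by (auto simp: tuples_def)
      then obtain q' where q': "prime q'" "v \<in> primes_over q'" using P by blast
      have "qnorm v = int q'" using primes_over_props(3)[OF q'(2)] .
      then have "q dvd q'" using v(2) by simp
      then have "q = q'" using q q' primes_dvd_imp_eq by blast
      then have "q = nat (qnorm v)" using \<open>qnorm v = int q'\<close> by simp
      then show ?thesis using q(2) v(1) by (auto simp: A_def)
    qed
    then show "xs \<in> tuples A k" using xs by (auto simp: tuples_def)
  qed
  then have "card {xs \<in> tuples P k. qprod xs = x} \<le> card (tuples A k)" by (rule card_mono[OF finite_tuples[OF fA]])
  also have "\<dots> = card A ^ k" by (rule card_tuples[OF fA])
  also have "\<dots> \<le> (2 * k) ^ k" using cA by (rule power_mono) simp
  finally show ?thesis .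
next
  case True
  then show ?thesis by (simp only: card.empty)
qed

text \<open>If the norms multiply to \<open>h\<^sup>2\<close>, then \<open>h \<le> Y\<close> and one
  norm is a divisor of \<open>h\<^sup>2\<close>: at most \<open>Y * D\<close> pairs of norms, each
  attained by at most \<open>(817 * D)\<^sup>2\<close> pairs of elements.\<close>

lemma card_square_norm_pairs:
  assumes W: "finite W" "W \<subseteq> fund_dom" "\<And>z. z \<in> W \<Longrightarrow> primitive z \<and> odd (qnorm z) \<and> qnorm z \<le> int Y"
    and D: "\<And>n. n > 0 \<Longrightarrow> n \<le> Y\<^sup>2 \<Longrightarrow> divcount n \<le> D"
  shows "card {(z, z') \<in> W \<times> W. is_square (qnorm z * qnorm z')} \<le> Y * (D * (817 * D)\<^sup>2)"
proof -
  let ?S = "{(z, z') \<in> W \<times> W. is_square (qnorm z * qnorm z')}"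
  define F where "F = (\<lambda>m. {z \<in> fund_dom. primitive z \<and> qnorm z = int m})"
  define I where "I = Sigma {1..Y} (\<lambda>h. {m. m dvd h\<^sup>2 \<and> odd (int m) \<and> odd (int (h\<^sup>2 div m)) \<and> m \<le> Y \<and> h\<^sup>2 div m \<le> Y})"
  have fF: "finite (F m)" for m
    by (rule finite_subset[OF _ finite_fund_dom[of m]]) (auto simp: F_def)
  have cF: "card (F m) \<le> 817 * D" if "m > 0" "odd (int m)" "m \<le> Y" for m
  proof -
    have "card (F m) \<le> 817 * divcount m" using card_fund_dom_norm[of "int m"] that by (simp add: F_def)
    moreover have "m \<le> Y\<^sup>2" using that by (metis dual_order.trans le_square power2_eq_square)
    ultimately show ?thesis using D[of m] that by simp
  qed
  have "?S \<subseteq> (\<Union>(h, m)\<in>I. F m \<times> F (h\<^sup>2 div m))"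
  proof
    fix p assume p: "p \<in> ?S"
    obtain z z' where zz: "p = (z, z')" by (cases p) blast
    have zW: "z \<in> W" "z' \<in> W" using p zz by auto
    define m where "m = nat (qnorm z)"
    define m' where "m' = nat (qnorm z')"
    have "qnorm z > 0" "qnorm z' > 0" using zW W(2) fund_dom_qnorm_pos by blast+
    then have m: "int m = qnorm z" "int m' = qnorm z'" and mp: "m > 0" "m' > 0" by (simp_all add: m_def m'_def)
    have mY: "m \<le> Y" "m' \<le> Y" using W(3)[OF zW(1)] W(3)[OF zW(2)] m by linarith+
    obtain s where s: "qnorm z * qnorm z' = s\<^sup>2" using p zz by (auto elim: is_nth_powerE)
    define h where "h = nat \<bar>s\<bar>"
    have "int (m * m') = int (h\<^sup>2)" using s m by (simp add: h_def)
    then have mh: "m * m' = h\<^sup>2" by (simp only: of_nat_eq_iff)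
    have "h\<^sup>2 \<le> Y\<^sup>2" using mh mY by (metis mult_le_mono power2_eq_square)
    then have "h \<le> Y" by (simp add: power2_nat_le_eq_le)
    moreover have "h \<ge> 1" using mh mp by (cases h) auto
    moreover have "h\<^sup>2 div m = m'" using mh mp by (metis nonzero_mult_div_cancel_left not_gr_zero)
    moreover have "m dvd h\<^sup>2" using mh by (metis dvd_triv_left)
    moreover have "odd (int m)" "odd (int m')" unfolding m using W(3)[OF zW(1)] W(3)[OF zW(2)] by blast+
    ultimately have "(h, m) \<in> I" using mY by (auto simp: I_def)
    moreover have "p \<in> F m \<times> F (h\<^sup>2 div m)" using zz zW W \<open>h\<^sup>2 div m = m'\<close> m by (auto simp: F_def)
    ultimately show "p \<in> (\<Union>(h, m)\<in>I. F m \<times> F (h\<^sup>2 div m))" by blast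
  qed
  moreover have fI: "finite I" unfolding I_def
    by (intro finite_SigmaI) (auto intro: rev_finite_subset[of "{..Y}"])
  ultimately have "card ?S \<le> card (\<Union>(h, m)\<in>I. F m \<times> F (h\<^sup>2 div m))"
    using fF by (intro card_mono) auto
  also have "\<dots> \<le> (\<Sum>i\<in>I. card (case i of (h, m) \<Rightarrow> F m \<times> F (h\<^sup>2 div m)))" by (rule card_UN_le[OF fI])
  also have "\<dots> \<le> (\<Sum>i\<in>I. (817 * D)\<^sup>2)"
  proof (rule sum_mono)
    fix i assume i: "i \<in> I"
    obtain h m where hm: "i = (h, m)" by force
    have "m > 0" "h\<^sup>2 div m > 0" using i hm by (auto simp: I_def intro!: gr0I dest: dvd_imp_le)
    then have "card (F m) * card (F (h\<^sup>2 div m)) \<le> (817 * D) * (817 * D)"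
      using i hm by (intro mult_le_mono cF) (auto simp: I_def)
    then show "card (case i of (h, m) \<Rightarrow> F m \<times> F (h\<^sup>2 div m)) \<le> (817 * D)\<^sup>2"
      by (simp add: hm card_cartesian_product power2_eq_square)
  qed
  also have "\<dots> = card I * (817 * D)\<^sup>2" by simp
  also have "\<dots> \<le> (Y * D) * (817 * D)\<^sup>2"
  proof (rule mult_right_mono)
    have "card I = (\<Sum>h\<in>{1..Y}. card {m. m dvd h\<^sup>2 \<and> odd (int m) \<and> odd (int (h\<^sup>2 div m)) \<and> m \<le> Y \<and> h\<^sup>2 div m \<le> Y})"
      unfolding I_def by (rule card_SigmaI) (auto intro: rev_finite_subset[of "{..Y}"])
    also have "\<dots> \<le> (\<Sum>h\<in>{1..Y}. D)"
    proof (rule sum_mono)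
      fix h assume h: "h \<in> {1..Y}"
      have "card {m. m dvd h\<^sup>2 \<and> odd (int m) \<and> odd (int (h\<^sup>2 div m)) \<and> m \<le> Y \<and> h\<^sup>2 div m \<le> Y} \<le> divcount (h\<^sup>2)"
        unfolding divcount_def using h by (intro card_mono) auto
      also have "\<dots> \<le> D" using h by (intro D power_mono) auto
      finally show "card {m. m dvd h\<^sup>2 \<and> odd (int m) \<and> odd (int (h\<^sup>2 div m)) \<and> m \<le> Y \<and> h\<^sup>2 div m \<le> Y} \<le> D" .
    qed
    also have "\<dots> = Y * D" by simp
    finally show "card I \<le> Y * D" .
  qed simp
  finally show ?thesis by (simp add: mult_ac)
qed

lemma primes_over_qsize:
  assumes "w \<in> primes_over q" shows "real_of_int (qsize w) \<le> 9 * sqrt (real q)"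
proof -
  obtain a b where w: "w = (a, b)" by force
  have p: "a > 0" "a\<^sup>2 - 2 * b\<^sup>2 = int q" "a\<^sup>2 \<le> 9 * int q" using primes_over_props[OF assms] w by auto
  have "b\<^sup>2 \<le> a\<^sup>2" using p(2) zero_le_power2[of b] by linarith
  then have "\<bar>b\<bar> \<le> \<bar>a\<bar>" by (simp only: abs_le_square_iff)
  then have "qsize w \<le> 3 * a" using p(1) w by simp
  moreover have "real_of_int a \<le> 3 * sqrt (real q)"
  proof -
    have "real_of_int (a\<^sup>2) \<le> real_of_int (9 * int q)" using p(3) by (simp only: of_int_le_iff)
    then have "(real_of_int a)\<^sup>2 \<le> (3 * sqrt (real q))\<^sup>2" by (simp add: power_mult_distrib)
    then show ?thesis by (rule power2_le_imp_le) simp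
  qed
  ultimately show ?thesis by linarith
qed

text \<open>The exponent \<open>149/150\<close> is the outcome of this choice of \<open>k\<close>: writing \<open>M = X^\<mu>\<close>, it amounts to
  \<open>75 \<mu> - 1 \<ge> k\<close> for some \<open>k \<ge> 6 \<mu> / (1 - \<mu>)\<close>, which is possible for \<open>0.03 \<le> \<mu> \<le> 0.915\<close>.\<close>
lemma Hoelder_exponent:
  fixes X M :: real
  assumes X: "X \<ge> 2" and M: "X powr (3/100) \<le> M" "M \<le> X powr (183/200)"
  obtains k :: nat where "k \<ge> 1" "k \<le> 66" "M ^ 6 \<le> (X / M) ^ k" "X powr (2 * real k / 150) \<le> (X powr (-1/150))\<^sup>2 * M"
proof -
  define l where "l = ln X"
  have l: "l > 0" using X by (simp add: l_def)
  define \<mu> where "\<mu> = ln M / l"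
  have M0: "M > 0" using M(1) X by (smt (verit) powr_gt_zero)
  have lnM: "ln M = \<mu> * l" using l by (simp add: \<mu>_def)
  have "M = exp (ln M)" using M0 by simp
  also have "\<dots> = X powr \<mu>" using X lnM by (simp add: powr_def l_def)
  finally have MX: "M = X powr \<mu>" .
  have \<mu>: "3/100 \<le> \<mu>" "\<mu> \<le> 183/200" using M X unfolding MX by auto
  \<comment> \<open>The least \<open>k\<close> for which the box of side about
    \<open>(X / M)\<close> to the power \<open>k / 2\<close> reaches \<open>M ^ 3\<close>.\<close>
  define k where "k = nat \<lceil>6 * \<mu> / (1 - \<mu>)\<rceil>"
  have m1: "1 - \<mu> > 0" using \<mu> by simp
  have pos: "6 * \<mu> / (1 - \<mu>) > 0" using \<mu> m1 by simp
  have k1: "6 * \<mu> / (1 - \<mu>) \<le> real k" "real k < 6 * \<mu> / (1 - \<mu>) + 1" using pos unfolding k_def by linarith+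
  \<comment> \<open>The cut points 3/100 and 183/200 enter as near-roots of the quadratic in
    \<open>\<mu>\<close>; the remainder \<open>\<mu> / 8 + 47 / 800\<close> is positive
    slack.\<close>
  have key: "6 * \<mu> / (1 - \<mu>) + 1 \<le> 75 * \<mu> - 1"
  proof -
    have "0 \<le> 75 * ((\<mu> - 3/100) * (183/200 - \<mu>))" using \<mu> by (intro mult_nonneg_nonneg) auto
    also have "75 * ((\<mu> - 3/100) * (183/200 - \<mu>)) = (75 * \<mu> - 2) * (1 - \<mu>) - 6 * \<mu> - (\<mu> / 8 + 47/800)"
      by (simp add: field_simps)
    finally have "6 * \<mu> \<le> (75 * \<mu> - 2) * (1 - \<mu>)" using \<mu> by linarith
    then have "6 * \<mu> / (1 - \<mu>) \<le> 75 * \<mu> - 2" using m1 by (simp add: pos_divide_le_eq)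
    then show ?thesis by simp
  qed
  show ?thesis
  proof
    show "k \<ge> 1" using k1(1) pos by linarith
    have "6 * \<mu> / (1 - \<mu>) \<le> 6 * (183/200) / (17/200)" using \<mu> by (intro frac_le) auto
    then show "k \<le> 66" using k1(2) by simp
    have "X / M = X powr (1 - \<mu>)" using X by (simp add: MX powr_diff)
    then have "(X / M) ^ k = X powr ((1 - \<mu>) * real k)" using X by (simp add: powr_power powr_powr mult.commute)
    moreover have "M ^ 6 = X powr (\<mu> * 6)" using X unfolding MX by (simp add: powr_power mult.commute)
    moreover have "\<mu> * 6 \<le> (1 - \<mu>) * real k" using k1(1) m1 by (simp add: pos_divide_le_eq mult.commute)
    ultimately show "M ^ 6 \<le> (X / M) ^ k" using X by simp
    have "(X powr (-1/150))\<^sup>2 * M = X powr (-1/75 + \<mu>)" using X unfolding MX by (simp add: powr_power powr_add[symmetric])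
    moreover have "2 * real k / 150 \<le> -1/75 + \<mu>" using k1(2) key by simp
    ultimately show "X powr (2 * real k / 150) \<le> (X powr (-1/150))\<^sup>2 * M" using X by simp
  qed
qed

text \<open>Here 1634 is twice 817, from the size of the block; \<open>2 * 66\<close> bounds
  \<open>2 * k\<close>; 50625 is \<open>625 * 81\<close>, from the fourth power of the box side; and
  9 is the sum of 1 for square pairs and 8 for the others.\<close>

definition block_const :: real where
  "block_const = 1634 * (2 * 66 * 50625 * 9)"

text \<open>An interval of length \<open>t \<ge> 1\<close> has at most \<open>2 * t\<close>
  integers; each is a norm at most \<open>817 * D\<close> times.\<close>

lemma card_fund_dom_short:
  assumes "finite W" "W \<subseteq> fund_dom" "\<And>z. z \<in> W \<Longrightarrow> primitive z \<and> odd (qnorm z) \<and> M < of_int (qnorm z) \<and> of_int (qnorm z) \<le> M + t"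
    and D: "\<And>n. n > 0 \<Longrightarrow> real n \<le> M + t \<Longrightarrow> divcount n \<le> D" and t: "t \<ge> 1" "M \<ge> 0"
  shows "real (card W) \<le> 1634 * real D * t"
proof -
  define I where "I = {m::int. M < of_int m \<and> of_int m \<le> M + t}"
  have I: "I \<subseteq> {\<lfloor>M\<rfloor> + 1..\<lfloor>M + t\<rfloor>}" by (auto simp: I_def le_floor_iff floor_less_iff) linarith
  then have fI: "finite I" by (rule finite_subset) simp
  have "card I \<le> card {\<lfloor>M\<rfloor> + 1..\<lfloor>M + t\<rfloor>}" by (rule card_mono[OF _ I]) simp
  also have "\<dots> = nat (\<lfloor>M + t\<rfloor> - \<lfloor>M\<rfloor>)" by simp
  finally have cI: "real (card I) \<le> 2 * t" using t by linarith
  have "W \<subseteq> (\<Union>m\<in>I. {z \<in> W. qnorm z = m})" using assms(3) by (auto simp: I_def)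
  then have "card W \<le> card (\<Union>m\<in>I. {z \<in> W. qnorm z = m})" using fI assms(1) by (intro card_mono) auto
  also have "\<dots> \<le> (\<Sum>m\<in>I. card {z \<in> W. qnorm z = m})" by (rule card_UN_le[OF fI])
  also have "\<dots> \<le> (\<Sum>m\<in>I. 817 * D)"
  proof (rule sum_mono)
    fix m assume m: "m \<in> I"
    show "card {z \<in> W. qnorm z = m} \<le> 817 * D"
    proof (cases "{z \<in> W. qnorm z = m} = {}")
      case False
      then obtain z where z: "z \<in> W" "qnorm z = m" by blast
      have "z \<in> fund_dom" using assms(2) z(1) by blast
      then have om: "odd m" "m > 0" using assms(3)[OF z(1)] z(2) fund_dom_qnorm_pos[of z] by blast+
      have "card {z \<in> W. qnorm z = m} \<le> card {z \<in> fund_dom. primitive z \<and> qnorm z = m}"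
        using assms(2,3) by (intro card_mono rev_finite_subset[OF finite_fund_dom[of "nat m"]]) auto
      also have "\<dots> \<le> 817 * divcount (nat m)" by (rule card_fund_dom_norm[OF om(2,1)])
      also have "\<dots> \<le> 817 * D" using D[of "nat m"] om m by (simp add: I_def)
      finally show ?thesis .
    next
      case True
      then show ?thesis by (simp only: card.empty)
    qed
  qed
  also have "\<dots> = card I * (817 * D)" by simp
  finally have "real (card W) \<le> real (card I * (817 * D))" by (simp only: of_nat_le_iff)
  then have "real (card W) \<le> real (card I) * (817 * real D)" by simp
  also have "\<dots> \<le> (2 * t) * (817 * real D)" using cI by (intro mult_right_mono) auto
  finally show ?thesis by (simp add: mult_ac)
qed

text \<open>Up to constants and divisor bounds, \<open>\<eta> * X\<close> is the trivial estimate,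
  so the content is the final factor \<open>X powr (-1/150)\<close>. The divisor bound is asked for
  up to \<open>X ^ 4\<close>, to cover products of two norms, which are at most
  \<open>4 * X\<^sup>2\<close>.\<close>

theorem block_bound:
  fixes X M :: real and \<beta> :: "int \<times> int \<Rightarrow> real"
  defines "\<eta> \<equiv> X powr (-1/150)"
  assumes X: "X \<ge> 2" and M: "X powr (3/100) \<le> M" "M \<le> X powr (183/200)"
    and D: "D \<ge> 1" "\<And>n. n > 0 \<Longrightarrow> real n \<le> X ^ 4 \<Longrightarrow> divcount n \<le> D"
    and W: "finite W" "W \<subseteq> fund_dom"
      "\<And>z. z \<in> W \<Longrightarrow> primitive z \<and> odd (qnorm z) \<and> M < of_int (qnorm z) \<and> of_int (qnorm z) \<le> M * (1 + \<eta>)"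
    and P: "finite P" "\<And>w. w \<in> P \<Longrightarrow> (\<exists>q. prime q \<and> w \<in> primes_over q) \<and> of_int (qnorm w) \<le> X / M"
    and \<beta>: "\<And>w. \<bar>\<beta> w\<bar> \<le> 1"
  shows "(\<Sum>z\<in>W. \<bar>\<Sum>w\<in>P. \<beta> w * of_int (qchar z w)\<bar>) \<le> block_const * (real D)\<^sup>2 * (\<eta> * X) * X powr (-1/150)"
proof -
  have M0: "M > 0" using M(1) X by (smt (verit) powr_gt_zero)
  have M1: "M \<ge> 1"
  proof -
    have "X powr (3/100) \<ge> 1" using X by (intro ge_one_powr_ge_zero) auto
    then show ?thesis using M by simp
  qed
  have MX: "M \<le> X"
  proof -
    have "X powr (183/200) \<le> X powr 1" using X by (intro powr_mono) auto
    then show ?thesis using M X by simp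
  qed
  define Q where "Q = X / M"
  have Q1: "Q \<ge> 1" using MX M0 by (simp add: Q_def)
  have "X powr (-1/150) \<le> X powr 0" using X by (intro powr_mono) auto
  then have \<eta>: "\<eta> > 0" "\<eta> \<le> 1" using X by (auto simp: \<eta>_def)
  have \<eta>M: "\<eta> * M \<ge> 1"
  proof -
    have "1 \<le> X powr (7/300)" using X by (intro ge_one_powr_ge_zero) auto
    also have "\<dots> = \<eta> * X powr (3/100)" by (simp add: \<eta>_def powr_add[symmetric])
    also have "\<dots> \<le> \<eta> * M" using M \<eta> by (intro mult_left_mono) auto
    finally show ?thesis .
  qed
  obtain k where k: "k \<ge> 1" "k \<le> 66" "M ^ 6 \<le> Q ^ k" "X powr (2 * real k / 150) \<le> \<eta>\<^sup>2 * M"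
    using Hoelder_exponent[OF X M] unfolding Q_def \<eta>_def by blast
  obtain k' where k': "k = Suc k'" using k(1) by (cases k) auto
  define Wb where "Wb = 1634 * real D * (\<eta> * M)"
  have D0: "real D \<ge> 1" using D(1) by simp
  have Wb0: "Wb > 0" using D0 \<eta>M by (simp add: Wb_def)
  have X4: "4 * X\<^sup>2 \<le> X ^ 4"
  proof -
    have "2 * 2 \<le> X * X" using X by (intro mult_mono) auto
    then have "4 * X\<^sup>2 \<le> (X * X) * X\<^sup>2" by (intro mult_right_mono) auto
    then show ?thesis by (simp add: power2_eq_square power4_eq_xxxx mult_ac)
  qed
  have M2: "M * (1 + \<eta>) \<le> 2 * M" using \<eta> M0 by simp
  have XX: "2 * X \<le> X\<^sup>2" using X by (simp add: power2_eq_square)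
  have cW: "real (card W) \<le> Wb"
    unfolding Wb_def
  proof (rule card_fund_dom_short[OF W(1,2), of M])
    fix n :: nat assume n: "n > 0" "real n \<le> M + \<eta> * M"
    have "M + \<eta> * M \<le> 2 * X" using M2 MX by (simp add: algebra_simps)
    then have "real n \<le> X ^ 4" using n X4 XX zero_le_power2[of X] by linarith
    then show "divcount n \<le> D" using D n by blast
  qed (use W(3) \<eta>M M0 in \<open>auto simp: algebra_simps\<close>)
  define Y where "Y = nat \<lfloor>2 * M\<rfloor>"
  have Y: "real Y \<le> 2 * M" using M0 by (simp add: Y_def)
  have WY: "qnorm z \<le> int Y" if "z \<in> W" for z
  proof -
    have "real_of_int (qnorm z) \<le> 2 * M" using W(3)[OF that] M2 by linarith
    then show ?thesis using M0 by (simp add: Y_def le_floor_iff)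
  qed
  define B where "B = real (Y * (D * (817 * D)\<^sup>2))"
  have cB: "real (card {(z, z') \<in> W \<times> W. is_square (qnorm z * qnorm z')}) \<le> B"
    unfolding B_def of_nat_le_iff
  proof (rule card_square_norm_pairs[OF W(1,2)])
    fix n :: nat assume n: "n > 0" "n \<le> Y\<^sup>2"
    have "real n \<le> (real Y)\<^sup>2" using n(2) by (metis of_nat_le_iff of_nat_power)
    also have "\<dots> \<le> (2 * X)\<^sup>2" using Y MX by (intro power_mono) auto
    finally have "real n \<le> X ^ 4" using X4 by (simp add: power_mult_distrib)
    then show "divcount n \<le> D" using D n by blast
  qed (use W(3) WY in auto)
  define H where "H = 9 * sqrt Q"
  have "sqrt Q \<ge> 1" using Q1 by simp
  then have H1: "H \<ge> 1" unfolding H_def by linarith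
  define L where "L = nat \<lceil>H ^ k\<rceil>"
  have Hk: "H ^ k \<ge> 1" using H1 by (rule one_le_power)
  have L: "H ^ k \<le> real L" "real L \<le> H ^ k + 1" using Hk unfolding L_def by linarith+
  define n where "n = real (2 * L + 1)"
  have n: "H ^ k \<le> n" "n \<le> 5 * H ^ k" using L Hk by (auto simp: n_def)
  have n0: "n > 0" using n Hk by linarith
  \<comment> \<open>With this box side the boundary terms, of relative size
    \<open>M ^ 2 / n\<close>, are no worse than \<open>1 / M\<close>.\<close>
  have nM: "M ^ 3 \<le> n"
  proof -
    have "(sqrt Q ^ k)\<^sup>2 = ((sqrt Q)\<^sup>2) ^ k" by (simp only: power_mult[symmetric] mult.commute)
    also have "\<dots> = Q ^ k" using Q1 by simp
    finally have "(M ^ 3)\<^sup>2 \<le> (sqrt Q ^ k)\<^sup>2" using k(3) by (simp add: power_mult[symmetric])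
    then have "M ^ 3 \<le> sqrt Q ^ k" by (rule power2_le_imp_le) (use Q1 in simp)
    also have "\<dots> \<le> H ^ k" unfolding H_def using Q1 by (intro power_mono) auto
    finally show ?thesis using n by simp
  qed
  define S where "S = (\<Sum>z\<in>W. \<bar>\<Sum>w\<in>P. \<beta> w * of_int (qchar z w)\<bar>)"
  define R where "R = real ((2 * k) ^ k)"
  have "S ^ (2 * Suc k') \<le> real (card W) ^ (2 * k') * R\<^sup>2 * (real (2 * L + 1))\<^sup>2 *
      (B * (real (2 * L + 1))\<^sup>2 + (real (card W))\<^sup>2 * (2 * real (2 * L + 1) * (2 * M)\<^sup>2))"
    unfolding S_def
  proof (rule bilinear_Hoelder[OF W(1) _ P(1) _ _ _ \<beta> _ cB])
    fix z assume z: "z \<in> W"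
    have "qnorm z > 0" using W(2) z fund_dom_qnorm_pos by blast
    then show "primitive z \<and> 0 < qnorm z \<and> odd (qnorm z) \<and> real_of_int (qnorm z) \<le> 2 * M"
      using W(3)[OF z] M2 by auto
  next
    fix w assume w: "w \<in> P"
    then obtain q where q: "w \<in> primes_over q" using P(2) by blast
    have "real q \<le> Q" using P(2)[OF w] primes_over_props(3)[OF q] by (simp add: Q_def)
    then have "9 * sqrt (real q) \<le> H" by (simp add: H_def)
    then show "real_of_int (qsize w) \<le> H" using primes_over_qsize[OF q] by linarith
  next
    show "0 \<le> H" using H1 by simp
    show "H ^ Suc k' \<le> real L" using L(1) k' by simp
    fix x show "real (card {xs \<in> tuples P (Suc k'). qprod xs = x}) \<le> R"
      unfolding R_def of_nat_le_iff k' using P(2) by (intro card_tuples_qprod[OF P(1)]) blast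
  qed
  then have "S ^ (2 * k) \<le> real (card W) ^ (2 * k') * R\<^sup>2 * n\<^sup>2 * (B * n\<^sup>2 + (real (card W))\<^sup>2 * (2 * n * (2 * M)\<^sup>2))"
    unfolding n_def k' .
  also have "\<dots> \<le> Wb ^ (2 * k') * R\<^sup>2 * n\<^sup>2 * (B * n\<^sup>2 + Wb\<^sup>2 * (2 * n * (2 * M)\<^sup>2))"
    using cW Wb0 n0 by (intro mult_mono power_mono add_mono order_refl mult_right_mono) (auto simp: B_def)
  \<comment> \<open>Relative to \<open>n\<^sup>2 * Wb\<^sup>2\<close>, square pairs save
    \<open>1 / (\<eta>\<^sup>2 * M)\<close> because their number is about \<open>M\<close>, and the
    remaining pairs save \<open>1 / M\<close>. The choice of \<open>k\<close> makes the weaker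
    saving a \<open>2 * k\<close>-th power of \<open>X powr (-1/150)\<close>.\<close>
  also have "B * n\<^sup>2 + Wb\<^sup>2 * (2 * n * (2 * M)\<^sup>2) \<le> n\<^sup>2 * (Wb\<^sup>2 * (9 * real D * X powr (- (2 * real k / 150))))"
  proof -
    define e where "e = 1 / (\<eta>\<^sup>2 * M)"
    have eM: "\<eta>\<^sup>2 * M > 0" using \<eta> M0 by simp
    have e0: "e > 0" using eM by (simp add: e_def)
    have e1: "e \<le> X powr (- (2 * real k / 150))"
      unfolding e_def powr_minus_divide using k(4) eM X by (intro divide_left_mono) auto
    have B1: "B \<le> Wb\<^sup>2 * (real D * e)"
    proof -
      have "B = real Y * (real D * (817 * real D)\<^sup>2)" by (simp add: B_def)
      also have "\<dots> \<le> (2 * M) * (real D * (817 * real D)\<^sup>2)" using Y by (intro mult_right_mono) auto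
      also have "\<dots> \<le> (4 * M) * (real D * (817 * real D)\<^sup>2)" using M0 by (intro mult_right_mono) auto
      also have "\<dots> = Wb\<^sup>2 * (real D * e)" using \<eta> M0 by (simp add: Wb_def e_def field_simps power2_eq_square)
      finally show ?thesis .
    qed
    have "2 * n * (2 * M)\<^sup>2 \<le> n\<^sup>2 * (8 * real D * e)"
    proof -
      have e2: "1 / M \<le> e" unfolding e_def using \<eta> M0 eM
        by (intro divide_left_mono) (auto simp: power2_eq_square mult_le_one intro!: mult_left_le_one_le)
      have "2 * n * (2 * M)\<^sup>2 = 8 * n * (M ^ 3 * (1 / M))" using M0 by (simp add: power2_eq_square power3_eq_cube)
      also have "\<dots> \<le> 8 * n * (n * e)" using nM e2 n0 M0 by (intro mult_left_mono mult_mono) auto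
      also have "\<dots> \<le> 8 * n * (n * (real D * e))" using D0 e0 n0 by (intro mult_left_mono) auto
      finally show ?thesis by (simp add: power2_eq_square mult_ac)
    qed
    then have "B * n\<^sup>2 + Wb\<^sup>2 * (2 * n * (2 * M)\<^sup>2) \<le> (Wb\<^sup>2 * (real D * e)) * n\<^sup>2 + Wb\<^sup>2 * (n\<^sup>2 * (8 * real D * e))"
      using B1 by (intro add_mono mult_right_mono mult_left_mono) auto
    also have "\<dots> = n\<^sup>2 * (Wb\<^sup>2 * (9 * real D * e))" by (simp add: algebra_simps)
    also have "\<dots> \<le> n\<^sup>2 * (Wb\<^sup>2 * (9 * real D * X powr (- (2 * real k / 150))))" using e1 by (intro mult_left_mono) auto
    finally show ?thesis .
  qed
  then have "Wb ^ (2 * k') * R\<^sup>2 * n\<^sup>2 * (B * n\<^sup>2 + Wb\<^sup>2 * (2 * n * (2 * M)\<^sup>2)) \<le>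
     Wb ^ (2 * k') * R\<^sup>2 * n\<^sup>2 * (n\<^sup>2 * (Wb\<^sup>2 * (9 * real D * X powr (- (2 * real k / 150)))))"
    using Wb0 by (intro mult_left_mono) auto
  also have "\<dots> = Wb ^ (2 * k) * R\<^sup>2 * n ^ 4 * (9 * real D) * X powr (- (2 * real k / 150))"
    by (simp add: k' power2_eq_square power4_eq_xxxx mult_ac)
  \<comment> \<open>Constants at least 1 are inflated to full \<open>2 * k\<close>-th powers, so
    that the root can be taken factor by factor.\<close>
  also have "\<dots> \<le> Wb ^ (2 * k) * (2 * real k) ^ (2 * k) * (50625 * Q) ^ (2 * k) * (9 * real D) ^ (2 * k) * (X powr (-1/150)) ^ (2 * k)"
  proof -
    have "R = (2 * real k) ^ k" by (simp add: R_def)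
    then have 1: "R\<^sup>2 = (2 * real k) ^ (2 * k)" by (simp only: power_mult[symmetric] mult.commute)
    have "n ^ 4 \<le> (5 * H ^ k) ^ 4" using n n0 by (intro power_mono) auto
    also have "\<dots> = 625 * (H ^ 4) ^ k" by (simp add: power_mult_distrib power_mult[symmetric] mult.commute)
    also have "H ^ 4 = (81 * Q)\<^sup>2" using Q1 by (simp add: H_def power_mult_distrib power4_eq_xxxx power2_eq_square)
    also have "625 * ((81 * Q)\<^sup>2) ^ k = 625 * (81 * Q) ^ (2 * k)" by (simp only: power_mult)
    also have "\<dots> \<le> 625 ^ (2 * k) * (81 * Q) ^ (2 * k)"
      using Q1 k(1) self_le_power[of "625::real" "2 * k"] by (intro mult_right_mono) auto
    also have "\<dots> = (50625 * Q) ^ (2 * k)" unfolding power_mult_distrib[symmetric] by simp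
    finally have 2: "n ^ 4 \<le> (50625 * Q) ^ (2 * k)" .
    have 3: "9 * real D \<le> (9 * real D) ^ (2 * k)" using D0 k(1) by (intro self_le_power) auto
    have 4: "X powr (- (2 * real k / 150)) = (X powr (-1/150)) ^ (2 * k)" using X by (simp add: powr_power)
    show ?thesis unfolding 1 4
      using 2 3 Wb0 n0 Q1 D0 by (intro mult_mono order_refl) auto
  qed
  also have "\<dots> = (Wb * (2 * real k) * (50625 * Q) * (9 * real D) * X powr (-1/150)) ^ (2 * k)"
    by (simp only: power_mult_distrib)
  finally have "S ^ (2 * k) \<le> (Wb * (2 * real k) * (50625 * Q) * (9 * real D) * X powr (-1/150)) ^ (2 * k)"
    .
  moreover have "2 * k = Suc (2 * k' + 1)" using k' by simp
  moreover have "0 \<le> Wb * (2 * real k) * (50625 * Q) * (9 * real D) * X powr (-1/150)"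
    using Wb0 Q1 D0 by (intro mult_nonneg_nonneg) auto
  ultimately have "S \<le> Wb * (2 * real k) * (50625 * Q) * (9 * real D) * X powr (-1/150)"
    using power_le_imp_le_base by metis
  also have "\<dots> \<le> Wb * (2 * 66) * (50625 * Q) * (9 * real D) * X powr (-1/150)"
    using Wb0 Q1 D0 k(2) by (intro mult_right_mono mult_left_mono) auto
  also have "\<dots> = block_const * (real D)\<^sup>2 * (\<eta> * (M * Q)) * X powr (-1/150)"
    by (simp add: Wb_def block_const_def power2_eq_square)
  also have "M * Q = X" using M0 by (simp add: Q_def)
  finally show ?thesis by (simp only: S_def)
qed

section \<open>Sums of the second type\<close>

definition spin_coeff :: "nat \<Rightarrow> real" where
  "spin_coeff n = (\<Sum>x | x \<in> spin_set \<and> qnorm x = int n. spin x)"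

lemma finite_spin_set: "finite {x. x \<in> spin_set \<and> qnorm x \<le> int N}"
  by (rule finite_subset[OF _ finite_fund_dom[of N]]) (auto simp: spin_set_iff)

lemma sum_spin_coeff:
  "(\<Sum>n\<in>{1..N}. spin_coeff n * \<phi> n) = (\<Sum>x | x \<in> spin_set \<and> qnorm x \<le> int N. spin x * \<phi> (nat (qnorm x)))"
proof -
  let ?X = "{x. x \<in> spin_set \<and> qnorm x \<le> int N}"
  have pos: "qnorm x > 0" if "x \<in> spin_set" for x using that fund_dom_qnorm_pos by (auto simp: spin_set_iff)
  have "(\<Sum>x\<in>?X. spin x * \<phi> (nat (qnorm x))) = (\<Sum>n\<in>{1..N}. \<Sum>x | x \<in> ?X \<and> nat (qnorm x) = n. spin x * \<phi> (nat (qnorm x)))"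
  proof (rule sum.group[OF finite_spin_set, symmetric])
    show "(\<lambda>x. nat (qnorm x)) ` ?X \<subseteq> {1..N}"
    proof
      fix n assume "n \<in> (\<lambda>x. nat (qnorm x)) ` ?X"
      then obtain x where "x \<in> spin_set" "qnorm x \<le> int N" "n = nat (qnorm x)" by blast
      then show "n \<in> {1..N}" using pos[of x] by auto
    qed
  qed simp
  also have "\<dots> = (\<Sum>n\<in>{1..N}. spin_coeff n * \<phi> n)"
  proof (rule sum.cong[OF refl])
    fix n assume n: "n \<in> {1..N}"
    have e: "{x. x \<in> ?X \<and> nat (qnorm x) = n} = {x. x \<in> spin_set \<and> qnorm x = int n}"
    proof (rule equalityI; rule subsetI)
      fix x assume "x \<in> {x. x \<in> ?X \<and> nat (qnorm x) = n}"
      then show "x \<in> {x. x \<in> spin_set \<and> qnorm x = int n}" using pos[of x] by auto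
    next
      fix x assume "x \<in> {x. x \<in> spin_set \<and> qnorm x = int n}"
      then show "x \<in> {x. x \<in> ?X \<and> nat (qnorm x) = n}" using n by auto
    qed
    show "(\<Sum>x | x \<in> ?X \<and> nat (qnorm x) = n. spin x * \<phi> (nat (qnorm x))) = spin_coeff n * \<phi> n"
      unfolding e spin_coeff_def sum_distrib_right by (rule sum.cong) auto
  qed
  finally show ?thesis by simp
qed

definition type2_sum :: "real \<Rightarrow> real \<Rightarrow> nat \<Rightarrow> real" where
  "type2_sum y z N = (\<Sum>n\<in>{1..N}. spin_coeff n *
     (\<Sum>q | prime q \<and> q dvd n \<and> z < real q \<and> y < real (n div q). moebius_trunc y (n div q) * ln (real q)))"

definition odd_primes_between :: "real \<Rightarrow> nat \<Rightarrow> nat set" where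
  "odd_primes_between z N = {q. prime q \<and> odd q \<and> z < real q \<and> q \<le> N}"

definition prime_elts :: "real \<Rightarrow> nat \<Rightarrow> (int \<times> int) set" where
  "prime_elts z N = (\<Union>q\<in>odd_primes_between z N. primes_over q)"

text \<open>The bound on the norm times \<open>z\<close> is inherited from the other factor having
  norm above \<open>z\<close>; imprimitive elements and even norms are left out because they make
  the spin of a product vanish or violate \<open>spin_cond\<close>.\<close>

definition type2_set :: "real \<Rightarrow> real \<Rightarrow> nat \<Rightarrow> (int \<times> int) set" where
  "type2_set y z N = {x \<in> fund_dom. primitive x \<and> odd (qnorm x) \<and> y < of_int (qnorm x) \<and> of_int (qnorm x) * z < real N \<and> qnorm x \<le> int N}"

lemma finite_odd_primes_between: "finite (odd_primes_between z N)"
  by (rule finite_subset[of _ "{..N}"]) (auto simp: odd_primes_between_def)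

lemma finite_prime_elts: "finite (prime_elts z N)"
  unfolding prime_elts_def using finite_odd_primes_between finite_primes_over by blast

lemma finite_type2_set: "finite (type2_set y z N)"
  by (rule finite_subset[OF _ finite_fund_dom[of N]]) (auto simp: type2_set_def)

lemma prime_elts_props:
  assumes "w \<in> prime_elts z N"
  shows "\<exists>q. prime q \<and> w \<in> primes_over q" "snd w \<noteq> 0" "w \<in> tot_pos" "z < of_int (qnorm w)" "1 \<le> qnorm w" "qnorm w \<le> int N"
proof -
  obtain q where q: "prime q" "odd q" "z < real q" "q \<le> N" "w \<in> primes_over q"
    using assms by (auto simp: prime_elts_def odd_primes_between_def)
  have q0: "q > 0" using q(1) prime_gt_0_nat by blast
  note p = primes_over_props[OF q(5)]
  show "\<exists>q. prime q \<and> w \<in> primes_over q" using q by blast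
  show "snd w \<noteq> 0" by (rule p(2))
  show "w \<in> tot_pos" by (rule primes_over_tot_pos[OF q0 q(5)])
  show "z < of_int (qnorm w)" "1 \<le> qnorm w" "qnorm w \<le> int N" unfolding p(3) using q q0 by auto
qed

lemma spin_set_qnorm_odd: "x \<in> spin_set \<Longrightarrow> odd (qnorm x)"
  by (cases x) (auto simp: spin_set_iff spin_cond_def odd_if_mod_16)

text \<open>Extension by 0 turns the congruence conditions on a product into part of the summand, so
  that the ranges of the two factors become independent of them.\<close>

definition cond_spin :: "int \<times> int \<Rightarrow> real" where
  "cond_spin x = (if spin_cond x then spin x else 0)"

lemma qmul_not_primitive:
  assumes "\<not> primitive z" "qmul w z \<in> tot_pos" shows "cond_spin (qmul w z) = 0"
proof (cases "spin_cond (qmul w z)")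
  case True
  obtain a b c d where wz: "w = (a, b)" "z = (c, d)" by force
  obtain g where g: "g dvd c" "g dvd d" "\<not> is_unit g" using assms(1) wz by (auto simp: primitive_def coprime_def)
  have "g dvd a * c + 2 * b * d" "g dvd a * d + b * c" using g by auto
  then have nc: "\<not> coprime (a * c + 2 * b * d) (a * d + b * c)" using g(3) coprime_common_divisor by blast
  have p: "a * c + 2 * b * d > 0" using assms(2) wz by (simp add: tot_pos_def)
  have "(a * c + 2 * b * d) mod 16 = 1" using True wz by (simp add: spin_cond_def)
  then have o: "odd (a * c + 2 * b * d)" by (rule odd_if_mod_16)
  show ?thesis using spin_not_primitive[OF p o nc] wz by (simp add: cond_spin_def del: spin.simps)
qed (simp add: cond_spin_def)

lemma qmul_even_norm:
  assumes "even (qnorm z)" shows "cond_spin (qmul w z) = 0"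
proof -
  have "even (qnorm (qmul w z))" using assms by (simp add: qnorm_qmul)
  then have "\<not> spin_cond (qmul w z)" by (cases "qmul w z") (auto simp: spin_cond_def odd_if_mod_16)
  then show ?thesis by (simp add: cond_spin_def)
qed

text \<open>Passing from rational primes to their generators leaves the bound on the product of the
  norms as the only condition in the ranges that links the two variables.\<close>

lemma type2_sum_eq:
  assumes yz: "y \<ge> 1" "z > 0"
  shows "type2_sum y z N = (\<Sum>x\<in>type2_set y z N. \<Sum>w | w \<in> prime_elts z N \<and> qnorm w * qnorm x \<le> int N.
     ln (of_int (qnorm w)) * cond_spin (qmul w x) * moebius_trunc y (nat (qnorm x)))"
proof -
  define h where "h = (\<lambda>t::int. if y < of_int t then moebius_trunc y (nat t) else 0)"
  let ?Pr = "odd_primes_between z N"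
  let ?X = "{x. x \<in> spin_set \<and> qnorm x \<le> int N}"
  let ?\<phi> = "\<lambda>n. \<Sum>q | prime q \<and> q dvd n \<and> z < real q \<and> y < real (n div q). moebius_trunc y (n div q) * ln (real q)"
  let ?t = "\<lambda>w x. ln (of_int (qnorm w)) * cond_spin (qmul w x) * moebius_trunc y (nat (qnorm x))"
  have fPr: "finite ?Pr" by (rule finite_odd_primes_between)
  have "type2_sum y z N = (\<Sum>x\<in>?X. spin x * ?\<phi> (nat (qnorm x)))"
    unfolding type2_sum_def by (rule sum_spin_coeff)
  also have "\<dots> = (\<Sum>x\<in>?X. \<Sum>q\<in>?Pr. if int q dvd qnorm x then ln (real q) * (spin x * h (qnorm x div int q)) else 0)"
  proof (rule sum.cong[OF refl])
    fix x assume x: "x \<in> ?X"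
    define n where "n = nat (qnorm x)"
    have xp: "qnorm x > 0" using x fund_dom_qnorm_pos by (auto simp: spin_set_iff)
    have n: "qnorm x = int n" "n > 0" "n \<le> N" using xp x by (auto simp: n_def)
    have on: "odd n" using spin_set_qnorm_odd[of x] x n by simp
    have dv: "int q dvd qnorm x \<longleftrightarrow> q dvd n" for q by (simp add: n)
    have hh: "h (qnorm x div int q) = (if y < real (n div q) then moebius_trunc y (n div q) else 0)" for q
      unfolding h_def n(1) zdiv_int[symmetric] by simp
    have "?\<phi> n = (\<Sum>q\<in>{q\<in>?Pr. q dvd n \<and> y < real (n div q)}. moebius_trunc y (n div q) * ln (real q))"
    proof (rule sum.cong[OF _ refl])
      show "{q. prime q \<and> q dvd n \<and> z < real q \<and> y < real (n div q)} = {q\<in>?Pr. q dvd n \<and> y < real (n div q)}"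
        using n on by (auto simp: odd_primes_between_def dest: dvd_imp_le)
    qed
    also have "\<dots> = (\<Sum>q\<in>?Pr. if q dvd n \<and> y < real (n div q) then moebius_trunc y (n div q) * ln (real q) else 0)"
      by (rule sum.inter_filter[OF fPr])
    finally have e: "?\<phi> n = (\<Sum>q\<in>?Pr. if q dvd n \<and> y < real (n div q) then moebius_trunc y (n div q) * ln (real q) else 0)" .
    show "spin x * ?\<phi> (nat (qnorm x)) = (\<Sum>q\<in>?Pr. if int q dvd qnorm x then ln (real q) * (spin x * h (qnorm x div int q)) else 0)"
      unfolding n_def[symmetric] e dv hh sum_distrib_left by (intro sum.cong refl) auto
  qed
  also have "\<dots> = (\<Sum>q\<in>?Pr. \<Sum>x\<in>?X. if int q dvd qnorm x then ln (real q) * (spin x * h (qnorm x div int q)) else 0)"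
    by (rule sum.swap)
  also have "\<dots> = (\<Sum>q\<in>?Pr. \<Sum>w\<in>primes_over q. \<Sum>x\<in>type2_set y z N. if qnorm w * qnorm x \<le> int N then ?t w x else 0)"
  proof (rule sum.cong[OF refl])
    fix q assume q: "q \<in> ?Pr"
    then have qp: "prime q" "odd q" "z < real q" by (auto simp: odd_primes_between_def)
    have q0: "q > 0" using qp(1) prime_gt_0_nat by blast
    have e: "{x \<in> ?X. int q dvd qnorm x} = {x. x \<in> spin_set \<and> qnorm x \<le> int N \<and> int q dvd qnorm x}" by auto
    have "(\<Sum>x\<in>?X. if int q dvd qnorm x then ln (real q) * (spin x * h (qnorm x div int q)) else 0) =
       ln (real q) * (\<Sum>x | x \<in> spin_set \<and> qnorm x \<le> int N \<and> int q dvd qnorm x. spin x * h (qnorm x div int q))"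
      unfolding sum.inter_filter[OF finite_spin_set, symmetric] e by (simp only: sum_distrib_left)
    also have "\<dots> = (\<Sum>w\<in>primes_over q. ln (real q) * (\<Sum>x | x \<in> fund_dom \<and> int q * qnorm x \<le> int N \<and> spin_cond (qmul w x). spin (qmul w x) * h (qnorm x)))"
      unfolding spin_sum_over_prime[OF qp(1,2)] by (simp only: sum_distrib_left)
    also have "\<dots> = (\<Sum>w\<in>primes_over q. \<Sum>x\<in>type2_set y z N. if qnorm w * qnorm x \<le> int N then ?t w x else 0)"
    proof (rule sum.cong[OF refl])
      fix w assume w: "w \<in> primes_over q"
      have nw: "qnorm w = int q" by (rule primes_over_props(3)[OF w])
      let ?A = "{x. x \<in> fund_dom \<and> int q * qnorm x \<le> int N \<and> spin_cond (qmul w x)}"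
      let ?B = "{x \<in> type2_set y z N. qnorm w * qnorm x \<le> int N}"
      let ?C = "{x. x \<in> fund_dom \<and> int q * qnorm x \<le> int N}"
      have le: "qnorm x \<le> int N" if "x \<in> ?C" for x
      proof -
        have "qnorm x > 0" using that fund_dom_qnorm_pos by blast
        then have "1 * qnorm x \<le> int q * qnorm x" using q0 by (intro mult_right_mono) auto
        then show ?thesis using that by simp
      qed
      have fC: "finite ?C" by (rule finite_subset[OF _ finite_fund_dom[of N]]) (use le in auto)
      have "ln (real q) * (\<Sum>x\<in>?A. spin (qmul w x) * h (qnorm x)) = (\<Sum>x\<in>?A. ln (real q) * (cond_spin (qmul w x) * h (qnorm x)))"
        unfolding sum_distrib_left by (intro sum.cong refl) (simp add: cond_spin_def)
      also have "\<dots> = (\<Sum>x\<in>?C. ln (real q) * (cond_spin (qmul w x) * h (qnorm x)))"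
        using fC by (intro sum.mono_neutral_left) (auto simp: cond_spin_def)
      also have "\<dots> = (\<Sum>x\<in>?B. ln (real q) * (cond_spin (qmul w x) * h (qnorm x)))"
      proof (rule sum.mono_neutral_right[OF fC])
        show "?B \<subseteq> ?C" by (auto simp: type2_set_def nw)
        show "\<forall>x\<in>?C - ?B. ln (real q) * (cond_spin (qmul w x) * h (qnorm x)) = 0"
        proof
          fix x assume x: "x \<in> ?C - ?B"
          have xf: "x \<in> fund_dom" "int q * qnorm x \<le> int N" using x by auto
          have xt: "qmul w x \<in> tot_pos" by (rule tot_pos_qmul[OF primes_over_tot_pos[OF q0 w] fund_dom_tot_pos[OF xf(1)]])
          have xpos: "qnorm x > 0" by (rule fund_dom_qnorm_pos[OF xf(1)])
          have "of_int (qnorm x) * z < of_int (qnorm x) * real q" using qp(3) xpos by (intro mult_strict_left_mono) auto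
          also have "\<dots> = real_of_int (int q * qnorm x)" by simp
          also have "\<dots> \<le> real_of_int (int N)" using xf(2) by (simp only: of_int_le_iff)
          finally have zz: "of_int (qnorm x) * z < real N" by simp
          then have "\<not> primitive x \<or> even (qnorm x) \<or> \<not> y < of_int (qnorm x)"
            using x le[of x] by (auto simp: type2_set_def nw)
          then show "ln (real q) * (cond_spin (qmul w x) * h (qnorm x)) = 0"
            using qmul_not_primitive[OF _ xt] qmul_even_norm[of x w] by (auto simp: h_def)
        qed
      qed
      also have "\<dots> = (\<Sum>x\<in>?B. ?t w x)"
        by (intro sum.cong refl) (auto simp: h_def type2_set_def nw)
      also have "\<dots> = (\<Sum>x\<in>type2_set y z N. if qnorm w * qnorm x \<le> int N then ?t w x else 0)"
        by (rule sum.inter_filter[OF finite_type2_set])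
      finally show "ln (real q) * (\<Sum>x\<in>?A. spin (qmul w x) * h (qnorm x)) = \<dots>" .
    qed
    finally show "(\<Sum>x\<in>?X. if int q dvd qnorm x then ln (real q) * (spin x * h (qnorm x div int q)) else 0) = \<dots>" .
  qed
  also have "\<dots> = (\<Sum>w\<in>prime_elts z N. \<Sum>x\<in>type2_set y z N. if qnorm w * qnorm x \<le> int N then ?t w x else 0)"
    unfolding prime_elts_def
  proof (rule sum.UNION_disjoint[symmetric])
    show "\<forall>i\<in>?Pr. \<forall>j\<in>?Pr. i \<noteq> j \<longrightarrow> primes_over i \<inter> primes_over j = {}"
    proof (intro ballI impI)
      fix i j :: nat assume "i \<noteq> j"
      show "primes_over i \<inter> primes_over j = {}"
      proof (rule equals0I)
        fix w assume "w \<in> primes_over i \<inter> primes_over j"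
        then have "qnorm w = int i" "qnorm w = int j" using primes_over_props(3) by blast+
        then show False using \<open>i \<noteq> j\<close> by simp
      qed
    qed
  qed (use fPr finite_primes_over in auto)
  also have "\<dots> = (\<Sum>x\<in>type2_set y z N. \<Sum>w\<in>prime_elts z N. if qnorm w * qnorm x \<le> int N then ?t w x else 0)"
    by (rule sum.swap)
  also have "\<dots> = (\<Sum>x\<in>type2_set y z N. \<Sum>w | w \<in> prime_elts z N \<and> qnorm w * qnorm x \<le> int N. ?t w x)"
    by (intro sum.cong refl sum.inter_filter[symmetric, OF finite_prime_elts])
  finally show ?thesis .
qed

text \<open>Records the existence statement of \<open>spin_qmul\<close> as a predicate, so that one
  factor can be chosen for each \<open>w\<close> before \<open>x\<close> varies.\<close>

definition spin_factor_spec :: "int \<times> int \<Rightarrow> (int \<Rightarrow> real) \<Rightarrow> bool" where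
  "spin_factor_spec w F \<longleftrightarrow> (\<forall>r. \<bar>F r\<bar> \<le> 1) \<and> (\<forall>c d. c > 0 \<longrightarrow> odd c \<longrightarrow> coprime c d \<longrightarrow> qnorm (c, d) > 0 \<longrightarrow>
      fst (qmul w (c, d)) > 0 \<longrightarrow> fst (qmul w (c, d)) mod 16 = 1 \<longrightarrow>
      spin (qmul w (c, d)) = F (c mod 8) * of_int (Jacobi d c * Jacobi c (qnorm (c, d))) * of_int (qchar (c, d) w))"

definition spin_factor :: "int \<times> int \<Rightarrow> int \<Rightarrow> real" where
  "spin_factor w = (SOME F. spin_factor_spec w F)"

lemma spin_factor:
  assumes "snd w \<noteq> 0" shows "spin_factor_spec w (spin_factor w)"
proof -
  obtain a b where w: "w = (a, b)" by force
  then have b: "b \<noteq> 0" using assms by simp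
  have "\<exists>F. spin_factor_spec w F"
  proof (rule spin_qmul[OF b, of a])
    fix F :: "int \<Rightarrow> real"
    assume F: "\<And>r. \<bar>F r\<bar> \<le> 1"
      "\<And>c d. c > 0 \<Longrightarrow> odd c \<Longrightarrow> coprime c d \<Longrightarrow> qnorm (c, d) > 0 \<Longrightarrow>
      fst (qmul (a, b) (c, d)) > 0 \<Longrightarrow> fst (qmul (a, b) (c, d)) mod 16 = 1 \<Longrightarrow>
      spin (qmul (a, b) (c, d)) = F (c mod 8) * of_int (Jacobi d c * Jacobi c (qnorm (c, d))) * of_int (qchar (c, d) (a, b))"
    have "spin_factor_spec w F" unfolding spin_factor_spec_def
    proof (intro conjI allI impI)
      show "\<bar>F r\<bar> \<le> 1" for r by (rule F(1))
      fix c d :: int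
      assume "c > 0" "odd c" "coprime c d" "qnorm (c, d) > 0" "fst (qmul w (c, d)) > 0" "fst (qmul w (c, d)) mod 16 = 1"
      then show "spin (qmul w (c, d)) = F (c mod 8) * of_int (Jacobi d c * Jacobi c (qnorm (c, d))) * of_int (qchar (c, d) w)"
        unfolding w by (rule F(2))
    qed
    then show "\<exists>F. spin_factor_spec w F" by (intro exI[of _ F])
  qed
  then show ?thesis unfolding spin_factor_def by (rule someI_ex)
qed

text \<open>Fixing this class of \<open>x\<close> decides \<open>spin_cond\<close> of the product
  and the residue of the first coordinate modulo 8, after which the coefficient depends on
  \<open>w\<close> alone. There are 256 classes.\<close>

definition class16 :: "int \<times> int \<Rightarrow> int \<times> int" where
  "class16 x = (fst x mod 16, snd x mod 16)"

lemma spin_cond_class16: "spin_cond (qmul w (class16 x)) \<longleftrightarrow> spin_cond (qmul w x)"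
proof -
  obtain a b c d where wx: "w = (a, b)" "x = (c, d)" by force
  have "16 dvd (c mod 16) - c" "16 dvd (d mod 16) - d" by (simp_all add: mod_eq_dvd_iff[symmetric])
  then obtain s t where st: "c mod 16 = c + 16 * s" "d mod 16 = d + 16 * t"
    by (metis dvdE diff_add_cancel add.commute)
  have "a * (c mod 16) + 2 * b * (d mod 16) = (a * c + 2 * b * d) + 16 * (a * s + 2 * b * t)"
    unfolding st by (simp add: algebra_simps)
  then have 1: "(a * (c mod 16) + 2 * b * (d mod 16)) mod 16 = (a * c + 2 * b * d) mod 16" by (simp only: mod_mult_self2)
  have "a * (d mod 16) + b * (c mod 16) = (a * d + b * c) + 2 * (8 * (a * t + b * s))"
    unfolding st by (simp add: algebra_simps)
  then have 2: "even (a * (d mod 16) + b * (c mod 16)) \<longleftrightarrow> even (a * d + b * c)" by simp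
  show ?thesis using 1 2 by (simp add: wx class16_def spin_cond_def)
qed

text \<open>Dividing by \<open>ln N\<close> normalises the weights to absolute value at most 1; the
  value 0 elsewhere lets that bound hold for every \<open>w\<close>.\<close>

definition type2_beta :: "real \<Rightarrow> nat \<Rightarrow> int \<times> int \<Rightarrow> int \<times> int \<Rightarrow> real" where
  "type2_beta z N \<kappa> w = (if w \<in> prime_elts z N \<and> spin_cond (qmul w \<kappa>)
     then ln (of_int (qnorm w)) / ln (real N) * spin_factor w (fst \<kappa> mod 8) else 0)"

lemma abs_type2_beta:
  assumes "N \<ge> 2" shows "\<bar>type2_beta z N \<kappa> w\<bar> \<le> 1"
proof (cases "w \<in> prime_elts z N \<and> spin_cond (qmul w \<kappa>)")
  case True
  note p = prime_elts_props[OF conjunct1[OF True]]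
  have "real_of_int (qnorm w) \<le> real N" using p(6) by (metis of_int_le_iff of_int_of_nat_eq)
  then have "ln (real_of_int (qnorm w)) \<le> ln (real N)" using p(5) by simp
  moreover have "ln (real_of_int (qnorm w)) \<ge> 0" using p(5) by simp
  moreover have "ln (real N) > 0" using assms by simp
  ultimately have "\<bar>ln (of_int (qnorm w)) / ln (real N)\<bar> \<le> 1" by simp
  moreover have "\<bar>spin_factor w (fst \<kappa> mod 8)\<bar> \<le> 1" using spin_factor[OF p(2)] unfolding spin_factor_spec_def by blast
  ultimately show ?thesis unfolding type2_beta_def if_P[OF True] abs_mult[of "ln _ / ln _"] by (intro mult_le_one) auto
qed (auto simp: type2_beta_def)

text \<open>The part of the spin of \<open>w x\<close> that depends on \<open>x\<close> alone; it
  disappears under the absolute values around the inner sum.\<close>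

definition twist :: "int \<times> int \<Rightarrow> real" where
  "twist x = of_int (Jacobi (snd x) (fst x) * Jacobi (fst x) (qnorm x))"

lemma cond_spin_qmul:
  assumes N: "N \<ge> 2" and w: "w \<in> prime_elts z N" and x: "x \<in> fund_dom" "primitive x" "odd (qnorm x)"
  shows "ln (of_int (qnorm w)) * cond_spin (qmul w x) =
    ln (real N) * twist x * (type2_beta z N (class16 x) w * of_int (qchar x w))"
proof (cases "spin_cond (qmul w x)")
  case True
  note p = prime_elts_props[OF w]
  obtain c d where cd: "x = (c, d)" by force
  have xt: "x \<in> tot_pos" by (rule fund_dom_tot_pos[OF x(1)])
  have c: "c > 0" "odd c" "coprime c d" "qnorm (c, d) > 0" using x xt cd by (auto simp: tot_pos_def primitive_def)
  have "fst (qmul w (c, d)) > 0" using tot_pos_qmul[OF p(3) xt] cd by (simp add: tot_pos_def)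
  moreover have "fst (qmul w (c, d)) mod 16 = 1" using True cd by (simp add: spin_cond_def)
  ultimately have "spin (qmul w (c, d)) = spin_factor w (c mod 8) * of_int (Jacobi d c * Jacobi c (qnorm (c, d))) * of_int (qchar (c, d) w)"
    using spin_factor[OF p(2)] c unfolding spin_factor_spec_def by blast
  then have s: "spin (qmul w x) = spin_factor w (c mod 8) * twist x * of_int (qchar x w)" by (simp add: cd twist_def)
  have k: "fst (class16 x) mod 8 = c mod 8" by (simp add: class16_def cd mod_mod_cancel)
  have "ln (real N) \<noteq> 0" using N by simp
  then show ?thesis using True w by (simp add: cond_spin_def s type2_beta_def spin_cond_class16 k)
next
  case False
  then show ?thesis by (simp add: cond_spin_def type2_beta_def spin_cond_class16)
qed

lemma abs_twist_le_1: "x \<in> fund_dom \<Longrightarrow> odd (qnorm x) \<Longrightarrow> \<bar>twist x\<bar> \<le> 1"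
proof -
  assume x: "x \<in> fund_dom" "odd (qnorm x)"
  obtain c d where cd: "x = (c, d)" by force
  have c: "c > 0" "odd c" using x cd by (auto simp: fund_dom_def)
  have "\<bar>Jacobi d c\<bar> \<le> 1" "\<bar>Jacobi c (qnorm x)\<bar> \<le> 1"
    using Jacobi_abs_le_1[OF c] Jacobi_abs_le_1[OF fund_dom_qnorm_pos[OF x(1)] x(2)] by auto
  then have "\<bar>Jacobi d c * Jacobi c (qnorm x)\<bar> \<le> 1" unfolding abs_mult by (intro mult_le_one) auto
  then show ?thesis unfolding twist_def cd by (simp only: fst_conv snd_conv of_int_abs[symmetric] of_int_le_1_iff)
qed

text \<open>Counts the pairs lost at the edges of the intervals. A pair is determined by the product
  of its norms, the divisor which is the norm of \<open>x\<close>, and elements of these norms: at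
  most \<open>817 * D\<close> and 2 choices.\<close>

lemma card_near_products:
  assumes N: "N \<ge> 2" and \<eta>: "0 < \<eta>" "\<eta> \<le> (1::real)" "\<eta> * real N \<ge> 1"
    and D: "\<And>n. n > 0 \<Longrightarrow> real n \<le> real N ^ 4 \<Longrightarrow> divcount n \<le> D"
  shows "real (card {p \<in> type2_set y z N \<times> prime_elts z N. real N < of_int (qnorm (snd p) * qnorm (fst p)) \<and>
      of_int (qnorm (snd p) * qnorm (fst p)) \<le> (1 + \<eta>) * real N}) \<le> 4 * 817 * (real D)\<^sup>2 * (\<eta> * real N)"
proof -
  let ?S = "{p \<in> type2_set y z N \<times> prime_elts z N. real N < of_int (qnorm (snd p) * qnorm (fst p)) \<and>
      of_int (qnorm (snd p) * qnorm (fst p)) \<le> (1 + \<eta>) * real N}"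
  define I where "I = {n::nat. real N < real n \<and> real n \<le> (1 + \<eta>) * real N}"
  define F where "F = (\<lambda>m. {x \<in> type2_set y z N. qnorm x = int m})"
  have N4: "2 * real N \<le> real N ^ 4"
  proof -
    have "2 ^ 3 \<le> real N ^ 3" using N by (intro power_mono) auto
    then have "real N * 2 \<le> real N * real N ^ 3" by (intro mult_left_mono) auto
    also have "real N * real N ^ 3 = real N ^ 4" by (simp add: power4_eq_xxxx power3_eq_cube)
    finally show ?thesis by simp
  qed
  have Ile: "real n \<le> real N ^ 4" "n > 0" if "n \<in> I" for n
  proof -
    have "(1 + \<eta>) * real N \<le> 2 * real N" using \<eta> by (intro mult_right_mono) auto
    moreover have "real n \<le> (1 + \<eta>) * real N" using that by (simp add: I_def)
    ultimately show "real n \<le> real N ^ 4" using N4 by linarith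
    show "n > 0" using that by (auto simp: I_def intro!: gr0I)
  qed
  have Isub: "I \<subseteq> {N + 1..nat \<lfloor>(1 + \<eta>) * real N\<rfloor>}" by (auto simp: I_def le_nat_iff le_floor_iff)
  then have fI: "finite I" by (rule finite_subset) simp
  have "card I \<le> card {N + 1..nat \<lfloor>(1 + \<eta>) * real N\<rfloor>}" by (rule card_mono[OF _ Isub]) simp
  also have "\<dots> = nat \<lfloor>(1 + \<eta>) * real N\<rfloor> - N" by simp
  finally have c1: "card I \<le> nat \<lfloor>(1 + \<eta>) * real N\<rfloor> - N" .
  define K where "K = nat \<lfloor>(1 + \<eta>) * real N\<rfloor>"
  have "real K \<le> (1 + \<eta>) * real N" using \<eta> by (simp add: K_def)
  also have "(1 + \<eta>) * real N = real N + \<eta> * real N" by (simp add: algebra_simps)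
  finally have "real (K - N) \<le> \<eta> * real N" using \<eta> by (cases "N \<le> K") (simp_all add: of_nat_diff)
  moreover have "real (card I) \<le> real (K - N)" using c1 by (simp only: K_def of_nat_le_iff)
  ultimately have cI: "real (card I) \<le> \<eta> * real N" by linarith
  have fF: "finite (F m)" for m unfolding F_def using finite_type2_set by simp
  have cF: "card (F m) \<le> 817 * D" if m: "m > 0" "real m \<le> real N ^ 4" for m
  proof (cases "F m = {}")
    case False
    then obtain x where "x \<in> F m" by blast
    then have "odd (qnorm x)" "qnorm x = int m" unfolding F_def type2_set_def by blast+
    then have om: "odd (int m)" by metis
    have "card (F m) \<le> card {x \<in> fund_dom. primitive x \<and> qnorm x = int m}"
      by (intro card_mono rev_finite_subset[OF finite_fund_dom[of m]]) (auto simp: F_def type2_set_def)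
    also have "\<dots> \<le> 817 * divcount (nat (int m))" using m om by (intro card_fund_dom_norm) auto
    also have "\<dots> \<le> 817 * D" using D m by simp
    finally show ?thesis .
  qed simp
  have "?S \<subseteq> (\<Union>n\<in>I. \<Union>m\<in>{m. m dvd n}. F m \<times> primes_over (n div m))"
  proof
    fix p assume p: "p \<in> ?S"
    obtain x w where xw: "p = (x, w)" by (cases p) blast
    have mem: "x \<in> type2_set y z N" "w \<in> prime_elts z N" using p xw by auto
    obtain q where q: "prime q" "w \<in> primes_over q" using prime_elts_props(1)[OF mem(2)] by blast
    have q0: "q > 0" using q(1) prime_gt_0_nat by blast
    have nw: "qnorm w = int q" by (rule primes_over_props(3)[OF q(2)])
    define m where "m = nat (qnorm x)"
    have "qnorm x > 0" using mem(1) fund_dom_qnorm_pos by (auto simp: type2_set_def)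
    then have m: "qnorm x = int m" "m > 0" by (auto simp: m_def)
    have pr: "real_of_int (qnorm w * qnorm x) = real (m * q)" unfolding nw m(1) by (simp add: mult.commute)
    have "real N < real (m * q)" "real (m * q) \<le> (1 + \<eta>) * real N" using p unfolding pr[symmetric] xw by auto
    then have "m * q \<in> I" unfolding I_def by blast
    moreover have "x \<in> F m" using mem m by (simp add: F_def)
    moreover have "m * q div m = q" using m by simp
    ultimately show "p \<in> (\<Union>n\<in>I. \<Union>m\<in>{m. m dvd n}. F m \<times> primes_over (n div m))"
      using xw q by (intro UN_I[of "m * q"] UN_I[of m]) auto
  qed
  moreover have fin: "finite {m. m dvd n}" if "n \<in> I" for n using Ile(2)[OF that] by simp
  ultimately have "card ?S \<le> card (\<Union>n\<in>I. \<Union>m\<in>{m. m dvd n}. F m \<times> primes_over (n div m))"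
    using fI fF finite_primes_over by (intro card_mono finite_UN_I finite_cartesian_product) auto
  also have "\<dots> \<le> (\<Sum>n\<in>I. card (\<Union>m\<in>{m. m dvd n}. F m \<times> primes_over (n div m)))" by (rule card_UN_le[OF fI])
  also have "\<dots> \<le> (\<Sum>n\<in>I. D * (817 * D * 2))"
  proof (rule sum_mono)
    fix n assume n: "n \<in> I"
    have "card (\<Union>m\<in>{m. m dvd n}. F m \<times> primes_over (n div m)) \<le> (\<Sum>m | m dvd n. card (F m \<times> primes_over (n div m)))"
      by (rule card_UN_le[OF fin[OF n]])
    also have "\<dots> \<le> (\<Sum>m | m dvd n. 817 * D * 2)"
    proof (rule sum_mono)
      fix m assume "m \<in> {m. m dvd n}"
      then have "m > 0" "m \<le> n" using Ile(2)[OF n] by (auto intro!: gr0I dvd_imp_le)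
      then have "card (F m) \<le> 817 * D" using Ile(1)[OF n] by (intro cF) auto
      then show "card (F m \<times> primes_over (n div m)) \<le> 817 * D * 2"
        unfolding card_cartesian_product using card_primes_over by (intro mult_le_mono)
    qed
    also have "\<dots> = divcount n * (817 * D * 2)" by (simp add: divcount_def)
    also have "\<dots> \<le> D * (817 * D * 2)" using D[OF Ile(2)[OF n] Ile(1)[OF n]] by (intro mult_right_mono) auto
    finally show "card (\<Union>m\<in>{m. m dvd n}. F m \<times> primes_over (n div m)) \<le> D * (817 * D * 2)" .
  qed
  also have "\<dots> = card I * (D * (817 * D * 2))" by simp
  finally have "real (card ?S) \<le> real (card I * (D * (817 * D * 2)))" by (simp only: of_nat_le_iff)
  also have "\<dots> = real (card I) * (2 * 817 * (real D)\<^sup>2)" by (simp add: power2_eq_square)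
  also have "\<dots> \<le> (\<eta> * real N) * (2 * 817 * (real D)\<^sup>2)" using cI by (intro mult_right_mono) auto
  also have "\<dots> \<le> (\<eta> * real N) * (4 * 817 * (real D)\<^sup>2)" using \<eta> by (intro mult_left_mono) auto
  finally show ?thesis by (simp add: mult_ac)
qed

text \<open>On one interval the bound on the product of norms is replaced by a bound on the norm of
  \<open>w\<close> alone. About \<open>2 * lX / \<eta>\<close> intervals, each of cost
  \<open>\<eta> * X * X powr (-1/150)\<close>, balance the edge pairs, which cost
  \<open>\<eta> * X\<close>: the reason for this \<open>\<eta>\<close>.\<close>

theorem type2_bound_aux:
  fixes N D :: nat
  defines "X \<equiv> real N" and "\<eta> \<equiv> real N powr (-1/150)"
  assumes N: "N \<ge> 2" and D: "D \<ge> 1" "\<And>n. n > 0 \<Longrightarrow> real n \<le> real N ^ 4 \<Longrightarrow> divcount n \<le> D"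
  shows "\<bar>type2_sum (X powr (3/100)) (X powr (17/200)) N\<bar> \<le>
    (1024 * block_const + 3268) * (real D ^ 3 * (1 + ln X)\<^sup>2) * X powr (149/150)"
proof -
  define y where "y = X powr (3/100)"
  define z where "z = X powr (17/200)"
  define V where "V = type2_set y z N"
  define PE where "PE = prime_elts z N"
  define \<beta> where "\<beta> = type2_beta z N"
  define lX where "lX = ln X"
  have X: "X \<ge> 2" using N by (simp add: X_def)
  have lX: "lX > 0" using X by (simp add: lX_def)
  have y1: "y \<ge> 1" using X by (simp add: y_def ge_one_powr_ge_zero)
  have z0: "z > 0" using X by (simp add: z_def)
  have fV: "finite V" "finite PE" by (simp_all add: V_def PE_def finite_type2_set finite_prime_elts)
  have V: "x \<in> fund_dom" "primitive x" "odd (qnorm x)" "y < of_int (qnorm x)" "of_int (qnorm x) * z < X" "qnorm x \<le> int N" "qnorm x > 0"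
    if "x \<in> V" for x
    using that fund_dom_qnorm_pos[of x] unfolding V_def type2_set_def X_def by blast+
  have D1: "real D \<ge> 1" using D(1) by simp
  have "X powr (-1/150) \<le> X powr 0" using X by (intro powr_mono) auto
  then have \<eta>: "\<eta> > 0" "\<eta> \<le> 1" using X by (auto simp: \<eta>_def X_def)
  have \<eta>X: "\<eta> * X = X powr (149/150)"
  proof -
    have "\<eta> * X = X powr (-1/150) * X powr 1" using X by (simp add: \<eta>_def X_def)
    then show ?thesis by (simp only: powr_add[symmetric]) simp
  qed
  have \<eta>X1: "\<eta> * X \<ge> 1" unfolding \<eta>X using X by (intro ge_one_powr_ge_zero) auto
  define Mj where "Mj = (\<lambda>j::nat. y * (1 + \<eta>) ^ j)"
  have Mj: "Mj j \<ge> y" "Mj j > 0" "Mj (Suc j) = Mj j * (1 + \<eta>)" for j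
  proof -
    have "(1 + \<eta>) ^ j \<ge> 1" using \<eta> by (intro one_le_power) auto
    then show "Mj j \<ge> y" "Mj j > 0" using y1 by (auto simp: Mj_def)
    show "Mj (Suc j) = Mj j * (1 + \<eta>)" by (simp add: Mj_def)
  qed
  define J where "J = nat \<lceil>2 * lX / \<eta>\<rceil>"
  have J1: "2 * lX / \<eta> \<le> real J" unfolding J_def by linarith
  have "2 * lX / \<eta> \<ge> 0" using lX \<eta> by simp
  then have J2: "real J \<le> 2 * lX / \<eta> + 1" unfolding J_def by linarith
  \<comment> \<open>From \<open>ln (1 + \<eta>) \<ge> \<eta> / 2\<close>: after \<open>J\<close>
    steps the intervals have passed \<open>X\<close>.\<close>
  have MJ: "X \<le> Mj J"
  proof -
    have "- ln (1 + \<eta>) = ln (1 / (1 + \<eta>))" using \<eta> by (simp add: ln_div)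
    also have "\<dots> \<le> 1 / (1 + \<eta>) - 1" using \<eta> by (intro ln_le_minus_one) auto
    also have "\<dots> = - (\<eta> / (1 + \<eta>))" using \<eta> by (simp add: field_simps)
    finally have "\<eta> / (1 + \<eta>) \<le> ln (1 + \<eta>)" by simp
    moreover have "\<eta> / 2 \<le> \<eta> / (1 + \<eta>)" using \<eta> by (intro divide_left_mono) auto
    ultimately have l2: "\<eta> / 2 \<le> ln (1 + \<eta>)" by linarith
    have "lX = (2 * lX / \<eta>) * (\<eta> / 2)" using \<eta> by simp
    also have "\<dots> \<le> real J * ln (1 + \<eta>)" using J1 l2 \<eta> by (intro mult_mono) auto
    also have "\<dots> = ln ((1 + \<eta>) ^ J)" using \<eta> by (simp add: ln_realpow)
    finally have "X \<le> (1 + \<eta>) ^ J" using X \<eta> unfolding lX_def by simp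
    also have "\<dots> \<le> Mj J" using y1 \<eta> mult_right_mono[of 1 y "(1 + \<eta>) ^ J"] by (simp add: Mj_def)
    finally show ?thesis .
  qed
  define jj where "jj = (\<lambda>x. LEAST j. of_int (qnorm x) \<le> Mj (Suc j))"
  have jj: "of_int (qnorm x) \<le> Mj (Suc (jj x))" "Mj (jj x) < of_int (qnorm x)" "jj x < J" if x: "x \<in> V" for x
  proof -
    have qX: "real_of_int (qnorm x) \<le> X" using V(6)[OF x] unfolding X_def by (metis of_int_le_iff of_int_of_nat_eq)
    have "Mj J \<le> Mj (Suc J)" using Mj \<eta> by simp
    then have "of_int (qnorm x) \<le> Mj (Suc J)" using qX MJ by linarith
    then show 1: "of_int (qnorm x) \<le> Mj (Suc (jj x))" unfolding jj_def by (rule LeastI)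
    show 2: "Mj (jj x) < of_int (qnorm x)"
    proof (cases "jj x")
      case 0
      then show ?thesis using V(4)[OF x] by (simp add: Mj_def)
    next
      case (Suc i)
      then have "i < jj x" by simp
      then have "\<not> of_int (qnorm x) \<le> Mj (Suc i)" unfolding jj_def by (rule not_less_Least)
      then show ?thesis using Suc by simp
    qed
    show "jj x < J"
    proof (rule ccontr)
      assume "\<not> jj x < J"
      then have "(1 + \<eta>) ^ J \<le> (1 + \<eta>) ^ jj x" using \<eta> by (intro power_increasing) auto
      then have "Mj J \<le> Mj (jj x)" using y1 by (simp add: Mj_def)
      then show False using 2 qX MJ by linarith
    qed
  qed
  define Pj where "Pj = (\<lambda>j. {w \<in> PE. of_int (qnorm w) \<le> X / Mj j})"
  define e where "e = (\<lambda>x. real (card {w \<in> PE. X < of_int (qnorm w * qnorm x) \<and> of_int (qnorm w * qnorm x) \<le> (1 + \<eta>) * X}))"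
  define T where "T = (\<lambda>x. \<Sum>w | w \<in> PE \<and> qnorm w * qnorm x \<le> int N. \<beta> (class16 x) w * of_int (qchar x w))"
  define U where "U = (\<lambda>j \<kappa> x. \<bar>\<Sum>w\<in>Pj j. \<beta> \<kappa> w * of_int (qchar x w)\<bar>)"
  have wpos: "qnorm w > 0" if "w \<in> PE" for w using prime_elts_props(5)[of w z N] that by (simp add: PE_def)
  have \<beta>1: "\<bar>\<beta> \<kappa> w\<bar> \<le> 1" for \<kappa> w unfolding \<beta>_def by (rule abs_type2_beta[OF N])
  \<comment> \<open>The independent range \<open>Pj\<close> contains the true one, and anything in
    excess has a product of norms between \<open>X\<close> and
    \<open>(1 + \<eta>) * X\<close>.\<close>
  have T_le: "\<bar>T x\<bar> \<le> U (jj x) (class16 x) x + e x" if x: "x \<in> V" for x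
  proof -
    let ?b = "\<lambda>w. \<beta> (class16 x) w * of_int (qchar x w)"
    let ?A = "{w. w \<in> PE \<and> qnorm w * qnorm x \<le> int N}"
    have qle: "qnorm w * qnorm x \<le> int N \<longleftrightarrow> of_int (qnorm w * qnorm x) \<le> X" for w
      unfolding X_def by (metis of_int_le_iff of_int_of_nat_eq)
    have sub: "?A \<subseteq> Pj (jj x)"
    proof
      fix w assume w: "w \<in> ?A"
      have "of_int (qnorm w) * Mj (jj x) \<le> real_of_int (qnorm w) * of_int (qnorm x)"
        using jj(2)[OF x] wpos[of w] w by (intro mult_left_mono) auto
      also have "\<dots> \<le> X" using w qle by simp
      finally have "of_int (qnorm w) \<le> X / Mj (jj x)" using Mj(2) by (simp add: pos_le_divide_eq)
      then show "w \<in> Pj (jj x)" using w by (simp add: Pj_def)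
    qed
    have fP: "finite (Pj (jj x))" using fV by (simp add: Pj_def)
    have b1: "\<bar>?b w\<bar> \<le> 1" for w
    proof -
      obtain a b where "w = (a, b)" by force
      then have "\<bar>qchar x w\<bar> \<le> 1" using Jacobi_abs_le_1[OF V(7)[OF x] V(3)[OF x]] by simp
      then have "\<bar>real_of_int (qchar x w)\<bar> \<le> 1" by (simp only: of_int_abs[symmetric] of_int_le_1_iff)
      then show ?thesis unfolding abs_mult using \<beta>1 by (intro mult_le_one) auto
    qed
    have "T x = (\<Sum>w\<in>Pj (jj x). ?b w) - (\<Sum>w\<in>Pj (jj x) - ?A. ?b w)"
      unfolding T_def using sum.subset_diff[OF sub fP, of ?b] by simp
    moreover have "\<bar>\<Sum>w\<in>Pj (jj x) - ?A. ?b w\<bar> \<le> e x"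
    proof -
      have "\<bar>\<Sum>w\<in>Pj (jj x) - ?A. ?b w\<bar> \<le> (\<Sum>w\<in>Pj (jj x) - ?A. \<bar>?b w\<bar>)" by (rule sum_abs)
      also have "\<dots> \<le> (\<Sum>w\<in>Pj (jj x) - ?A. 1)" by (intro sum_mono b1)
      also have "\<dots> = real (card (Pj (jj x) - ?A))" by simp
      also have "\<dots> \<le> e x" unfolding e_def of_nat_le_iff
      proof (rule card_mono)
        show "Pj (jj x) - ?A \<subseteq> {w \<in> PE. X < of_int (qnorm w * qnorm x) \<and> of_int (qnorm w * qnorm x) \<le> (1 + \<eta>) * X}"
        proof
          fix w assume w: "w \<in> Pj (jj x) - ?A"
          then have wP: "w \<in> PE" "of_int (qnorm w) \<le> X / Mj (jj x)" by (auto simp: Pj_def)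
          have gt: "X < of_int (qnorm w * qnorm x)" using w wP qle[of w] by auto
          have "real_of_int (qnorm w) * of_int (qnorm x) \<le> (X / Mj (jj x)) * (Mj (jj x) * (1 + \<eta>))"
            using wP wpos[OF wP(1)] jj(1)[OF x] V(7)[OF x] Mj(2)[of "jj x"] X unfolding Mj(3) by (intro mult_mono) auto
          also have "\<dots> = (1 + \<eta>) * X" using Mj(2)[of "jj x"] by simp
          finally show "w \<in> {w \<in> PE. X < of_int (qnorm w * qnorm x) \<and> of_int (qnorm w * qnorm x) \<le> (1 + \<eta>) * X}"
            using wP gt by simp
        qed
      qed (use fV in simp)
      finally show ?thesis .
    qed
    ultimately show ?thesis unfolding U_def by linarith
  qed
  have t2: "type2_sum y z N = (\<Sum>x\<in>V. lX * twist x * moebius_trunc y (nat (qnorm x)) * T x)"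
    unfolding type2_sum_eq[OF y1 z0] V_def[symmetric] PE_def[symmetric]
  proof (rule sum.cong[OF refl])
    fix x assume x: "x \<in> V"
    show "(\<Sum>w | w \<in> PE \<and> qnorm w * qnorm x \<le> int N. ln (of_int (qnorm w)) * cond_spin (qmul w x) * moebius_trunc y (nat (qnorm x)))
       = lX * twist x * moebius_trunc y (nat (qnorm x)) * T x"
      unfolding T_def sum_distrib_left
    proof (rule sum.cong[OF refl])
      fix w assume "w \<in> {w. w \<in> PE \<and> qnorm w * qnorm x \<le> int N}"
      then have w: "w \<in> prime_elts z N" by (simp add: PE_def)
      show "ln (of_int (qnorm w)) * cond_spin (qmul w x) * moebius_trunc y (nat (qnorm x)) =
         lX * twist x * moebius_trunc y (nat (qnorm x)) * (\<beta> (class16 x) w * of_int (qchar x w))"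
        unfolding cond_spin_qmul[OF N w V(1-3)[OF x]] lX_def X_def \<beta>_def by (simp only: mult_ac)
    qed
  qed
  have coef: "\<bar>lX * twist x * moebius_trunc y (nat (qnorm x)) * T x\<bar> \<le> (lX * real D) * (U (jj x) (class16 x) x + e x)" if x: "x \<in> V" for x
  proof -
    have "\<bar>twist x\<bar> \<le> 1" by (rule abs_twist_le_1[OF V(1,3)[OF x]])
    moreover have "\<bar>moebius_trunc y (nat (qnorm x))\<bar> \<le> real D"
    proof -
      have "real N \<le> real N ^ 4" using N by (intro self_le_power) auto
      moreover have "real (nat (qnorm x)) \<le> real N" using V(6)[OF x] by linarith
      ultimately have "real (nat (qnorm x)) \<le> real N ^ 4" by (rule order_trans[rotated])
      moreover have "nat (qnorm x) > 0" using V(7)[OF x] by simp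
      ultimately have "divcount (nat (qnorm x)) \<le> D" using D(2) by blast
      then show ?thesis using abs_moebius_trunc_le[of "nat (qnorm x)" y] V(7)[OF x] by simp
    qed
    ultimately have "lX * \<bar>twist x\<bar> * \<bar>moebius_trunc y (nat (qnorm x))\<bar> * \<bar>T x\<bar> \<le> lX * 1 * real D * (U (jj x) (class16 x) x + e x)"
      using T_le[OF x] lX by (intro mult_mono) auto
    then show ?thesis using lX by (simp add: abs_mult)
  qed
  define K where "K = ({0..<16} :: int set) \<times> ({0..<16} :: int set)"
  have fK: "finite ({..<J} \<times> K)" by (simp add: K_def)
  have US: "(\<Sum>x\<in>V. U (jj x) (class16 x) x) \<le> (real J * 256) * (block_const * (real D)\<^sup>2 * (\<eta> * X) * X powr (-1/150))"
  proof -
    let ?bb = "block_const * (real D)\<^sup>2 * (\<eta> * X) * X powr (-1/150)"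
    have bb0: "?bb \<ge> 0" using \<eta> X by (simp add: block_const_def)
    have im: "(\<lambda>x. (jj x, class16 x)) ` V \<subseteq> {..<J} \<times> K" using jj(3) by (auto simp: K_def class16_def)
    have "(\<Sum>x\<in>V. U (jj x) (class16 x) x) = (\<Sum>i\<in>{..<J} \<times> K. \<Sum>x | x \<in> V \<and> (jj x, class16 x) = i. U (jj x) (class16 x) x)"
      by (rule sum.group[OF fV(1) fK im, symmetric])
    also have "\<dots> \<le> (\<Sum>i\<in>{..<J} \<times> K. ?bb)"
    proof (rule sum_mono)
      fix i assume "i \<in> {..<J} \<times> K"
      obtain j \<kappa> where i: "i = (j, \<kappa>)" by (cases i) blast
      define W where "W = {x. x \<in> V \<and> (jj x, class16 x) = i}"
      have "(\<Sum>x\<in>W. U (jj x) (class16 x) x) = (\<Sum>x\<in>W. \<bar>\<Sum>w\<in>Pj j. \<beta> \<kappa> w * of_int (qchar x w)\<bar>)"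
        unfolding U_def by (intro sum.cong refl) (auto simp: W_def i)
      also have "\<dots> \<le> ?bb"
      proof (cases "W = {}")
        case True
        then show ?thesis using bb0 by simp
      next
        case False
        then obtain x0 where x0: "x0 \<in> V" "jj x0 = j" by (auto simp: W_def i)
        have "Mj j * z \<le> of_int (qnorm x0) * z" using jj(2)[OF x0(1)] x0(2) z0 by (intro mult_right_mono) auto
        then have "Mj j * z \<le> X" using V(5)[OF x0(1)] by linarith
        then have "Mj j \<le> X / z" using z0 by (simp add: pos_le_divide_eq)
        also have "X / z = X powr (183/200)"
        proof -
          have "X / z = X powr 1 / X powr (17/200)" using X by (simp add: z_def)
          then show ?thesis by (simp only: powr_diff[symmetric]) simp
        qed
        finally have M2: "Mj j \<le> X powr (183/200)" .
        have M1: "X powr (3/100) \<le> Mj j" using Mj(1)[of j] by (simp add: y_def)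
        show ?thesis
          unfolding \<eta>_def X_def[symmetric]
        proof (rule block_bound[OF X M1 M2 D(1)])
          fix n :: nat assume "n > 0" "real n \<le> X ^ 4"
          then show "divcount n \<le> D" using D(2) by (simp add: X_def)
        next
          show "finite W" using fV by (simp add: W_def)
          show "W \<subseteq> fund_dom" using V(1) by (auto simp: W_def)
          fix x assume "x \<in> W"
          then have x: "x \<in> V" "jj x = j" by (auto simp: W_def i)
          show "primitive x \<and> odd (qnorm x) \<and> Mj j < of_int (qnorm x) \<and> of_int (qnorm x) \<le> Mj j * (1 + X powr (-1/150))"
            using V(2,3)[OF x(1)] jj(1,2)[OF x(1)] unfolding x(2) Mj(3) \<eta>_def X_def by blast
        next
          show "finite (Pj j)" using fV by (simp add: Pj_def)
          fix w assume "w \<in> Pj j"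
          then show "(\<exists>q. prime q \<and> w \<in> primes_over q) \<and> real_of_int (qnorm w) \<le> X / Mj j"
            using prime_elts_props(1)[of w z N] by (simp add: Pj_def PE_def)
        qed (rule \<beta>1)
      qed
      finally show "(\<Sum>x | x \<in> V \<and> (jj x, class16 x) = i. U (jj x) (class16 x) x) \<le> ?bb" by (simp only: W_def)
    qed
    also have "\<dots> = (real J * 256) * ?bb" by (simp add: card_cartesian_product K_def)
    finally show ?thesis .
  qed
  have ES: "(\<Sum>x\<in>V. e x) \<le> 4 * 817 * (real D)\<^sup>2 * (\<eta> * X)"
  proof -
    have "(\<Sum>x\<in>V. e x) = real (\<Sum>x\<in>V. card {w \<in> PE. X < of_int (qnorm w * qnorm x) \<and> of_int (qnorm w * qnorm x) \<le> (1 + \<eta>) * X})"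
      by (simp add: e_def)
    also have "(\<Sum>x\<in>V. card {w \<in> PE. X < of_int (qnorm w * qnorm x) \<and> of_int (qnorm w * qnorm x) \<le> (1 + \<eta>) * X}) =
       card (Sigma V (\<lambda>x. {w \<in> PE. X < of_int (qnorm w * qnorm x) \<and> of_int (qnorm w * qnorm x) \<le> (1 + \<eta>) * X}))"
      using fV by (subst card_SigmaI) auto
    also have "Sigma V (\<lambda>x. {w \<in> PE. X < of_int (qnorm w * qnorm x) \<and> of_int (qnorm w * qnorm x) \<le> (1 + \<eta>) * X}) =
       {p \<in> type2_set y z N \<times> prime_elts z N. real N < of_int (qnorm (snd p) * qnorm (fst p)) \<and>
          of_int (qnorm (snd p) * qnorm (fst p)) \<le> (1 + \<eta>) * real N}"
      unfolding V_def PE_def X_def by auto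
    also have "real (card \<dots>) \<le> 4 * 817 * (real D)\<^sup>2 * (\<eta> * real N)"
      using \<eta>X1 by (intro card_near_products[OF N \<eta>] D(2)) (auto simp: X_def)
    finally show ?thesis by (simp add: X_def)
  qed
  define G where "G = (real D)\<^sup>2 * X powr (149/150)"
  have G0: "G \<ge> 0" by (simp add: G_def)
  have US': "(\<Sum>x\<in>V. U (jj x) (class16 x) x) \<le> (1024 * block_const) * (1 + lX) * G"
  proof -
    have b0: "block_const \<ge> 0" by (simp add: block_const_def)
    have "real J * \<eta> \<le> (2 * lX / \<eta> + 1) * \<eta>" using J2 \<eta> by (intro mult_right_mono) auto
    also have "\<dots> = 2 * lX + \<eta>" using \<eta> by (simp add: field_simps)
    also have "\<dots> \<le> 4 * (1 + lX)" using \<eta> lX by simp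
    finally have JE: "real J * \<eta> \<le> 4 * (1 + lX)" .
    have XX: "X * X powr (-1/150) = X powr (149/150)" using \<eta>X by (simp add: \<eta>_def X_def mult.commute)
    have "(real J * 256) * (block_const * (real D)\<^sup>2 * (\<eta> * X) * X powr (-1/150)) =
       (real J * \<eta>) * (256 * block_const * (real D)\<^sup>2 * (X * X powr (-1/150)))" by (simp only: mult_ac)
    also have "\<dots> \<le> (4 * (1 + lX)) * (256 * block_const * (real D)\<^sup>2 * (X * X powr (-1/150)))"
      using JE b0 X by (intro mult_right_mono) auto
    also have "\<dots> = (1024 * block_const) * (1 + lX) * G" unfolding XX G_def by simp
    finally show ?thesis using US by linarith
  qed
  have ES': "(\<Sum>x\<in>V. e x) \<le> 3268 * (1 + lX) * G"
  proof -
    have "(\<Sum>x\<in>V. e x) \<le> 3268 * 1 * G" using ES unfolding \<eta>X G_def by simp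
    also have "\<dots> \<le> 3268 * (1 + lX) * G" using lX G0 by (intro mult_right_mono mult_left_mono) auto
    finally show ?thesis .
  qed
  have "\<bar>type2_sum y z N\<bar> \<le> (\<Sum>x\<in>V. \<bar>lX * twist x * moebius_trunc y (nat (qnorm x)) * T x\<bar>)"
    unfolding t2 by (rule sum_abs)
  also have "\<dots> \<le> (\<Sum>x\<in>V. (lX * real D) * (U (jj x) (class16 x) x + e x))" by (intro sum_mono coef)
  also have "\<dots> = (lX * real D) * ((\<Sum>x\<in>V. U (jj x) (class16 x) x) + (\<Sum>x\<in>V. e x))"
    by (simp only: sum_distrib_left[symmetric] sum.distrib)
  also have "\<dots> \<le> ((1 + lX) * real D) * ((1024 * block_const) * (1 + lX) * G + 3268 * (1 + lX) * G)"
  proof (rule mult_mono)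
    show "(\<Sum>x\<in>V. U (jj x) (class16 x) x) + (\<Sum>x\<in>V. e x) \<le> (1024 * block_const) * (1 + lX) * G + 3268 * (1 + lX) * G"
      using US' ES' by (rule add_mono)
    show "0 \<le> (\<Sum>x\<in>V. U (jj x) (class16 x) x) + (\<Sum>x\<in>V. e x)"
      by (intro add_nonneg_nonneg sum_nonneg) (auto simp: U_def e_def)
  qed (use lX in \<open>auto intro: mult_right_mono\<close>)
  also have "\<dots> = (1024 * block_const + 3268) * (real D ^ 3 * (1 + lX)\<^sup>2) * X powr (149/150)"
    by (simp add: G_def power2_eq_square power3_eq_cube algebra_simps)
  finally show ?thesis by (simp only: y_def z_def lX_def)
qed

theorem type2_bound:
  assumes "\<epsilon> > 0"
  obtains C where "C > 0" "\<And>N. N \<ge> 2 \<Longrightarrow>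
    \<bar>type2_sum (real N powr (3/100)) (real N powr (17/200)) N\<bar> \<le> C * real N powr (149/150 + \<epsilon>)"
proof -
  \<comment> \<open>Three divisor bounds at arguments up to \<open>N ^ 4\<close> cost
    \<open>12 * \<delta>\<close> and two logarithms cost \<open>2 * \<delta>\<close>.\<close>
  define \<delta> where "\<delta> = \<epsilon> / 14"
  have d: "\<delta> > 0" using assms by (simp add: \<delta>_def)
  obtain K where K: "K \<ge> 1" "\<And>n. n > 0 \<Longrightarrow> real (divcount n) \<le> K * real n powr \<delta>"
    using divcount_bound[OF d] by blast
  define A where "A = 1024 * block_const + 3268"
  have A0: "A > 0" by (simp add: A_def block_const_def)
  show ?thesis
  proof
    show "A * (K ^ 3 * (1 + 1/\<delta>)\<^sup>2) > 0" using A0 K(1) d by (intro mult_pos_pos zero_less_power) (auto simp: add_pos_pos)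
    fix N :: nat assume N: "N \<ge> 2"
    define X where "X = real N"
    have X: "X \<ge> 2" using N by (simp add: X_def)
    have x1: "X powr (4 * \<delta>) \<ge> 1" using X d by (intro ge_one_powr_ge_zero) auto
    define D where "D = nat \<lfloor>K * X powr (4 * \<delta>)\<rfloor>"
    have KX: "K * X powr (4 * \<delta>) \<ge> 1" using K(1) x1 mult_mono[of 1 K 1 "X powr (4 * \<delta>)"] by simp
    have D1: "D \<ge> 1" using KX by (simp add: D_def le_nat_iff le_floor_iff)
    have D2: "divcount n \<le> D" if "n > 0" "real n \<le> real N ^ 4" for n
    proof -
      have "real (divcount n) \<le> K * real n powr \<delta>" by (rule K(2)[OF that(1)])
      also have "\<dots> \<le> K * (X ^ 4) powr \<delta>" using that d K(1) by (intro mult_left_mono powr_mono2) (auto simp: X_def)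
      also have "(X ^ 4) powr \<delta> = X powr (4 * \<delta>)" using X by (simp add: powr_powr flip: powr_numeral)
      finally show ?thesis unfolding D_def by (simp add: le_nat_iff le_floor_iff)
    qed
    have D3: "real D \<le> K * X powr (4 * \<delta>)" unfolding D_def using KX by simp
    have "\<bar>type2_sum (X powr (3/100)) (X powr (17/200)) N\<bar> \<le> A * (real D ^ 3 * (1 + ln X)\<^sup>2) * X powr (149/150)"
      unfolding A_def X_def by (rule type2_bound_aux[OF N D1 D2])
    also have "\<dots> \<le> A * ((K * X powr (4 * \<delta>)) ^ 3 * ((1 + 1/\<delta>) * X powr \<delta>)\<^sup>2) * X powr (149/150)"
      using A0 D3 one_plus_ln_le_powr[of X \<delta>] X d K(1)
      by (intro mult_right_mono mult_left_mono mult_mono power_mono) auto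
    also have "\<dots> = A * (K ^ 3 * (1 + 1/\<delta>)\<^sup>2) * ((X powr (4 * \<delta>)) ^ 3 * (X powr \<delta>)\<^sup>2 * X powr (149/150))"
      by (simp add: power_mult_distrib mult_ac)
    also have "(X powr (4 * \<delta>)) ^ 3 * (X powr \<delta>)\<^sup>2 * X powr (149/150) = X powr (149/150 + \<epsilon>)"
      using X by (simp add: powr_power powr_add[symmetric] \<delta>_def add.commute)
    finally show "\<bar>type2_sum (real N powr (3/100)) (real N powr (17/200)) N\<bar> \<le> A * (K ^ 3 * (1 + 1/\<delta>)\<^sup>2) * real N powr (149/150 + \<epsilon>)"
      by (simp add: X_def)
  qed
qed

section \<open>Sums over primes\<close>

lemma spin_set_qnorm_mod16:
  assumes "x \<in> spin_set" shows "qnorm x mod 16 = 15"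
proof -
  obtain u v where x: "x = (u, v)" by force
  have u: "u mod 16 = 1" and v: "odd v" using assms x by (auto simp: spin_set_iff spin_cond_def)
  obtain s where s: "u = 1 + 16 * s" using u by (metis add.commute mult_div_mod_eq)
  obtain t where t: "v = 2 * t + 1" using v by (auto elim: oddE)
  have "2 dvd t * (t + 1)" by simp
  then obtain r where r: "t * (t + 1) = 2 * r" by (rule dvdE)
  have "qnorm x = - 1 + 16 * (2 * s + 16 * s * s) - 8 * (t * (t + 1))"
    by (simp add: x s t power2_eq_square algebra_simps)
  also have "\<dots> = 15 + 16 * (2 * s + 16 * s * s - r - 1)" unfolding r by simp
  finally have "qnorm x = 15 + 16 * (2 * s + 16 * s * s - r - 1)" .
  then show ?thesis by (simp only: mod_mult_self2) simp
qed

text \<open>These are the even powers of \<open>1 + \<surd>2\<close> from -2 to 4; the half-open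
  cone keeps \<open>(17, 12)\<close> and drops \<open>(17, - 12)\<close>. The bound
  \<open>a \<le> 17\<close> makes the check finite.\<close>

lemma unit_in_fund_dom:
  assumes "e \<in> fund_dom" "qnorm e = 1"
  shows "e \<in> {(1, 0), (3, 2), (3, -2), (17, 12)}"
proof -
  obtain a b where e: "e = (a, b)" by force
  have a: "a > 0" "- 12 * a < 17 * b" "17 * b \<le> 12 * a" and n: "a\<^sup>2 = 1 + 2 * b\<^sup>2"
    using assms e by (auto simp: fund_dom_def)
  have "a\<^sup>2 \<le> 289" using fund_dom_sq_le[of a b] assms e by simp
  then have "a\<^sup>2 \<le> 17\<^sup>2" by simp
  then have a17: "a \<le> 17" by (rule power2_le_imp_le) simp
  then have b12: "- 12 \<le> b" "b \<le> 12" using a by linarith+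
  have "\<forall>a\<in>set [1..17]. \<forall>b\<in>set [-12..12]. a * a = 1 + 2 * (b * b) \<longrightarrow> - 12 * a < 17 * b \<longrightarrow>
      (a, b) \<in> {(1, 0), (3, 2), (3, -2), (17, 12 :: int)}" by code_simp
  moreover have "a \<in> {1..17}" "b \<in> {-12..12}" using a a17 b12 by auto
  then have "a \<in> set [1..17]" "b \<in> set [-12..12]" by (simp_all only: set_upto)
  moreover have "a * a = 1 + 2 * (b * b)" using n by (simp add: power2_eq_square)
  ultimately show ?thesis using a(2) e by blast
qed

text \<open>The quotient is a unit of norm 1, up to \<open>unit_eta\<close> one of four. The
  nontrivial ones break the congruence on the first coordinate: \<open>3 u \<plusminus> 4 v\<close>
  is 7 modulo 8, and \<open>17 u + 24 v\<close> is 9 modulo 16.\<close>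

lemma spin_cond_associate:
  assumes w: "w \<in> tot_pos" "spin_cond w" and x: "x \<in> fund_dom" "spin_cond x" "qnorm x = qnorm w" "qdvd w x"
  shows "x = eta_rep w"
proof -
  obtain e where e: "x = qmul w e" using x(4) by (auto simp: qdvd_def)
  have xt: "x \<in> tot_pos" by (rule fund_dom_tot_pos[OF x(1)])
  have et: "e \<in> tot_pos" using tot_pos_quotient[OF w(1)] xt e by simp
  have wn: "qnorm w > 0" using w(1) by (simp add: tot_pos_def)
  have "qnorm w * qnorm e = qnorm w * 1" using x(3) e by (simp add: qnorm_qmul)
  then have ne: "qnorm e = 1" using wn by simp
  define f where "f = eta_rep e"
  have f: "f \<in> fund_dom" "eta_equiv e f" using eta_rep[OF et] by (auto simp: f_def)
  have nf: "qnorm f = 1" using eta_equiv_qnorm[OF f(2)] ne by simp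
  have eq: "eta_equiv x (qmul w f)" using eta_equiv_qmul[OF f(2)] e by simp
  have wf: "qmul w f \<in> tot_pos" by (rule tot_pos_qmul[OF w(1) fund_dom_tot_pos[OF f(1)]])
  have cond: "spin_cond (qmul w f)" using spin_eta_equiv(1)[OF xt wf eq] x(2) by simp
  obtain u v where uv: "w = (u, v)" by force
  have u: "u mod 16 = 1" and v: "odd v" using w(2) uv by (auto simp: spin_cond_def)
  obtain s where s: "u = 1 + 16 * s" using u by (metis add.commute mult_div_mod_eq)
  obtain t where t: "v = 2 * t + 1" using v by (auto elim: oddE)
  have "f = (1, 0)"
  proof (rule ccontr)
    assume "f \<noteq> (1, 0)"
    then consider "f = (3, 2)" | "f = (3, -2)" | "f = (17, 12)" using unit_in_fund_dom[OF f(1) nf] by blast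
    then show False
    proof cases
      case 1
      then have "(3 * u + 4 * v) mod 16 = 1" using cond uv by (simp add: spin_cond_def algebra_simps)
      then have "(3 * u + 4 * v) mod 8 = 1" using mod_mod_cancel[of 8 16 "3 * u + 4 * v"] by simp
      moreover have "3 * u + 4 * v = 7 + 8 * (6 * s + t)" by (simp add: s t)
      ultimately show False by (simp only: mod_mult_self2) simp
    next
      case 2
      then have "(3 * u - 4 * v) mod 16 = 1" using cond uv by (simp add: spin_cond_def algebra_simps)
      then have "(3 * u - 4 * v) mod 8 = 1" using mod_mod_cancel[of 8 16 "3 * u - 4 * v"] by simp
      moreover have "3 * u - 4 * v = 7 + 8 * (6 * s - t - 1)" by (simp add: s t)
      ultimately show False by (simp only: mod_mult_self2) simp
    next
      case 3
      then have "(17 * u + 24 * v) mod 16 = 1" using cond uv by (simp add: spin_cond_def algebra_simps)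
      moreover have "17 * u + 24 * v = 9 + 16 * (17 * s + 3 * t + 2)" by (simp add: s t)
      ultimately show False by (simp only: mod_mult_self2) simp
    qed
  qed
  then have "eta_equiv x w" using eq by (simp add: qmul_commute[of w])
  then show ?thesis using eta_rep_eqI[OF w(1) x(1)] eta_equiv_sym by metis
qed

text \<open>The two elements of norm \<open>p\<close> are the representatives of
  \<open>(u, v)\<close> and its conjugate. They are distinct, and their spins agree because -1 has
  symbol 1 at \<open>u\<close>. Hence the symbol does not depend on the representation of
  \<open>p\<close>.\<close>

lemma spin_coeff_prime:
  assumes p: "prime p" "[int p = -1] (mod 16)" and uv: "int p = u\<^sup>2 - 2 * v\<^sup>2" "u > 0" "[u = 1] (mod 16)"
  shows "spin_coeff p = 2 * jac u v"
proof -
  have u16: "u mod 16 = 1" using uv(3) by (simp add: cong_def)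
  have ou: "odd u" using u16 by (rule odd_if_mod_16)
  have p16: "int p mod 16 = 15" using p(2) by (simp add: cong_def)
  then have op: "odd (int p)" by presburger
  have pp: "prime (int p)" using p(1) by simp
  \<comment> \<open>An even \<open>v\<close> would make the norm 1 modulo 8.\<close>
  have ov: "odd v"
  proof
    assume "even v"
    then obtain t where t: "v = 2 * t" by (auto elim: evenE)
    obtain s where s: "u = 1 + 16 * s" using u16 by (metis add.commute mult_div_mod_eq)
    have "int p = 1 + 8 * (4 * s + 32 * s * s - t * t)" using uv(1) by (simp add: s t power2_eq_square algebra_simps)
    then have "int p mod 8 = 1" by (metis mod_mult_self2 mod_pos_pos_trivial numeral_One numeral_less_iff semiring_norm(76) zero_le_one)
    then show False using p16 mod_mod_cancel[of 8 16 "int p"] by simp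
  qed
  have p0: "int p > 0" using p(1) prime_gt_0_nat by simp
  define w where "w = (u, v)"
  define w' where "w' = (u, - v)"
  have n: "qnorm w = int p" "qnorm w' = int p" using uv by (auto simp: w_def w'_def)
  have tp: "w \<in> tot_pos" "w' \<in> tot_pos" using uv(2) n p0 by (auto simp: tot_pos_def w_def w'_def)
  have sc: "spin_cond w" "spin_cond w'" using u16 ov by (auto simp: spin_cond_def w_def w'_def)
  have Ju: "Jacobi (- v) u = Jacobi v u"
  proof -
    have "Jacobi ((-1) * v) u = Jacobi (-1) u * Jacobi v u" by (rule Jacobi_mult_top[OF uv(2) ou])
    moreover have "u mod 4 = 1" using u16 mod_mod_cancel[of 4 16 u] by simp
    ultimately show ?thesis using Jacobi_minus_1[OF uv(2) ou] by simp
  qed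
  define x where "x = eta_rep w"
  define x' where "x' = eta_rep w'"
  note r = eta_rep[OF tp(1)] and r' = eta_rep[OF tp(2)]
  have xs: "x \<in> spin_set" "qnorm x = int p" "spin x = jac u v"
    using r spin_eta_equiv[OF tp(1) fund_dom_tot_pos[OF r(1)] r(2)] sc n eta_equiv_qnorm[OF r(2)]
    by (auto simp: x_def spin_set_iff w_def)
  have xs': "x' \<in> spin_set" "qnorm x' = int p" "spin x' = jac u v"
    using r' spin_eta_equiv[OF tp(2) fund_dom_tot_pos[OF r'(1)] r'(2)] sc n eta_equiv_qnorm[OF r'(2)] Ju
    by (auto simp: x'_def spin_set_iff w'_def)
  have uvp: "u\<^sup>2 - 2 * v\<^sup>2 = int p" "u\<^sup>2 - 2 * (- v)\<^sup>2 = int p" using uv(1) by auto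
  note nd = prime_norm_not_dvd[OF pp op uvp(1)]
  have ne: "x \<noteq> x'"
  proof
    assume "x = x'"
    then have "eta_equiv w w'" using r(2) eta_equiv_sym[OF r'(2)] eta_equiv_trans unfolding x_def x'_def by metis
    moreover have "qdvd w w" unfolding qdvd_def by (rule exI[of _ "(1, 0)"]) (simp add: qmul_commute[of w])
    ultimately have "qdvd (u, v) (u, - v)" using qdvd_eta_equiv[OF _ tp(1)] by (simp add: w_def w'_def)
    then have "int p dvd (- v) * u - u * v" using qdvd_iff[OF pp op uvp(1)] by blast
    then have "int p dvd - (2 * (u * v))" by (simp add: algebra_simps)
    then have "int p dvd 2 * (u * v)" by (simp only: dvd_minus_iff)
    then show False using odd_prime_not_dvd_2[OF pp op] nd pp prime_dvd_mult_iff by blast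
  qed
  have "{y. y \<in> spin_set \<and> qnorm y = int p} = {x, x'}"
  proof (rule equalityI; rule subsetI)
    fix y assume "y \<in> {y. y \<in> spin_set \<and> qnorm y = int p}"
    then have y: "y \<in> fund_dom" "spin_cond y" "qnorm y = int p" by (auto simp: spin_set_iff)
    obtain c d where cd: "y = (c, d)" by force
    have ny: "c\<^sup>2 - 2 * d\<^sup>2 = int p" using y(3) cd by simp
    have "(d * u - c * v) * (d * u - c * (- v)) = int p * d\<^sup>2 - v\<^sup>2 * int p"
    proof -
      have e: "u * u = int p + 2 * (v * v)" "c * c = int p + 2 * (d * d)" using uvp(1) ny by (simp_all add: power2_eq_square)
      have "(d * u - c * v) * (d * u - c * (- v)) = (d * d) * (u * u) - (v * v) * (c * c)" by (simp add: algebra_simps)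
      then show ?thesis unfolding e by (simp add: power2_eq_square algebra_simps)
    qed
    then have "int p dvd (d * u - c * v) * (d * u - c * (- v))" by simp
    then have "int p dvd d * u - c * v \<or> int p dvd d * u - c * (- v)" using pp prime_dvd_mult_iff by blast
    then have "qdvd w y \<or> qdvd w' y"
      using qdvd_iff[OF pp op uvp(1), of c d] qdvd_iff[OF pp op uvp(2), of c d] by (simp add: w_def w'_def cd)
    then show "y \<in> {x, x'}"
      using spin_cond_associate[OF tp(1) sc(1) y(1,2)] spin_cond_associate[OF tp(2) sc(2) y(1,2)] y(3) n
      by (auto simp: x_def x'_def)
  qed (use xs xs' in auto)
  then show ?thesis using ne xs(3) xs'(3) by (simp add: spin_coeff_def)
qed

lemma spin_coeff_eq_0:
  assumes "int n mod 16 \<noteq> 15" shows "spin_coeff n = 0"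
proof -
  have "{x. x \<in> spin_set \<and> qnorm x = int n} = {}" using spin_set_qnorm_mod16 assms by fastforce
  then show ?thesis by (simp only: spin_coeff_def sum.empty)
qed

lemma abs_spin_coeff_le:
  assumes "n > 0" shows "\<bar>spin_coeff n\<bar> \<le> 817 * real (divcount n)"
proof (cases "odd n")
  case True
  let ?S = "{x. x \<in> spin_set \<and> qnorm x = int n}"
  let ?P = "{x \<in> fund_dom. primitive x \<and> qnorm x = int n}"
  have fS: "finite ?S" by (rule finite_subset[OF _ finite_spin_set[of n]]) auto
  have fP: "finite ?P" by (rule finite_subset[OF _ finite_fund_dom[of n]]) auto
  have 1: "\<bar>spin x\<bar> \<le> (if x \<in> ?P then 1 else 0)" if x: "x \<in> ?S" for x
  proof -
    obtain u v where uv: "x = (u, v)" by force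
    have u: "u > 0" "odd u" using x uv by (auto simp: spin_set_iff fund_dom_def spin_cond_def odd_if_mod_16)
    show ?thesis
    proof (cases "coprime u v")
      case True
      then have "x \<in> ?P" using x uv by (auto simp: spin_set_iff primitive_def)
      then show ?thesis using spin_abs_le_1[OF u] uv by simp
    next
      case False
      then have "spin x = 0" using spin_not_primitive[OF u False] uv by simp
      then show ?thesis by simp
    qed
  qed
  have "\<bar>spin_coeff n\<bar> \<le> (\<Sum>x\<in>?S. \<bar>spin x\<bar>)" unfolding spin_coeff_def by (rule sum_abs)
  also have "\<dots> \<le> (\<Sum>x\<in>?S. if x \<in> ?P then 1 else 0)" by (intro sum_mono 1)
  also have "\<dots> = real (card {x \<in> ?S. x \<in> ?P})" by (simp only: sum.inter_filter[OF fS, symmetric] real_of_card)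
  also have "\<dots> \<le> real (card ?P)" unfolding of_nat_le_iff by (rule card_mono[OF fP]) auto
  also have "\<dots> \<le> real (817 * divcount (nat (int n)))"
    unfolding of_nat_le_iff by (rule card_fund_dom_norm) (use assms True in auto)
  finally show ?thesis by simp
next
  case False
  then have "int n mod 16 \<noteq> 15" by presburger
  then show ?thesis using spin_coeff_eq_0 by simp
qed

lemma sum_spin_coeff_dvd:
  "(\<Sum>n\<in>{1..N}. if d dvd n then spin_coeff n else 0) = (\<Sum>x | x \<in> spin_set \<and> qnorm x \<le> int N \<and> int d dvd qnorm x. spin x)"
proof -
  let ?X = "{x. x \<in> spin_set \<and> qnorm x \<le> int N}"
  have "(\<Sum>n\<in>{1..N}. if d dvd n then spin_coeff n else 0) = (\<Sum>n\<in>{1..N}. spin_coeff n * (if d dvd n then 1 else 0))"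
    by (rule sum.cong) auto
  also have "\<dots> = (\<Sum>x\<in>?X. spin x * (if d dvd nat (qnorm x) then 1 else 0))" by (rule sum_spin_coeff)
  also have "\<dots> = (\<Sum>x\<in>?X. if int d dvd qnorm x then spin x else 0)"
  proof (rule sum.cong[OF refl])
    fix x assume "x \<in> ?X"
    then have "qnorm x > 0" using fund_dom_qnorm_pos by (auto simp: spin_set_iff)
    then have "d dvd nat (qnorm x) \<longleftrightarrow> int d dvd qnorm x" by (simp add: nat_dvd_iff int_dvd_int_iff[symmetric])
    then show "spin x * (if d dvd nat (qnorm x) then 1 else 0) = (if int d dvd qnorm x then spin x else 0)" by simp
  qed
  also have "\<dots> = (\<Sum>x\<in>{x\<in>?X. int d dvd qnorm x}. spin x)" by (rule sum.inter_filter[OF finite_spin_set, symmetric])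
  also have "{x\<in>?X. int d dvd qnorm x} = {x. x \<in> spin_set \<and> qnorm x \<le> int N \<and> int d dvd qnorm x}" by auto
  finally show ?thesis .
qed

section \<open>Higher prime powers and the first-type parts of Vaughan's identity\<close>

lemma sum_inverse_squares_le:
  assumes "m \<ge> 1" shows "(\<Sum>e\<in>{m..<m + k}. 1 / (real e)\<^sup>2) \<le> 2 / real m"
proof -
  have "(\<Sum>e\<in>{m..<m + k}. 1 / (real e)\<^sup>2) \<le> 2 / real m - 2 / real (m + k)"
  proof (induction k)
    case (Suc k)
    define t where "t = real (m + k)"
    have t: "t \<ge> 1" using assms by (simp add: t_def)
    have "1 / t\<^sup>2 \<le> 2 / (t * (t + 1))"
    proof -
      have "t * (t + 1) \<le> t * (2 * t)" using t by (intro mult_left_mono) auto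
      then have "t * (t + 1) \<le> 2 * t\<^sup>2" by (simp add: power2_eq_square)
      then show ?thesis using t by (simp add: divide_simps power2_eq_square)
    qed
    also have "\<dots> = 2 / t - 2 / (t + 1)" using t by (simp add: field_simps)
    finally have "1 / t\<^sup>2 \<le> 2 / t - 2 / (t + 1)" .
    moreover have "{m..<m + Suc k} = insert (m + k) {m..<m + k}" by auto
    ultimately show ?case using Suc unfolding t_def by (simp add: add.commute)
  qed simp
  then show ?thesis by (smt (verit) divide_nonneg_nonneg of_nat_0_le_iff)
qed

lemma card_square_multiples_le:
  assumes "E > 0"
  shows "real (card {n\<in>{1..N}. \<exists>e. E < real e \<and> e\<^sup>2 dvd n}) \<le> 2 * real N / E"
proof -
  define m where "m = nat \<lfloor>E\<rfloor> + 1"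
  have m: "m \<ge> 1" "E < real m" by (simp_all add: m_def) linarith
  let ?S = "{n\<in>{1..N}. \<exists>e. E < real e \<and> e\<^sup>2 dvd n}"
  have sub: "?S \<subseteq> (\<Union>e\<in>{m..<m + N}. {n\<in>{1..N}. e\<^sup>2 dvd n})"
  proof
    fix n assume n: "n \<in> ?S"
    then obtain e where e: "E < real e" "e\<^sup>2 dvd n" by blast
    have "m \<le> e" using e(1) assms unfolding m_def by linarith
    moreover have "e < m + N"
    proof -
      have "e\<^sup>2 \<le> n" using e(2) n by (intro dvd_imp_le) auto
      moreover have "e \<le> e\<^sup>2" by (cases e) (auto simp: power2_eq_square)
      ultimately show ?thesis using n m by auto
    qed
    ultimately show "n \<in> (\<Union>e\<in>{m..<m + N}. {n\<in>{1..N}. e\<^sup>2 dvd n})" using e n by auto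
  qed
  have "card ?S \<le> card (\<Union>e\<in>{m..<m + N}. {n\<in>{1..N}. e\<^sup>2 dvd n})" by (rule card_mono[OF _ sub]) auto
  also have "\<dots> \<le> (\<Sum>e\<in>{m..<m + N}. card {n\<in>{1..N}. e\<^sup>2 dvd n})" by (rule card_UN_le) simp
  finally have "real (card ?S) \<le> (\<Sum>e\<in>{m..<m + N}. real (card {n\<in>{1..N}. e\<^sup>2 dvd n}))"
    unfolding of_nat_sum[symmetric] of_nat_le_iff .
  also have "\<dots> \<le> (\<Sum>e\<in>{m..<m + N}. real N * (1 / (real e)\<^sup>2))"
  proof (rule sum_mono)
    fix e assume "e \<in> {m..<m + N}"
    then have e: "e > 0" using m by auto
    have "{n\<in>{1..N}. e\<^sup>2 dvd n} \<subseteq> (*) (e\<^sup>2) ` {1..N div e\<^sup>2}"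
    proof
      fix n assume n: "n \<in> {n\<in>{1..N}. e\<^sup>2 dvd n}"
      then obtain k where k: "n = e\<^sup>2 * k" by blast
      have "k \<le> N div e\<^sup>2" using n k e by (simp add: less_eq_div_iff_mult_less_eq mult.commute)
      moreover have "k \<ge> 1" using n k by (cases k) auto
      ultimately show "n \<in> (*) (e\<^sup>2) ` {1..N div e\<^sup>2}" using k by auto
    qed
    then have "card {n\<in>{1..N}. e\<^sup>2 dvd n} \<le> card ((*) (e\<^sup>2) ` {1..N div e\<^sup>2})" by (intro card_mono) auto
    also have "\<dots> \<le> N div e\<^sup>2" using card_image_le[of "{1..N div e\<^sup>2}" "(*) (e\<^sup>2)"] by simp
    finally have "real (card {n\<in>{1..N}. e\<^sup>2 dvd n}) \<le> real (N div e\<^sup>2)" by (simp only: of_nat_le_iff)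
    also have "\<dots> \<le> real N / real (e\<^sup>2)" by (rule of_nat_div_le_of_nat)
    finally show "real (card {n\<in>{1..N}. e\<^sup>2 dvd n}) \<le> real N * (1 / (real e)\<^sup>2)" by simp
  qed
  also have "\<dots> = real N * (\<Sum>e\<in>{m..<m + N}. 1 / (real e)\<^sup>2)" by (simp only: sum_distrib_left)
  also have "\<dots> \<le> real N * (2 / real m)" using sum_inverse_squares_le[OF m(1)] by (intro mult_left_mono) auto
  also have "\<dots> \<le> real N * (2 / E)" using m assms by (intro mult_left_mono divide_left_mono) auto
  finally show ?thesis by (simp add: mult.commute)
qed

text \<open>For \<open>c = p ^ k\<close> with \<open>k \<ge> 2\<close>, take
  \<open>e = p ^ (k div 2)\<close>: its square divides \<open>c\<close>, and
  \<open>c \<le> e ^ 3\<close> since \<open>k\<close> is at most \<open>3 * (k div 2)\<close>. Thus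
  large higher prime powers occur only in the sparse \<open>n\<close> with a large square
  divisor.\<close>

lemma primepow_nonprime_square:
  assumes "primepow c" "\<not> prime c" "z < real c" "z > 0"
  shows "\<exists>e. z powr (1/3) < real e \<and> e\<^sup>2 dvd c"
proof -
  obtain p k where pk: "prime p" "k > 0" "c = p ^ k" using assms(1) by (auto simp: primepow_def)
  have k2: "k \<ge> 2" using pk assms(2) by (cases "k = 1") auto
  define e where "e = p ^ (k div 2)"
  have p1: "p \<ge> 1" using pk(1) prime_ge_1_nat by blast
  have sq: "e\<^sup>2 dvd c" unfolding e_def pk(3) power_mult[symmetric] by (rule le_imp_power_dvd) simp
  have "c \<le> e ^ 3" unfolding e_def pk(3) power_mult[symmetric] using k2 p1 by (intro power_increasing) auto
  then have "real c \<le> real e ^ 3" by (metis of_nat_le_iff of_nat_power)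
  then have "z < real e ^ 3" using assms(3) by linarith
  then have "z powr (1/3) < (real e ^ 3) powr (1/3)" using assms(4) by (intro powr_less_mono2) auto
  also have "(real e ^ 3) powr (1/3) = real e"
  proof -
    have "real e > 0" using pk(1) prime_gt_0_nat by (simp add: e_def)
    then show ?thesis by (simp add: powr_powr flip: powr_numeral)
  qed
  finally show ?thesis using sq by blast
qed

lemma mangoldt_le_ln:
  assumes "c > 0" shows "mangoldt c \<le> ln (real c)"
proof (cases "primepow c")
  case True
  then have "c > Suc 0" by (rule primepow_gt_Suc_0)
  then have "aprimedivisor c \<le> c" "aprimedivisor c > 0" by (auto intro: aprimedivisor_le_nat)
  then show ?thesis using True by (simp add: mangoldt_def)
next
  case False
  then show ?thesis using assms by (simp add: mangoldt_def)
qed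

lemma card_real_le: "real (card {n. 0 < n \<and> real n \<le> y}) \<le> y" if "y \<ge> 0" for y :: real
proof -
  have "{n. 0 < n \<and> real n \<le> y} \<subseteq> {1..nat \<lfloor>y\<rfloor>}" by (auto simp: le_nat_iff le_floor_iff)
  then have "card {n. 0 < n \<and> real n \<le> y} \<le> card {1..nat \<lfloor>y\<rfloor>}" by (intro card_mono) auto
  then have "real (card {n. 0 < n \<and> real n \<le> y}) \<le> real (nat \<lfloor>y\<rfloor>)" by simp
  also have "\<dots> \<le> y" using that by simp
  finally show ?thesis .
qed

lemma finite_real_le: "finite {n::nat. 0 < n \<and> real n \<le> y}"
proof (rule finite_subset)
  show "{n::nat. 0 < n \<and> real n \<le> y} \<subseteq> {..nat \<lfloor>\<bar>y\<bar>\<rfloor>}" by (auto simp: le_nat_iff le_floor_iff)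
qed simp

lemma moebius_trunc_sum_swap:
  fixes \<phi> :: "nat \<Rightarrow> real"
  shows "(\<Sum>n\<in>{1..N}. moebius_trunc y n * \<phi> n) =
    (\<Sum>b | 0 < b \<and> real b \<le> y. moebius b * (\<Sum>n\<in>{1..N}. if b dvd n then \<phi> n else 0))"
proof -
  let ?B = "{b. 0 < b \<and> real b \<le> y}"
  have fB: "finite ?B" by (rule finite_real_le)
  have "(\<Sum>n\<in>{1..N}. moebius_trunc y n * \<phi> n) = (\<Sum>n\<in>{1..N}. \<Sum>b\<in>?B. if b dvd n then moebius b * \<phi> n else 0)"
  proof (rule sum.cong[OF refl])
    fix n assume "n \<in> {1..N}"
    then have "{b. b dvd n \<and> real b \<le> y} = {b \<in> ?B. b dvd n}" by (auto intro: gr0I)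
    then have "moebius_trunc y n = (\<Sum>b\<in>?B. if b dvd n then moebius b else 0)"
      unfolding moebius_trunc_def using sum.inter_filter[OF fB] by simp
    then show "moebius_trunc y n * \<phi> n = (\<Sum>b\<in>?B. if b dvd n then moebius b * \<phi> n else 0)"
      by (simp add: sum_distrib_right if_distrib[of "\<lambda>t. t * \<phi> n"] cong: if_cong)
  qed
  also have "\<dots> = (\<Sum>b\<in>?B. \<Sum>n\<in>{1..N}. if b dvd n then moebius b * \<phi> n else 0)" by (rule sum.swap)
  also have "\<dots> = (\<Sum>b\<in>?B. moebius b * (\<Sum>n\<in>{1..N}. if b dvd n then \<phi> n else 0))"
    by (intro sum.cong refl) (simp add: sum_distrib_left if_distrib cong: if_cong)
  finally show ?thesis .
qed

text \<open>One factor \<open>y\<close> counts the moduli, the other bounds each modulus in the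
  first-type estimate; summation by parts inserts the logarithm.\<close>

lemma type1_log_sum:
  assumes C: "C > 0" "e \<ge> 0" "\<And>d N. d > 0 \<Longrightarrow> N > 0 \<Longrightarrow>
      \<bar>\<Sum>x | x \<in> spin_set \<and> qnorm x \<le> int N \<and> int d dvd qnorm x. spin x\<bar> \<le> C * real d * real N powr e"
    and y: "y \<ge> 1" and N: "N \<ge> 1"
  shows "\<bar>\<Sum>n\<in>{1..N}. moebius_trunc y n * (spin_coeff n * ln (real n))\<bar> \<le> 2 * C * y\<^sup>2 * ln (real N) * real N powr e"
proof -
  let ?B = "{b. 0 < b \<and> real b \<le> y}"
  have inner: "\<bar>\<Sum>n\<in>{1..N}. if b dvd n then spin_coeff n * ln (real n) else 0\<bar> \<le> 2 * ln (real N) * (C * y * real N powr e)"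
    if b: "b \<in> ?B" for b
  proof -
    have "(\<Sum>n\<in>{1..N}. if b dvd n then spin_coeff n * ln (real n) else 0) = (\<Sum>n=1..N. (if b dvd n then spin_coeff n else 0) * ln (real n))"
      by (rule sum.cong) auto
    also have "\<bar>\<dots>\<bar> \<le> 2 * ln (real N) * (C * y * real N powr e)"
    proof (rule abel_bound)
      fix n assume n: "n \<le> N"
      show "\<bar>\<Sum>k=1..n. if b dvd k then spin_coeff k else 0\<bar> \<le> C * y * real N powr e"
      proof (cases "n = 0")
        case True
        then show ?thesis using C y by simp
      next
        case False
        have "\<bar>\<Sum>k\<in>{1..n}. if b dvd k then spin_coeff k else 0\<bar> \<le> C * real b * real n powr e"
          unfolding sum_spin_coeff_dvd using False b by (intro C(3)) auto
        also have "\<dots> \<le> C * y * real N powr e"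
          using b n C y False by (intro mult_mono mult_left_mono powr_mono2) auto
        finally show ?thesis .
      qed
    next
      show "(\<forall>n. 1 \<le> n \<and> n < N \<longrightarrow> ln (real n) \<le> ln (real (Suc n))) \<or> (\<forall>n. 1 \<le> n \<and> n < N \<longrightarrow> ln (real (Suc n)) \<le> ln (real n))"
        by (intro disjI1) auto
    qed (use N in auto)
    finally show ?thesis .
  qed
  have "\<bar>\<Sum>n\<in>{1..N}. moebius_trunc y n * (spin_coeff n * ln (real n))\<bar> \<le>
     (\<Sum>b\<in>?B. \<bar>moebius b * (\<Sum>n\<in>{1..N}. if b dvd n then spin_coeff n * ln (real n) else 0)\<bar>)"
    unfolding moebius_trunc_sum_swap by (rule sum_abs)
  also have "\<dots> \<le> (\<Sum>b\<in>?B. 1 * (2 * ln (real N) * (C * y * real N powr e)))"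
    unfolding abs_mult using abs_moebius_le_1 inner by (intro sum_mono mult_mono) auto
  also have "\<dots> = real (card ?B) * (2 * ln (real N) * (C * y * real N powr e))" by simp
  also have "\<dots> \<le> y * (2 * ln (real N) * (C * y * real N powr e))"
    using card_real_le[of y] y C N by (intro mult_right_mono) auto
  finally show ?thesis by (simp add: power2_eq_square mult_ac)
qed

text \<open>Divisibility by \<open>b\<close> and by \<open>c\<close> is divisibility by their lcm,
  at most \<open>y * z\<close>; there are at most \<open>y * z\<close> such pairs.\<close>

lemma type1_mangoldt_sum:
  assumes C: "C > 0" "e \<ge> 0" "\<And>d N. d > 0 \<Longrightarrow> N > 0 \<Longrightarrow>
      \<bar>\<Sum>x | x \<in> spin_set \<and> qnorm x \<le> int N \<and> int d dvd qnorm x. spin x\<bar> \<le> C * real d * real N powr e"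
    and y: "y \<ge> 1" and z: "z \<ge> 1" "z \<le> real N" and N: "N \<ge> 1"
  shows "\<bar>\<Sum>n\<in>{1..N}. moebius_trunc y n * (spin_coeff n * (\<Sum>c | c dvd n \<and> real c \<le> z. mangoldt c))\<bar> \<le>
    C * (y * z)\<^sup>2 * ln (real N) * real N powr e"
proof -
  let ?B = "{b. 0 < b \<and> real b \<le> y}"
  let ?C = "{c. 0 < c \<and> real c \<le> z}"
  let ?b = "ln (real N) * (C * (y * z) * real N powr e)"
  have fC: "finite ?C" by (rule finite_real_le)
  have inner: "\<bar>\<Sum>n\<in>{1..N}. if b dvd n then spin_coeff n * (\<Sum>c | c dvd n \<and> real c \<le> z. mangoldt c) else 0\<bar> \<le> z * ?b"
    if b: "b \<in> ?B" for b
  proof -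
    have "(\<Sum>n\<in>{1..N}. if b dvd n then spin_coeff n * (\<Sum>c | c dvd n \<and> real c \<le> z. mangoldt c) else 0) =
        (\<Sum>n\<in>{1..N}. \<Sum>c\<in>?C. mangoldt c * (if lcm b c dvd n then spin_coeff n else 0))"
    proof (rule sum.cong[OF refl])
      fix n assume n: "n \<in> {1..N}"
      have "{c. c dvd n \<and> real c \<le> z} = {c \<in> ?C. c dvd n}" using n by (auto intro: gr0I)
      then have "(\<Sum>c | c dvd n \<and> real c \<le> z. mangoldt c) = (\<Sum>c\<in>?C. if c dvd n then mangoldt c else (0::real))"
        using sum.inter_filter[OF fC] by simp
      then show "(if b dvd n then spin_coeff n * (\<Sum>c | c dvd n \<and> real c \<le> z. mangoldt c) else 0) =
         (\<Sum>c\<in>?C. mangoldt c * (if lcm b c dvd n then spin_coeff n else 0))"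
        by (simp add: sum_distrib_left) (auto intro!: sum.cong)
    qed
    also have "\<dots> = (\<Sum>c\<in>?C. mangoldt c * (\<Sum>n\<in>{1..N}. if lcm b c dvd n then spin_coeff n else 0))"
      by (subst sum.swap) (simp add: sum_distrib_left)
    finally have E: "(\<Sum>n\<in>{1..N}. if b dvd n then spin_coeff n * (\<Sum>c | c dvd n \<and> real c \<le> z. mangoldt c) else 0) =
        (\<Sum>c\<in>?C. mangoldt c * (\<Sum>n\<in>{1..N}. if lcm b c dvd n then spin_coeff n else 0))" .
    have "\<bar>\<Sum>n\<in>{1..N}. if b dvd n then spin_coeff n * (\<Sum>c | c dvd n \<and> real c \<le> z. mangoldt c) else 0\<bar> \<le>
       (\<Sum>c\<in>?C. \<bar>mangoldt c * (\<Sum>n\<in>{1..N}. if lcm b c dvd n then spin_coeff n else 0)\<bar>)"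
      unfolding E by (rule sum_abs)
    also have "\<dots> \<le> (\<Sum>c\<in>?C. ?b)"
    proof (rule sum_mono)
      fix c assume c: "c \<in> ?C"
      have l0: "lcm b c > 0" using b c by (simp add: lcm_pos_nat)
      have "lcm b c \<le> b * c" using b c by (intro dvd_imp_le) auto
      then have "real (lcm b c) \<le> real b * real c" by (metis of_nat_le_iff of_nat_mult)
      also have "\<dots> \<le> y * z" using b c y by (intro mult_mono) auto
      finally have l: "real (lcm b c) \<le> y * z" .
      have "\<bar>\<Sum>n\<in>{1..N}. if lcm b c dvd n then spin_coeff n else 0\<bar> \<le> C * real (lcm b c) * real N powr e"
        unfolding sum_spin_coeff_dvd using l0 N by (intro C(3)) auto
      also have "\<dots> \<le> C * (y * z) * real N powr e" using l C by (intro mult_right_mono mult_left_mono) auto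
      finally have 1: "\<bar>\<Sum>n\<in>{1..N}. if lcm b c dvd n then spin_coeff n else 0\<bar> \<le> C * (y * z) * real N powr e" .
      have "mangoldt c \<le> ln (real c)" using c by (intro mangoldt_le_ln) auto
      also have "\<dots> \<le> ln (real N)" using c z by simp
      finally have "\<bar>mangoldt c\<bar> \<le> ln (real N)" using mangoldt_nonneg[of c] by simp
      then show "\<bar>mangoldt c * (\<Sum>n\<in>{1..N}. if lcm b c dvd n then spin_coeff n else 0)\<bar> \<le> ?b"
        unfolding abs_mult using 1 N by (intro mult_mono) auto
    qed
    also have "\<dots> = real (card ?C) * ?b" by simp
    also have "\<dots> \<le> z * ?b" using card_real_le[of z] y z C N by (intro mult_right_mono) auto
    finally show ?thesis .
  qed
  have "\<bar>\<Sum>n\<in>{1..N}. moebius_trunc y n * (spin_coeff n * (\<Sum>c | c dvd n \<and> real c \<le> z. mangoldt c))\<bar> \<le>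
     (\<Sum>b\<in>?B. \<bar>moebius b * (\<Sum>n\<in>{1..N}. if b dvd n then spin_coeff n * (\<Sum>c | c dvd n \<and> real c \<le> z. mangoldt c) else 0)\<bar>)"
    unfolding moebius_trunc_sum_swap by (rule sum_abs)
  also have "\<dots> \<le> (\<Sum>b\<in>?B. 1 * (z * ?b))"
    unfolding abs_mult[of "moebius _"] using abs_moebius_le_1 inner by (intro sum_mono mult_mono) auto
  also have "\<dots> = real (card ?B) * (z * ?b)" by simp
  also have "\<dots> \<le> y * (z * ?b)" using card_real_le[of y] y z C N by (intro mult_right_mono) auto
  finally show ?thesis by (simp add: power2_eq_square mult_ac)
qed

lemma prime_powers_sum:
  assumes D: "\<And>n. n > 0 \<Longrightarrow> n \<le> N \<Longrightarrow> real (divcount n) \<le> D" and z: "z > 0" and N: "N \<ge> 1"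
  shows "\<bar>\<Sum>n\<in>{1..N}. moebius_trunc y n * (spin_coeff n * (\<Sum>c | c dvd n \<and> z < real c \<and> \<not> prime c. mangoldt c))\<bar> \<le>
    1634 * D\<^sup>2 * ln (real N) * (real N / z powr (1/3))"
proof -
  let ?\<Lambda> = "\<lambda>n. \<Sum>c | c dvd n \<and> z < real c \<and> \<not> prime c. mangoldt c :: real"
  define S where "S = {n\<in>{1..N}. \<exists>e. z powr (1/3) < real e \<and> e\<^sup>2 dvd n}"
  have zero: "?\<Lambda> n = 0" if "n \<in> {1..N} - S" for n
  proof (rule sum.neutral, rule ballI)
    fix c assume c: "c \<in> {c. c dvd n \<and> z < real c \<and> \<not> prime c}"
    have "\<not> primepow c"
    proof
      assume "primepow c"
      then obtain e where "z powr (1/3) < real e" "e\<^sup>2 dvd c" using primepow_nonprime_square c z by blast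
      then show False using that c by (auto simp: S_def dest: dvd_trans)
    qed
    then show "mangoldt c = (0::real)" by (simp add: mangoldt_def)
  qed
  have up: "\<bar>moebius_trunc y n * (spin_coeff n * ?\<Lambda> n)\<bar> \<le> D * ((817 * D) * ln (real N))" if n: "n \<in> S" for n
  proof -
    have n1: "n > 0" "n \<le> N" using n by (auto simp: S_def)
    have "?\<Lambda> n \<le> (\<Sum>c | c dvd n. mangoldt c)" using n1 mangoldt_nonneg by (intro sum_mono2) auto
    also have "\<dots> = ln (real n)" using mangoldt_sum[of n, where 'a = real] n1 by simp
    also have "\<dots> \<le> ln (real N)" using n1 by simp
    finally have "\<bar>?\<Lambda> n\<bar> \<le> ln (real N)" using mangoldt_nonneg by (simp add: sum_nonneg)
    moreover have "\<bar>spin_coeff n\<bar> \<le> 817 * D" using abs_spin_coeff_le[OF n1(1)] D[OF n1] by linarith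
    moreover have "\<bar>moebius_trunc y n\<bar> \<le> D" using abs_moebius_trunc_le[OF n1(1), of y] D[OF n1] by linarith
    ultimately show ?thesis unfolding abs_mult by (intro mult_mono) auto
  qed
  have D0: "D \<ge> 0" using D[of 1] N by (smt (verit) of_nat_0_le_iff zero_less_one)
  have "(\<Sum>n\<in>{1..N}. moebius_trunc y n * (spin_coeff n * ?\<Lambda> n)) = (\<Sum>n\<in>S. moebius_trunc y n * (spin_coeff n * ?\<Lambda> n))"
  proof (rule sum.mono_neutral_right)
    show "\<forall>i\<in>{1..N} - S. moebius_trunc y i * (spin_coeff i * ?\<Lambda> i) = 0" using zero by simp
  qed (auto simp: S_def)
  then have "\<bar>\<Sum>n\<in>{1..N}. moebius_trunc y n * (spin_coeff n * ?\<Lambda> n)\<bar> \<le> (\<Sum>n\<in>S. \<bar>moebius_trunc y n * (spin_coeff n * ?\<Lambda> n)\<bar>)"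
    by (simp only: sum_abs)
  also have "\<dots> \<le> (\<Sum>n\<in>S. D * ((817 * D) * ln (real N)))" by (intro sum_mono up)
  also have "\<dots> = real (card S) * (D * ((817 * D) * ln (real N)))" by simp
  also have "\<dots> \<le> (2 * real N / z powr (1/3)) * (D * ((817 * D) * ln (real N)))"
    unfolding S_def using z D0 N by (intro mult_right_mono card_square_multiples_le) auto
  finally show ?thesis by (simp add: power2_eq_square mult_ac)
qed

lemma small_primes_sum:
  assumes D: "\<And>n. n > 0 \<Longrightarrow> n \<le> N \<Longrightarrow> real (divcount n) \<le> D" and z: "z \<ge> 0" and N: "N \<ge> 1"
  shows "\<bar>\<Sum>n\<in>{1..N}. spin_coeff n * (if prime n \<and> real n \<le> z then ln (real n) else 0)\<bar> \<le> z * (817 * D * ln (real N))"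
proof -
  let ?S = "{n\<in>{1..N}. prime n \<and> real n \<le> z}"
  have D0: "D \<ge> 0" using D[of 1] N by (smt (verit) of_nat_0_le_iff zero_less_one)
  have "(\<Sum>n\<in>{1..N}. spin_coeff n * (if prime n \<and> real n \<le> z then ln (real n) else 0)) = (\<Sum>n\<in>{1..N}. if prime n \<and> real n \<le> z then spin_coeff n * ln (real n) else 0)"
    by (rule sum.cong) auto
  also have "\<dots> = (\<Sum>n\<in>?S. spin_coeff n * ln (real n))" by (rule sum.inter_filter[symmetric]) simp
  finally have "\<bar>\<Sum>n\<in>{1..N}. spin_coeff n * (if prime n \<and> real n \<le> z then ln (real n) else 0)\<bar> \<le> (\<Sum>n\<in>?S. \<bar>spin_coeff n * ln (real n)\<bar>)"
    by (simp only: sum_abs)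
  also have "\<dots> \<le> (\<Sum>n\<in>?S. 817 * D * ln (real N))"
  proof (rule sum_mono)
    fix n assume n: "n \<in> ?S"
    then have n1: "n > 0" "n \<le> N" by auto
    have "\<bar>spin_coeff n\<bar> \<le> 817 * D" using abs_spin_coeff_le[OF n1(1)] D[OF n1] by linarith
    then show "\<bar>spin_coeff n * ln (real n)\<bar> \<le> 817 * D * ln (real N)" unfolding abs_mult using n1 D0 by (intro mult_mono) auto
  qed
  also have "\<dots> = real (card ?S) * (817 * D * ln (real N))" by simp
  also have "\<dots> \<le> z * (817 * D * ln (real N))"
  proof (rule mult_right_mono)
    have "card ?S \<le> card {n. 0 < n \<and> real n \<le> z}" by (rule card_mono[OF finite_real_le]) auto
    then show "real (card ?S) \<le> z" using card_real_le[OF z] by linarith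
  qed (use D0 N in auto)
  finally show ?thesis .
qed

lemma prime_sum_decomposition:
  assumes "1 \<le> y" "y \<le> z"
  shows "(\<Sum>n\<in>{1..N}. spin_coeff n * (if prime n then ln (real n) else 0)) =
    (\<Sum>n\<in>{1..N}. spin_coeff n * (if prime n \<and> real n \<le> z then ln (real n) else 0))
    + (\<Sum>n\<in>{1..N}. moebius_trunc y n * (spin_coeff n * ln (real n)))
    - (\<Sum>n\<in>{1..N}. moebius_trunc y n * (spin_coeff n * (\<Sum>c | c dvd n \<and> real c \<le> z. mangoldt c)))
    - (\<Sum>n\<in>{1..N}. moebius_trunc y n * (spin_coeff n * (\<Sum>c | c dvd n \<and> z < real c \<and> \<not> prime c. mangoldt c)))
    - type2_sum y z N"
  unfolding type2_sum_def sum.distrib[symmetric] sum_subtractf[symmetric]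
proof (rule sum.cong[OF refl])
  fix n assume "n \<in> {1..N}"
  then have n: "n > 0" by simp
  let ?P = "\<Sum>q | prime q \<and> q dvd n \<and> z < real q \<and> y < real (n div q). moebius_trunc y (n div q) * ln (real q)"
  let ?A = "\<Sum>c | c dvd n \<and> real c \<le> z. mangoldt c :: real"
  let ?B = "\<Sum>c | c dvd n \<and> z < real c \<and> \<not> prime c. mangoldt c :: real"
  have i: "(if prime n \<and> z < real n then ln (real n) else 0) = moebius_trunc y n * ln (real n) - moebius_trunc y n * ?A - moebius_trunc y n * ?B - ?P"
    using moebius_trunc_ln_identity[OF assms n] by linarith
  have "(if prime n then ln (real n) else 0) = (if prime n \<and> real n \<le> z then ln (real n) else 0) + (if prime n \<and> z < real n then ln (real n) else 0)"
    by auto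
  then have "spin_coeff n * (if prime n then ln (real n) else 0) = spin_coeff n * ((if prime n \<and> real n \<le> z then ln (real n) else 0)
     + (moebius_trunc y n * ln (real n) - moebius_trunc y n * ?A - moebius_trunc y n * ?B - ?P))" unfolding i by (rule arg_cong)
  then show "spin_coeff n * (if prime n then ln (real n) else 0) =
     spin_coeff n * (if prime n \<and> real n \<le> z then ln (real n) else 0) + moebius_trunc y n * (spin_coeff n * ln (real n))
     - moebius_trunc y n * (spin_coeff n * ?A) - moebius_trunc y n * (spin_coeff n * ?B) - spin_coeff n * ?P"
    by (simp only: ring_distribs mult_ac)
qed

theorem prime_log_sum_bound:
  assumes "\<epsilon> > 0"
  obtains C where "C > 0" "\<And>N. N \<ge> 2 \<Longrightarrow>
    \<bar>\<Sum>n\<in>{1..N}. spin_coeff n * (if prime n then ln (real n) else 0)\<bar> \<le> C * real N powr (149/150 + \<epsilon>)"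
proof -
  define \<delta> where "\<delta> = \<epsilon> / 2"
  have d: "\<delta> > 0" using assms by (simp add: \<delta>_def)
  obtain C1 where C1: "C1 > 0" "\<And>d N. d > 0 \<Longrightarrow> N > 0 \<Longrightarrow>
    \<bar>\<Sum>x | x \<in> spin_set \<and> qnorm x \<le> int N \<and> int d dvd qnorm x. spin x\<bar> \<le> C1 * real d * real N powr (3/4 + \<delta>)"
    using type1_bound[OF d] by blast
  obtain C2 where C2: "C2 > 0" "\<And>N. N \<ge> 2 \<Longrightarrow>
    \<bar>type2_sum (real N powr (3/100)) (real N powr (17/200)) N\<bar> \<le> C2 * real N powr (149/150 + \<epsilon>)"
    using type2_bound[OF assms] by blast
  obtain K where K: "K \<ge> 1" "\<And>n. n > 0 \<Longrightarrow> real (divcount n) \<le> K * real n powr \<delta>"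
    using divcount_bound[OF d] by blast
  show ?thesis
  proof
    show "817 * K * 100 + 2 * C1 * 100 + C1 * 100 + 1634 * K\<^sup>2 * 100 + C2 > 0" using C1 C2 K(1) by (simp add: add_pos_pos)
    fix N :: nat assume N: "N \<ge> 2"
    define X where "X = real N"
    have X: "X \<ge> 2" using N by (simp add: X_def)
    define y where "y = X powr (3/100)"
    define z where "z = X powr (17/200)"
    define P where "P = X powr (149/150 + \<epsilon>)"
    have yz: "1 \<le> y" "y \<le> z" "z \<le> real N" "z \<ge> 1" "z > 0"
    proof -
      show "1 \<le> y" "1 \<le> z" using X by (auto simp: y_def z_def ge_one_powr_ge_zero)
      then show "z > 0" by simp
      show "y \<le> z" unfolding y_def z_def using X by (intro powr_mono) auto
      have "z \<le> X powr 1" unfolding z_def using X by (intro powr_mono) auto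
      then show "z \<le> real N" using X by (simp add: X_def)
    qed
    \<comment> \<open>Logarithms are paid for with a fixed power \<open>X powr (1/100)\<close>, for
      which the elementary terms have room.\<close>
    have lnX: "ln X \<le> 100 * X powr (1/100)" using ln_powr_bound[of X "1/100"] X by simp
    have ln0: "ln X \<ge> 0" using X by simp
    define D where "D = K * X powr \<delta>"
    have D: "real (divcount n) \<le> D" if "n > 0" "n \<le> N" for n
    proof -
      have "real n powr \<delta> \<le> X powr \<delta>" using that d by (intro powr_mono2) (auto simp: X_def)
      then have "K * real n powr \<delta> \<le> D" unfolding D_def using K(1) by (intro mult_left_mono) auto
      then show ?thesis using K(2)[OF that(1)] by linarith
    qed
    have mono: "X powr a \<le> P" if "a \<le> 149/150 + \<epsilon>" for a unfolding P_def using that X by (intro powr_mono) auto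
    have N1: "N \<ge> 1" using N by simp
    let ?S1 = "\<Sum>n\<in>{1..N}. spin_coeff n * (if prime n \<and> real n \<le> z then ln (real n) else 0)"
    let ?S2 = "\<Sum>n\<in>{1..N}. moebius_trunc y n * (spin_coeff n * ln (real n))"
    let ?S3 = "\<Sum>n\<in>{1..N}. moebius_trunc y n * (spin_coeff n * (\<Sum>c | c dvd n \<and> real c \<le> z. mangoldt c))"
    let ?S4 = "\<Sum>n\<in>{1..N}. moebius_trunc y n * (spin_coeff n * (\<Sum>c | c dvd n \<and> z < real c \<and> \<not> prime c. mangoldt c))"
    have S1: "\<bar>?S1\<bar> \<le> (817 * K * 100) * P"
    proof -
      have "\<bar>?S1\<bar> \<le> z * (817 * D * ln X)" unfolding X_def using yz N1 by (intro small_primes_sum D) auto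
      also have "\<dots> \<le> z * (817 * D * (100 * X powr (1/100)))"
        using lnX yz K(1) by (intro mult_left_mono) (auto simp: D_def)
      also have "\<dots> = (817 * K * 100) * (X powr (17/200) * X powr \<delta> * X powr (1/100))" by (simp add: z_def D_def)
      also have "X powr (17/200) * X powr \<delta> * X powr (1/100) = X powr (17/200 + \<delta> + 1/100)" by (simp only: powr_add)
      also have "(817 * K * 100) * X powr (17/200 + \<delta> + 1/100) \<le> (817 * K * 100) * P"
        using K(1) assms by (intro mult_left_mono mono) (auto simp: \<delta>_def)
      finally show ?thesis .
    qed
    have S2: "\<bar>?S2\<bar> \<le> (2 * C1 * 100) * P"
    proof -
      have "\<bar>?S2\<bar> \<le> 2 * C1 * y\<^sup>2 * ln X * X powr (3/4 + \<delta>)"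
        unfolding X_def using d by (intro type1_log_sum C1 yz N1) auto
      also have "\<dots> \<le> 2 * C1 * y\<^sup>2 * (100 * X powr (1/100)) * X powr (3/4 + \<delta>)"
        using lnX C1(1) by (intro mult_right_mono mult_left_mono) auto
      also have "\<dots> = (2 * C1 * 100) * (X powr (3/100) * X powr (3/100) * X powr (1/100) * X powr (3/4 + \<delta>))"
        by (simp add: y_def power2_eq_square mult_ac)
      also have "X powr (3/100) * X powr (3/100) * X powr (1/100) * X powr (3/4 + \<delta>) = X powr (3/100 + 3/100 + 1/100 + (3/4 + \<delta>))"
        by (simp only: powr_add)
      also have "(2 * C1 * 100) * X powr (3/100 + 3/100 + 1/100 + (3/4 + \<delta>)) \<le> (2 * C1 * 100) * P"
        using C1(1) assms by (intro mult_left_mono mono) (auto simp: \<delta>_def)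
      finally show ?thesis .
    qed
    have S3: "\<bar>?S3\<bar> \<le> (C1 * 100) * P"
    proof -
      have "\<bar>?S3\<bar> \<le> C1 * (y * z)\<^sup>2 * ln X * X powr (3/4 + \<delta>)"
        unfolding X_def using d by (intro type1_mangoldt_sum C1 yz N1) auto
      also have "\<dots> \<le> C1 * (y * z)\<^sup>2 * (100 * X powr (1/100)) * X powr (3/4 + \<delta>)"
        using lnX C1(1) by (intro mult_right_mono mult_left_mono) auto
      also have "\<dots> = (C1 * 100) * (X powr (3/100) * X powr (3/100) * X powr (17/200) * X powr (17/200) * X powr (1/100) * X powr (3/4 + \<delta>))"
        by (simp add: y_def z_def power2_eq_square mult_ac)
      also have "X powr (3/100) * X powr (3/100) * X powr (17/200) * X powr (17/200) * X powr (1/100) * X powr (3/4 + \<delta>) =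
          X powr (3/100 + 3/100 + 17/200 + 17/200 + 1/100 + (3/4 + \<delta>))"
        by (simp only: powr_add)
      \<comment> \<open>The tightest first-type exponent:
        \<open>3/4 + 2 * (3/100 + 17/200) + 1/100\<close> is 99/100, below 149/150.\<close>
      also have "(C1 * 100) * X powr (3/100 + 3/100 + 17/200 + 17/200 + 1/100 + (3/4 + \<delta>)) \<le> (C1 * 100) * P"
        using C1(1) assms by (intro mult_left_mono mono) (auto simp: \<delta>_def)
      finally show ?thesis .
    qed
    have S4: "\<bar>?S4\<bar> \<le> (1634 * K\<^sup>2 * 100) * P"
    proof -
      have "\<bar>?S4\<bar> \<le> 1634 * D\<^sup>2 * ln X * (X / z powr (1/3))"
        unfolding X_def using yz N1 by (intro prime_powers_sum D) auto
      also have "\<dots> \<le> 1634 * D\<^sup>2 * (100 * X powr (1/100)) * (X / z powr (1/3))"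
        using lnX X by (intro mult_right_mono mult_left_mono) auto
      also have "X / z powr (1/3) = X powr (1 - 17/600)"
      proof -
        have "X / z powr (1/3) = X powr 1 / X powr (17/600)" using X by (simp add: z_def powr_powr)
        then show ?thesis by (simp only: powr_diff)
      qed
      also have "1634 * D\<^sup>2 * (100 * X powr (1/100)) * X powr (1 - 17/600) =
         (1634 * K\<^sup>2 * 100) * (X powr \<delta> * X powr \<delta> * X powr (1/100) * X powr (1 - 17/600))"
        by (simp add: D_def power2_eq_square mult_ac)
      also have "X powr \<delta> * X powr \<delta> * X powr (1/100) * X powr (1 - 17/600) = X powr (\<delta> + \<delta> + 1/100 + (1 - 17/600))"
        by (simp only: powr_add)
      \<comment> \<open>The cube root of \<open>z\<close> saves 17/600; after the logarithm 11/600
        remain, more than the required 1/150.\<close>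
      also have "(1634 * K\<^sup>2 * 100) * X powr (\<delta> + \<delta> + 1/100 + (1 - 17/600)) \<le> (1634 * K\<^sup>2 * 100) * P"
        using assms by (intro mult_left_mono mono) (auto simp: \<delta>_def)
      finally show ?thesis .
    qed
    have S5: "\<bar>type2_sum y z N\<bar> \<le> C2 * P" unfolding y_def z_def P_def X_def by (rule C2(2)[OF N])
    have "\<bar>\<Sum>n\<in>{1..N}. spin_coeff n * (if prime n then ln (real n) else 0)\<bar> \<le>
        (817 * K * 100) * P + (2 * C1 * 100) * P + (C1 * 100) * P + (1634 * K\<^sup>2 * 100) * P + C2 * P"
      unfolding prime_sum_decomposition[OF yz(1,2)] using S1 S2 S3 S4 S5 by linarith
    also have "\<dots> = (817 * K * 100 + 2 * C1 * 100 + C1 * 100 + 1634 * K\<^sup>2 * 100 + C2) * P" by (simp only: distrib_right)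
    finally show "\<bar>\<Sum>n\<in>{1..N}. spin_coeff n * (if prime n then ln (real n) else 0)\<bar> \<le>
        (817 * K * 100 + 2 * C1 * 100 + C1 * 100 + 1634 * K\<^sup>2 * 100 + C2) * real N powr (149/150 + \<epsilon>)"
      by (simp only: P_def X_def)
  qed
qed

text \<open>Removes the weight \<open>ln\<close> by partial summation against its reciprocal, a
  bounded decreasing function.\<close>

theorem prime_sum_bound:
  assumes "\<epsilon> > 0"
  obtains C where "C > 0" "\<And>N. N \<ge> 2 \<Longrightarrow>
    \<bar>\<Sum>n\<in>{1..N}. if prime n then spin_coeff n else 0\<bar> \<le> C * real N powr (149/150 + \<epsilon>)"
proof -
  obtain C where C: "C > 0" "\<And>N. N \<ge> 2 \<Longrightarrow>
    \<bar>\<Sum>n\<in>{1..N}. spin_coeff n * (if prime n then ln (real n) else 0)\<bar> \<le> C * real N powr (149/150 + \<epsilon>)"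
    using prime_log_sum_bound[OF assms] by blast
  show ?thesis
  proof
    show "2 * (1 / ln 2) * C > 0" using C by simp
    fix N :: nat assume N: "N \<ge> 2"
    define b where "b = (\<lambda>n::nat. spin_coeff n * (if prime n then ln (real n) else 0))"
    \<comment> \<open>Taking \<open>max n 2\<close> keeps the weight positive and monotone at
      \<open>n = 1\<close>, where \<open>b\<close> vanishes.\<close>
    define w where "w = (\<lambda>n::nat. 1 / ln (real (max n 2)))"
    have "(\<Sum>n\<in>{1..N}. if prime n then spin_coeff n else 0) = (\<Sum>n=1..N. b n * w n)"
    proof (rule sum.cong[OF refl])
      fix n
      show "(if prime n then spin_coeff n else 0) = b n * w n"
      proof (cases "prime n")
        case True
        then have "n \<ge> 2" by (rule prime_ge_2_nat)
        then have "max n 2 = n" "ln (real n) > 0" by auto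
        then show ?thesis using True by (simp add: b_def w_def)
      qed (simp add: b_def)
    qed
    also have "\<bar>\<dots>\<bar> \<le> 2 * (1 / ln 2) * (C * real N powr (149/150 + \<epsilon>))"
    proof (rule abel_bound)
      fix n assume n: "n \<le> N"
      show "\<bar>\<Sum>k=1..n. b k\<bar> \<le> C * real N powr (149/150 + \<epsilon>)"
      proof (cases "n \<ge> 2")
        case True
        have "\<bar>\<Sum>k=1..n. b k\<bar> \<le> C * real n powr (149/150 + \<epsilon>)" unfolding b_def by (rule C(2)[OF True])
        also have "\<dots> \<le> C * real N powr (149/150 + \<epsilon>)" using C n assms by (intro mult_left_mono powr_mono2) auto
        finally show ?thesis .
      next
        case False
        have "b k = 0" if "k \<in> {1..n}" for k
        proof -
          have "k = 1" using that False by auto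
          then show ?thesis by (simp add: b_def)
        qed
        then show ?thesis using C by simp
      qed
    next
      fix n :: nat
      have "ln 2 \<le> ln (real (max n 2))" by simp
      then show "0 \<le> w n \<and> w n \<le> 1 / ln 2" by (auto simp: w_def intro!: divide_left_mono)
    next
      show "(\<forall>n. 1 \<le> n \<and> n < N \<longrightarrow> w n \<le> w (Suc n)) \<or> (\<forall>n. 1 \<le> n \<and> n < N \<longrightarrow> w (Suc n) \<le> w n)"
      proof (intro disjI2 allI impI)
        fix n :: nat
        have "ln (real (max n 2)) \<le> ln (real (max (Suc n) 2))" by simp
        moreover have "ln (real (max n 2)) > 0" by simp
        ultimately show "w (Suc n) \<le> w n" unfolding w_def by (intro divide_left_mono mult_pos_pos) auto
      qed
    qed simp
    finally show "\<bar>\<Sum>n\<in>{1..N}. if prime n then spin_coeff n else 0\<bar> \<le> 2 * (1 / ln 2) * C * real N powr (149/150 + \<epsilon>)"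
      by (simp only: mult.assoc)
  qed
qed

theorem theorem2:
  fixes \<epsilon> :: real
  assumes "\<epsilon> > 0"
  shows "\<exists>C::real. C > 0 \<and>
    (\<forall>X::real. X \<ge> 2 \<longrightarrow>
      (\<forall>u v :: nat \<Rightarrow> int.
        (\<forall>p. prime p \<and> real p \<le> X \<and> [int p = -1] (mod 16) \<longrightarrow>
           int p = (u p)\<^sup>2 - 2 * (v p)\<^sup>2 \<and> u p > 0 \<and> [u p = 1] (mod 16)) \<longrightarrow>
        \<bar>\<Sum>p | prime p \<and> real p \<le> X \<and> [int p = -1] (mod 16). real_of_int (Jacobi (v p) (u p))\<bar>
          \<le> C * X powr (149 / 150 + \<epsilon>)))"
proof -
  obtain C where C: "C > 0" "\<And>N. N \<ge> 2 \<Longrightarrow>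
    \<bar>\<Sum>n\<in>{1..N}. if prime n then spin_coeff n else 0\<bar> \<le> C * real N powr (149/150 + \<epsilon>)"
    using prime_sum_bound[OF assms] by blast
  have main: "\<bar>\<Sum>p | prime p \<and> real p \<le> X \<and> [int p = -1] (mod 16). real_of_int (Jacobi (v p) (u p))\<bar> \<le> C * X powr (149/150 + \<epsilon>)"
    if X: "X \<ge> 2" and uv: "\<forall>p. prime p \<and> real p \<le> X \<and> [int p = -1] (mod 16) \<longrightarrow>
        int p = (u p)\<^sup>2 - 2 * (v p)\<^sup>2 \<and> u p > 0 \<and> [u p = 1] (mod 16)" for X :: real and u v :: "nat \<Rightarrow> int"
  proof -
    define N where "N = nat \<lfloor>X\<rfloor>"
    have N: "N \<ge> 2" "real N \<le> X" using X by (auto simp: N_def le_nat_iff le_floor_iff)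
    have leN: "real p \<le> X \<longleftrightarrow> p \<le> N" for p using X by (simp add: N_def le_nat_iff le_floor_iff)
    let ?S = "{p. prime p \<and> real p \<le> X \<and> [int p = -1] (mod 16)}"
    have sub: "?S \<subseteq> {1..N}" using leN prime_ge_1_nat by auto
    have "(\<Sum>n\<in>{1..N}. if prime n then spin_coeff n else 0) = (\<Sum>p\<in>?S. if prime p then spin_coeff p else 0)"
    proof (rule sum.mono_neutral_right[OF _ sub])
      show "\<forall>i\<in>{1..N} - ?S. (if prime i then spin_coeff i else 0) = 0"
      proof
        fix i assume i: "i \<in> {1..N} - ?S"
        show "(if prime i then spin_coeff i else 0) = 0"
        proof (cases "prime i")
          case True
          then have "\<not> [int i = -1] (mod 16)" using i leN by auto
          then have "int i mod 16 \<noteq> 15" by (simp add: cong_def)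
          then show ?thesis using spin_coeff_eq_0 by simp
        qed simp
      qed
    qed simp
    \<comment> \<open>Each prime is counted twice, through a generator and its conjugate, whichever
      representation \<open>u p\<close>, \<open>v p\<close> was supplied.\<close>
    also have "\<dots> = (\<Sum>p\<in>?S. 2 * real_of_int (Jacobi (v p) (u p)))"
    proof (rule sum.cong[OF refl])
      fix p assume p: "p \<in> ?S"
      then have "int p = (u p)\<^sup>2 - 2 * (v p)\<^sup>2" "u p > 0" "[u p = 1] (mod 16)" using uv by auto
      then have "spin_coeff p = 2 * jac (u p) (v p)" using p by (intro spin_coeff_prime) auto
      then show "(if prime p then spin_coeff p else 0) = 2 * real_of_int (Jacobi (v p) (u p))" using p by simp
    qed
    also have "\<dots> = 2 * (\<Sum>p\<in>?S. real_of_int (Jacobi (v p) (u p)))" by (simp only: sum_distrib_left)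
    finally have "2 * \<bar>\<Sum>p\<in>?S. real_of_int (Jacobi (v p) (u p))\<bar> = \<bar>\<Sum>n\<in>{1..N}. if prime n then spin_coeff n else 0\<bar>"
      by (simp only: abs_mult abs_numeral)
    also have "\<dots> \<le> C * real N powr (149/150 + \<epsilon>)" by (rule C(2)[OF N(1)])
    also have "\<dots> \<le> C * X powr (149/150 + \<epsilon>)" using C N assms by (intro mult_left_mono powr_mono2) auto
    finally show ?thesis by linarith
  qed
  show ?thesis using C(1) main by (intro exI[of _ C] conjI allI impI) auto
qed

end
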